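(* Let $r$ be a positive integer and let $X[-]$ be a dihedral set. (a) $|\operatorname{sd}_rX[-]|$ is given, via the canonical bijection, by the filtered colimit $$\operatorname{colim}_{F\in\mathcal{F}'_r}\widetilde X[\pi_0(\mathbb{R}/r\mathbb{Z}\setminus F)],$$ and hence admits an action by $G_r=\operatorname{Homeo}\mathbb{R}/r\mathbb{Z}$. In particular, the bijection $s:\mathbb{R}/r\mathbb{Z}\to\mathbb{R}/\mathbb{Z}$, $x\mapsto x/r$, induces isomorphisms $D_r:|\operatorname{sd}_rX[-]|\to|X[-]|$ (a homeomorphism) and $d_r:G_r\to G=\operatorname{Homeo}\mathbb{R}/\mathbb{Z}$ (of groups) such that the diagram $$\begin{array}{ccc}G_r\times|\operatorname{sd}_rX[-]|&\to&|\operatorname{sd}_rX[-]|\\ {\scriptstyle d_r\times D_r}\downarrow&&\downarrow{\scriptstyle D_r}\\ G\times|X[-]|&\to&|X[-]|\end{array}$$ whose horizontal maps are the actions, commutes. (b) $|\operatorname{sd}^{\mathrm{e}}_rX[-]|$ is given, via the canonical bijection, by the filtered colimit $$\operatorname{colim}_{F\in\mathcal{F}'_{2r}}\widetilde X[\pi_0(\mathbb{R}/2r\mathbb{Z}\setminus F)],$$ and hence admits an action by $G^{\mathrm{e}}_r=\operatorname{Homeo}\mathbb{R}/2r\mathbb{Z}$. In particular, the bijection $s^{\mathrm e}:\mathbb{R}/2r\mathbb{Z}\to\mathbb{R}/\mathbb{Z}$, $x\mapsto x/(2r)$, induces isomorphisms $D^{\mathrm{e}}_r:|\operatorname{sd}^{\mathrm{e}}_rX[-]|\to|X[-]|$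 (a homeomorphism) and $d^{\mathrm{e}}_r:G^{\mathrm{e}}_r\to G=\operatorname{Homeo}\mathbb{R}/\mathbb{Z}$ (of groups) such that the diagram $$\begin{array}{ccc}G^{\mathrm{e}}_r\times|\operatorname{sd}^{\mathrm{e}}_rX[-]|&\to&|\operatorname{sd}^{\mathrm{e}}_rX[-]|\\ {\scriptstyle d^{\mathrm{e}}_r\times D^{\mathrm{e}}_r}\downarrow&&\downarrow{\scriptstyle D^{\mathrm{e}}_r}\\ G\times|X[-]|&\to&|X[-]|\end{array}$$ commutes.
   Context: **$\mathbb{Z}_+$-categories.** Let $\mathbb{Z}_+$ be the additive monoid of non-negative integers. A $\mathbb{Z}_+$-category is a category with a non-identity endomorphism $1_c:c\to c$ on each object $c$ such that $f\circ1_{c_1}=1_{c_2}\circ f$ for all $f:c_1\to c_2$. A (covariant) $\mathbb{Z}_+$-functor is a functor preserving these endomorphisms. $\mathcal{C}^{\mathrm{op}}$ is a $\mathbb{Z}_+$-category with $1_c=(1_c)^{\mathrm{op}}$; a contravariant $\mathbb{Z}_+$-functor $\mathcal{C}\to\mathcal{D}$ is a $\mathbb{Z}_+$-functor $\mathcal{C}\to\mathcal{D}^{\mathrm{op}}$. For a positive integer $L$, $\mathbb{R}/L\mathbb{Z}$ is a $\mathbb{Z}_+$-category: objects are points; morphisms $x\to y$ are homotopy classes of paths from $x$ to $y$ of the form $[0,1]\to\mathbb{R}\to\mathbb{R}/L\mathbb{Z}$, the first map continuous non-decreasing and the second the projection; $1_x$ is the class of degree 1 loops at $x$. For a finite subset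 $F$, $\pi_0(\mathbb{R}/L\mathbb{Z}\setminus F)$ is the $\mathbb{Z}_+$-category with objects the connected components and $\operatorname{Hom}(c,d)=\operatorname{Hom}_{\mathbb{R}/L\mathbb{Z}}(x_c,x_d)$ for chosen $x_c\in c$, $x_d\in d$. For a finite nonempty linearly ordered set $\mathcal{A}=\{a_0<\dots<a_n\}$, $\mathcal{A}_{\mathrm{cyc}}$ is the $\mathbb{Z}_+$-category with the objects of $\mathcal{A}$ and morphisms generated by those of $\mathcal{A}$ and one new generator $a_n\to a_0$, with $1_{a_i}:a_i\to a_n\to a_0\to a_i$; it is functorial for order-preserving maps. With $[n]=\{0<\dots<n\}$, $[n]_{\mathrm{cyc}}$ is identified with the full subcategory of $\mathbb{R}/\mathbb{Z}$ on $0,\frac1{n+1},\dots,\frac n{n+1}$. If $F\subset[0,L]$ is finite and contains $0$ or $L$, with image $\overline F$ in $\mathbb{R}/L\mathbb{Z}$, then $\pi_0([0,L]\setminus F)_{\mathrm{cyc}}=\pi_0(\mathbb{R}/L\mathbb{Z}\setminus\overline F)$, where $\pi_0([0,L]\setminus F)$ is ordered by $[x]\le[y]$ if $x\le y$. **Dihedral sets.** $\Delta D$ (resp. $\Delta_{\mathrm{big}}D$) has as objects the $[n]_{\mathrm{cyc}}$, $n\ge0$ (resp. all small $\mathbb{Z}_+$-categories isomorphic to some $[n]_{\mathrm{cyc}}$), and its morphism sets are the disjoint unions of the sets of covariant and of contravariant $\mathbb{Z}_+$-functors; composition is composition of functors, with composites of two functors of the same variance covariant and of different variances contravariant. A dihedral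 set is a functor $X[-]:(\Delta D)^{\mathrm{op}}\to\mathrm{Sets}$; $\widetilde X[-]:(\Delta_{\mathrm{big}}D)^{\mathrm{op}}\to\mathrm{Sets}$ is its extension along the equivalence $\Delta D\subset\Delta_{\mathrm{big}}D$ (unique up to unique isomorphism restricting to the identity). **Realization.** $\Delta$ is the category of the $[n]$ and order-preserving maps, embedded in $\Delta D$ by $[n]\mapsto[n]_{\mathrm{cyc}}$, $f\mapsto f_{\mathrm{cyc}}$. The realization of a simplicial set $Y$ is $\coprod_nY[n]\times\Delta[n]/\sim$ with $\Delta[n]=\{(z_0,\dots,z_n)\in[0,1]^{n+1}\mid\sum z_i=1\}$, $Y[n]$ discrete, $\sim$ generated by $(y,\theta_*z)\sim(\theta^*y,z)$. The realization of a dihedral set is that of its underlying simplicial set $X|_{\Delta^{\mathrm{op}}}[-]$. **Subdivisions.** $\operatorname{sd}_r:\Delta\to\Delta$ is given by $\operatorname{sd}_r[n]=[r(n+1)-1]$ and $\operatorname{sd}_r[f](a(m+1)+b)=a(n+1)+f(b)$ for $f:[m]\to[n]$, $0\le a<r$, $0\le b\le m$. $\operatorname{sd}^{\mathrm{e}}:\Delta\to\Delta$ is given by $\operatorname{sd}^{\mathrm{e}}[n]=[2n+1]$ and $\operatorname{sd}^{\mathrm e}[f]=f^{\mathrm{e}}:[2m+1]\to[2n+1]$, $f^{\mathrm{e}}(k)=f(k)$, $f^{\mathrm{e}}(2m+1-k)=2n+1-f(k)$ for $0\le k\le m$. The underlying simplicial sets of $\operatorname{sd}_rX[-]$ and $\operatorname{sd}^{\mathrm{e}}_rX[-]$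 (on which their realizations depend) are $X|_{\Delta^{\mathrm{op}}}[-]\circ\operatorname{sd}_r$ and $X|_{\Delta^{\mathrm{op}}}[-]\circ\operatorname{sd}_r\circ\operatorname{sd}^{\mathrm{e}}$, respectively. **Index categories.** $\mathcal{F}'_L$ is the set of finite subsets of $\mathbb{R}/L\mathbb{Z}$, viewed as a category by inclusions; for $F\subset G$ there is an evident $\mathbb{Z}_+$-functor $\pi_0(\mathbb{R}/L\mathbb{Z}\setminus G)\to\pi_0(\mathbb{R}/L\mathbb{Z}\setminus F)$. $\mathrm{in}_F$ is the canonical map from the $F$-term to the colimit. **Canonical bijections.** For $z\in\Delta[n]$ put $x_0=0$, $x_i=z_0+\dots+z_{i-1}$ (so $x_{n+1}=1$). In (a), a point of $|\operatorname{sd}_rX[-]|$ represented by $(\xi,z)\in X[r(n+1)-1]\times\Delta[n]$ is sent to $\mathrm{in}_{\overline F}(\widetilde X[f_{\mathrm{cyc}}](\xi))$, where $F=\{k+x_i\mid0\le k<r,\,0\le i\le n+1\}\subset[0,r]$ and $f:\pi_0([0,r]\setminus F)\to[r(n+1)-1]$ sends the component $(k+x_i,k+x_{i+1})$ (when nonempty) to $k(n+1)+i$. For $r=1$ this is the canonical bijection $|X[-]|\to\operatorname{colim}_{F\in\mathcal{F}'_1}\widetilde X[\pi_0(\mathbb{R}/\mathbb{Z}\setminus F)]$. In (b), a point of $|\operatorname{sd}^{\mathrm e}_rX[-]|$ represented by $(\xi,z)\in X[2r(n+1)-1]\times\Delta[n]$ is sent to $\mathrm{in}_{\overline F}(\widetilde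 X[f_{\mathrm{cyc}}](\xi))$, where $F=\{2k+x_i,\,2k+2-x_i\mid0\le k<r,\,0\le i\le n+1\}\subset[0,2r]$ and $f:\pi_0([0,2r]\setminus F)\to[2r(n+1)-1]$ sends $(2k+x_i,2k+x_{i+1})$ to $2k(n+1)+i$ and $(2k+2-x_{i+1},2k+2-x_i)$ to $2k(n+1)+2n+1-i$ (when these are nonempty). **Actions and induced maps.** $\operatorname{Homeo}\mathbb{R}/L\mathbb{Z}$ is the group of all homeomorphisms. A homeomorphism $\alpha$ of $\mathbb{R}/L\mathbb{Z}$, and also each rescaling $t\in\{s,s^{\mathrm e}\}$, induces $\mathbb{Z}_+$-isomorphisms $\alpha_F$ (resp. $t_F$), covariant or contravariant according as orientation is preserved or reversed, from $\pi_0$ of the complement of $F$ to $\pi_0$ of the complement of $\alpha(F)$ (resp. $t(F)$). The action of $\alpha$ is the map $\rho_\alpha$ with $\rho_\alpha\circ\mathrm{in}_F=\mathrm{in}_{\alpha(F)}\circ\widetilde X[\alpha_F^{-1}]$. The induced maps are given by $D_r\circ\mathrm{in}_F=\mathrm{in}_{s(F)}\circ\widetilde X[s_F^{-1}]$, $d_r(\alpha)=s\circ\alpha\circ s^{-1}$, and likewise $D^{\mathrm e}_r$, $d^{\mathrm e}_r$ with $s^{\mathrm e}$ in place of $s$.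
   Formalization: The colimits are indexed by the nonempty finite subsets of R/LZ; the empty set is left out of F'_L because there are no compatible Z_+-functors from π_0(R/LZ∖G) to π_0(R/LZ), so the diagram is undefined there. *)

theory Defs
  imports "HOL-Homology.Homology" "HOL-Algebra.Group_Action"
begin

section \<open>$\mathbb{Z}_+$-categories and dihedral sets\<close>

text \<open>\<^term>\<open>zComp C g f\<close> is the composite $g \circ f$ (first \<open>f\<close>, then \<open>g\<close>), and
  \<^term>\<open>zEnd C c\<close> is the distinguished endomorphism $1_c$.\<close>

record ('o, 'm) zcat =
  zOb :: "'o set"
  zAr :: "'m set"
  zSrc :: "'m \<Rightarrow> 'o"
  zTgt :: "'m \<Rightarrow> 'o"
  zId :: "'o \<Rightarrow> 'm"
  zComp :: "'m \<Rightarrow> 'm \<Rightarrow> 'm"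
  zEnd :: "'o \<Rightarrow> 'm"

definition zHom :: "('o, 'm) zcat \<Rightarrow> 'o \<Rightarrow> 'o \<Rightarrow> 'm set" where
  "zHom C a b = {f \<in> zAr C. zSrc C f = a \<and> zTgt C f = b}"

definition zcategory :: "('o, 'm) zcat \<Rightarrow> bool" where
  "zcategory C \<longleftrightarrow>
     zSrc C \<in> zAr C \<rightarrow> zOb C \<and> zTgt C \<in> zAr C \<rightarrow> zOb C \<and>
     (\<forall>a\<in>zOb C. zId C a \<in> zHom C a a) \<and>
     (\<forall>a\<in>zOb C. \<forall>b\<in>zOb C. \<forall>c\<in>zOb C. \<forall>f\<in>zHom C a b. \<forall>g\<in>zHom C b c.
        zComp C g f \<in> zHom C a c) \<and>
     (\<forall>a\<in>zOb C. \<forall>b\<in>zOb C. \<forall>f\<in>zHom C a b.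
        zComp C f (zId C a) = f \<and> zComp C (zId C b) f = f) \<and>
     (\<forall>a\<in>zOb C. \<forall>b\<in>zOb C. \<forall>c\<in>zOb C. \<forall>d\<in>zOb C.
        \<forall>f\<in>zHom C a b. \<forall>g\<in>zHom C b c. \<forall>h\<in>zHom C c d.
        zComp C h (zComp C g f) = zComp C (zComp C h g) f) \<and>
     (\<forall>a\<in>zOb C. zEnd C a \<in> zHom C a a \<and> zEnd C a \<noteq> zId C a) \<and>
     (\<forall>a\<in>zOb C. \<forall>b\<in>zOb C. \<forall>f\<in>zHom C a b.
        zComp C f (zEnd C a) = zComp C (zEnd C b) f)"

definition zop :: "('o, 'm) zcat \<Rightarrow> ('o, 'm) zcat" where
  "zop C = \<lparr>zOb = zOb C, zAr = zAr C, zSrc = zTgt C, zTgt = zSrc C, zId = zId C,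
            zComp = (\<lambda>g f. zComp C f g), zEnd = zEnd C\<rparr>"

definition zfunctor ::
  "('o, 'm) zcat \<Rightarrow> ('p, 'n) zcat \<Rightarrow> ('o \<Rightarrow> 'p) \<Rightarrow> ('m \<Rightarrow> 'n) \<Rightarrow> bool" where
  "zfunctor C D u v \<longleftrightarrow>
     u \<in> zOb C \<rightarrow>\<^sub>E zOb D \<and> v \<in> zAr C \<rightarrow>\<^sub>E zAr D \<and>
     (\<forall>a\<in>zOb C. \<forall>b\<in>zOb C. \<forall>f\<in>zHom C a b. v f \<in> zHom D (u a) (u b)) \<and>
     (\<forall>a\<in>zOb C. v (zId C a) = zId D (u a)) \<and>
     (\<forall>a\<in>zOb C. \<forall>b\<in>zOb C. \<forall>c\<in>zOb C. \<forall>f\<in>zHom C a b. \<forall>g\<in>zHom C b c.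
        v (zComp C g f) = zComp D (v g) (v f)) \<and>
     (\<forall>a\<in>zOb C. v (zEnd C a) = zEnd D (u a))"

text \<open>All small $\mathbb{Z}_+$-categories that occur have objects in one type: \<open>Num\<close> for the elements of
  $[n]$, \<open>Intv\<close> for the components of $[0,L] \setminus F$ and \<open>Arc\<close> for those of
  $\mathbb{R}/L\mathbb{Z} \setminus F$.  An arrow is a triple (source, label, target) whose label is
  either a number (in the categories $\mathcal{A}_{\mathrm{cyc}}$) or a homotopy class of paths in
  $\mathbb{R}/L\mathbb{Z}$ (a point of which is a coset, of type \<^typ>\<open>real set\<close>).\<close>

datatype zob = Num (num_of: nat) | Intv (intv_of: "real set") | Arc (arc_of: "real set set")

datatype zlabel = Wind (wind: nat) | Path (path_class: "(real \<Rightarrow> real set) set")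

type_synonym zar = "zob \<times> zlabel \<times> zob"
type_synonym zc = "(zob, zar) zcat"

text \<open>In $\mathcal{A}_{\mathrm{cyc}}$ a composite of morphisms of $\mathcal{A}$ and of the generator
  $a_n \to a_0$ is determined by its source, its target and the number \<open>k\<close> of times the generator
  occurs in it; \<open>k = 0\<close> is possible only if source \<open>\<le>\<close> target.\<close>

definition cyc :: "zob set \<Rightarrow> (zob \<Rightarrow> zob \<Rightarrow> bool) \<Rightarrow> zc" where
  "cyc A R = \<lparr>zOb = A,
     zAr = {(a, Wind k, b) | a k b. a \<in> A \<and> b \<in> A \<and> (R a b \<or> 1 \<le> k)},
     zSrc = fst, zTgt = (\<lambda>f. snd (snd f)),
     zId = (\<lambda>a. (a, Wind 0, a)),
     zComp = (\<lambda>g f. (fst f, Wind (wind (fst (snd f)) + wind (fst (snd g))), snd (snd g))),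
     zEnd = (\<lambda>a. (a, Wind 1, a))\<rparr>"

definition ord_set :: "nat \<Rightarrow> zob set" where
  "ord_set n = Num ` {..n}"

definition ord_le :: "zob \<Rightarrow> zob \<Rightarrow> bool" where
  "ord_le a b \<longleftrightarrow> num_of a \<le> num_of b"

definition ncyc :: "nat \<Rightarrow> zc" where
  "ncyc n = cyc (ord_set n) ord_le"

text \<open>Morphisms of $\Delta_{\mathrm{big}}D$.  The flag records the variance, so that the morphism sets are
  disjoint unions; a contravariant functor is a functor to the opposite category.\<close>

record dmor =
  dSrc :: zc
  dTgt :: zc
  dContra :: bool
  dOb :: "zob \<Rightarrow> zob"
  dAr :: "zar \<Rightarrow> zar"

definition dHom :: "zc \<Rightarrow> zc \<Rightarrow> dmor set" where
  "dHom C D = {f. dSrc f = C \<and> dTgt f = D \<and>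
     zfunctor C (if dContra f then zop D else D) (dOb f) (dAr f)}"

definition dId :: "zc \<Rightarrow> dmor" where
  "dId C = \<lparr>dSrc = C, dTgt = C, dContra = False,
     dOb = (\<lambda>a\<in>zOb C. a), dAr = (\<lambda>f\<in>zAr C. f)\<rparr>"

definition dComp :: "dmor \<Rightarrow> dmor \<Rightarrow> dmor" where
  "dComp g f = \<lparr>dSrc = dSrc f, dTgt = dTgt g, dContra = (dContra f \<noteq> dContra g),
     dOb = compose (zOb (dSrc f)) (dOb g) (dOb f),
     dAr = compose (zAr (dSrc f)) (dAr g) (dAr f)\<rparr>"

definition dInv :: "dmor \<Rightarrow> dmor" where
  "dInv f = (THE g. g \<in> dHom (dTgt f) (dSrc f) \<and>
     dComp g f = dId (dSrc f) \<and> dComp f g = dId (dTgt f))"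

definition zisomorphic :: "zc \<Rightarrow> zc \<Rightarrow> bool" where
  "zisomorphic C D \<longleftrightarrow> (\<exists>f\<in>dHom C D. \<exists>g\<in>dHom D C. \<not> dContra f \<and> \<not> dContra g \<and>
     dComp g f = dId C \<and> dComp f g = dId D)"

text \<open>The objects of $\Delta D$ and of $\Delta_{\mathrm{big}}D$.\<close>

definition DeltaD :: "zc set" where
  "DeltaD = range ncyc"

definition DeltaBigD :: "zc set" where
  "DeltaBigD = {C. zcategory C \<and> (\<exists>n. zisomorphic (ncyc n) C)}"

text \<open>Contravariant functors to sets from the full subcategory on a class of objects.\<close>

record 'a presheaf =
  pset :: "zc \<Rightarrow> 'a set"
  pmap :: "dmor \<Rightarrow> 'a \<Rightarrow> 'a"

definition presheaf_on :: "zc set \<Rightarrow> 'a presheaf \<Rightarrow> bool" where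
  "presheaf_on S X \<longleftrightarrow>
     (\<forall>C\<in>S. \<forall>D\<in>S. \<forall>f\<in>dHom C D. pmap X f \<in> pset X D \<rightarrow> pset X C) \<and>
     (\<forall>C\<in>S. \<forall>x\<in>pset X C. pmap X (dId C) x = x) \<and>
     (\<forall>B\<in>S. \<forall>C\<in>S. \<forall>D\<in>S. \<forall>f\<in>dHom B C. \<forall>g\<in>dHom C D. \<forall>x\<in>pset X D.
        pmap X (dComp g f) x = pmap X f (pmap X g x))"

definition dihedral_set :: "'a presheaf \<Rightarrow> bool" where
  "dihedral_set X \<longleftrightarrow> presheaf_on DeltaD X"

definition dihedral_extension :: "'a presheaf \<Rightarrow> 'a presheaf \<Rightarrow> bool" where
  "dihedral_extension X P \<longleftrightarrow> presheaf_on DeltaBigD P \<and>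
     (\<forall>C\<in>DeltaD. pset P C = pset X C) \<and>
     (\<forall>C\<in>DeltaD. \<forall>D\<in>DeltaD. \<forall>f\<in>dHom C D. \<forall>x\<in>pset X D. pmap P f x = pmap X f x)"

lemma zcategoryD:
  assumes "zcategory C"
  shows "\<And>a. a \<in> zOb C \<Longrightarrow> zId C a \<in> zHom C a a"
    and "\<And>a. a \<in> zOb C \<Longrightarrow> zEnd C a \<in> zHom C a a"
    and "\<And>a b c f g. \<lbrakk>a \<in> zOb C; b \<in> zOb C; c \<in> zOb C; f \<in> zHom C a b; g \<in> zHom C b c\<rbrakk>
           \<Longrightarrow> zComp C g f \<in> zHom C a c"
  using assms unfolding zcategory_def by blast+

lemma zHom_zAr: "f \<in> zHom C a b \<Longrightarrow> f \<in> zAr C"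
  by (simp add: zHom_def)

lemma zfunctor_compose:
  assumes A: "zcategory A" and F: "zfunctor A B u v" and G: "zfunctor B C u' v'"
  shows "zfunctor A C (compose (zOb A) u' u) (compose (zAr A) v' v)"
proof -
  note AD = zcategoryD[OF A]
  have u: "a \<in> zOb A \<Longrightarrow> u a \<in> zOb B" and v: "f \<in> zHom A a b \<Longrightarrow> a \<in> zOb A \<Longrightarrow> b \<in> zOb A \<Longrightarrow> v f \<in> zHom B (u a) (u b)" for a b f
    using F unfolding zfunctor_def by auto
  have "compose (zOb A) u' u \<in> zOb A \<rightarrow>\<^sub>E zOb C" "compose (zAr A) v' v \<in> zAr A \<rightarrow>\<^sub>E zAr C"
    using F G unfolding zfunctor_def by (auto simp: compose_def PiE_iff)
  moreover have "compose (zAr A) v' v f \<in> zHom C (compose (zOb A) u' u a) (compose (zOb A) u' u b)"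
    if "a \<in> zOb A" "b \<in> zOb A" "f \<in> zHom A a b" for a b f
    using that v u G zHom_zAr[OF that(3)] unfolding zfunctor_def by (simp add: compose_eq)
  moreover have "compose (zAr A) v' v (zId A a) = zId C (compose (zOb A) u' u a)"
    and "compose (zAr A) v' v (zEnd A a) = zEnd C (compose (zOb A) u' u a)"
    if "a \<in> zOb A" for a
    using that F G u zHom_zAr[OF AD(1)[OF that]] zHom_zAr[OF AD(2)[OF that]]
    unfolding zfunctor_def by (simp_all add: compose_eq)
  moreover have "compose (zAr A) v' v (zComp A g f)
      = zComp C (compose (zAr A) v' v g) (compose (zAr A) v' v f)"
    if h: "a \<in> zOb A" "b \<in> zOb A" "c \<in> zOb A" "f \<in> zHom A a b" "g \<in> zHom A b c" for a b c f g
  proof -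
    have "v (zComp A g f) = zComp B (v g) (v f)"
      using F h unfolding zfunctor_def by blast
    moreover have "v' (zComp B (v g) (v f)) = zComp C (v' (v g)) (v' (v f))"
      using G u[OF h(1)] u[OF h(2)] u[OF h(3)] v[OF h(4,1,2)] v[OF h(5,2,3)]
      unfolding zfunctor_def by blast
    ultimately show ?thesis
      using zHom_zAr[OF AD(3)[OF h]] zHom_zAr[OF h(4)] zHom_zAr[OF h(5)] by (simp add: compose_eq)
  qed
  ultimately show ?thesis
    unfolding zfunctor_def by blast
qed

lemma zop_simps [simp]:
  "zOb (zop C) = zOb C" "zAr (zop C) = zAr C" "zId (zop C) = zId C" "zEnd (zop C) = zEnd C"
  "zComp (zop C) g f = zComp C f g" "zHom (zop C) a b = zHom C b a" "zop (zop C) = C"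
  by (auto simp: zop_def zHom_def)

lemma zfunctor_zop: "zfunctor C D u v \<Longrightarrow> zfunctor (zop C) (zop D) u v"
  unfolding zfunctor_def by simp

lemma dComp_in_dHom:
  assumes "zcategory B" "f \<in> dHom B C" "g \<in> dHom C D"
  shows "dComp g f \<in> dHom B D"
proof -
  have "zfunctor C (if dContra g then zop D else D) (dOb g) (dAr g)"
    using assms(3) by (simp add: dHom_def)
  then have "zfunctor (if dContra f then zop C else C)
      (if dContra f \<noteq> dContra g then zop D else D) (dOb g) (dAr g)"
    using zfunctor_zop[of C "if dContra g then zop D else D"] by (auto split: if_splits)
  moreover have "zfunctor B (if dContra f then zop C else C) (dOb f) (dAr f)"
    using assms(2) by (simp add: dHom_def)
  ultimately have "zfunctor B (if dContra f \<noteq> dContra g then zop D else D)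
      (compose (zOb B) (dOb g) (dOb f)) (compose (zAr B) (dAr g) (dAr f))"
    using zfunctor_compose[OF assms(1)] by blast
  with assms(2,3) show ?thesis
    by (simp add: dHom_def dComp_def)
qed

lemma dId_in_dHom:
  assumes "zcategory C"
  shows "dId C \<in> dHom C C"
proof -
  note D = zcategoryD[OF assms]
  show ?thesis
    using D(1,2)[THEN zHom_zAr] D(3)[THEN zHom_zAr]
    by (auto simp: dHom_def dId_def zfunctor_def dest: zHom_zAr)
qed

lemma dmor_eqI:
  fixes f g :: dmor
  shows "\<lbrakk>dSrc f = dSrc g; dTgt f = dTgt g; dContra f = dContra g; dOb f = dOb g; dAr f = dAr g\<rbrakk> \<Longrightarrow> f = g"
  by simp

lemma dComp_assoc:
  assumes "f \<in> dHom A B" "g \<in> dHom B C" "h \<in> dHom C D"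
  shows "dComp h (dComp g f) = dComp (dComp h g) f"
proof -
  have "dOb f \<in> zOb A \<rightarrow> zOb B" "dAr f \<in> zAr A \<rightarrow> zAr B"
    using assms(1) by (auto simp: dHom_def zfunctor_def split: if_splits)
  then show ?thesis
    using assms by (intro dmor_eqI) (auto simp: dHom_def dComp_def compose_def fun_eq_iff)
qed

lemma dComp_dId:
  assumes "f \<in> dHom C D"
  shows "dComp f (dId C) = f" and "dComp (dId D) f = f"
proof -
  have *: "dOb f \<in> zOb C \<rightarrow>\<^sub>E zOb D" "dAr f \<in> zAr C \<rightarrow>\<^sub>E zAr D"
    using assms by (auto simp: dHom_def zfunctor_def split: if_splits)
  show "dComp f (dId C) = f" "dComp (dId D) f = f"
    using assms * by (auto intro!: dmor_eqI ext
        simp: dHom_def dComp_def dId_def compose_def restrict_def PiE_iff extensional_def)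
qed

lemma zcategory_ncyc: "zcategory (ncyc n)"
  by (auto simp: zcategory_def zHom_def ncyc_def cyc_def ord_le_def)

lemma ncyc_in_DeltaBigD: "ncyc n \<in> DeltaBigD"
proof -
  have "dComp (dId (ncyc n)) (dId (ncyc n)) = dId (ncyc n)"
    by (rule dComp_dId[OF dId_in_dHom[OF zcategory_ncyc]])
  moreover have "\<not> dContra (dId (ncyc n))"
    by (simp add: dId_def)
  ultimately have "zisomorphic (ncyc n) (ncyc n)"
    unfolding zisomorphic_def using dId_in_dHom[OF zcategory_ncyc] by blast
  then show ?thesis
    unfolding DeltaBigD_def using zcategory_ncyc by blast
qed

text \<open>A dihedral set has an extension to $\Delta_{\mathrm{big}}D$.\<close>

lemma dihedral_extension_exists:
  fixes X :: "'a presheaf"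
  assumes "dihedral_set X"
  shows "\<exists>P :: 'a presheaf. dihedral_extension X P"
proof -
  define good where "good C E f g \<longleftrightarrow> E \<in> DeltaD \<and> f \<in> dHom E C \<and> g \<in> dHom C E \<and>
      dComp g f = dId E \<and> dComp f g = dId C \<and> (C \<in> DeltaD \<longrightarrow> E = C \<and> f = dId C \<and> g = dId C)"
    for C E f g
  have "\<forall>C\<in>DeltaBigD. \<exists>E f g. good C E f g"
  proof
    fix C assume C: "C \<in> DeltaBigD"
    show "\<exists>E f g. good C E f g"
    proof (cases "C \<in> DeltaD")
      case True
      then have "dId C \<in> dHom C C"
        using dId_in_dHom zcategory_ncyc unfolding DeltaD_def by blast
      with True show ?thesis
        unfolding good_def using dComp_dId by blast
    next
      case False
      with C show ?thesis
        unfolding good_def DeltaBigD_def zisomorphic_def DeltaD_def by blast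
    qed
  qed
  then obtain E I J where g: "\<And>C. C \<in> DeltaBigD \<Longrightarrow> good C (E C) (I C) (J C)"
    by metis
  define P :: "'a presheaf" where
    "P = \<lparr>pset = (\<lambda>C. pset X (E C)),
          pmap = (\<lambda>f. pmap X (dComp (J (dTgt f)) (dComp f (I (dSrc f)))))\<rparr>"
  have E: "E C \<in> DeltaD" and I: "I C \<in> dHom (E C) C" and J: "J C \<in> dHom C (E C)"
    and JI: "dComp (J C) (I C) = dId (E C)" and IJ: "dComp (I C) (J C) = dId C"
    if "C \<in> DeltaBigD" for C
    using g[OF that] by (auto simp: good_def)
  have zE: "zcategory (E C)" and z: "zcategory C" if "C \<in> DeltaBigD" for C
    using E[OF that] zcategory_ncyc that by (auto simp: DeltaD_def DeltaBigD_def)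
  have X: "presheaf_on DeltaD X"
    using assms by (simp add: dihedral_set_def)
  have ends: "dSrc f = C" "dTgt f = D" if "f \<in> dHom C D" for f C D
    using that by (auto simp: dHom_def)
  have conj: "dComp (J D) (dComp f (I C)) \<in> dHom (E C) (E D)"
    if "C \<in> DeltaBigD" "D \<in> DeltaBigD" "f \<in> dHom C D" for C D f
    using that I J zE dComp_in_dHom by meson
  have "presheaf_on DeltaBigD P"
    unfolding presheaf_on_def
  proof (intro conjI ballI)
    fix C D f assume h: "C \<in> DeltaBigD" "D \<in> DeltaBigD" "f \<in> dHom C D"
    then show "pmap P f \<in> pset P D \<rightarrow> pset P C"
      using X conj[OF h] E ends[OF h(3)] unfolding presheaf_on_def P_def by simp
  next
    fix C x assume h: "C \<in> DeltaBigD" "x \<in> pset P C"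
    have "dComp (J C) (dComp (dId C) (I C)) = dId (E C)"
      using dComp_dId(2)[OF I[OF h(1)]] JI[OF h(1)] by simp
    then show "pmap P (dId C) x = x"
      using X E[OF h(1)] h ends[OF dId_in_dHom[OF z[OF h(1)]]]
      unfolding presheaf_on_def P_def by simp
  next
    fix B C D f k x
    assume h: "B \<in> DeltaBigD" "C \<in> DeltaBigD" "D \<in> DeltaBigD" "f \<in> dHom B C" "k \<in> dHom C D"
      "x \<in> pset P D"
    let ?f = "dComp (J C) (dComp f (I B))" and ?k = "dComp (J D) (dComp k (I C))"
    have kf: "dComp k f \<in> dHom B D"
      using dComp_in_dHom z h by blast
    have fI: "dComp f (I B) \<in> dHom (E B) C"
      using dComp_in_dHom[OF zE I] h by blast
    have kI: "dComp k (I C) \<in> dHom (E C) D"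
      using dComp_in_dHom[OF zE I] h by blast
    have f': "?f \<in> dHom (E B) (E C)" and k': "?k \<in> dHom (E C) (E D)"
      using conj h by auto
    have "dComp ?k ?f = dComp (J D) (dComp (dComp k (I C)) ?f)"
      using dComp_assoc[OF f' kI J] h by simp
    also have "dComp (dComp k (I C)) ?f = dComp k (dComp (I C) ?f)"
      using dComp_assoc[OF f' I h(5)] h by simp
    also have "dComp (I C) ?f = dComp (dComp (I C) (J C)) (dComp f (I B))"
      using dComp_assoc[OF fI J I] h by simp
    also have "\<dots> = dComp f (I B)"
      using IJ dComp_dId(2)[OF fI] h by simp
    also have "dComp k (dComp f (I B)) = dComp (dComp k f) (I B)"
      using dComp_assoc[OF I h(4,5)] h by simp
    finally have "dComp ?k ?f = dComp (J D) (dComp (dComp k f) (I B))" .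
    moreover have "pmap X (dComp ?k ?f) x = pmap X ?f (pmap X ?k x)"
    proof -
      have "x \<in> pset X (E D)"
        using h(6) by (simp add: P_def)
      then show ?thesis
        using X f' k' E[OF h(1)] E[OF h(2)] E[OF h(3)] unfolding presheaf_on_def by blast
    qed
    ultimately show "pmap P (dComp k f) x = pmap P f (pmap P k x)"
      using ends[OF kf] ends[OF h(4)] ends[OF h(5)] unfolding P_def by simp
  qed
  moreover have D: "E C = C" "I C = dId C" "J C = dId C" if "C \<in> DeltaD" for C
    using g[of C] that ncyc_in_DeltaBigD by (auto simp: good_def DeltaD_def)
  moreover have "pmap P f x = pmap X f x" if "C \<in> DeltaD" "D \<in> DeltaD" "f \<in> dHom C D" for C D f x
    using D that ends[OF that(3)] dComp_dId[OF that(3)] unfolding P_def by simp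
  ultimately show ?thesis
    unfolding dihedral_extension_def by (intro exI[of _ P]) (auto simp: P_def)
qed

definition cyc_mor ::
  "zob set \<Rightarrow> (zob \<Rightarrow> zob \<Rightarrow> bool) \<Rightarrow> zob set \<Rightarrow> (zob \<Rightarrow> zob \<Rightarrow> bool) \<Rightarrow> (zob \<Rightarrow> zob) \<Rightarrow> dmor" where
  "cyc_mor A leA B leB f = \<lparr>dSrc = cyc A leA, dTgt = cyc B leB, dContra = False,
     dOb = (\<lambda>a\<in>A. f a),
     dAr = (\<lambda>t\<in>zAr (cyc A leA). (f (fst t), fst (snd t), f (snd (snd t))))\<rparr>"


section \<open>Simplicial sets, realization and subdivisions\<close>

text \<open>\<^term>\<open>smap Y m n \<theta>\<close> is $\theta^* : Y[n] \to Y[m]$ for $\theta : [m] \to [n]$ in $\Delta$.\<close>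

record 'a sset =
  cells :: "nat \<Rightarrow> 'a set"
  smap :: "nat \<Rightarrow> nat \<Rightarrow> (nat \<Rightarrow> nat) \<Rightarrow> 'a \<Rightarrow> 'a"

definition DeltaHom :: "nat \<Rightarrow> nat \<Rightarrow> (nat \<Rightarrow> nat) set" where
  "DeltaHom m n = {\<theta> \<in> {..m} \<rightarrow>\<^sub>E {..n}. mono_on {..m} \<theta>}"

definition underlying_sset :: "'a presheaf \<Rightarrow> 'a sset" where
  "underlying_sset X = \<lparr>cells = (\<lambda>n. pset X (ncyc n)),
     smap = (\<lambda>m n \<theta>. pmap X (cyc_mor (ord_set m) ord_le (ord_set n) ord_le (\<lambda>a. Num (\<theta> (num_of a)))))\<rparr>"

definition sd_map :: "nat \<Rightarrow> nat \<Rightarrow> nat \<Rightarrow> (nat \<Rightarrow> nat) \<Rightarrow> nat \<Rightarrow> nat" where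
  "sd_map r m n f =
     (\<lambda>j\<in>{..r * (m + 1) - 1}. (j div (m + 1)) * (n + 1) + f (j mod (m + 1)))"

definition sd :: "nat \<Rightarrow> 'a sset \<Rightarrow> 'a sset" where
  "sd r Y = \<lparr>cells = (\<lambda>n. cells Y (r * (n + 1) - 1)),
     smap = (\<lambda>m n f. smap Y (r * (m + 1) - 1) (r * (n + 1) - 1) (sd_map r m n f))\<rparr>"

definition sde_map :: "nat \<Rightarrow> nat \<Rightarrow> (nat \<Rightarrow> nat) \<Rightarrow> nat \<Rightarrow> nat" where
  "sde_map m n f =
     (\<lambda>j\<in>{..2 * m + 1}. if j \<le> m then f j else 2 * n + 1 - f (2 * m + 1 - j))"

definition sde :: "'a sset \<Rightarrow> 'a sset" where
  "sde Y = \<lparr>cells = (\<lambda>n. cells Y (2 * n + 1)),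
     smap = (\<lambda>m n f. smap Y (2 * m + 1) (2 * n + 1) (sde_map m n f))\<rparr>"

text \<open>The quotient topology on the set of values of \<open>q\<close>.\<close>

definition quotient_top :: "'a topology \<Rightarrow> ('a \<Rightarrow> 'b) \<Rightarrow> 'b topology" where
  "quotient_top T q =
     topology (\<lambda>U. U \<subseteq> q ` topspace T \<and> openin T {x \<in> topspace T. q x \<in> U})"

lemma openin_quotient_top:
  "openin (quotient_top T q) U \<longleftrightarrow> U \<subseteq> q ` topspace T \<and> openin T {x \<in> topspace T. q x \<in> U}"
proof -
  have "istopology (\<lambda>U. U \<subseteq> q ` topspace T \<and> openin T {x \<in> topspace T. q x \<in> U})"
    unfolding istopology_def
  proof (intro conjI allI impI)
    fix S U
    assume "S \<subseteq> q ` topspace T \<and> openin T {x \<in> topspace T. q x \<in> S}"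
      and "U \<subseteq> q ` topspace T \<and> openin T {x \<in> topspace T. q x \<in> U}"
    moreover have "{x \<in> topspace T. q x \<in> S \<inter> U} =
        {x \<in> topspace T. q x \<in> S} \<inter> {x \<in> topspace T. q x \<in> U}"
      by auto
    ultimately show "S \<inter> U \<subseteq> q ` topspace T" and "openin T {x \<in> topspace T. q x \<in> S \<inter> U}"
      by auto
  next
    fix \<K>
    assume *: "\<forall>K\<in>\<K>. K \<subseteq> q ` topspace T \<and> openin T {x \<in> topspace T. q x \<in> K}"
    then show "\<Union> \<K> \<subseteq> q ` topspace T"
      by blast
    have "{x \<in> topspace T. q x \<in> \<Union> \<K>} = (\<Union>K\<in>\<K>. {x \<in> topspace T. q x \<in> K})"
      by auto
    then show "openin T {x \<in> topspace T. q x \<in> \<Union> \<K>}"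
      using * by auto
  qed
  then show ?thesis
    by (simp add: quotient_top_def)
qed

lemma topspace_quotient_top: "topspace (quotient_top T q) = q ` topspace T"
proof
  show "topspace (quotient_top T q) \<subseteq> q ` topspace T"
    using openin_topspace[of "quotient_top T q"] unfolding openin_quotient_top by (rule conjunct1)
  have "{x \<in> topspace T. q x \<in> q ` topspace T} = topspace T"
    by auto
  then have "openin (quotient_top T q) (q ` topspace T)"
    by (simp add: openin_quotient_top)
  then show "q ` topspace T \<subseteq> topspace (quotient_top T q)"
    by (rule openin_subset)
qed

lemma quotient_map_quotient_top: "quotient_map T (quotient_top T q) q"
  by (simp add: quotient_map_def topspace_quotient_top openin_quotient_top)

text \<open>The map on equivalence classes induced by a map \<open>h\<close> on representatives; meaningful when \<open>h\<close> is
  constant on each class.\<close>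

definition class_map :: "('b \<Rightarrow> 'c) \<Rightarrow> 'b set \<Rightarrow> 'c" where
  "class_map h K = the_elem (h ` K)"

text \<open>$\theta_* : \Delta[m] \to \Delta[n]$.\<close>

definition simplex_push :: "nat \<Rightarrow> (nat \<Rightarrow> nat) \<Rightarrow> (nat \<Rightarrow> real) \<Rightarrow> nat \<Rightarrow> real" where
  "simplex_push m \<theta> z = (\<lambda>j. \<Sum>i | i \<le> m \<and> \<theta> i = j. z i)"

definition realize_step ::
  "'a sset \<Rightarrow> nat \<times> 'a \<times> (nat \<Rightarrow> real) \<Rightarrow> nat \<times> 'a \<times> (nat \<Rightarrow> real) \<Rightarrow> bool" where
  "realize_step Y p q \<longleftrightarrow> (\<exists>m n. \<exists>\<theta>\<in>DeltaHom m n. \<exists>y\<in>cells Y n. \<exists>z\<in>standard_simplex m.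
     p = (n, y, simplex_push m \<theta> z) \<and> q = (m, smap Y m n \<theta> y, z))"

definition realize_class ::
  "'a sset \<Rightarrow> nat \<times> 'a \<times> (nat \<Rightarrow> real) \<Rightarrow> (nat \<times> 'a \<times> (nat \<Rightarrow> real)) set" where
  "realize_class Y p = {q. equivclp (realize_step Y) p q}"

definition realization :: "'a sset \<Rightarrow> (nat \<times> 'a \<times> (nat \<Rightarrow> real)) set topology" where
  "realization Y = quotient_top
     (sum_topology (\<lambda>n. prod_topology (discrete_topology (cells Y n))
        (subtopology (powertop_real UNIV) (standard_simplex n))) UNIV)
     (realize_class Y)"


section \<open>The circle $\mathbb{R}/L\mathbb{Z}$ and $\pi_0$ of complements of finite subsets\<close>

definition circ_proj :: "nat \<Rightarrow> real \<Rightarrow> real set" where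
  "circ_proj L x = {x + of_int k * real L | k. True}"

definition circ :: "nat \<Rightarrow> real set topology" where
  "circ L = quotient_top euclideanreal (circ_proj L)"

text \<open>Paths are functions on all of \<^typ>\<open>real\<close> considered on \<^term>\<open>{0..1::real}\<close> only, as in the library.
  \<open>lifts_to L p g\<close>: the path \<open>p\<close> is the continuous non-decreasing \<open>g\<close> followed by the projection.\<close>

definition lifts_to :: "nat \<Rightarrow> (real \<Rightarrow> real set) \<Rightarrow> (real \<Rightarrow> real) \<Rightarrow> bool" where
  "lifts_to L p g \<longleftrightarrow> continuous_on {0..1} g \<and> mono_on {0..1} g \<and> (\<forall>t\<in>{0..1}. p t = circ_proj L (g t))"

definition mono_paths :: "nat \<Rightarrow> (real \<Rightarrow> real set) set" where
  "mono_paths L = {p. \<exists>g. lifts_to L p g}"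

definition path_homotopic :: "nat \<Rightarrow> (real \<Rightarrow> real set) \<Rightarrow> (real \<Rightarrow> real set) \<Rightarrow> bool" where
  "path_homotopic L p q \<longleftrightarrow>
     homotopic_with (\<lambda>h. h 0 = p 0 \<and> h 1 = p 1) (top_of_set {0..1}) (circ L) p q"

definition path_hclass :: "nat \<Rightarrow> (real \<Rightarrow> real set) \<Rightarrow> (real \<Rightarrow> real set) set" where
  "path_hclass L p = {q \<in> mono_paths L. path_homotopic L p q}"

definition path_join :: "(real \<Rightarrow> 'b) \<Rightarrow> (real \<Rightarrow> 'b) \<Rightarrow> real \<Rightarrow> 'b" where
  "path_join p q = (\<lambda>t. if t \<le> 1 / 2 then p (2 * t) else q (2 * t - 1))"

definition circ_cat :: "nat \<Rightarrow> (real set, (real \<Rightarrow> real set) set) zcat" where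
  "circ_cat L = \<lparr>zOb = topspace (circ L),
     zAr = path_hclass L ` mono_paths L,
     zSrc = class_map (\<lambda>p. p 0), zTgt = class_map (\<lambda>p. p 1),
     zId = (\<lambda>x. path_hclass L (\<lambda>t. x)),
     zComp = (\<lambda>B A. \<Union>p\<in>A. \<Union>q\<in>B. path_hclass L (path_join p q)),
     zEnd = (\<lambda>x. {p. \<exists>g. lifts_to L p g \<and> circ_proj L (g 0) = x \<and> g 1 = g 0 + real L})\<rparr>"

definition arcs :: "nat \<Rightarrow> real set set \<Rightarrow> real set set set" where
  "arcs L F = connected_components_of (subtopology (circ L) (topspace (circ L) - F))"

text \<open>The chosen point $x_c$ of a component $c$.\<close>

definition pt :: "real set set \<Rightarrow> real set" where
  "pt c = (SOME x. x \<in> c)"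

definition pi0 :: "nat \<Rightarrow> real set set \<Rightarrow> zc" where
  "pi0 L F = \<lparr>zOb = Arc ` arcs L F,
     zAr = {(Arc c, Path A, Arc d) | c A d.
        c \<in> arcs L F \<and> d \<in> arcs L F \<and> A \<in> zHom (circ_cat L) (pt c) (pt d)},
     zSrc = fst, zTgt = (\<lambda>f. snd (snd f)),
     zId = (\<lambda>a. (a, Path (zId (circ_cat L) (pt (arc_of a))), a)),
     zComp = (\<lambda>g f. (fst f,
        Path (zComp (circ_cat L) (path_class (fst (snd g))) (path_class (fst (snd f)))),
        snd (snd g))),
     zEnd = (\<lambda>a. (a, Path (zEnd (circ_cat L) (pt (arc_of a))), a))\<rparr>"

definition orient_pres :: "nat \<Rightarrow> nat \<Rightarrow> (real set \<Rightarrow> real set) \<Rightarrow> bool" where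
  "orient_pres L M \<phi> \<longleftrightarrow>
     (\<exists>g. continuous_on UNIV g \<and> mono g \<and> (\<forall>x. \<phi> (circ_proj L x) = circ_proj M (g x)))"

text \<open>A path from a point of \<open>c\<close> to a point of \<open>d\<close> is moved to paths from $x_c$ to $x_d$ by homotopies
  whose ends stay inside \<open>c\<close> and \<open>d\<close>.  As \<open>c\<close> and \<open>d\<close> are arcs, the result is one homotopy class.\<close>

definition transport ::
  "nat \<Rightarrow> real set set \<Rightarrow> real set set \<Rightarrow> (real \<Rightarrow> real set) \<Rightarrow> (real \<Rightarrow> real set) set" where
  "transport L c d p = {q \<in> mono_paths L. q 0 = pt c \<and> q 1 = pt d \<and>
     homotopic_with (\<lambda>h. h 0 \<in> c \<and> h 1 \<in> d) (top_of_set {0..1}) (circ L) p q}"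

text \<open>The functor from $\pi_0(\mathbb{R}/L\mathbb{Z} \setminus F)$ to
  $\pi_0(\mathbb{R}/M\mathbb{Z} \setminus G)$ induced by a map \<open>\<phi>\<close> carrying the complement of \<open>F\<close> into the
  complement of \<open>G\<close>.  It is used for inclusions of complements, for homeomorphisms and for
  rescalings.  If \<open>\<phi>\<close> reverses the orientation, the image paths are traversed backwards.\<close>

definition arc_image ::
  "nat \<Rightarrow> real set set \<Rightarrow> (real set \<Rightarrow> real set) \<Rightarrow> real set set \<Rightarrow> real set set" where
  "arc_image M G \<phi> c = (THE c'. c' \<in> arcs M G \<and> \<phi> ` c \<subseteq> c')"

definition pi0_mor ::
  "nat \<Rightarrow> real set set \<Rightarrow> nat \<Rightarrow> real set set \<Rightarrow> (real set \<Rightarrow> real set) \<Rightarrow> dmor" where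
  "pi0_mor L F M G \<phi> = (let im = arc_image M G \<phi> in
     \<lparr>dSrc = pi0 L F, dTgt = pi0 M G, dContra = (\<not> orient_pres L M \<phi>),
      dOb = (\<lambda>a\<in>zOb (pi0 L F). Arc (im (arc_of a))),
      dAr = (\<lambda>f\<in>zAr (pi0 L F).
        let c = im (arc_of (fst f)); d = im (arc_of (snd (snd f))); A = path_class (fst (snd f)) in
        if orient_pres L M \<phi>
        then (Arc c, Path (\<Union>p\<in>A. transport M c d (\<lambda>t. \<phi> (p t))), Arc d)
        else (Arc d, Path (\<Union>p\<in>A. transport M d c (\<lambda>t. \<phi> (p (1 - t)))), Arc c))\<rparr>)"

text \<open>The identification of $\pi_0(\mathbb{R}/L\mathbb{Z} \setminus \overline F)$ with
  $\pi_0([0,L] \setminus F)_{\mathrm{cyc}}$: the generator corresponds to crossing the base point, so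
  the label of an arrow counts how often the paths in its class cross it.\<close>

definition ipi0 :: "nat \<Rightarrow> real set \<Rightarrow> zob set" where
  "ipi0 L F = Intv ` components ({0..real L} - F)"

definition ipi0_le :: "zob \<Rightarrow> zob \<Rightarrow> bool" where
  "ipi0_le a b \<longleftrightarrow> (\<exists>x\<in>intv_of a. \<exists>y\<in>intv_of b. x \<le> y)"

definition unroll :: "nat \<Rightarrow> real set \<Rightarrow> real set set \<Rightarrow> real set" where
  "unroll L F c =
     (THE e. e \<in> components ({0..real L} - F) \<and> {x \<in> {0..real L}. circ_proj L x \<in> c} \<subseteq> e)"

definition cut_mor :: "nat \<Rightarrow> real set \<Rightarrow> dmor" where
  "cut_mor L F = \<lparr>dSrc = pi0 L (circ_proj L ` F), dTgt = cyc (ipi0 L F) ipi0_le, dContra = False,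
     dOb = (\<lambda>a\<in>zOb (pi0 L (circ_proj L ` F)). Intv (unroll L F (arc_of a))),
     dAr = (\<lambda>f\<in>zAr (pi0 L (circ_proj L ` F)).
        let e = unroll L F (arc_of (fst f)); e' = unroll L F (arc_of (snd (snd f))) in
        (Intv e,
         Wind (THE k. \<exists>p\<in>path_class (fst (snd f)). \<exists>g. lifts_to L p g \<and>
            g 0 \<in> e \<and> g 1 - real k * real L \<in> e'),
         Intv e'))\<rparr>"


section \<open>The colimits and the canonical bijections\<close>

text \<open>Only nonempty finite subsets index the colimit: when two or more points are removed there
  is no canonical functor to $\pi_0$ of the whole circle, and no choice of such functors is
  compatible with composition.\<close>

definition fin_subsets :: "nat \<Rightarrow> real set set set" where
  "fin_subsets L = {F. finite F \<and> F \<noteq> {} \<and> F \<subseteq> topspace (circ L)}"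

definition transition :: "'a presheaf \<Rightarrow> nat \<Rightarrow> real set set \<Rightarrow> real set set \<Rightarrow> 'a \<Rightarrow> 'a" where
  "transition P L F G = pmap P (pi0_mor L G L F (\<lambda>x. x))"

definition filtered_diagram :: "'a presheaf \<Rightarrow> nat \<Rightarrow> bool" where
  "filtered_diagram P L \<longleftrightarrow>
     fin_subsets L \<noteq> {} \<and>
     (\<forall>F\<in>fin_subsets L. \<forall>G\<in>fin_subsets L. \<exists>H\<in>fin_subsets L. F \<subseteq> H \<and> G \<subseteq> H) \<and>
     (\<forall>F\<in>fin_subsets L. pi0 L F \<in> DeltaBigD) \<and>
     (\<forall>F\<in>fin_subsets L. \<forall>G\<in>fin_subsets L. F \<subseteq> G \<longrightarrow>
        pi0_mor L G L F (\<lambda>x. x) \<in> dHom (pi0 L G) (pi0 L F) \<and>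
        transition P L F G \<in> pset P (pi0 L F) \<rightarrow> pset P (pi0 L G)) \<and>
     (\<forall>F\<in>fin_subsets L. \<forall>x\<in>pset P (pi0 L F). transition P L F F x = x) \<and>
     (\<forall>F\<in>fin_subsets L. \<forall>G\<in>fin_subsets L. \<forall>H\<in>fin_subsets L. F \<subseteq> G \<and> G \<subseteq> H \<longrightarrow>
        (\<forall>x\<in>pset P (pi0 L F). transition P L F H x = transition P L G H (transition P L F G x)))"

definition colim_step ::
  "'a presheaf \<Rightarrow> nat \<Rightarrow> real set set \<times> 'a \<Rightarrow> real set set \<times> 'a \<Rightarrow> bool" where
  "colim_step P L p q \<longleftrightarrow> (\<exists>F\<in>fin_subsets L. \<exists>G\<in>fin_subsets L. \<exists>x\<in>pset P (pi0 L F).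
     F \<subseteq> G \<and> p = (F, x) \<and> q = (G, transition P L F G x))"

definition cin :: "'a presheaf \<Rightarrow> nat \<Rightarrow> real set set \<Rightarrow> 'a \<Rightarrow> (real set set \<times> 'a) set" where
  "cin P L F x = {q. equivclp (colim_step P L) (F, x) q}"

definition colim :: "'a presheaf \<Rightarrow> nat \<Rightarrow> (real set set \<times> 'a) set set" where
  "colim P L = {cin P L F x | F x. F \<in> fin_subsets L \<and> x \<in> pset P (pi0 L F)}"

text \<open>The element $\mathrm{in}_{\overline F}(\widetilde X[f_{\mathrm{cyc}}](\xi))$ for
  $f : \pi_0([0,L] \setminus F) \to [N]$ and $\xi \in X[N]$.\<close>

definition interval_point ::
  "'a presheaf \<Rightarrow> nat \<Rightarrow> real set \<Rightarrow> nat \<Rightarrow> (real set \<Rightarrow> nat) \<Rightarrow> 'a \<Rightarrow> (real set set \<times> 'a) set" where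
  "interval_point P L F N f \<xi> = cin P L (circ_proj L ` F)
     (pmap P (dComp (cyc_mor (ipi0 L F) ipi0_le (ord_set N) ord_le (\<lambda>e. Num (f (intv_of e)))) (cut_mor L F)) \<xi>)"

definition xcoord :: "(nat \<Rightarrow> real) \<Rightarrow> nat \<Rightarrow> real" where
  "xcoord z i = (\<Sum>j<i. z j)"

definition rep_sd ::
  "'a presheaf \<Rightarrow> nat \<Rightarrow> nat \<times> 'a \<times> (nat \<Rightarrow> real) \<Rightarrow> (real set set \<times> 'a) set" where
  "rep_sd P r = (\<lambda>(n, \<xi>, z). let x = xcoord z in
     interval_point P r {real k + x i | k i. k < r \<and> i \<le> n + 1} (r * (n + 1) - 1)
       (\<lambda>e. THE j. \<exists>k<r. \<exists>i\<le>n.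
          e = {real k + x i <..< real k + x (i + 1)} \<and> j = k * (n + 1) + i)
       \<xi>)"

definition rep_sde ::
  "'a presheaf \<Rightarrow> nat \<Rightarrow> nat \<times> 'a \<times> (nat \<Rightarrow> real) \<Rightarrow> (real set set \<times> 'a) set" where
  "rep_sde P r = (\<lambda>(n, \<xi>, z). let x = xcoord z in
     interval_point P (2 * r)
       ({2 * real k + x i | k i. k < r \<and> i \<le> n + 1} \<union>
        {2 * real k + 2 - x i | k i. k < r \<and> i \<le> n + 1})
       (2 * r * (n + 1) - 1)
       (\<lambda>e. THE j. \<exists>k<r. \<exists>i\<le>n.
          e = {2 * real k + x i <..< 2 * real k + x (i + 1)} \<and> j = 2 * k * (n + 1) + i \<or>
          e = {2 * real k + 2 - x (i + 1) <..< 2 * real k + 2 - x i} \<and>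
            j = 2 * k * (n + 1) + 2 * n + 1 - i)
       \<xi>)"

text \<open>The map given on representatives by \<open>rep\<close> is well defined and bijective from the realization
  onto the colimit.\<close>

definition canonical_bijection ::
  "'a presheaf \<Rightarrow> nat \<Rightarrow> 'a sset \<Rightarrow> (nat \<times> 'a \<times> (nat \<Rightarrow> real) \<Rightarrow> (real set set \<times> 'a) set) \<Rightarrow> bool" where
  "canonical_bijection P L Y rep \<longleftrightarrow>
     (\<forall>n. \<forall>\<xi>\<in>cells Y n. \<forall>z\<in>standard_simplex n.
        class_map rep (realize_class Y (n, \<xi>, z)) = rep (n, \<xi>, z)) \<and>
     bij_betw (class_map rep) (topspace (realization Y)) (colim P L)"


section \<open>Actions and induced maps\<close>

definition Homeo :: "nat \<Rightarrow> (real set \<Rightarrow> real set) monoid" where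
  "Homeo L = \<lparr>carrier = {\<alpha> \<in> extensional (topspace (circ L)). homeomorphic_map (circ L) (circ L) \<alpha>},
     mult = (\<lambda>\<alpha> \<beta>. compose (topspace (circ L)) \<alpha> \<beta>),
     one = (\<lambda>x\<in>topspace (circ L). x)\<rparr>"

text \<open>The map of colimits sending $\mathrm{in}_F(x)$ to
  $\mathrm{in}_{\varphi(F)}(\widetilde X[\varphi_F^{-1}](x))$.\<close>

definition colim_rep ::
  "'a presheaf \<Rightarrow> nat \<Rightarrow> nat \<Rightarrow> (real set \<Rightarrow> real set) \<Rightarrow> real set set \<Rightarrow> 'a \<Rightarrow> (real set set \<times> 'a) set" where
  "colim_rep P L M \<phi> F x = cin P M (\<phi> ` F) (pmap P (dInv (pi0_mor L F M (\<phi> ` F) \<phi>)) x)"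

definition colim_map ::
  "'a presheaf \<Rightarrow> nat \<Rightarrow> nat \<Rightarrow> (real set \<Rightarrow> real set) \<Rightarrow>
     (real set set \<times> 'a) set \<Rightarrow> (real set set \<times> 'a) set" where
  "colim_map P L M \<phi> = class_map (\<lambda>(F, x). colim_rep P L M \<phi> F x)"

definition colim_map_well_defined ::
  "'a presheaf \<Rightarrow> nat \<Rightarrow> nat \<Rightarrow> (real set \<Rightarrow> real set) \<Rightarrow> bool" where
  "colim_map_well_defined P L M \<phi> \<longleftrightarrow>
     (\<forall>F\<in>fin_subsets L. \<forall>x\<in>pset P (pi0 L F).
        colim_map P L M \<phi> (cin P L F x) = colim_rep P L M \<phi> F x)"

text \<open>The action of the homeomorphism group, carried over to the realization.\<close>

definition act ::
  "'a presheaf \<Rightarrow> nat \<Rightarrow> 'a sset \<Rightarrow> (nat \<times> 'a \<times> (nat \<Rightarrow> real) \<Rightarrow> (real set set \<times> 'a) set) \<Rightarrow>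
     (real set \<Rightarrow> real set) \<Rightarrow>
     (nat \<times> 'a \<times> (nat \<Rightarrow> real)) set \<Rightarrow> (nat \<times> 'a \<times> (nat \<Rightarrow> real)) set" where
  "act P L Y rep \<alpha> = (\<lambda>p\<in>topspace (realization Y).
     inv_into (topspace (realization Y)) (class_map rep) (colim_map P L L \<alpha> (class_map rep p)))"

definition rescale :: "nat \<Rightarrow> real set \<Rightarrow> real set" where
  "rescale L c = (\<lambda>x. x / real L) ` c"

text \<open>The maps $D_r$ (\<open>L = r\<close>) and $D^{\mathrm e}_r$ (\<open>L = 2r\<close>) to $|X[-]|$, and the maps $d_r$ and
  $d^{\mathrm e}_r$.\<close>

definition realization_rescale ::
  "'a presheaf \<Rightarrow> 'a presheaf \<Rightarrow> nat \<Rightarrow>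
     (nat \<times> 'a \<times> (nat \<Rightarrow> real) \<Rightarrow> (real set set \<times> 'a) set) \<Rightarrow>
     (nat \<times> 'a \<times> (nat \<Rightarrow> real)) set \<Rightarrow> (nat \<times> 'a \<times> (nat \<Rightarrow> real)) set" where
  "realization_rescale X P L rep p =
     inv_into (topspace (realization (underlying_sset X))) (class_map (rep_sd P 1))
       (colim_map P L 1 (rescale L) (class_map rep p))"

definition Homeo_rescale :: "nat \<Rightarrow> (real set \<Rightarrow> real set) \<Rightarrow> real set \<Rightarrow> real set" where
  "Homeo_rescale L \<alpha> = (\<lambda>x\<in>topspace (circ 1).
     rescale L (\<alpha> (inv_into (topspace (circ L)) (rescale L) x)))"

end

theory Submission
  imports Defs "HOL-Analysis.Analysis"
begin

text \<open>The whole proof takes place on the line. Let $\widetilde F \subseteq \mathbb{R}$ be the preimage of a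
nonempty finite $F \subseteq \mathbb{R}/L\mathbb{Z}$. A monotone path in $\mathbb{R}/L\mathbb{Z}$ is
determined, up to homotopy, by the ends of a lift: linear interpolation joins any two lifts, and the
covering $\mathbb{R} \to \mathbb{R}/L\mathbb{Z}$ lifts any homotopy. Hence
$\pi_0(\mathbb{R}/L\mathbb{Z} \setminus F)$ is the quotient by the translation $x \mapsto x + L$ of the
preordered set $\mathbb{R} \setminus \widetilde F$, in which $x$ precedes $y$ unless a point of
$\widetilde F$ separates $y < x$; the endomorphism $1_c$ is the class of the pair $(x, x + L)$
(\<open>presents_pi0P\<close>). The category $[N]_{\mathrm{cyc}}$ is the quotient of the same kind for
$\mathbb{Z} \subseteq \mathbb{R}$ and the translation by $N + 1$ (\<open>presents_ncycP\<close>).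

Every functor in the theorem is then induced by an equivariant monotone or antitone function
$\mathbb{R} \to \mathbb{R}$: inclusions of finite sets by the identity, homeomorphisms and rescalings by
their lifts (\<open>induces_pi0_mor\<close>), maps of $\Delta$ by periodic step functions
(\<open>induces_ncyc_mor\<close>), and a labelling of the components of $[0,L] \setminus F$ by the periodic extension
of the labels (\<open>induces_label_mor\<close>). Functions that agree up to components and a translation induce the
same functor, and composition of functors is composition of functions (\<open>induces_unique\<close>,
\<open>induces_comp\<close>), so each identity between composites of functors reduces to one between functions on
$\mathbb{R}$.

Parts (a), (b) and the case $r = 1$ are one statement about a periodic word $\varepsilon$ that says,
for each unit interval $[q, q+1]$, whether the simplex is laid out forwards or backwards
(\<open>sd_seq\<close>): the constant word gives $\mathrm{sd}_r$, and the alternating word, on a circle of length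
$2r$, gives $\mathrm{sd}^{\mathrm e}_r$. A point $(\xi, z)$ of the realization subdivides $\mathbb{R}$ at the nodes of
$z$, and its image in the colimit is the pullback of the cell $\xi$ along the labelling of the gaps.

\<^item> Pushing $z$ forward along $\theta$ drops nodes and composes the labelling with the subdivision of
  $\theta$, so the map is well defined (\<open>rep_step\<close>).
\<^item> Folding a finite set into $[0,1]$ shows that it is contained in the nodes of some interior point
  $u$ of a simplex, and the labelling of an interior point is an isomorphism. Surjectivity follows.
  Two points with the same image are also equivalent to points over one common interior $u$, where
  their cells are compared by that isomorphism; this is injectivity (\<open>rep_inj\<close>).

The rescaling map $D$ sends $(\xi, z)$ to $(\xi, z')$ where $z'$ lists the gaps of $z$ on $[0,L]$ divided
by $L$, so it is continuous. It is closed because a simplex is covered by the images of finitely many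
maps $w \mapsto \theta_*(w')$: the trace of $D(C)$ on a simplex is a finite union of images of compact sets
(\<open>homeomorphic_realization_rescale\<close>). The statements about groups hold because a homeomorphism
of the circle lifts to a monotone homeomorphism of the line and the maps of colimits are functorial
(\<open>homeo_circ_homeo\<close>, \<open>colim_map_comp\<close>).\<close>

section \<open>Quotients of the punctured line\<close>

text \<open>The preorder on the complement of a set \<open>S\<close> of cuts: two points are equivalent exactly when they lie in
the same component of the complement, and the components are ordered as in the line.\<close>

definition seg_le :: "real set \<Rightarrow> real \<Rightarrow> real \<Rightarrow> bool" where
  "seg_le S x y \<longleftrightarrow> {y<..<x} \<inter> S = {}"

definition seg_eq :: "real set \<Rightarrow> real \<Rightarrow> real \<Rightarrow> bool" where
  "seg_eq S x y \<longleftrightarrow> seg_le S x y \<and> seg_le S y x"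

lemma seg_le_of_le: "x \<le> y \<Longrightarrow> seg_le S x y"
  by (auto simp: seg_le_def)

lemma seg_le_trans:
  assumes "seg_le S x y" "seg_le S y z" "y \<notin> S"
  shows "seg_le S x z"
  unfolding seg_le_def
proof (rule equals0I)
  fix s assume s: "s \<in> {z<..<x} \<inter> S"
  then have "s \<noteq> y" using assms(3) by auto
  then consider "s < y" | "y < s" by linarith
  then show False
    using s assms(1,2) unfolding seg_le_def by cases auto
qed

lemma seg_eq_refl [simp]: "seg_eq S x x"
  by (auto simp: seg_eq_def seg_le_def)

lemma seg_le_refl [simp]: "seg_le S x x"
  by (auto simp: seg_le_def)

lemma seg_eq_sym: "seg_eq S x y \<Longrightarrow> seg_eq S y x"
  by (auto simp: seg_eq_def)

lemma seg_eq_trans: "\<lbrakk>seg_eq S x y; seg_eq S y z; y \<notin> S\<rbrakk> \<Longrightarrow> seg_eq S x z"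
  unfolding seg_eq_def using seg_le_trans by blast

definition periodic :: "real set \<Rightarrow> real \<Rightarrow> bool" where
  "periodic S T \<longleftrightarrow> T > 0 \<and> S \<noteq> {} \<and> (\<forall>x. x + T \<in> S \<longleftrightarrow> x \<in> S)"

lemma periodic_shift:
  assumes "periodic S T"
  shows "x + of_int k * T \<in> S \<longleftrightarrow> x \<in> S"
proof (induction k rule: int_induct[where k = 0])
  case (step1 i)
  have "x + of_int (i + 1) * T = (x + of_int i * T) + T" by (simp add: algebra_simps)
  then show ?case using step1 assms unfolding periodic_def by metis
next
  case (step2 i)
  have "x + of_int i * T = (x + of_int (i - 1) * T) + T" by (simp add: algebra_simps)
  then show ?case using step2 assms unfolding periodic_def by metis
qed simp

lemma seg_le_shift:
  assumes "periodic S T"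
  shows "seg_le S (x + of_int k * T) (y + of_int k * T) \<longleftrightarrow> seg_le S x y"
proof -
  have "{y<..<x} \<inter> S = {} \<Longrightarrow> {y + of_int k * T<..<x + of_int k * T} \<inter> S = {}" for x y k
  proof (clarsimp simp: disjoint_iff)
    fix s assume h: "\<forall>u. y < u \<and> u < x \<longrightarrow> u \<notin> S" "y + of_int k * T < s" "s < x + of_int k * T" "s \<in> S"
    then have "s + of_int (- k) * T \<in> S"
      using periodic_shift[OF assms] by blast
    with h(1)[rule_format, of "s + of_int (- k) * T"] h(2,3) show False by simp
  qed
  from this[of y x k] this[of "y + of_int k * T" "x + of_int k * T" "- k"] show ?thesis
    by (auto simp: seg_le_def)
qed

lemma seg_eq_shift:
  assumes "periodic S T"
  shows "seg_eq S (x + of_int k * T) (y + of_int k * T) \<longleftrightarrow> seg_eq S x y"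
  using seg_le_shift[OF assms] by (simp add: seg_eq_def)

lemma periodic_between:
  assumes "periodic S T" "x \<notin> S"
  shows "\<exists>s\<in>S. x < s \<and> s < x + T"
proof -
  obtain s0 where s0: "s0 \<in> S" and T: "T > 0" using assms by (auto simp: periodic_def)
  \<comment> \<open>The first translate of \<open>s0\<close> to the right of \<open>x\<close>.\<close>
  define k where "k = \<lfloor>(x - s0) / T\<rfloor> + 1"
  define s where "s = s0 + of_int k * T"
  have s: "s \<in> S" using s0 periodic_shift[OF assms(1)] by (simp add: s_def)
  have "of_int (k - 1) \<le> (x - s0) / T" "(x - s0) / T < of_int k"
    unfolding k_def by linarith+
  then have "of_int (k - 1) * T \<le> x - s0" "x - s0 < of_int k * T"
    using T by (simp_all add: field_simps)
  then have "x < s" "s \<le> x + T" by (simp_all add: s_def algebra_simps)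
  moreover have "s \<noteq> x + T" using s assms by (auto simp: periodic_def)
  ultimately show ?thesis using s by force
qed

text \<open>Between a point and its translate there is a cut. Therefore translations act freely on components, which
separates $1_c$ from the identity and makes base points of components unique.\<close>

lemma seg_eq_no_wrap:
  assumes "periodic S T" "x \<notin> S" "seg_eq S x (x + of_int k * T)"
  shows "k = 0"
proof (rule ccontr)
  assume "k \<noteq> 0"
  have T: "T > 0" using assms by (auto simp: periodic_def)
  obtain s where s: "s \<in> S" "x < s" "s < x + T" using periodic_between assms by blast
  have *: "False" if "seg_le S (x + of_int j * T) x" "j \<ge> 1" for j :: int
  proof -
    have "T * 1 \<le> T * of_int j" using that(2) T by (intro mult_left_mono) auto
    then have "T \<le> of_int j * T" by (simp add: mult.commute)
    then have "s < x + of_int j * T" using s(3) by linarith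
    then have "s \<in> {x<..<x + of_int j * T} \<inter> S" using s by simp
    then show False using that by (auto simp: seg_le_def)
  qed
  show False
  proof (cases "k \<ge> 1")
    case True then show ?thesis using * assms(3) by (auto simp: seg_eq_def)
  next
    case False
    have "seg_le S (x + of_int (- k) * T) x"
      using assms(3) seg_le_shift[OF assms(1), of "x" "-k" "x + of_int k * T"] by (simp add: seg_eq_def)
    then show ?thesis using *[of "-k"] False \<open>k \<noteq> 0\<close> by linarith
  qed
qed

text \<open>A $\mathbb{Z}_+$-category written as the quotient of the line with the cuts \<open>prS\<close> by the translation by
\<open>prT\<close>. The maps \<open>prOb\<close> and \<open>prAr\<close> send a point to its object and a pair of points to its arrow.\<close>

record zpres =
  prC :: zc
  prS :: "real set"
  prT :: real
  prOb :: "real \<Rightarrow> zob"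
  prAr :: "real \<Rightarrow> real \<Rightarrow> zar"

definition par_ok :: "zpres \<Rightarrow> real \<Rightarrow> real \<Rightarrow> bool" where
  "par_ok p x y \<longleftrightarrow> x \<notin> prS p \<and> y \<notin> prS p \<and> seg_le (prS p) x y"

text \<open>Equality of objects and of arrows is equality up to components and a common translation. In
particular an arrow may be moved to start at any chosen point over its source, and then composition is
juxtaposition of pairs.\<close>

definition presents :: "zpres \<Rightarrow> bool" where
  "presents p \<longleftrightarrow>
     periodic (prS p) (prT p) \<and>
     zOb (prC p) = prOb p ` (- prS p) \<and>
     zAr (prC p) = {prAr p x y | x y. par_ok p x y} \<and>
     (\<forall>x y. x \<notin> prS p \<longrightarrow> y \<notin> prS p \<longrightarrow>
        (prOb p x = prOb p y \<longleftrightarrow> (\<exists>k::int. seg_eq (prS p) x (y + of_int k * prT p)))) \<and>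
     (\<forall>x y x' y'. par_ok p x y \<longrightarrow> par_ok p x' y' \<longrightarrow>
        (prAr p x y = prAr p x' y' \<longleftrightarrow>
          (\<exists>k::int. seg_eq (prS p) x (x' + of_int k * prT p) \<and> seg_eq (prS p) y (y' + of_int k * prT p)))) \<and>
     (\<forall>x y. par_ok p x y \<longrightarrow> zSrc (prC p) (prAr p x y) = prOb p x \<and> zTgt (prC p) (prAr p x y) = prOb p y) \<and>
     (\<forall>x. x \<notin> prS p \<longrightarrow> zId (prC p) (prOb p x) = prAr p x x \<and> zEnd (prC p) (prOb p x) = prAr p x (x + prT p)) \<and>
     (\<forall>x y z. par_ok p x y \<longrightarrow> par_ok p y z \<longrightarrow> zComp (prC p) (prAr p y z) (prAr p x y) = prAr p x z)"

lemma presentsD: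
  assumes "presents p"
  shows "periodic (prS p) (prT p)"
    and "zOb (prC p) = prOb p ` (- prS p)"
    and "zAr (prC p) = {prAr p x y | x y. par_ok p x y}"
    and "\<And>x y. \<lbrakk>x \<notin> prS p; y \<notin> prS p\<rbrakk> \<Longrightarrow>
        prOb p x = prOb p y \<longleftrightarrow> (\<exists>k::int. seg_eq (prS p) x (y + of_int k * prT p))"
    and "\<And>x y x' y'. \<lbrakk>par_ok p x y; par_ok p x' y'\<rbrakk> \<Longrightarrow>
        prAr p x y = prAr p x' y' \<longleftrightarrow>
          (\<exists>k::int. seg_eq (prS p) x (x' + of_int k * prT p) \<and> seg_eq (prS p) y (y' + of_int k * prT p))"
    and "\<And>x y. par_ok p x y \<Longrightarrow> zSrc (prC p) (prAr p x y) = prOb p x"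
    and "\<And>x y. par_ok p x y \<Longrightarrow> zTgt (prC p) (prAr p x y) = prOb p y"
    and "\<And>x. x \<notin> prS p \<Longrightarrow> zId (prC p) (prOb p x) = prAr p x x"
    and "\<And>x. x \<notin> prS p \<Longrightarrow> zEnd (prC p) (prOb p x) = prAr p x (x + prT p)"
    and "\<And>x y z. \<lbrakk>par_ok p x y; par_ok p y z\<rbrakk> \<Longrightarrow> zComp (prC p) (prAr p y z) (prAr p x y) = prAr p x z"
  using assms unfolding presents_def by simp_all

lemma par_ok_refl [simp]: "par_ok p x x \<longleftrightarrow> x \<notin> prS p"
  by (simp add: par_ok_def)

lemma par_ok_trans: "\<lbrakk>par_ok p x y; par_ok p y z\<rbrakk> \<Longrightarrow> par_ok p x z"
  unfolding par_ok_def using seg_le_trans by blast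

lemma par_ok_loop: "presents p \<Longrightarrow> x \<notin> prS p \<Longrightarrow> par_ok p x (x + prT p)"
  using presentsD(1)[of p] seg_le_of_le[of x "x + prT p"] by (simp add: par_ok_def periodic_def)

lemma par_ok_shift: "presents p \<Longrightarrow> par_ok p (x + of_int k * prT p) (y + of_int k * prT p) \<longleftrightarrow> par_ok p x y"
  using presentsD(1)[of p] by (simp add: par_ok_def seg_le_shift periodic_shift)

lemma presents_Ob_mem: "presents p \<Longrightarrow> x \<notin> prS p \<Longrightarrow> prOb p x \<in> zOb (prC p)"
  by (simp add: presentsD(2))

lemma presents_Ar_mem: "presents p \<Longrightarrow> par_ok p x y \<Longrightarrow> prAr p x y \<in> zHom (prC p) (prOb p x) (prOb p y)"
  by (auto simp: zHom_def presentsD)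

lemma presents_Ob_shift: "presents p \<Longrightarrow> x \<notin> prS p \<Longrightarrow> prOb p (x + of_int k * prT p) = prOb p x"
  using presentsD(4)[of p "x + of_int k * prT p" x] presentsD(1)[of p] periodic_shift seg_eq_refl by blast

lemma presents_Ar_shift:
  "presents p \<Longrightarrow> par_ok p x y \<Longrightarrow> prAr p (x + of_int k * prT p) (y + of_int k * prT p) = prAr p x y"
  using presentsD(5)[of p "x + of_int k * prT p" "y + of_int k * prT p" x y] par_ok_shift seg_eq_refl by blast

lemma presents_zHomE:
  assumes "presents p" "f \<in> zHom (prC p) a b"
  obtains x y where "par_ok p x y" "f = prAr p x y" "a = prOb p x" "b = prOb p y"
proof -
  have "f \<in> zAr (prC p)" using assms(2) by (simp add: zHom_def)
  then obtain x y where x: "par_ok p x y" "f = prAr p x y" using presentsD(3)[OF assms(1)] by auto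
  then show ?thesis using that assms presentsD(6,7)[OF assms(1) x(1)] by (simp add: zHom_def)
qed

text \<open>This is what makes composable arrows literally composable: the second pair is translated so as to
begin where the first one ends.\<close>

lemma presents_zHom_from:
  assumes p: "presents p" and y: "y \<notin> prS p" and g: "g \<in> zHom (prC p) (prOb p y) c"
  obtains z where "par_ok p y z" "g = prAr p y z" "c = prOb p z"
proof -
  note per = presentsD(1)[OF p]
  obtain u v where uv: "par_ok p u v" "g = prAr p u v" "prOb p y = prOb p u" "c = prOb p v"
    using presents_zHomE[OF p g] by metis
  then obtain k :: int where k: "seg_eq (prS p) y (u + of_int k * prT p)"
    using presentsD(4)[OF p] y unfolding par_ok_def by blast
  let ?z = "v + of_int k * prT p"
  have "par_ok p (u + of_int k * prT p) ?z" using uv(1) par_ok_shift[OF p] by blast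
  then have ok: "par_ok p y ?z"
    using k y seg_le_trans unfolding par_ok_def seg_eq_def by blast
  moreover have "g = prAr p y ?z"
    using uv(1,2) presentsD(5)[OF p ok uv(1)] k seg_eq_refl by metis
  moreover have "c = prOb p ?z" using uv presents_Ob_shift[OF p] by (simp add: par_ok_def)
  ultimately show ?thesis using that by blast
qed

lemma presents_zcategory:
  assumes p: "presents p"
  shows "zcategory (prC p)"
proof -
  let ?C = "prC p"
  note D = presentsD[OF p]
  have "zSrc ?C \<in> zAr ?C \<rightarrow> zOb ?C \<and> zTgt ?C \<in> zAr ?C \<rightarrow> zOb ?C"
    by (auto simp: D par_ok_def)
  moreover have "zId ?C a \<in> zHom ?C a a" if "a \<in> zOb ?C" for a
    using that presents_Ar_mem[OF p] by (auto simp: D)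
  moreover have "zComp ?C g f \<in> zHom ?C a c" if fg: "f \<in> zHom ?C a b" "g \<in> zHom ?C b c" for a b c f g
  proof -
    obtain x y where x: "par_ok p x y" "f = prAr p x y" "a = prOb p x" "b = prOb p y"
      using presents_zHomE[OF p fg(1)] by metis
    obtain z where "par_ok p y z" "g = prAr p y z" "c = prOb p z"
      using presents_zHom_from[OF p _ fg(2)[unfolded x(4)]] x(1) unfolding par_ok_def by metis
    then show ?thesis using x presents_Ar_mem[OF p] par_ok_trans D(10) by metis
  qed
  moreover have "zComp ?C f (zId ?C a) = f \<and> zComp ?C (zId ?C b) f = f \<and>
      zComp ?C f (zEnd ?C a) = zComp ?C (zEnd ?C b) f" if fg: "f \<in> zHom ?C a b" for a b f
  proof -
    obtain x y where x: "par_ok p x y" "f = prAr p x y" "a = prOb p x" "b = prOb p y"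
      using presents_zHomE[OF p fg] by metis
    then have xy: "x \<notin> prS p" "y \<notin> prS p" by (auto simp: par_ok_def)
    have f': "f = prAr p (x + prT p) (y + prT p)" "par_ok p (x + prT p) (y + prT p)"
      using presents_Ar_shift[OF p x(1), of 1] par_ok_shift[OF p, of x 1 y] x by auto
    have "zComp ?C f (zEnd ?C a) = prAr p x (y + prT p)"
      using D(10)[OF par_ok_loop[OF p xy(1)] f'(2)] f'(1) D(9)[OF xy(1)] x(3) by simp
    moreover have "zComp ?C (zEnd ?C b) f = prAr p x (y + prT p)"
      using D(10)[OF x(1) par_ok_loop[OF p xy(2)]] x D(9)[OF xy(2)] by simp
    ultimately show ?thesis using x xy D(8,10) by simp
  qed
  moreover have "zComp ?C h (zComp ?C g f) = zComp ?C (zComp ?C h g) f"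
    if fg: "f \<in> zHom ?C a b" "g \<in> zHom ?C b c" "h \<in> zHom ?C c d" for a b c d f g h
  proof -
    obtain x y where x: "par_ok p x y" "f = prAr p x y" "a = prOb p x" "b = prOb p y"
      using presents_zHomE[OF p fg(1)] by metis
    obtain z where z: "par_ok p y z" "g = prAr p y z" "c = prOb p z"
      using presents_zHom_from[OF p _ fg(2)[unfolded x(4)]] x(1) unfolding par_ok_def by metis
    obtain w where w: "par_ok p z w" "h = prAr p z w" "d = prOb p w"
      using presents_zHom_from[OF p _ fg(3)[unfolded z(3)]] z(1) unfolding par_ok_def by metis
    show ?thesis using x z w D(10) par_ok_trans by metis
  qed
  moreover have "zEnd ?C a \<in> zHom ?C a a \<and> zEnd ?C a \<noteq> zId ?C a" if a: "a \<in> zOb ?C" for a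
  proof -
    obtain x where x: "x \<notin> prS p" "a = prOb p x" using a D(2) by auto
    have "prOb p (x + prT p) = prOb p x" using presents_Ob_shift[OF p x(1), of 1] by simp
    then have "zEnd ?C a \<in> zHom ?C a a"
      using presents_Ar_mem[OF p par_ok_loop[OF p x(1)]] D(9)[OF x(1)] x(2) by simp
    moreover have "prAr p x (x + prT p) \<noteq> prAr p x x"
    proof
      assume "prAr p x (x + prT p) = prAr p x x"
      then obtain k :: int where k: "seg_eq (prS p) x (x + of_int k * prT p)" "seg_eq (prS p) (x + prT p) (x + of_int k * prT p)"
        using D(5)[OF par_ok_loop[OF p x(1)], of x x] x(1) by auto
      then have "k = 0" using seg_eq_no_wrap[OF D(1) x(1)] by blast
      then have "seg_eq (prS p) x (x + of_int 1 * prT p)" using k(2) seg_eq_sym by simp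
      then have "(1::int) = 0" by (rule seg_eq_no_wrap[OF D(1) x(1)])
      then show False by simp
    qed
    ultimately show ?thesis using D(8,9) x by simp
  qed
  ultimately show ?thesis unfolding zcategory_def by (intro conjI ballI) blast+
qed

text \<open>The flag \<open>c\<close> stands for contravariance: the function then reverses the order and turns a translation into
the opposite translation.\<close>

definition equivariant :: "zpres \<Rightarrow> zpres \<Rightarrow> bool \<Rightarrow> (real \<Rightarrow> real) \<Rightarrow> bool" where
  "equivariant p q c g \<longleftrightarrow>
     (\<forall>x. x \<notin> prS p \<longrightarrow> g x \<notin> prS q) \<and>
     (\<forall>x y. par_ok p x y \<longrightarrow> (if c then seg_le (prS q) (g y) (g x) else seg_le (prS q) (g x) (g y))) \<and>
     (\<forall>x. x \<notin> prS p \<longrightarrow> seg_eq (prS q) (g (x + prT p)) (if c then g x - prT q else g x + prT q))"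

lemma equivariant_notin: "equivariant p q c g \<Longrightarrow> x \<notin> prS p \<Longrightarrow> g x \<notin> prS q"
  by (simp add: equivariant_def)

lemma equivariant_ok:
  "equivariant p q c g \<Longrightarrow> par_ok p x y \<Longrightarrow> (if c then par_ok q (g y) (g x) else par_ok q (g x) (g y))"
  by (simp add: equivariant_def par_ok_def)

lemma equivariant_seg_eq:
  "equivariant p q c g \<Longrightarrow> x \<notin> prS p \<Longrightarrow> y \<notin> prS p \<Longrightarrow> seg_eq (prS p) x y \<Longrightarrow> seg_eq (prS q) (g x) (g y)"
  unfolding equivariant_def par_ok_def seg_eq_def by (cases c) auto

lemma equivariant_shift:
  assumes p: "presents p" and q: "presents q" and g: "equivariant p q c g" and x: "x \<notin> prS p"
  shows "seg_eq (prS q) (g (x + of_int k * prT p)) (g x + of_int (if c then - k else k) * prT q)"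
proof (induction k rule: int_induct[where k = 0])
  case base
  then show ?case by simp
next
  note P = presentsD(1)[OF p] and Q = presentsD(1)[OF q]
  let ?s = "if c then - 1 else 1 :: int"
  have st: "seg_eq (prS q) (g (y + prT p)) (g y + of_int ?s * prT q)" if "y \<notin> prS p" for y
    using g that by (auto simp: equivariant_def)
  have nin: "x + of_int i * prT p \<notin> prS p" for i using periodic_shift[OF P] x by blast
  have gn: "g (x + of_int i * prT p) \<notin> prS q" for i using nin g by (simp add: equivariant_def)
  { case (step1 i)
    have e: "seg_eq (prS q) (g (x + of_int (i + 1) * prT p)) (g (x + of_int i * prT p) + of_int ?s * prT q)"
      using st[OF nin[of i]] by (simp add: algebra_simps)
    have "seg_eq (prS q) (g (x + of_int i * prT p) + of_int ?s * prT q)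
        (g x + of_int (if c then - i else i) * prT q + of_int ?s * prT q)"
      using step1 seg_eq_shift[OF Q] by blast
    moreover have "g x + of_int (if c then - i else i) * prT q + of_int ?s * prT q = g x + of_int (if c then - (i + 1) else i + 1) * prT q"
      by (simp add: algebra_simps)
    ultimately have e': "seg_eq (prS q) (g (x + of_int i * prT p) + of_int ?s * prT q)
        (g x + of_int (if c then - (i + 1) else i + 1) * prT q)"
      by (simp only:)
    have "g (x + of_int i * prT p) + of_int ?s * prT q \<notin> prS q"
      using gn periodic_shift[OF Q] by blast
    from seg_eq_trans[OF e e' this] show ?case .
  next
    case (step2 i)
    have "seg_eq (prS q) (g (x + of_int i * prT p)) (g (x + of_int (i - 1) * prT p) + of_int ?s * prT q)"
      using st[OF nin[of "i - 1"]] by (simp add: algebra_simps)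
    then have "seg_eq (prS q) (g (x + of_int (i - 1) * prT p) + of_int ?s * prT q) (g x + of_int (if c then - i else i) * prT q)"
      using seg_eq_trans[OF seg_eq_sym step2(2) gn] by blast
    then have "seg_eq (prS q) (g (x + of_int (i - 1) * prT p) + of_int ?s * prT q + of_int (- ?s) * prT q) (g x + of_int (if c then - i else i) * prT q + of_int (- ?s) * prT q)"
      using seg_eq_shift[OF Q] by blast
    moreover have "g x + of_int (if c then - i else i) * prT q + of_int (- ?s) * prT q = g x + of_int (if c then - (i - 1) else i - 1) * prT q"
      by (simp add: algebra_simps)
    moreover have "g (x + of_int (i - 1) * prT p) + of_int ?s * prT q + of_int (- ?s) * prT q = g (x + of_int (i - 1) * prT p)"
      by (simp add: algebra_simps)
    ultimately show ?case by (simp only:) }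
qed

text \<open>The functor acts on representatives by \<open>g\<close>. The function is arbitrary on the cuts, and outside them it
matters only up to components and a global translation.\<close>

definition induces :: "zpres \<Rightarrow> zpres \<Rightarrow> bool \<Rightarrow> (real \<Rightarrow> real) \<Rightarrow> dmor \<Rightarrow> bool" where
  "induces p q c g f \<longleftrightarrow> equivariant p q c g \<and>
     dSrc f = prC p \<and> dTgt f = prC q \<and> dContra f = c \<and>
     dOb f \<in> extensional (zOb (prC p)) \<and> dAr f \<in> extensional (zAr (prC p)) \<and>
     (\<forall>x. x \<notin> prS p \<longrightarrow> dOb f (prOb p x) = prOb q (g x)) \<and>
     (\<forall>x y. par_ok p x y \<longrightarrow> dAr f (prAr p x y) = (if c then prAr q (g y) (g x) else prAr q (g x) (g y)))"

lemma inducesD: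
  assumes "induces p q c g f"
  shows "equivariant p q c g" "dSrc f = prC p" "dTgt f = prC q" "dContra f = c"
    "dOb f \<in> extensional (zOb (prC p))" "dAr f \<in> extensional (zAr (prC p))"
    "\<And>x. x \<notin> prS p \<Longrightarrow> dOb f (prOb p x) = prOb q (g x)"
    "\<And>x y. par_ok p x y \<Longrightarrow> dAr f (prAr p x y) = (if c then prAr q (g y) (g x) else prAr q (g x) (g y))"
  using assms unfolding induces_def by auto

text \<open>The endomorphism $1_c$ is preserved because \<open>g\<close> is equivariant: it sends the pair $(x, x + T)$ to
$(g x, g x + T')$, or to $(g x - T', g x)$, which is the same arrow, in the contravariant case.\<close>

lemma induces_dHom:
  assumes p: "presents p" and q: "presents q" and f: "induces p q c g f"
  shows "f \<in> dHom (prC p) (prC q)"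
proof -
  note P = presentsD[OF p] and Q = presentsD[OF q] and F = inducesD[OF f]
  let ?D = "if c then zop (prC q) else prC q"
  have ok: "if c then par_ok q (g y) (g x) else par_ok q (g x) (g y)" if "par_ok p x y" for x y
    using equivariant_ok[OF F(1) that] .
  have hom: "dAr f h \<in> zHom ?D (dOb f a) (dOb f b)" if h: "h \<in> zHom (prC p) a b" for a b h
  proof -
    obtain x y where x: "par_ok p x y" "h = prAr p x y" "a = prOb p x" "b = prOb p y"
      using presents_zHomE[OF p h] by metis
    then have "x \<notin> prS p" "y \<notin> prS p" by (auto simp: par_ok_def)
    then show ?thesis using x F(7,8) ok[OF x(1)] presents_Ar_mem[OF q] by (simp split: if_splits)
  qed
  have loop: "prAr q (g x - prT q) (g x) = prAr q (g x) (g x + prT q)" "par_ok q (g x - prT q) (g x)" if "x \<notin> prS p" for x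
    using presents_Ar_shift[OF q par_ok_loop[OF q equivariant_notin[OF F(1) that]], of "-1"]
      par_ok_shift[OF q, of "g x" "-1" "g x + prT q"] par_ok_loop[OF q equivariant_notin[OF F(1) that]]
    by auto
  have "zfunctor (prC p) ?D (dOb f) (dAr f)"
    unfolding zfunctor_def
  proof (intro conjI ballI)
    show "dOb f \<in> zOb (prC p) \<rightarrow>\<^sub>E zOb ?D"
      using F(1,5,7) by (auto simp: PiE_def P(2) Q(2) equivariant_def)
    show "dAr f \<in> zAr (prC p) \<rightarrow>\<^sub>E zAr ?D"
    proof -
      have "dAr f h \<in> zAr ?D" if "h \<in> zAr (prC p)" for h
      proof -
        have "h \<in> zHom (prC p) (zSrc (prC p) h) (zTgt (prC p) h)" using that by (simp add: zHom_def)
        from zHom_zAr[OF hom[OF this]] show ?thesis .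
      qed
      then show ?thesis using F(6) by (auto simp: PiE_def)
    qed
  next
    fix a b h assume "h \<in> zHom (prC p) a b"
    then show "dAr f h \<in> zHom ?D (dOb f a) (dOb f b)" by (rule hom)
  next
    fix a assume "a \<in> zOb (prC p)"
    then obtain x where x: "x \<notin> prS p" "a = prOb p x" using P(2) by auto
    have gx: "g x \<notin> prS q" by (rule equivariant_notin[OF F(1) x(1)])
    show "dAr f (zId (prC p) a) = zId ?D (dOb f a)"
      using x gx F(8)[of x x] by (simp add: F(7) P(8) Q(8))
    have ok1: "par_ok p x (x + prT p)" by (rule par_ok_loop[OF p x(1)])
    have e: "seg_eq (prS q) (g (x + prT p)) (if c then g x - prT q else g x + prT q)"
      using F(1) x(1) by (simp add: equivariant_def)
    \<comment> \<open>In the contravariant case the image pair is $(g x - T', g x)$, a translate of $(g x, g x + T')$.\<close>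
    have "(if c then prAr q (g (x + prT p)) (g x) else prAr q (g x) (g (x + prT p))) = prAr q (g x) (g x + prT q)"
    proof (cases c)
      case True
      then have "prAr q (g (x + prT p)) (g x) = prAr q (g x - prT q) (g x)"
        using Q(5)[of "g (x + prT p)" "g x" "g x - prT q" "g x"] ok[OF ok1] loop(2)[OF x(1)] e
        by (auto intro!: exI[of _ 0])
      then show ?thesis using True loop(1)[OF x(1)] by simp
    next
      case False
      then show ?thesis
        using Q(5)[of "g x" "g (x + prT p)" "g x" "g x + prT q"] ok[OF ok1] par_ok_loop[OF q gx] e
        by (auto intro!: exI[of _ 0])
    qed
    then show "dAr f (zEnd (prC p) a) = zEnd ?D (dOb f a)"
      using F(8)[OF ok1] x gx by (simp add: F(7) P(9) Q(9))
  next
    fix a b d h k assume h: "h \<in> zHom (prC p) a b" and k: "k \<in> zHom (prC p) b d"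
    obtain x y where x: "par_ok p x y" "h = prAr p x y" "a = prOb p x" "b = prOb p y"
      using presents_zHomE[OF p h] by metis
    obtain z where z: "par_ok p y z" "k = prAr p y z" "d = prOb p z"
      using presents_zHom_from[OF p _ k[unfolded x(4)]] x(1) unfolding par_ok_def by metis
    show "dAr f (zComp (prC p) k h) = zComp ?D (dAr f k) (dAr f h)"
      using ok[OF x(1)] ok[OF z(1)] F(8)[OF x(1)] F(8)[OF z(1)] F(8)[OF par_ok_trans[OF x(1) z(1)]]
        P(10)[OF x(1) z(1)] x(2) z(2) by (simp add: Q(10) split: if_splits)
  qed
  then show ?thesis using F(2-4) by (simp add: dHom_def)
qed

text \<open>All comparisons of functors below rest on this lemma: they become comparisons of real functions.\<close>

lemma induces_unique:
  assumes p: "presents p" and q: "presents q" and f: "induces p q c g f" and f': "induces p q c g' f'"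
    and e: "\<And>x. x \<notin> prS p \<Longrightarrow> seg_eq (prS q) (g x) (g' x + of_int k * prT q)"
  shows "f = f'"
proof (rule dmor_eqI)
  note P = presentsD[OF p] and Q = presentsD[OF q] and F = inducesD[OF f] and F' = inducesD[OF f']
  show "dSrc f = dSrc f'" "dTgt f = dTgt f'" "dContra f = dContra f'"
    using F F' by auto
  show "dOb f = dOb f'"
  proof (rule extensionalityI[OF F(5) F'(5)])
    fix a assume "a \<in> zOb (prC p)"
    then obtain x where x: "x \<notin> prS p" "a = prOb p x" using P(2) by auto
    show "dOb f a = dOb f' a"
      using Q(4)[OF equivariant_notin[OF F(1) x(1)] equivariant_notin[OF F'(1) x(1)]] e[OF x(1)] F(7) F'(7) x by auto
  qed
  show "dAr f = dAr f'"
  proof (rule extensionalityI[OF F(6) F'(6)])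
    fix a assume "a \<in> zAr (prC p)"
    then obtain x y where x: "par_ok p x y" "a = prAr p x y" using P(3) by auto
    then have "x \<notin> prS p" "y \<notin> prS p" by (auto simp: par_ok_def)
    then have "seg_eq (prS q) (g x) (g' x + of_int k * prT q)" "seg_eq (prS q) (g y) (g' y + of_int k * prT q)"
      using e by auto
    then show "dAr f a = dAr f' a"
      using equivariant_ok[OF F(1) x(1)] equivariant_ok[OF F'(1) x(1)] F(8)[OF x(1)] F'(8)[OF x(1)] x(2)
        Q(5)[of "g x" "g y" "g' x" "g' y"] Q(5)[of "g y" "g x" "g' y" "g' x"] by (auto split: if_splits)
  qed
qed

lemma equivariant_comp:
  assumes p: "presents p" and q: "presents q" and r: "presents r"
    and g: "equivariant p q c g" and h: "equivariant q r d h"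
  shows "equivariant p r (c \<noteq> d) (\<lambda>x. h (g x))"
  unfolding equivariant_def
proof (intro conjI allI impI)
  fix x assume x: "x \<notin> prS p"
  then have gx: "g x \<notin> prS q" using g by (simp add: equivariant_def)
  then show "h (g x) \<notin> prS r" using h by (simp add: equivariant_def)
  have a: "seg_eq (prS q) (g (x + of_int 1 * prT p)) (g x + of_int (if c then - 1 else 1) * prT q)"
    using equivariant_shift[OF p q g x, of 1] by simp
  have n: "x + of_int 1 * prT p \<notin> prS p" "g x + of_int (if c then - 1 else 1) * prT q \<notin> prS q"
    using x gx periodic_shift presentsD(1) p q by blast+
  have n2: "g (x + of_int 1 * prT p) \<notin> prS q" using n g by (simp add: equivariant_def)
  have "seg_eq (prS r) (h (g (x + of_int 1 * prT p))) (h (g x + of_int (if c then - 1 else 1) * prT q))"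
    by (rule equivariant_seg_eq[OF h n2 n(2) a])
  moreover have "seg_eq (prS r) (h (g x + of_int (if c then - 1 else 1) * prT q))
      (h (g x) + of_int (if d then - (if c then - 1 else 1) else if c then - 1 else 1) * prT r)"
    using equivariant_shift[OF q r h gx, of "if c then - 1 else 1"] by simp
  moreover have "h (g x + of_int (if c then - 1 else 1) * prT q) \<notin> prS r"
    using n(2) h by (simp add: equivariant_def)
  ultimately have "seg_eq (prS r) (h (g (x + of_int 1 * prT p)))
      (h (g x) + of_int (if d then - (if c then - 1 else 1) else if c then - 1 else 1) * prT r)"
    using seg_eq_trans by blast
  then show "seg_eq (prS r) (h (g (x + prT p))) (if c \<noteq> d then h (g x) - prT r else h (g x) + prT r)"
    by (cases c; cases d) auto
next
  fix x y assume "par_ok p x y"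
  from equivariant_ok[OF g this] show "if c \<noteq> d then seg_le (prS r) (h (g y)) (h (g x)) else seg_le (prS r) (h (g x)) (h (g y))"
    using h unfolding equivariant_def by (auto split: if_splits)
qed

lemma induces_comp:
  assumes p: "presents p" and q: "presents q" and r: "presents r"
    and f: "induces p q c g f" and k: "induces q r d h k"
  shows "induces p r (c \<noteq> d) (\<lambda>x. h (g x)) (dComp k f)"
proof -
  note F = inducesD[OF f] and K = inducesD[OF k] and P = presentsD[OF p]
  have "dOb (dComp k f) (prOb p x) = prOb r (h (g x))" if "x \<notin> prS p" for x
    using that F(2,7) K(7) equivariant_notin[OF F(1) that] presents_Ob_mem[OF p that] by (simp add: dComp_def compose_eq)
  moreover have "dAr (dComp k f) (prAr p x y) = (if c \<noteq> d then prAr r (h (g y)) (h (g x)) else prAr r (h (g x)) (h (g y)))"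
    if ok: "par_ok p x y" for x y
    using F(2) F(8)[OF ok] K(8) equivariant_ok[OF F(1) ok] zHom_zAr[OF presents_Ar_mem[OF p ok]]
    by (auto simp add: dComp_def compose_eq split: if_splits)
  ultimately show ?thesis
    using F(2,4) K(3,4) equivariant_comp[OF p q r F(1) K(1)] by (auto simp: induces_def dComp_def)
qed

lemma induces_id: "presents p \<Longrightarrow> induces p p False (\<lambda>x. x) (dId (prC p))"
  by (auto simp: induces_def equivariant_def dId_def par_ok_def presents_Ob_mem zHom_zAr[OF presents_Ar_mem])

text \<open>Representatives of objects and arrows are chosen arbitrarily; \<open>induces_ind\<close> shows that the choice does not
matter for equivariant \<open>g\<close>.\<close>

definition ind :: "zpres \<Rightarrow> zpres \<Rightarrow> bool \<Rightarrow> (real \<Rightarrow> real) \<Rightarrow> dmor" where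
  "ind p q c g = \<lparr>dSrc = prC p, dTgt = prC q, dContra = c,
     dOb = (\<lambda>a\<in>zOb (prC p). prOb q (g (SOME x. x \<notin> prS p \<and> prOb p x = a))),
     dAr = (\<lambda>f\<in>zAr (prC p). let (x, y) = (SOME (x, y). par_ok p x y \<and> prAr p x y = f)
        in if c then prAr q (g y) (g x) else prAr q (g x) (g y))\<rparr>"

lemma induces_ind:
  assumes p: "presents p" and q: "presents q" and g: "equivariant p q c g"
  shows "induces p q c g (ind p q c g)"
proof -
  note P = presentsD[OF p] and Q = presentsD[OF q]
  have sh: "seg_eq (prS q) (g x) (g y + of_int (if c then - k else k) * prT q)"
    if "x \<notin> prS p" "y \<notin> prS p" "seg_eq (prS p) x (y + of_int k * prT p)" for x y and k :: int
  proof -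
    have y': "y + of_int k * prT p \<notin> prS p" using that periodic_shift P(1) by blast
    show ?thesis
      using equivariant_seg_eq[OF g that(1) y' that(3)] equivariant_shift[OF p q g that(2), of k]
        equivariant_notin[OF g y'] seg_eq_trans by blast
  qed
  have "dOb (ind p q c g) (prOb p x) = prOb q (g x)" if x: "x \<notin> prS p" for x
  proof -
    define y where "y = (SOME y. y \<notin> prS p \<and> prOb p y = prOb p x)"
    have y: "y \<notin> prS p" "prOb p y = prOb p x"
      using someI[of "\<lambda>y. y \<notin> prS p \<and> prOb p y = prOb p x" x] x by (auto simp: y_def)
    then obtain k :: int where "seg_eq (prS p) y (x + of_int k * prT p)" using P(4) x by blast
    then have "prOb q (g y) = prOb q (g x)"
      using sh[OF y(1) x] Q(4)[OF equivariant_notin[OF g y(1)] equivariant_notin[OF g x]] by blast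
    then show ?thesis using presents_Ob_mem[OF p x] by (simp add: ind_def y_def)
  qed
  moreover have "dAr (ind p q c g) (prAr p x y) = (if c then prAr q (g y) (g x) else prAr q (g x) (g y))"
    if ok: "par_ok p x y" for x y
  proof -
    define z where "z = (SOME (u, v). par_ok p u v \<and> prAr p u v = prAr p x y)"
    obtain u v where uv: "z = (u, v)" by fastforce
    have "case z of (u, v) \<Rightarrow> par_ok p u v \<and> prAr p u v = prAr p x y"
      unfolding z_def by (rule someI[of _ "(x, y)"]) (use ok in simp)
    then have z: "par_ok p u v" "prAr p u v = prAr p x y" using uv by auto
    then obtain k :: int where k: "seg_eq (prS p) u (x + of_int k * prT p)" "seg_eq (prS p) v (y + of_int k * prT p)"
      using P(5)[OF z(1) ok] by blast
    have "(if c then prAr q (g v) (g u) else prAr q (g u) (g v)) = (if c then prAr q (g y) (g x) else prAr q (g x) (g y))"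
    proof -
      let ?k = "if c then - k else k"
      have "seg_eq (prS q) (g u) (g x + of_int ?k * prT q)" "seg_eq (prS q) (g v) (g y + of_int ?k * prT q)"
        using sh[OF _ _ k(1)] sh[OF _ _ k(2)] z(1) ok by (simp_all add: par_ok_def)
      then show ?thesis
        using equivariant_ok[OF g ok] equivariant_ok[OF g z(1)]
          Q(5)[of "g u" "g v" "g x" "g y"] Q(5)[of "g v" "g u" "g y" "g x"]
        by (cases c) (simp_all only: if_True if_False, blast+)
    qed
    moreover have "(SOME (u, v). par_ok p u v \<and> prAr p u v = prAr p x y) = (u, v)"
      using z_def uv by simp
    ultimately show ?thesis using zHom_zAr[OF presents_Ar_mem[OF p ok]] by (simp add: ind_def)
  qed
  ultimately show ?thesis using g by (auto simp: induces_def ind_def)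
qed

lemma induces_dInv:
  assumes p: "presents p" and q: "presents q"
    and f: "induces p q c g f" and k: "induces q p c h k"
    and hg: "\<And>x. x \<notin> prS p \<Longrightarrow> seg_eq (prS p) (h (g x)) x"
    and gh: "\<And>y. y \<notin> prS q \<Longrightarrow> seg_eq (prS q) (g (h y)) y"
  shows "dComp k f = dId (prC p)" "dComp f k = dId (prC q)" "dInv f = k"
proof -
  have 1: "induces p p False (\<lambda>x. h (g x)) (dComp k f)" "induces q q False (\<lambda>x. g (h x)) (dComp f k)"
    using induces_comp[OF p q p f k] induces_comp[OF q p q k f] by simp_all
  show kf: "dComp k f = dId (prC p)"
    by (rule induces_unique[where k = 0, OF p p 1(1) induces_id[OF p]]) (simp add: hg)
  show fk: "dComp f k = dId (prC q)"
    by (rule induces_unique[where k = 0, OF q q 1(2) induces_id[OF q]]) (simp add: gh)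
  have fH: "f \<in> dHom (prC p) (prC q)" and kH: "k \<in> dHom (prC q) (prC p)"
    using induces_dHom p q f k by blast+
  have "m = k" if m: "m \<in> dHom (prC q) (prC p)" "dComp m f = dId (prC p)" for m
  proof -
    have "m = dComp m (dComp f k)" using fk dComp_dId[OF m(1)] by simp
    also have "\<dots> = dComp (dComp m f) k" by (rule dComp_assoc[OF kH fH m(1)])
    also have "\<dots> = k" using m(2) dComp_dId[OF kH] by simp
    finally show ?thesis .
  qed
  note uniq = this
  show "dInv f = k"
    unfolding dInv_def inducesD(2,3)[OF f]
  proof (rule the_equality)
    show "k \<in> dHom (prC q) (prC p) \<and> dComp k f = dId (prC p) \<and> dComp f k = dId (prC q)"
      by (intro conjI kf fk kH)
  qed (elim conjE, rule uniq)
qed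

text \<open>A quotient of the line belongs to $\Delta_{\mathrm{big}}D$ as soon as equivariant functions in both
directions between it and the model of $[n]_{\mathrm{cyc}}$ are inverse up to components.\<close>

lemma presents_DeltaBigD:
  assumes p: "presents p" and q: "presents q" and n: "prC q = ncyc n"
    and f: "induces p q False g f" and k: "induces q p False h k"
    and hg: "\<And>x. x \<notin> prS p \<Longrightarrow> seg_eq (prS p) (h (g x)) x"
    and gh: "\<And>y. y \<notin> prS q \<Longrightarrow> seg_eq (prS q) (g (h y)) y"
  shows "prC p \<in> DeltaBigD"
proof -
  note inv = induces_dInv[OF p q f k hg gh]
  have fH: "f \<in> dHom (prC p) (ncyc n)" and kH: "k \<in> dHom (ncyc n) (prC p)"
    using induces_dHom[OF p q f] induces_dHom[OF q p k] unfolding n .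
  have "\<not> dContra f" "\<not> dContra k"
    using inducesD(4)[OF f] inducesD(4)[OF k] by simp_all
  moreover have "dComp f k = dId (ncyc n)" using inv(2) unfolding n .
  ultimately have "zisomorphic (ncyc n) (prC p)"
    unfolding zisomorphic_def by (intro bexI[OF _ kH] bexI[OF _ fH] conjI inv(1))
  then show ?thesis
    unfolding DeltaBigD_def by (intro CollectI conjI presents_zcategory[OF p] exI[of _ n])
qed

section \<open>The circle and its monotone paths\<close>

lemma mem_circ_proj: "y \<in> circ_proj L x \<longleftrightarrow> (\<exists>k::int. y = x + of_int k * real L)"
  by (auto simp: circ_proj_def)

lemma self_in_circ_proj: "x \<in> circ_proj L x"
  unfolding mem_circ_proj by (intro exI[of _ 0]) simp

lemma circ_proj_eq_iff: "circ_proj L x = circ_proj L y \<longleftrightarrow> (\<exists>k::int. x = y + of_int k * real L)"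
proof
  assume "circ_proj L x = circ_proj L y"
  then show "\<exists>k::int. x = y + of_int k * real L" using self_in_circ_proj mem_circ_proj by metis
next
  assume "\<exists>k::int. x = y + of_int k * real L"
  then obtain k :: int where k: "x = y + of_int k * real L" ..
  show "circ_proj L x = circ_proj L y"
  proof (intro Set.set_eqI iffI)
    fix u assume "u \<in> circ_proj L x"
    then obtain j :: int where "u = x + of_int j * real L" unfolding mem_circ_proj ..
    then have "u = y + of_int (k + j) * real L" using k by (simp add: algebra_simps)
    then show "u \<in> circ_proj L y" unfolding mem_circ_proj by blast
  next
    fix u assume "u \<in> circ_proj L y"
    then obtain j :: int where "u = y + of_int j * real L" unfolding mem_circ_proj ..
    then have "u = x + of_int (j - k) * real L" using k by (simp add: algebra_simps)
    then show "u \<in> circ_proj L x" unfolding mem_circ_proj by blast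
  qed
qed

lemma circ_proj_shift [simp]: "circ_proj L (x + of_int k * real L) = circ_proj L x"
  unfolding circ_proj_eq_iff by blast

lemma circ_proj_mem_eq: "x \<in> circ_proj L y \<Longrightarrow> circ_proj L x = circ_proj L y"
  unfolding mem_circ_proj circ_proj_eq_iff by blast

lemma topspace_circ: "topspace (circ L) = range (circ_proj L)"
  by (simp add: circ_def topspace_quotient_top)

lemma circ_proj_in_topspace [simp]: "circ_proj L x \<in> topspace (circ L)"
  by (simp add: topspace_circ)

lemma quotient_map_circ_proj: "quotient_map euclideanreal (circ L) (circ_proj L)"
  unfolding circ_def by (rule quotient_map_quotient_top)

lemma continuous_map_circ_proj:
  "continuous_on S g \<Longrightarrow> continuous_map (top_of_set S) (circ L) (\<lambda>x. circ_proj L (g x))"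
  using continuous_map_compose[of "top_of_set S" euclideanreal g "circ L" "circ_proj L"]
    quotient_imp_continuous_map[OF quotient_map_circ_proj] by (simp add: o_def)

lemma openin_circ: "openin (circ L) U \<longleftrightarrow> U \<subseteq> topspace (circ L) \<and> open {x. circ_proj L x \<in> U}"
  unfolding circ_def openin_quotient_top topspace_quotient_top by simp

text \<open>The circle consists of cosets and carries no metric. This embedding into the complex plane gives access
to the logarithm, hence to lifting.\<close>

definition circ_exp :: "nat \<Rightarrow> real set \<Rightarrow> complex" where
  "circ_exp L c = cis (2 * pi * (SOME x. x \<in> c) / real L)"

lemma circ_exp_circ_proj:
  assumes "L > 0"
  shows "circ_exp L (circ_proj L x) = cis (2 * pi * x / real L)"
proof -
  have "(SOME y. y \<in> circ_proj L x) \<in> circ_proj L x"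
    by (rule someI[of _ x]) (rule self_in_circ_proj)
  then obtain k :: int where k: "(SOME y. y \<in> circ_proj L x) = x + of_int k * real L"
    unfolding mem_circ_proj ..
  have "2 * pi * (x + of_int k * real L) / real L = 2 * pi * x / real L + 2 * pi * of_int k"
    using assms by (simp add: field_simps)
  then show ?thesis
    unfolding circ_exp_def k by (simp add: cis_mult[symmetric] cis_multiple_2pi)
qed

lemma circ_exp_inj:
  assumes "L > 0" "circ_exp L (circ_proj L x) = circ_exp L (circ_proj L y)"
  shows "circ_proj L x = circ_proj L y"
proof -
  have "exp (\<i> * of_real (2 * pi * x / real L)) = exp (\<i> * of_real (2 * pi * y / real L))"
    using assms by (simp add: circ_exp_circ_proj cis_conv_exp)
  then obtain n :: int where "\<i> * of_real (2 * pi * x / real L) = \<i> * of_real (2 * pi * y / real L) + (of_int (2 * n) * pi) * \<i>"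
    unfolding exp_eq by blast
  then have "Im (\<i> * of_real (2 * pi * x / real L)) = Im (\<i> * of_real (2 * pi * y / real L) + (of_int (2 * n) * pi) * \<i>)"
    by (rule arg_cong)
  then have "2 * pi * x / real L = 2 * pi * y / real L + of_int (2 * n) * pi" by simp
  then have "2 * pi * x = 2 * pi * (y + of_int n * real L)"
    using assms(1) by (simp add: field_simps)
  then have "x = y + of_int n * real L" by (metis mult_left_cancel mult_eq_0_iff pi_neq_zero zero_neq_numeral)
  then show ?thesis unfolding circ_proj_eq_iff by blast
qed

lemma continuous_map_circ_exp:
  assumes "L > 0"
  shows "continuous_map (circ L) euclidean (circ_exp L)"
proof (rule continuous_compose_quotient_map[OF quotient_map_circ_proj])
  have "circ_exp L \<circ> circ_proj L = (\<lambda>x. cis (2 * pi * x / real L))"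
    using assms by (auto simp: circ_exp_circ_proj)
  then show "continuous_map euclideanreal euclidean (circ_exp L \<circ> circ_proj L)"
    using assms by (auto simp: cis_conv_exp intro!: continuous_intros)
qed

text \<open>On a contractible set a map into the circle has a continuous logarithm, whose imaginary part is a lift.
Used for squares (homotopies) and for the line (homeomorphisms of the circle).\<close>

lemma circ_lift_exists:
  fixes S :: "'a::real_normed_vector set"
  assumes L: "L > 0" and S: "contractible S" and f: "continuous_map (top_of_set S) (circ L) f"
  obtains g where "continuous_on S g" "\<And>x. x \<in> S \<Longrightarrow> f x = circ_proj L (g x)"
proof -
  have rng: "\<exists>y. f x = circ_proj L y" if "x \<in> S" for x
  proof -
    have "f x \<in> topspace (circ L)" using f that unfolding continuous_map_def by auto
    then show ?thesis unfolding topspace_circ by auto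
  qed
  have "continuous_on S (\<lambda>x. circ_exp L (f x))"
    using continuous_map_compose[OF f continuous_map_circ_exp[OF L]] by (simp add: o_def)
  moreover have "circ_exp L (f x) \<noteq> 0" if "x \<in> S" for x
    using rng[OF that] L by (auto simp: circ_exp_circ_proj)
  ultimately obtain h where h: "continuous_on S h" "\<And>x. x \<in> S \<Longrightarrow> circ_exp L (f x) = exp (h x)"
    using continuous_logarithm_on_contractible[OF _ S, of "\<lambda>x. circ_exp L (f x)"] by metis
  \<comment> \<open>The exponential embedding is \<open>x \<mapsto> exp (2 \<pi> \<i> x / L)\<close>, so this inverts it.\<close>
  define g where "g x = real L * Im (h x) / (2 * pi)" for x
  have "f x = circ_proj L (g x)" if x: "x \<in> S" for x
  proof -
    obtain y where y: "f x = circ_proj L y" using rng[OF x] by blast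
    have 1: "cis (2 * pi * y / real L) = exp (h x)"
      using h(2)[OF x] L y by (simp add: circ_exp_circ_proj)
    then have "cmod (exp (h x)) = 1" by (metis norm_cis)
    then have "Re (h x) = 0" by simp
    then have "exp (h x) = cis (Im (h x))" by (simp add: exp_eq_polar)
    also have "\<dots> = circ_exp L (circ_proj L (g x))"
      using L by (simp add: circ_exp_circ_proj g_def)
    finally have "circ_exp L (circ_proj L y) = circ_exp L (circ_proj L (g x))"
      using 1 L by (simp add: circ_exp_circ_proj)
    then show ?thesis using circ_exp_inj[OF L] y by simp
  qed
  moreover have "continuous_on S g"
    unfolding g_def by (intro continuous_intros h) simp
  ultimately show ?thesis using that by blast
qed

text \<open>The difference of two lifts, divided by \<open>L\<close>, is continuous with integer values.\<close>

lemma circ_lift_unique: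
  fixes g h :: "'a::topological_space \<Rightarrow> real"
  assumes L: "L > 0" and S: "connected S" and g: "continuous_on S g" and h: "continuous_on S h"
    and e: "\<And>x. x \<in> S \<Longrightarrow> circ_proj L (g x) = circ_proj L (h x)"
  obtains k :: int where "\<And>x. x \<in> S \<Longrightarrow> g x = h x + of_int k * real L"
proof -
  define d where "d x = (g x - h x) / real L" for x
  have di: "\<exists>k::int. d x = of_int k" if x: "x \<in> S" for x
  proof -
    obtain k :: int where "g x = h x + of_int k * real L" using e[OF x] unfolding circ_proj_eq_iff by blast
    then have "d x = of_int k" using L by (simp add: d_def)
    then show ?thesis by blast
  qed
  have "d constant_on S"
  proof (rule continuous_discrete_range_constant[OF S])
    show "continuous_on S d" unfolding d_def using g h L by (intro continuous_intros) auto
    fix x assume x: "x \<in> S"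
    have "1 \<le> norm (d y - d x)" if y: "y \<in> S" "d y \<noteq> d x" for y
    proof -
      obtain i j :: int where ij: "d x = of_int i" "d y = of_int j" using di x y(1) by metis
      then have "1 \<le> \<bar>j - i\<bar>" using y(2) by auto
      then have "(1::real) \<le> of_int \<bar>j - i\<bar>" by linarith
      then show ?thesis using ij by simp
    qed
    then show "\<exists>e>0. \<forall>y. y \<in> S \<and> d y \<noteq> d x \<longrightarrow> e \<le> norm (d y - d x)"
      by (intro exI[of _ 1]) auto
  qed
  then obtain c where c: "\<And>x. x \<in> S \<Longrightarrow> d x = c" unfolding constant_on_def by blast
  show ?thesis
  proof (cases "S = {}")
    case True then show ?thesis using that by blast
  next
    case False
    then obtain k :: int where "c = of_int k" using c di by fastforce
    then have "g x = h x + of_int k * real L" if "x \<in> S" for x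
      using c[OF that] L by (simp add: d_def field_simps)
    then show ?thesis using that by blast
  qed
qed

lemma lifts_to_shift: "lifts_to L p g \<Longrightarrow> lifts_to L p (\<lambda>t. g t + of_int k * real L)"
  unfolding lifts_to_def mono_on_def by (auto intro!: continuous_intros)

lemma lifts_to_unique:
  assumes L: "L > 0" and g: "lifts_to L p g" and h: "lifts_to L p h"
  obtains k :: int where "\<And>t. t \<in> {0..1} \<Longrightarrow> g t = h t + of_int k * real L"
  by (rule circ_lift_unique[OF L, of "{0..1::real}" g h]) (use g h in \<open>auto simp: lifts_to_def\<close>)

lemma lifts_to_le: "lifts_to L p g \<Longrightarrow> g 0 \<le> g 1"
  unfolding lifts_to_def mono_on_def by auto

text \<open>The homotopy interpolates linearly between the lifts, so its ends run along segments; \<open>c\<close> and \<open>d\<close> need to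
contain only the images of these segments.\<close>

lemma homotopic_lifts:
  fixes g h :: "real \<Rightarrow> real" and p q :: "real \<Rightarrow> real set"
  assumes g: "continuous_on {0..1} g" "\<And>t. t \<in> {0..1} \<Longrightarrow> p t = circ_proj L (g t)"
    and h: "continuous_on {0..1} h" "\<And>t. t \<in> {0..1} \<Longrightarrow> q t = circ_proj L (h t)"
    and c: "\<And>s. s \<in> {0..1::real} \<Longrightarrow> circ_proj L ((1 - s) * g 0 + s * h 0) \<in> c"
    and d: "\<And>s. s \<in> {0..1::real} \<Longrightarrow> circ_proj L ((1 - s) * g 1 + s * h 1) \<in> d"
  shows "homotopic_with (\<lambda>h. h 0 \<in> c \<and> h 1 \<in> d) (top_of_set {0..1}) (circ L) p q"
proof (subst homotopic_with)
  let ?H = "\<lambda>x::real \<times> real. circ_proj L ((1 - fst x) * g (snd x) + fst x * h (snd x))"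
  have "continuous_map (top_of_set ({0..1} \<times> {0..1})) (circ L) ?H"
    by (intro continuous_map_circ_proj continuous_intros continuous_on_compose2[OF g(1)]
        continuous_on_compose2[OF h(1)]) auto
  then show "\<exists>H. continuous_map (prod_topology (top_of_set {0..1::real}) (top_of_set {0..1::real})) (circ L) H \<and>
      (\<forall>x\<in>topspace (top_of_set {0..1}). H (0, x) = p x) \<and>
      (\<forall>x\<in>topspace (top_of_set {0..1}). H (1, x) = q x) \<and>
      (\<forall>t\<in>{0..1}. H (t, 0) \<in> c \<and> H (t, 1) \<in> d)"
    using g h c d by (intro exI[of _ ?H]) (auto simp: prod_topology_subtopology_eu)
qed auto

text \<open>Lifting the homotopy to the line produces paths \<open>a\<close> and \<open>b\<close> traced by the two ends. When \<open>c\<close> is a point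
the path \<open>a\<close> is constant, and when \<open>c\<close> is an arc it cannot leave a component; in both cases the homotopy
determines where a lift of the other path starts, and likewise where it ends.\<close>

lemma homotopic_lift_ends:
  fixes p q :: "real \<Rightarrow> real set"
  assumes L: "L > 0"
    and hom: "homotopic_with (\<lambda>h. h 0 \<in> c \<and> h 1 \<in> d) (top_of_set {0..1}) (circ L) p q"
    and g: "lifts_to L p g" and h: "lifts_to L q h"
  obtains k :: int and a b :: "real \<Rightarrow> real" where
    "continuous_on {0..1} a" "a 0 = g 0" "a 1 = h 0 + of_int k * real L" "\<And>s. s \<in> {0..1} \<Longrightarrow> circ_proj L (a s) \<in> c"
    "continuous_on {0..1} b" "b 0 = g 1" "b 1 = h 1 + of_int k * real L" "\<And>s. s \<in> {0..1} \<Longrightarrow> circ_proj L (b s) \<in> d"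
proof -
  obtain H where H: "continuous_map (prod_topology (top_of_set {0..1}) (top_of_set {0..1})) (circ L) H"
    "\<And>x. H (0::real, x) = p x" "\<And>x. H (1, x) = q x" "\<And>t. t \<in> {0..1} \<Longrightarrow> H (t, 0) \<in> c \<and> H (t, 1) \<in> d"
    using hom unfolding homotopic_with_def by blast
  have "contractible ({0..1::real} \<times> {0..1::real})"
    by (intro convex_imp_contractible convex_Times) auto
  then obtain K where K: "continuous_on ({0..1} \<times> {0..1}) K" "\<And>x. x \<in> {0..1} \<times> {0..1} \<Longrightarrow> H x = circ_proj L (K x)"
    using circ_lift_exists[OF L, of "{0..1} \<times> {0..1}" H] H(1) by (auto simp: prod_topology_subtopology_eu)
  have cont: "continuous_on {0..1} (\<lambda>t. K (s, t))" "continuous_on {0..1} (\<lambda>t. K (t, s))" if "s \<in> {0..1}" for s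
    using that by (auto intro!: continuous_intros continuous_on_compose2[OF K(1)])
  have "circ_proj L (K (0, t)) = circ_proj L (g t)" if "t \<in> {0..1}" for t
    using K(2)[of "(0, t)"] H(2) g that by (auto simp: lifts_to_def)
  then obtain i :: int where i: "\<And>t. t \<in> {0..1} \<Longrightarrow> K (0, t) = g t + of_int i * real L"
    using circ_lift_unique[OF L, of "{0..1::real}" "\<lambda>t. K (0, t)" g] cont(1)[of 0] g
    by (auto simp: lifts_to_def)
  have "circ_proj L (K (1, t)) = circ_proj L (h t)" if "t \<in> {0..1}" for t
    using K(2)[of "(1, t)"] H(3) h that by (auto simp: lifts_to_def)
  then obtain j :: int where j: "\<And>t. t \<in> {0..1} \<Longrightarrow> K (1, t) = h t + of_int j * real L"
    using circ_lift_unique[OF L, of "{0..1::real}" "\<lambda>t. K (1, t)" h] cont(1)[of 1] h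
    by (auto simp: lifts_to_def)
  have pr: "circ_proj L (x - of_int i * real L) = circ_proj L x" for x
    using circ_proj_shift[of L x "- i"] by simp
  show ?thesis
  proof (rule that[of "\<lambda>s. K (s, 0) - of_int i * real L" "j - i" "\<lambda>s. K (s, 1) - of_int i * real L"])
    show "circ_proj L (K (s, 0) - of_int i * real L) \<in> c" "circ_proj L (K (s, 1) - of_int i * real L) \<in> d"
      if "s \<in> {0..1}" for s
      using K(2)[of "(s, 0)"] K(2)[of "(s, 1)"] H(4)[OF that] that by (auto simp: pr)
  qed (use i j cont in \<open>auto intro!: continuous_intros simp: algebra_simps\<close>)
qed

text \<open>The homotopy classes in the circle, relative to the end points (\<open>path_hclass_eq\<close>), are these sets.\<close>

definition lift_class :: "nat \<Rightarrow> real \<Rightarrow> real \<Rightarrow> (real \<Rightarrow> real set) set" where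
  "lift_class L u v = {p. \<exists>g. lifts_to L p g \<and> g 0 = u \<and> g 1 = v}"

lemma lift_class_ends: "p \<in> lift_class L u v \<Longrightarrow> p 0 = circ_proj L u \<and> p 1 = circ_proj L v"
  unfolding lift_class_def lifts_to_def by auto

lemma lift_class_sub: "lift_class L u v \<subseteq> mono_paths L"
  by (auto simp: lift_class_def mono_paths_def)

lemma lift_class_nonempty:
  assumes "u \<le> v"
  shows "lift_class L u v \<noteq> {}"
proof -
  let ?g = "\<lambda>t. u + t * (v - u)"
  have "lifts_to L (\<lambda>t. circ_proj L (?g t)) ?g"
    using assms by (auto simp: lifts_to_def intro!: continuous_intros mono_onI mult_right_mono)
  then have "(\<lambda>t. circ_proj L (?g t)) \<in> lift_class L u v" unfolding lift_class_def by (intro CollectI exI[of _ ?g]) simp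
  then show ?thesis by blast
qed

lemma lift_class_shift: "lift_class L (u + of_int k * real L) (v + of_int k * real L) = lift_class L u v"
proof -
  have 1: "lift_class L u v \<subseteq> lift_class L (u + of_int k * real L) (v + of_int k * real L)" for u v k
    unfolding lift_class_def using lifts_to_shift[of L _ _ k] by fastforce
  from 1[of u v k] 1[of "u + of_int k * real L" "v + of_int k * real L" "- k"] show ?thesis by simp
qed

lemma lift_class_lift:
  assumes "L > 0" "p \<in> lift_class L u v" "lifts_to L p g"
  obtains k :: int where "u = g 0 + of_int k * real L" "v = g 1 + of_int k * real L"
proof -
  obtain h where h: "lifts_to L p h" "h 0 = u" "h 1 = v" using assms(2) by (auto simp: lift_class_def)
  then obtain k :: int where "\<And>t. t \<in> {0..1} \<Longrightarrow> h t = g t + of_int k * real L"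
    using lifts_to_unique[OF assms(1) h(1) assms(3)] by metis
  then show ?thesis using that[of k] h by auto
qed

lemma lift_class_eq_iff:
  assumes "L > 0" "u \<le> v"
  shows "lift_class L u v = lift_class L u' v' \<longleftrightarrow> (\<exists>k::int. u = u' + of_int k * real L \<and> v = v' + of_int k * real L)"
proof
  assume e: "lift_class L u v = lift_class L u' v'"
  obtain p where p: "p \<in> lift_class L u v" using lift_class_nonempty[OF assms(2)] by blast
  then obtain g where g: "lifts_to L p g" "g 0 = u'" "g 1 = v'" using e by (auto simp: lift_class_def)
  show "\<exists>k::int. u = u' + of_int k * real L \<and> v = v' + of_int k * real L"
    by (rule lift_class_lift[OF assms(1) p g(1)]) (use g in blast)
next
  assume "\<exists>k::int. u = u' + of_int k * real L \<and> v = v' + of_int k * real L"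
  then show "lift_class L u v = lift_class L u' v'" using lift_class_shift by auto
qed

text \<open>A homotopy relative to the end points keeps both ends of the lift fixed, because the fibres of the
projection are discrete.\<close>

lemma path_hclass_eq:
  assumes L: "L > 0" and g: "lifts_to L p g"
  shows "path_hclass L p = lift_class L (g 0) (g 1)"
proof (intro Set.set_eqI iffI)
  have p: "p 0 = circ_proj L (g 0)" "p 1 = circ_proj L (g 1)" using g by (auto simp: lifts_to_def)
  fix q
  {
    assume "q \<in> lift_class L (g 0) (g 1)"
    then obtain h where h: "lifts_to L q h" "h 0 = g 0" "h 1 = g 1" by (auto simp: lift_class_def)
    have e: "(1 - s) * x + s * x = x" for s x :: real by (simp add: algebra_simps)
    have "homotopic_with (\<lambda>h. h 0 \<in> {p 0} \<and> h 1 \<in> {p 1}) (top_of_set {0..1}) (circ L) p q"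
      by (rule homotopic_lifts[where g = g and h = h]) (use g h p in \<open>auto simp: lifts_to_def e\<close>)
    then show "q \<in> path_hclass L p" using h(1) by (auto simp: path_hclass_def mono_paths_def path_homotopic_def)
  next
    assume q: "q \<in> path_hclass L p"
    then obtain h where h: "lifts_to L q h" by (auto simp: path_hclass_def mono_paths_def)
    have "homotopic_with (\<lambda>h. h 0 \<in> {p 0} \<and> h 1 \<in> {p 1}) (top_of_set {0..1}) (circ L) p q"
      using q by (simp add: path_hclass_def path_homotopic_def)
    from homotopic_lift_ends[OF L this g h] obtain k :: int and a b :: "real \<Rightarrow> real" where
      a: "continuous_on {0..1} a" "a 0 = g 0" "a 1 = h 0 + of_int k * real L" "\<And>s. s \<in> {0..1} \<Longrightarrow> circ_proj L (a s) \<in> {p 0}"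
      and b: "continuous_on {0..1} b" "b 0 = g 1" "b 1 = h 1 + of_int k * real L" "\<And>s. s \<in> {0..1} \<Longrightarrow> circ_proj L (b s) \<in> {p 1}"
      by metis
    have const: "f 1 = f 0" if "continuous_on {0..1} f" "\<And>s. s \<in> {0..1} \<Longrightarrow> circ_proj L (f s) = circ_proj L y" for f :: "real \<Rightarrow> real" and y
      by (rule circ_lift_unique[OF L, of "{0..1}" f "\<lambda>s. y"]) (use that in auto)
    \<comment> \<open>The ends of the homotopy are fixed and the fibres discrete.\<close>
    have "a 1 = a 0" "b 1 = b 0" using const[OF a(1)] const[OF b(1)] a(4) b(4) p by auto
    then have "lifts_to L q (\<lambda>t. h t + of_int k * real L)" "h 0 + of_int k * real L = g 0" "h 1 + of_int k * real L = g 1"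
      using lifts_to_shift[OF h] a b by auto
    then show "q \<in> lift_class L (g 0) (g 1)" unfolding lift_class_def by blast
  }
qed

lemma circ_cat_zAr:
  assumes "L > 0"
  shows "zAr (circ_cat L) = {lift_class L u v | u v. u \<le> v}"
proof -
  have "zAr (circ_cat L) = path_hclass L ` mono_paths L" by (simp add: circ_cat_def)
  also have "\<dots> = {lift_class L u v | u v. u \<le> v}"
  proof (intro Set.set_eqI iffI)
    fix A assume "A \<in> path_hclass L ` mono_paths L"
    then obtain p g where "lifts_to L p g" "A = path_hclass L p" by (auto simp: mono_paths_def)
    then show "A \<in> {lift_class L u v | u v. u \<le> v}"
      using path_hclass_eq[OF assms] lifts_to_le by blast
  next
    fix A assume "A \<in> {lift_class L u v | u v. u \<le> v}"
    then obtain u v where A: "A = lift_class L u v" "u \<le> v" by blast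
    then obtain p g where "lifts_to L p g" "g 0 = u" "g 1 = v"
      using lift_class_nonempty[of u v L] by (auto simp: lift_class_def)
    then have "A = path_hclass L p" "p \<in> mono_paths L" using path_hclass_eq[OF assms, of p g] A by (auto simp: mono_paths_def)
    then show "A \<in> path_hclass L ` mono_paths L" by blast
  qed
  finally show ?thesis .
qed

lemma circ_cat_ends:
  assumes "u \<le> v"
  shows "zSrc (circ_cat L) (lift_class L u v) = circ_proj L u" "zTgt (circ_cat L) (lift_class L u v) = circ_proj L v"
proof -
  have "(\<lambda>p. p 0) ` lift_class L u v = {circ_proj L u}" "(\<lambda>p. p 1) ` lift_class L u v = {circ_proj L v}"
    using lift_class_nonempty[OF assms, of L] lift_class_ends[of _ L u v] by (force simp: image_iff)+
  then show "zSrc (circ_cat L) (lift_class L u v) = circ_proj L u" "zTgt (circ_cat L) (lift_class L u v) = circ_proj L v"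
    by (simp_all add: circ_cat_def class_map_def)
qed

lemma circ_cat_zHom:
  assumes L: "L > 0"
  shows "A \<in> zHom (circ_cat L) (circ_proj L x) (circ_proj L y) \<longleftrightarrow>
    (\<exists>k::int. x \<le> y + of_int k * real L \<and> A = lift_class L x (y + of_int k * real L))"
proof
  assume A: "A \<in> zHom (circ_cat L) (circ_proj L x) (circ_proj L y)"
  then obtain u v where uv: "u \<le> v" "A = lift_class L u v" using circ_cat_zAr[OF L] by (auto simp: zHom_def)
  then have "circ_proj L x = circ_proj L u" "circ_proj L y = circ_proj L v" using A circ_cat_ends by (auto simp: zHom_def)
  then obtain i j :: int where "x = u + of_int i * real L" "y = v + of_int j * real L" unfolding circ_proj_eq_iff by blast
  then have e: "x = u + of_int i * real L" "y + of_int (i - j) * real L = v + of_int i * real L" by (auto simp: algebra_simps)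
  then have "x \<le> y + of_int (i - j) * real L" "A = lift_class L x (y + of_int (i - j) * real L)"
    unfolding e using uv lift_class_shift by auto
  then show "\<exists>k::int. x \<le> y + of_int k * real L \<and> A = lift_class L x (y + of_int k * real L)" by blast
next
  assume "\<exists>k::int. x \<le> y + of_int k * real L \<and> A = lift_class L x (y + of_int k * real L)"
  then show "A \<in> zHom (circ_cat L) (circ_proj L x) (circ_proj L y)"
    using circ_cat_zAr[OF L] circ_cat_ends by (auto simp: zHom_def)
qed

lemma lifts_to_join:
  assumes p: "lifts_to L p g" and q: "lifts_to L q h" and e: "g 1 = h 0"
  shows "lifts_to L (path_join p q) (path_join g h)"
proof -
  have "mono_on {0..1} (path_join g h)"
  proof (rule mono_onI)
    fix s t :: real assume st: "s \<in> {0..1}" "t \<in> {0..1}" "s \<le> t"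
    have g: "\<And>x y. \<lbrakk>x \<in> {0..1}; y \<in> {0..1}; x \<le> y\<rbrakk> \<Longrightarrow> g x \<le> g y" and h: "\<And>x y. \<lbrakk>x \<in> {0..1}; y \<in> {0..1}; x \<le> y\<rbrakk> \<Longrightarrow> h x \<le> h y"
      using p q by (auto simp: lifts_to_def mono_on_def)
    consider "t \<le> 1 / 2" | "s \<le> 1 / 2" "1 / 2 < t" | "1 / 2 < s" using st by linarith
    then show "path_join g h s \<le> path_join g h t"
    proof cases
      case 1 then show ?thesis using st g[of "2 * s" "2 * t"] by (auto simp: path_join_def)
    next
      case 2
      then have "g (2 * s) \<le> g 1" "h 0 \<le> h (2 * t - 1)" using st g h by auto
      then show ?thesis using 2 e by (auto simp: path_join_def)
    next
      case 3 then show ?thesis using st h[of "2 * s - 1" "2 * t - 1"] by (auto simp: path_join_def)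
    qed
  qed
  moreover have "continuous_on {0..1} (path_join g h)"
  proof -
    have c: "continuous_on {0..1} g" "continuous_on {0..1} h" using p q by (auto simp: lifts_to_def)
    have "continuous_on ({0..1/2} \<union> {1/2..1}) (\<lambda>t. if t \<le> 1 / 2 then g (2 * t) else h (2 * t - 1))"
    proof (rule continuous_on_cases)
      have "g (2 * t) = h (2 * t - 1)" if "t = 1 / 2" for t
        using e unfolding that by simp
      then show "\<forall>t. t \<in> {0..1/2} \<and> \<not> t \<le> 1 / 2 \<or> t \<in> {1/2..1} \<and> t \<le> 1 / 2 \<longrightarrow> g (2 * t) = h (2 * t - 1)"
        by force
    qed (auto intro!: continuous_on_compose2[OF c(1)] continuous_on_compose2[OF c(2)] continuous_intros)
    moreover have "{0..1/2} \<union> {1/2..1} = {0..1::real}" by auto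
    ultimately show ?thesis by (simp add: path_join_def)
  qed
  moreover have "path_join p q t = circ_proj L (path_join g h t)" if "t \<in> {0..1}" for t
    using p q that by (auto simp: lifts_to_def path_join_def)
  ultimately show ?thesis by (simp add: lifts_to_def)
qed

lemma circ_cat_zComp:
  assumes L: "L > 0" and uv: "u \<le> v" and vw: "v \<le> w"
  shows "zComp (circ_cat L) (lift_class L v w) (lift_class L u v) = lift_class L u w"
proof -
  have "path_hclass L (path_join p q) = lift_class L u w" if pq: "p \<in> lift_class L u v" "q \<in> lift_class L v w" for p q
  proof -
    obtain g h where g: "lifts_to L p g" "g 0 = u" "g 1 = v" and h: "lifts_to L q h" "h 0 = v" "h 1 = w"
      using pq by (auto simp: lift_class_def)
    then show ?thesis using path_hclass_eq[OF L lifts_to_join[OF g(1) h(1)]] by (simp add: path_join_def)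
  qed
  then have "(\<Union>p\<in>lift_class L u v. \<Union>q\<in>lift_class L v w. path_hclass L (path_join p q)) = lift_class L u w"
    using lift_class_nonempty[OF uv, of L] lift_class_nonempty[OF vw, of L] by auto
  then show ?thesis by (simp add: circ_cat_def)
qed

lemma circ_cat_zId:
  assumes L: "L > 0"
  shows "zId (circ_cat L) (circ_proj L u) = lift_class L u u"
  using path_hclass_eq[OF L, of "\<lambda>t. circ_proj L u" "\<lambda>t. u"]
  by (simp add: circ_cat_def lifts_to_def mono_on_def)

lemma circ_cat_zEnd: "zEnd (circ_cat L) (circ_proj L u) = lift_class L u (u + real L)"
proof -
  have "\<exists>h. lifts_to L p h \<and> h 0 = u \<and> h 1 = u + real L" if g: "lifts_to L p g" "circ_proj L (g 0) = circ_proj L u" "g 1 = g 0 + real L" for p g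
  proof -
    obtain k :: int where "u = g 0 + of_int k * real L" using g(2) circ_proj_eq_iff by metis
    then show ?thesis using lifts_to_shift[OF g(1), of k] g(3) by (intro exI[of _ "\<lambda>t. g t + of_int k * real L"]) simp
  qed
  then have "{p. \<exists>g. lifts_to L p g \<and> circ_proj L (g 0) = circ_proj L u \<and> g 1 = g 0 + real L} = lift_class L u (u + real L)"
    by (auto simp: lift_class_def)
  then show ?thesis by (simp add: circ_cat_def)
qed

section \<open>Components of complements of finite sets\<close>

definition pre :: "nat \<Rightarrow> real set set \<Rightarrow> real set" where
  "pre L F = {x. circ_proj L x \<in> F}"

definition comp_at :: "real set \<Rightarrow> real \<Rightarrow> real set" where
  "comp_at S x = {y. y \<notin> S \<and> seg_eq S x y}"

definition arc_at :: "nat \<Rightarrow> real set set \<Rightarrow> real \<Rightarrow> real set set" where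
  "arc_at L F x = circ_proj L ` comp_at (pre L F) x"

text \<open>The lift of the chosen point of the arc to the component of \<open>x\<close>. It exists once in each component because
translations act freely on components.\<close>

definition base_pt :: "nat \<Rightarrow> real set set \<Rightarrow> real \<Rightarrow> real" where
  "base_pt L F x = (SOME y. y \<in> comp_at (pre L F) x \<and> circ_proj L y = pt (arc_at L F x))"

definition pi0P :: "nat \<Rightarrow> real set set \<Rightarrow> zpres" where
  "pi0P L F = \<lparr>prC = pi0 L F, prS = pre L F, prT = real L,
     prOb = (\<lambda>x. Arc (arc_at L F x)),
     prAr = (\<lambda>x y. (Arc (arc_at L F x), Path (lift_class L (base_pt L F x) (base_pt L F y)), Arc (arc_at L F y)))\<rparr>"

lemma pi0P_simps [simp]:
  "prC (pi0P L F) = pi0 L F" "prS (pi0P L F) = pre L F" "prT (pi0P L F) = real L"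
  "prOb (pi0P L F) x = Arc (arc_at L F x)"
  "prAr (pi0P L F) x y = (Arc (arc_at L F x), Path (lift_class L (base_pt L F x) (base_pt L F y)), Arc (arc_at L F y))"
  by (simp_all add: pi0P_def)

lemma periodic_pre:
  assumes "L > 0" "F \<in> fin_subsets L"
  shows "periodic (pre L F) (real L)"
proof -
  obtain c where "c \<in> F" "c \<in> topspace (circ L)" using assms(2) by (auto simp: fin_subsets_def)
  then have "pre L F \<noteq> {}" by (auto simp: pre_def topspace_circ)
  moreover have "circ_proj L (x + real L) = circ_proj L x" for x using circ_proj_shift[of L x 1] by simp
  ultimately show ?thesis using assms(1) by (simp add: periodic_def pre_def)
qed

lemma closed_pre:
  assumes "L > 0" "F \<in> fin_subsets L"
  shows "closed (pre L F)"
proof -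
  have "pre L F = \<Union>F"
  proof (intro Set.set_eqI iffI)
    fix x assume "x \<in> pre L F" then show "x \<in> \<Union>F" using self_in_circ_proj by (auto simp: pre_def)
  next
    fix x assume "x \<in> \<Union>F"
    then obtain c where c: "c \<in> F" "x \<in> c" by blast
    then obtain y where "c = circ_proj L y" using assms(2) by (auto simp: fin_subsets_def topspace_circ)
    then show "x \<in> pre L F" using circ_proj_mem_eq c by (auto simp: pre_def)
  qed
  moreover have "closed c" if "c \<in> F" for c
  proof -
    obtain y where "c = circ_proj L y" using assms(2) \<open>c \<in> F\<close> by (auto simp: fin_subsets_def topspace_circ)
    then have "c = (\<lambda>x. (x - y) / real L) -` \<int>"
      using assms(1) by (auto simp: mem_circ_proj Ints_def field_simps)
    moreover have "closed ((\<lambda>x. (x - y) / real L) -` \<int>)"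
      by (rule closed_vimage) (use assms in \<open>auto intro!: continuous_intros\<close>)
    ultimately show ?thesis by simp
  qed
  ultimately show ?thesis using assms(2) by (auto simp: fin_subsets_def intro!: closed_Union)
qed

lemma comp_at_self: "x \<notin> S \<Longrightarrow> x \<in> comp_at S x"
  by (simp add: comp_at_def)

lemma comp_at_cong: "seg_eq S x y \<Longrightarrow> x \<notin> S \<Longrightarrow> y \<notin> S \<Longrightarrow> comp_at S x = comp_at S y"
  unfolding comp_at_def using seg_eq_trans seg_eq_sym by blast

lemma comp_at_shift:
  assumes "periodic S T"
  shows "u + of_int k * T \<in> comp_at S (x + of_int k * T) \<longleftrightarrow> u \<in> comp_at S x"
  using periodic_shift[OF assms] seg_eq_shift[OF assms] by (simp add: comp_at_def)

lemma seg_eq_mid: "\<lbrakk>seg_eq S x y; x \<le> z; z \<le> y\<rbrakk> \<Longrightarrow> seg_eq S x z"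
  unfolding seg_eq_def seg_le_def disjoint_iff greaterThanLessThan_iff by (meson le_less_trans less_le_trans not_less)

lemma comp_at_convex:
  assumes "u \<in> comp_at S x" "v \<in> comp_at S x" "x \<notin> S" "u \<le> z" "z \<le> v"
  shows "z \<in> comp_at S x"
proof -
  have uv: "seg_eq S u v" using assms unfolding comp_at_def using seg_eq_trans seg_eq_sym by blast
  have uz: "seg_eq S u z" using seg_eq_mid[OF uv] assms by blast
  have "z \<notin> S"
  proof
    assume "z \<in> S"
    then have "z \<noteq> u" "z \<noteq> v" using assms by (auto simp: comp_at_def)
    then have "z \<in> {u<..<v} \<inter> S" using \<open>z \<in> S\<close> assms by auto
    then show False using uv by (auto simp: seg_eq_def seg_le_def)
  qed
  then show ?thesis using uz assms(1) seg_eq_trans unfolding comp_at_def by blast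
qed

lemma comp_at_combination:
  assumes "u \<in> comp_at S x" "v \<in> comp_at S x" "x \<notin> S" "s \<in> {0..1}"
  shows "(1 - s) * u + s * v \<in> comp_at S x"
proof -
  have "convex (comp_at S x)"
    unfolding is_interval_convex_1[symmetric] is_interval_1 using comp_at_convex[OF _ _ assms(3)] by blast
  then show ?thesis using assms by (auto simp: convex_alt)
qed

text \<open>By the intermediate value theorem.\<close>

lemma continuous_avoid_seg_eq:
  fixes a :: "real \<Rightarrow> real"
  assumes a: "continuous_on {l..r} a" "l \<le> r" and S: "\<And>s. s \<in> {l..r} \<Longrightarrow> a s \<notin> S"
  shows "seg_eq S (a l) (a r)"
proof -
  have "t \<notin> S" if "a l < t \<and> t < a r \<or> a r < t \<and> t < a l" for t
  proof -
    have "\<exists>s. l \<le> s \<and> s \<le> r \<and> a s = t"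
      using that IVT'[of a l t r] IVT2'[of a r t l] a by auto
    then show ?thesis using S by auto
  qed
  then show ?thesis by (auto simp: seg_eq_def seg_le_def)
qed

lemma open_comp_at:
  assumes "closed S" "x \<notin> S"
  shows "open (comp_at S x)"
proof (rule openI)
  fix y assume y: "y \<in> comp_at S x"
  then have "y \<in> - S" by (simp add: comp_at_def)
  then obtain e where e: "e > 0" "ball y e \<subseteq> - S" using assms(1) open_contains_ball by (metis open_Compl)
  have "ball y e \<subseteq> comp_at S x"
  proof
    fix z assume z: "z \<in> ball y e"
    have "t \<notin> S" if "y < t \<and> t < z \<or> z < t \<and> t < y" for t
    proof -
      have "t \<in> ball y e" using that z by (auto simp: dist_real_def)
      then show ?thesis using e by auto
    qed
    then have "seg_eq S y z" by (auto simp: seg_eq_def seg_le_def)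
    then show "z \<in> comp_at S x" using y z e(2) seg_eq_trans unfolding comp_at_def by blast
  qed
  then show "\<exists>e>0. ball y e \<subseteq> comp_at S x" using e(1) by blast
qed

lemma arc_at_mem_iff:
  assumes "L > 0" "F \<in> fin_subsets L" "x \<notin> pre L F"
  shows "circ_proj L u \<in> arc_at L F x \<longleftrightarrow> (\<exists>k::int. u + of_int k * real L \<in> comp_at (pre L F) x)"
proof
  assume "circ_proj L u \<in> arc_at L F x"
  then obtain v where v: "v \<in> comp_at (pre L F) x" "circ_proj L v = circ_proj L u" by (auto simp: arc_at_def)
  then obtain k :: int where "v = u + of_int k * real L" unfolding circ_proj_eq_iff by blast
  then show "\<exists>k::int. u + of_int k * real L \<in> comp_at (pre L F) x" using v(1) by blast
next
  assume "\<exists>k::int. u + of_int k * real L \<in> comp_at (pre L F) x"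
  then obtain k :: int where "u + of_int k * real L \<in> comp_at (pre L F) x" ..
  then have "circ_proj L (u + of_int k * real L) \<in> arc_at L F x" unfolding arc_at_def by (rule imageI)
  then show "circ_proj L u \<in> arc_at L F x" by simp
qed

lemma arc_at_eq_iff:
  assumes L: "L > 0" and F: "F \<in> fin_subsets L" and x: "x \<notin> pre L F" and y: "y \<notin> pre L F"
  shows "arc_at L F x = arc_at L F y \<longleftrightarrow> (\<exists>k::int. seg_eq (pre L F) x (y + of_int k * real L))"
proof
  note per = periodic_pre[OF L F]
  assume "arc_at L F x = arc_at L F y"
  then have "circ_proj L x \<in> arc_at L F y" using comp_at_self[OF x] unfolding arc_at_def by blast
  then obtain k :: int where "x + of_int k * real L \<in> comp_at (pre L F) y"
    using arc_at_mem_iff[OF L F y] by blast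
  then have "seg_eq (pre L F) (y + of_int (-k) * real L) (x + of_int k * real L + of_int (-k) * real L)"
    unfolding seg_eq_shift[OF per] by (simp add: comp_at_def)
  then have "seg_eq (pre L F) x (y + of_int (-k) * real L)" using seg_eq_sym by simp
  then show "\<exists>k::int. seg_eq (pre L F) x (y + of_int k * real L)" by blast
next
  note per = periodic_pre[OF L F]
  assume "\<exists>k::int. seg_eq (pre L F) x (y + of_int k * real L)"
  then obtain k :: int where k: "seg_eq (pre L F) x (y + of_int k * real L)" ..
  have y': "y + of_int k * real L \<notin> pre L F" using periodic_shift[OF per] y by blast
  have e: "comp_at (pre L F) x = comp_at (pre L F) (y + of_int k * real L)" by (rule comp_at_cong[OF k x y'])
  show "arc_at L F x = arc_at L F y"
  proof (intro Set.set_eqI iffI)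
    fix c assume "c \<in> arc_at L F x"
    then obtain u where u: "c = circ_proj L u" "u \<in> comp_at (pre L F) (y + of_int k * real L)" unfolding arc_at_def e by blast
    then have "u + of_int (-k) * real L \<in> comp_at (pre L F) y"
      using comp_at_shift[OF per, of "u + of_int (-k) * real L" k y] by simp
    then show "c \<in> arc_at L F y" using u(1) arc_at_mem_iff[OF L F y] by blast
  next
    fix c assume "c \<in> arc_at L F y"
    then obtain u where u: "c = circ_proj L u" "u \<in> comp_at (pre L F) y" unfolding arc_at_def by blast
    then have "u + of_int k * real L \<in> comp_at (pre L F) x" unfolding e comp_at_shift[OF per] by simp
    then show "c \<in> arc_at L F x" using u(1) arc_at_mem_iff[OF L F x] by blast
  qed
qed

lemma arc_at_self: "x \<notin> pre L F \<Longrightarrow> circ_proj L x \<in> arc_at L F x"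
  unfolding arc_at_def using comp_at_self by blast

lemma arc_at_disjoint:
  assumes L: "L > 0" and F: "F \<in> fin_subsets L" and x: "x \<notin> pre L F" and y: "y \<notin> pre L F"
    and c: "c \<in> arc_at L F x" "c \<in> arc_at L F y"
  shows "arc_at L F x = arc_at L F y"
proof -
  have "arc_at L F z = arc_at L F u" if z: "z \<notin> pre L F" "u \<in> comp_at (pre L F) z" for z u
    using that arc_at_eq_iff[OF L F z(1), of u] by (auto simp: comp_at_def intro!: exI[of _ 0])
  note 1 = this
  obtain u where u: "c = circ_proj L u" "u \<in> comp_at (pre L F) x" using c(1) by (auto simp: arc_at_def)
  obtain v where v: "c = circ_proj L v" "v \<in> comp_at (pre L F) y" using c(2) by (auto simp: arc_at_def)
  have "u \<notin> pre L F" "v \<notin> pre L F" using u v by (auto simp: comp_at_def)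
  then have "arc_at L F u = arc_at L F v"
    using u v arc_at_eq_iff[OF L F] circ_proj_eq_iff[of L u v] seg_eq_refl by metis
  then show ?thesis using 1 u v x y by metis
qed

lemma openin_arc_at:
  assumes L: "L > 0" and F: "F \<in> fin_subsets L" and x: "x \<notin> pre L F"
  shows "openin (circ L) (arc_at L F x)"
proof -
  have "{u. circ_proj L u \<in> arc_at L F x} = (\<Union>k::int. (\<lambda>u. u + of_int k * real L) -` comp_at (pre L F) x)"
    using arc_at_mem_iff[OF L F x] by auto
  moreover have "open ((\<lambda>u. u + of_int k * real L) -` comp_at (pre L F) x)" for k :: int
    by (intro open_vimage open_comp_at closed_pre L F x continuous_intros)
  ultimately have "open {u. circ_proj L u \<in> arc_at L F x}" by auto
  then show ?thesis unfolding openin_circ by (auto simp: arc_at_def)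
qed

text \<open>The image of a component of the line is connected. It is also open and closed in the complement, since
the remaining images are open as well, so it is a connected component.\<close>

lemma arcs_eq:
  assumes L: "L > 0" and F: "F \<in> fin_subsets L"
  shows "arcs L F = arc_at L F ` (- pre L F)"
proof -
  let ?X = "subtopology (circ L) (topspace (circ L) - F)"
  have top: "topspace ?X = circ_proj L ` (- pre L F)" by (auto simp: topspace_circ pre_def)
  have sub: "arc_at L F x \<subseteq> topspace (circ L) - F" for x
    by (auto simp: arc_at_def comp_at_def pre_def)
  have op: "openin ?X (arc_at L F x)" if "x \<notin> pre L F" for x
    using openin_arc_at[OF L F that] sub[of x] unfolding openin_subtopology by blast
  have "connected_component_of_set ?X (circ_proj L x) = arc_at L F x" if x: "x \<notin> pre L F" for x
  proof
    have "connected (comp_at (pre L F) x)"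
      unfolding is_interval_connected_1[symmetric] is_interval_1 using comp_at_convex[OF _ _ x] by blast
    moreover have "continuous_map euclideanreal (circ L) (circ_proj L)"
      by (rule quotient_imp_continuous_map[OF quotient_map_circ_proj])
    ultimately have "connectedin (circ L) (arc_at L F x)"
      unfolding arc_at_def using connectedin_continuous_map_image by fastforce
    then have "connectedin ?X (arc_at L F x)" using sub[of x] by (simp add: connectedin_subtopology)
    then show "arc_at L F x \<subseteq> connected_component_of_set ?X (circ_proj L x)"
      using connected_component_of_maximal arc_at_self[OF x] by metis
    have rest: "topspace ?X - arc_at L F x = \<Union>{arc_at L F y | y. y \<notin> pre L F \<and> arc_at L F y \<noteq> arc_at L F x}"
    proof (intro Set.set_eqI iffI)
      fix c assume "c \<in> topspace ?X - arc_at L F x"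
      then have "c \<in> circ_proj L ` (- pre L F)" "c \<notin> arc_at L F x" unfolding top by auto
      then obtain y where y: "y \<notin> pre L F" "c = circ_proj L y" "c \<notin> arc_at L F x" by auto
      then have "c \<in> arc_at L F y" using arc_at_self by blast
      then show "c \<in> \<Union>{arc_at L F y | y. y \<notin> pre L F \<and> arc_at L F y \<noteq> arc_at L F x}" using y by blast
    next
      fix c assume "c \<in> \<Union>{arc_at L F y | y. y \<notin> pre L F \<and> arc_at L F y \<noteq> arc_at L F x}"
      then obtain y where "y \<notin> pre L F" "arc_at L F y \<noteq> arc_at L F x" "c \<in> arc_at L F y" by blast
      then show "c \<in> topspace ?X - arc_at L F x"
        using arc_at_disjoint[OF L F _ x] sub[of y] by auto
    qed
    \<comment> \<open>The complement of the arc is the union of the other arcs, which are open.\<close>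
    have "closedin ?X (arc_at L F x)"
      unfolding closedin_def rest using op openin_subset[OF op[OF x]] by (auto intro!: openin_Union)
    moreover have "connectedin ?X (connected_component_of_set ?X (circ_proj L x))"
      by (rule connectedin_connected_component_of)
    ultimately have "connected_component_of_set ?X (circ_proj L x) \<subseteq> arc_at L F x \<or>
        disjnt (connected_component_of_set ?X (circ_proj L x)) (arc_at L F x)"
      using connectedin_clopen_cases op[OF x] by blast
    moreover have "circ_proj L x \<in> connected_component_of_set ?X (circ_proj L x)"
      using top x by (simp add: connected_component_of_refl)
    ultimately show "connected_component_of_set ?X (circ_proj L x) \<subseteq> arc_at L F x"
      using arc_at_self[OF x] by (auto simp: disjnt_iff)
  qed
  then show ?thesis unfolding arcs_def connected_components_of_def top image_image by auto
qed

lemma base_pt: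
  assumes L: "L > 0" and F: "F \<in> fin_subsets L" and x: "x \<notin> pre L F"
  shows "base_pt L F x \<in> comp_at (pre L F) x" "circ_proj L (base_pt L F x) = pt (arc_at L F x)"
proof -
  have "pt (arc_at L F x) \<in> arc_at L F x"
    unfolding pt_def using someI[of "\<lambda>c. c \<in> arc_at L F x"] arc_at_self[OF x] by blast
  then have "\<exists>y. y \<in> comp_at (pre L F) x \<and> circ_proj L y = pt (arc_at L F x)"
    by (auto simp: arc_at_def)
  from someI_ex[OF this] show "base_pt L F x \<in> comp_at (pre L F) x" "circ_proj L (base_pt L F x) = pt (arc_at L F x)"
    unfolding base_pt_def by auto
qed

lemma base_pt_unique:
  assumes L: "L > 0" and F: "F \<in> fin_subsets L" and x: "x \<notin> pre L F"
    and y: "y \<in> comp_at (pre L F) x" "circ_proj L y = pt (arc_at L F x)"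
  shows "y = base_pt L F x"
proof -
  note b = base_pt[OF L F x]
  obtain k :: int where k: "y = base_pt L F x + of_int k * real L" using y(2) b(2) circ_proj_eq_iff by metis
  have "seg_eq (pre L F) (base_pt L F x) (base_pt L F x + of_int k * real L)"
    using b(1) y(1) x unfolding comp_at_def k using seg_eq_trans seg_eq_sym by blast
  then have "k = 0" using seg_eq_no_wrap[OF periodic_pre[OF L F]] b(1) by (auto simp: comp_at_def)
  then show ?thesis using k by simp
qed

lemma base_pt_cong:
  assumes L: "L > 0" and F: "F \<in> fin_subsets L" and x: "x \<notin> pre L F" and y: "y \<notin> pre L F"
    and e: "seg_eq (pre L F) x (y + of_int k * real L)"
  shows "base_pt L F x = base_pt L F y + of_int k * real L"
proof (rule base_pt_unique[OF L F x, symmetric])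
  have y': "y + of_int k * real L \<notin> pre L F" using periodic_shift[OF periodic_pre[OF L F]] y by blast
  show "base_pt L F y + of_int k * real L \<in> comp_at (pre L F) x"
    unfolding comp_at_cong[OF e x y'] comp_at_shift[OF periodic_pre[OF L F]] by (rule base_pt[OF L F y])
  show "circ_proj L (base_pt L F y + of_int k * real L) = pt (arc_at L F x)"
    using base_pt(2)[OF L F y] arc_at_eq_iff[OF L F x y] e by auto
qed

lemma base_pt_le:
  assumes L: "L > 0" and F: "F \<in> fin_subsets L" and ok: "par_ok (pi0P L F) x y"
  shows "base_pt L F x \<le> base_pt L F y"
proof (rule ccontr)
  assume "\<not> base_pt L F x \<le> base_pt L F y"
  then have le: "seg_le (pre L F) (base_pt L F y) (base_pt L F x)" by (simp add: seg_le_of_le)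
  have x: "x \<notin> pre L F" and y: "y \<notin> pre L F" and xy: "seg_le (pre L F) x y" using ok by (auto simp: par_ok_def)
  have "seg_le (pre L F) y x"
    using base_pt(1)[OF L F x] base_pt(1)[OF L F y] le seg_le_trans unfolding comp_at_def seg_eq_def by blast
  then have "seg_eq (pre L F) x y" using xy by (simp add: seg_eq_def)
  then have "base_pt L F x = base_pt L F y" using base_pt_cong[OF L F x y, of 0] by simp
  then show False using \<open>\<not> base_pt L F x \<le> base_pt L F y\<close> by simp
qed

text \<open>An arrow between the base points of two arcs is given by lifts of these points in order; the components
that contain the lifts form an ordered pair, and conversely.\<close>

lemma pi0_zAr:
  assumes L: "L > 0" and F: "F \<in> fin_subsets L"
  shows "zAr (pi0 L F) = {prAr (pi0P L F) x y | x y. par_ok (pi0P L F) x y}"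
proof (intro Set.set_eqI iffI)
  note per = periodic_pre[OF L F]
  fix f
  {
    assume "f \<in> zAr (pi0 L F)"
    then obtain x y A where x: "x \<notin> pre L F" and y: "y \<notin> pre L F" and f: "f = (Arc (arc_at L F x), Path A, Arc (arc_at L F y))"
      and A: "A \<in> zHom (circ_cat L) (pt (arc_at L F x)) (pt (arc_at L F y))"
      by (auto simp: pi0_def arcs_eq[OF L F])
    from A obtain k :: int where k: "base_pt L F x \<le> base_pt L F y + of_int k * real L"
      "A = lift_class L (base_pt L F x) (base_pt L F y + of_int k * real L)"
      unfolding base_pt(2)[OF L F x, symmetric] base_pt(2)[OF L F y, symmetric] circ_cat_zHom[OF L] by blast
    let ?y = "y + of_int k * real L"
    have y': "?y \<notin> pre L F" using periodic_shift[OF per] y by blast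
    have b: "base_pt L F ?y = base_pt L F y + of_int k * real L" by (rule base_pt_cong[OF L F y' y]) simp
    have "arc_at L F ?y = arc_at L F y" using arc_at_eq_iff[OF L F y' y] seg_eq_refl by blast
    moreover have "seg_le (pre L F) x ?y"
      using base_pt(1)[OF L F x] base_pt(1)[OF L F y'] seg_le_of_le[of "base_pt L F x" "base_pt L F ?y" "pre L F"] k(1)
      unfolding b comp_at_def seg_eq_def using seg_le_trans by blast
    ultimately have "f = prAr (pi0P L F) x ?y" "par_ok (pi0P L F) x ?y"
      using f k b x y' by (auto simp: par_ok_def)
    then show "f \<in> {prAr (pi0P L F) x y | x y. par_ok (pi0P L F) x y}" by blast
  next
    assume "f \<in> {prAr (pi0P L F) x y | x y. par_ok (pi0P L F) x y}"
    then obtain x y where ok: "par_ok (pi0P L F) x y" and f: "f = prAr (pi0P L F) x y" by blast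
    then have x: "x \<notin> pre L F" and y: "y \<notin> pre L F" by (auto simp: par_ok_def)
    have "lift_class L (base_pt L F x) (base_pt L F y) \<in> zHom (circ_cat L) (pt (arc_at L F x)) (pt (arc_at L F y))"
      unfolding base_pt(2)[OF L F x, symmetric] base_pt(2)[OF L F y, symmetric] circ_cat_zHom[OF L]
      using base_pt_le[OF L F ok] by (intro exI[of _ 0]) simp
    then show "f \<in> zAr (pi0 L F)" using f x y by (auto simp: pi0_def arcs_eq[OF L F])
  }
qed

text \<open>A homotopy class of monotone paths between the base points is determined by the lifts of its ends up to a
common translation, hence by a pair of components up to translation.\<close>

lemma presents_pi0P:
  assumes L: "L > 0" and F: "F \<in> fin_subsets L"
  shows "presents (pi0P L F)"
  unfolding presents_def
proof (intro conjI allI impI)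
  note per = periodic_pre[OF L F]
  show "periodic (prS (pi0P L F)) (prT (pi0P L F))" using per by simp
  show "zOb (prC (pi0P L F)) = prOb (pi0P L F) ` (- prS (pi0P L F))" by (auto simp: pi0_def arcs_eq[OF L F])
  show "zAr (prC (pi0P L F)) = {prAr (pi0P L F) x y | x y. par_ok (pi0P L F) x y}" using pi0_zAr[OF L F] by simp
  show "prOb (pi0P L F) x = prOb (pi0P L F) y \<longleftrightarrow> (\<exists>k::int. seg_eq (prS (pi0P L F)) x (y + of_int k * prT (pi0P L F)))"
    if "x \<notin> prS (pi0P L F)" "y \<notin> prS (pi0P L F)" for x y
    using arc_at_eq_iff[OF L F] that by simp
  show "prAr (pi0P L F) x y = prAr (pi0P L F) x' y' \<longleftrightarrow>
          (\<exists>k::int. seg_eq (prS (pi0P L F)) x (x' + of_int k * prT (pi0P L F)) \<and> seg_eq (prS (pi0P L F)) y (y' + of_int k * prT (pi0P L F)))"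
    if ok: "par_ok (pi0P L F) x y" and ok': "par_ok (pi0P L F) x' y'" for x y x' y'
  proof -
    have n: "x \<notin> pre L F" "y \<notin> pre L F" "x' \<notin> pre L F" "y' \<notin> pre L F" using ok ok' by (auto simp: par_ok_def)
    have bp: "seg_eq (pre L F) u (v + of_int k * real L)"
      if uv: "u \<notin> pre L F" "v \<notin> pre L F" "base_pt L F u = base_pt L F v + of_int k * real L" for u v and k :: int
    proof -
      have "base_pt L F u \<in> comp_at (pre L F) u" by (rule base_pt[OF L F uv(1)])
      moreover have "base_pt L F u \<in> comp_at (pre L F) (v + of_int k * real L)"
        unfolding uv(3) comp_at_shift[OF per] by (rule base_pt[OF L F uv(2)])
      ultimately show ?thesis unfolding comp_at_def using seg_eq_trans seg_eq_sym by blast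
    qed
    show ?thesis
    proof
      assume "prAr (pi0P L F) x y = prAr (pi0P L F) x' y'"
      then have "lift_class L (base_pt L F x) (base_pt L F y) = lift_class L (base_pt L F x') (base_pt L F y')" by simp
      then obtain k :: int where "base_pt L F x = base_pt L F x' + of_int k * real L" "base_pt L F y = base_pt L F y' + of_int k * real L"
        unfolding lift_class_eq_iff[OF L base_pt_le[OF L F ok]] by blast
      then show "\<exists>k::int. seg_eq (prS (pi0P L F)) x (x' + of_int k * prT (pi0P L F)) \<and> seg_eq (prS (pi0P L F)) y (y' + of_int k * prT (pi0P L F))"
        using bp n by auto
    next
      assume "\<exists>k::int. seg_eq (prS (pi0P L F)) x (x' + of_int k * prT (pi0P L F)) \<and> seg_eq (prS (pi0P L F)) y (y' + of_int k * prT (pi0P L F))"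
      then obtain k :: int where k: "seg_eq (pre L F) x (x' + of_int k * real L)" "seg_eq (pre L F) y (y' + of_int k * real L)" by auto
      have "lift_class L (base_pt L F x) (base_pt L F y) = lift_class L (base_pt L F x') (base_pt L F y')"
        unfolding lift_class_eq_iff[OF L base_pt_le[OF L F ok]] using base_pt_cong[OF L F] n k by blast
      then show "prAr (pi0P L F) x y = prAr (pi0P L F) x' y'" using k n arc_at_eq_iff[OF L F] by auto
    qed
  qed
  show "zSrc (prC (pi0P L F)) (prAr (pi0P L F) x y) = prOb (pi0P L F) x" "zTgt (prC (pi0P L F)) (prAr (pi0P L F) x y) = prOb (pi0P L F) y" for x y
    by (simp_all add: pi0_def)
  show "zId (prC (pi0P L F)) (prOb (pi0P L F) x) = prAr (pi0P L F) x x" if "x \<notin> prS (pi0P L F)" for x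
    using that circ_cat_zId[OF L] base_pt(2)[OF L F, of x] by (simp add: pi0_def) metis
  show "zEnd (prC (pi0P L F)) (prOb (pi0P L F) x) = prAr (pi0P L F) x (x + prT (pi0P L F))" if "x \<notin> prS (pi0P L F)" for x
  proof -
    have x: "x \<notin> pre L F" using that by simp
    have x': "x + real L \<notin> pre L F" using per x by (simp add: periodic_def)
    have "base_pt L F (x + real L) = base_pt L F x + real L" using base_pt_cong[OF L F x' x, of 1] by simp
    moreover have "arc_at L F (x + real L) = arc_at L F x" using arc_at_eq_iff[OF L F x' x] by (auto intro!: exI[of _ 1])
    moreover have "zEnd (circ_cat L) (pt (arc_at L F x)) = lift_class L (base_pt L F x) (base_pt L F x + real L)"
      using circ_cat_zEnd[of L "base_pt L F x"] base_pt(2)[OF L F x] by simp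
    ultimately show ?thesis by (simp add: pi0_def)
  qed
  show "zComp (prC (pi0P L F)) (prAr (pi0P L F) y z) (prAr (pi0P L F) x y) = prAr (pi0P L F) x z"
    if "par_ok (pi0P L F) x y" "par_ok (pi0P L F) y z" for x y z
    using circ_cat_zComp[OF L base_pt_le[OF L F that(1)] base_pt_le[OF L F that(2)]] by (simp add: pi0_def)
qed

text \<open>Moving the ends of a path inside arcs moves the ends of its lift inside components of the line. The only
lifts of the chosen points in these components are the base points.\<close>

lemma transport_eq:
  assumes L: "L > 0" and F: "F \<in> fin_subsets L" and x: "x \<notin> pre L F" and y: "y \<notin> pre L F"
    and g: "lifts_to L p g" "g 0 \<in> comp_at (pre L F) x" "g 1 \<in> comp_at (pre L F) y"
  shows "transport L (arc_at L F x) (arc_at L F y) p = lift_class L (base_pt L F x) (base_pt L F y)"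
proof (intro Set.set_eqI iffI)
  fix q
  let ?P = "\<lambda>h. h 0 \<in> arc_at L F x \<and> h 1 \<in> arc_at L F y"
  {
    assume q: "q \<in> lift_class L (base_pt L F x) (base_pt L F y)"
    then obtain h where h: "lifts_to L q h" "h 0 = base_pt L F x" "h 1 = base_pt L F y" by (auto simp: lift_class_def)
    have "homotopic_with ?P (top_of_set {0..1}) (circ L) p q"
    proof (rule homotopic_lifts[where g = g and h = h])
      fix s :: real assume s: "s \<in> {0..1}"
      show "circ_proj L ((1 - s) * g 0 + s * h 0) \<in> arc_at L F x"
        unfolding h arc_at_def by (intro imageI comp_at_combination g base_pt L F x s)
      show "circ_proj L ((1 - s) * g 1 + s * h 1) \<in> arc_at L F y"
        unfolding h arc_at_def by (intro imageI comp_at_combination g base_pt L F y s)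
    qed (use g h in \<open>auto simp: lifts_to_def\<close>)
    then show "q \<in> transport L (arc_at L F x) (arc_at L F y) p"
      using lift_class_ends[OF q] lift_class_sub q base_pt(2)[OF L F x] base_pt(2)[OF L F y]
      by (auto simp: transport_def)
  next
    assume q: "q \<in> transport L (arc_at L F x) (arc_at L F y) p"
    then obtain h where h: "lifts_to L q h" by (auto simp: transport_def mono_paths_def)
    have "homotopic_with ?P (top_of_set {0..1}) (circ L) p q" using q by (simp add: transport_def)
    from homotopic_lift_ends[OF L this g(1) h] obtain k :: int and a b :: "real \<Rightarrow> real" where
      a: "continuous_on {0..1} a" "a 0 = g 0" "a 1 = h 0 + of_int k * real L" "\<And>s. s \<in> {0..1} \<Longrightarrow> circ_proj L (a s) \<in> arc_at L F x"
      and b: "continuous_on {0..1} b" "b 0 = g 1" "b 1 = h 1 + of_int k * real L" "\<And>s. s \<in> {0..1} \<Longrightarrow> circ_proj L (b s) \<in> arc_at L F y"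
      by metis
    \<comment> \<open>A path over an arc that starts in a component of the line stays there.\<close>
    have end_eq: "f 1 = base_pt L F z"
      if f: "continuous_on {0..1} f" "f 0 \<in> comp_at (pre L F) z" "\<And>s. s \<in> {0..1} \<Longrightarrow> circ_proj L (f s) \<in> arc_at L F z"
        "circ_proj L (f 1) = pt (arc_at L F z)" and z: "z \<notin> pre L F" for f :: "real \<Rightarrow> real" and z
    proof (rule base_pt_unique[OF L F z _ f(4)])
      have n: "f s \<notin> pre L F" if "s \<in> {0..1}" for s
        using f(3)[OF that] by (auto simp: arc_at_def comp_at_def pre_def)
      then have "seg_eq (pre L F) (f 0) (f 1)" by (intro continuous_avoid_seg_eq f) auto
      then show "f 1 \<in> comp_at (pre L F) z" using f(2) n[of 1] n[of 0] seg_eq_trans by (auto simp: comp_at_def)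
    qed
    have "q 0 = pt (arc_at L F x)" "q 1 = pt (arc_at L F y)" using q by (auto simp: transport_def)
    moreover have "q 0 = circ_proj L (h 0)" "q 1 = circ_proj L (h 1)" using h by (auto simp: lifts_to_def)
    ultimately have "a 1 = base_pt L F x" "b 1 = base_pt L F y"
      using end_eq[OF a(1) _ a(4) _ x] end_eq[OF b(1) _ b(4) _ y] g a b by auto
    then have "lifts_to L q (\<lambda>t. h t + of_int k * real L)" "h 0 + of_int k * real L = base_pt L F x" "h 1 + of_int k * real L = base_pt L F y"
      using lifts_to_shift[OF h] a b by auto
    then show "q \<in> lift_class L (base_pt L F x) (base_pt L F y)" unfolding lift_class_def by blast
  }
qed

text \<open>The flag \<open>c\<close> says that the lift is antitone. The periodicity condition says that the degree of the map is
\<open>1\<close> or \<open>-1\<close>.\<close>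

definition circ_lift :: "nat \<Rightarrow> nat \<Rightarrow> (real set \<Rightarrow> real set) \<Rightarrow> bool \<Rightarrow> (real \<Rightarrow> real) \<Rightarrow> bool" where
  "circ_lift L M \<phi> c g \<longleftrightarrow> continuous_on UNIV g \<and> (\<forall>x. \<phi> (circ_proj L x) = circ_proj M (g x)) \<and>
     (if c then antimono g else mono g) \<and> (\<forall>x. g (x + real L) = (if c then g x - real M else g x + real M))"

lemma circ_liftD:
  assumes "circ_lift L M \<phi> c g"
  shows "continuous_on UNIV g" "\<And>x. \<phi> (circ_proj L x) = circ_proj M (g x)"
    "\<And>x. g (x + real L) = (if c then g x - real M else g x + real M)"
    "\<And>x y. x \<le> y \<Longrightarrow> if c then g y \<le> g x else g x \<le> g y"
  using assms by (auto simp: circ_lift_def mono_def antimono_def)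

text \<open>Lifts differ by a constant. A decreasing lift with \<open>g (x + L) = g x - M\<close> therefore excludes a monotone one.\<close>

lemma circ_lift_orient:
  assumes L: "L > 0" and M: "M > 0" and g: "circ_lift L M \<phi> c g"
  shows "orient_pres L M \<phi> \<longleftrightarrow> \<not> c"
proof
  assume "\<not> c"
  then show "orient_pres L M \<phi>" using g by (auto simp: circ_lift_def orient_pres_def)
next
  note G = circ_liftD[OF g]
  assume "orient_pres L M \<phi>"
  then obtain h where h: "continuous_on UNIV h" "mono h" "\<And>x. \<phi> (circ_proj L x) = circ_proj M (h x)"
    by (auto simp: orient_pres_def)
  then obtain k :: int where k: "\<And>x. h x = g x + of_int k * real M"
    using circ_lift_unique[OF M, of UNIV h g] G by auto
  \<comment> \<open>The monotone lift would differ from \<open>g\<close> by a constant, although \<open>g\<close> decreases over a period.\<close>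
  have "h 0 \<le> h (0 + real L)" using h(2) by (simp add: mono_def)
  then show "\<not> c" using k G(3)[of 0] M by auto
qed

lemma circ_lift_seg_eq:
  assumes g: "circ_lift L M \<phi> c g" and avoid: "\<And>x. x \<notin> S \<Longrightarrow> g x \<notin> S'"
    and x: "x \<notin> S" and y: "y \<notin> S" and e: "seg_eq S x y"
  shows "seg_eq S' (g x) (g y)"
proof -
  have 1: "seg_eq S' (g u) (g v)" if uv: "u \<le> v" "u \<notin> S" "v \<notin> S" "seg_eq S u v" for u v
  proof (rule continuous_avoid_seg_eq[OF _ uv(1)])
    show "continuous_on {u..v} g" using circ_liftD(1)[OF g] continuous_on_subset by blast
    fix s assume "s \<in> {u..v}"
    then have "s \<notin> S" using uv
      by (cases "s = u \<or> s = v") (auto simp: seg_eq_def seg_le_def disjoint_iff)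
    then show "g s \<notin> S'" by (rule avoid)
  qed
  show ?thesis using 1[of x y] 1[of y x] x y e seg_eq_sym by (cases "x \<le> y") auto
qed

text \<open>One lemma for inclusions (\<open>g\<close> is the identity), homeomorphisms and rescalings. A path of a class is carried
by \<open>\<phi>\<close> to the path with lift \<open>g\<close> composed with the lift, read backwards if \<open>g\<close> is decreasing, and
\<open>transport_eq\<close> identifies its class.\<close>

lemma induces_pi0_mor:
  assumes L: "L > 0" and M: "M > 0" and F: "F \<in> fin_subsets L" and G: "G \<in> fin_subsets M"
    and g: "circ_lift L M \<phi> c g" and avoid: "\<And>x. x \<notin> pre L F \<Longrightarrow> g x \<notin> pre M G"
  shows "induces (pi0P L F) (pi0P M G) c g (pi0_mor L F M G \<phi>)"
proof -
  let ?p = "pi0P L F" and ?q = "pi0P M G"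
  note D = circ_liftD[OF g] and or = circ_lift_orient[OF L M g] and P = presents_pi0P[OF L F] and Q = presents_pi0P[OF M G]
  have se: "seg_eq (pre M G) (g x) (g y)" if "x \<notin> pre L F" "y \<notin> pre L F" "seg_eq (pre L F) x y" for x y
    by (rule circ_lift_seg_eq[OF g avoid that])
  have eqv: "equivariant ?p ?q c g"
    unfolding equivariant_def
  proof (intro conjI allI impI)
    fix x y assume "par_ok ?p x y"
    then have x: "x \<notin> pre L F" "y \<notin> pre L F" "seg_le (pre L F) x y" by (auto simp: par_ok_def)
    show "if c then seg_le (prS ?q) (g y) (g x) else seg_le (prS ?q) (g x) (g y)"
    proof (cases "x \<le> y")
      case True then show ?thesis using D(4)[OF True] seg_le_of_le by auto
    next
      case False
      then have "seg_eq (pre L F) x y" using x seg_le_of_le[of y x "pre L F"] by (simp add: seg_eq_def)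
      then show ?thesis using se[OF x(1,2)] by (auto simp: seg_eq_def)
    qed
  qed (use avoid D(3) in auto)
  have arc_im: "arc_image M G \<phi> (arc_at L F x) = arc_at M G (g x)" if x: "x \<notin> pre L F" for x
    unfolding arc_image_def
  proof (rule the_equality)
    have "\<phi> (circ_proj L u) \<in> arc_at M G (g x)" if "u \<in> comp_at (pre L F) x" for u
    proof -
      have "g u \<in> comp_at (pre M G) (g x)" using that se[OF x, of u] avoid by (auto simp: comp_at_def)
      then show ?thesis by (simp add: D(2) arc_at_def)
    qed
    then show "arc_at M G (g x) \<in> arcs M G \<and> \<phi> ` arc_at L F x \<subseteq> arc_at M G (g x)"
      using arcs_eq[OF M G] avoid[OF x] by (auto simp: arc_at_def[of L])
    fix c' assume c': "c' \<in> arcs M G \<and> \<phi> ` arc_at L F x \<subseteq> c'"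
    then obtain y where y: "y \<notin> pre M G" "c' = arc_at M G y" using arcs_eq[OF M G] by auto
    have "\<phi> (circ_proj L x) \<in> c'" using c' arc_at_self[OF x] by blast
    then show "c' = arc_at M G (g x)"
      using arc_at_disjoint[OF M G y(1) avoid[OF x], of "circ_proj M (g x)"] arc_at_self[OF avoid[OF x]] y(2) D(2) by simp
  qed
  have "dAr (pi0_mor L F M G \<phi>) (prAr ?p x y) = (if c then prAr ?q (g y) (g x) else prAr ?q (g x) (g y))" if ok: "par_ok ?p x y" for x y
  proof -
    have x: "x \<notin> pre L F" and y: "y \<notin> pre L F" using ok by (auto simp: par_ok_def)
    have gb: "g (base_pt L F z) \<in> comp_at (pre M G) (g z)" if z: "z \<notin> pre L F" for z
      using base_pt(1)[OF L F z] se[OF z, of "base_pt L F z"] avoid by (auto simp: comp_at_def)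
    have ne: "lift_class L (base_pt L F x) (base_pt L F y) \<noteq> {}" by (rule lift_class_nonempty[OF base_pt_le[OF L F ok]])
    have mem: "prAr ?p x y \<in> zAr (pi0 L F)" using zHom_zAr[OF presents_Ar_mem[OF P ok]] by simp
    show ?thesis
    proof (cases c)
      case False
      have "transport M (arc_at M G (g x)) (arc_at M G (g y)) (\<lambda>t. \<phi> (p t)) = lift_class M (base_pt M G (g x)) (base_pt M G (g y))"
        if p: "p \<in> lift_class L (base_pt L F x) (base_pt L F y)" for p
      proof -
        obtain h where h: "lifts_to L p h" "h 0 = base_pt L F x" "h 1 = base_pt L F y" using p by (auto simp: lift_class_def)
        have "lifts_to M (\<lambda>t. \<phi> (p t)) (\<lambda>t. g (h t))"
          using h(1) D(2) False D(4) unfolding lifts_to_def mono_on_def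
          by (auto intro!: continuous_on_compose2[OF D(1)])
        then show ?thesis using transport_eq[OF M G avoid[OF x] avoid[OF y]] gb[OF x] gb[OF y] h by simp
      qed
      then have "(\<Union>p\<in>lift_class L (base_pt L F x) (base_pt L F y). transport M (arc_at M G (g x)) (arc_at M G (g y)) (\<lambda>t. \<phi> (p t)))
          = lift_class M (base_pt M G (g x)) (base_pt M G (g y))" using ne by auto
      then show ?thesis using False mem by (simp add: pi0_mor_def or Let_def arc_im x y)
    next
      case True
      have "transport M (arc_at M G (g y)) (arc_at M G (g x)) (\<lambda>t. \<phi> (p (1 - t))) = lift_class M (base_pt M G (g y)) (base_pt M G (g x))"
        if p: "p \<in> lift_class L (base_pt L F x) (base_pt L F y)" for p
      proof -
        obtain h where h: "lifts_to L p h" "h 0 = base_pt L F x" "h 1 = base_pt L F y" using p by (auto simp: lift_class_def)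
        have "continuous_on {0..1} (\<lambda>t. h (1 - t))"
          using h(1) unfolding lifts_to_def by (auto intro!: continuous_on_compose2[of "{0..1}" h] continuous_intros)
        then have "lifts_to M (\<lambda>t. \<phi> (p (1 - t))) (\<lambda>t. g (h (1 - t)))"
          using h(1) D(2) True D(4) unfolding lifts_to_def mono_on_def
          by (auto intro!: continuous_on_compose2[OF D(1)])
        then show ?thesis using transport_eq[OF M G avoid[OF y] avoid[OF x]] gb[OF x] gb[OF y] h by simp
      qed
      then have "(\<Union>p\<in>lift_class L (base_pt L F x) (base_pt L F y). transport M (arc_at M G (g y)) (arc_at M G (g x)) (\<lambda>t. \<phi> (p (1 - t))))
          = lift_class M (base_pt M G (g y)) (base_pt M G (g x))" using ne by auto
      then show ?thesis using True mem by (simp add: pi0_mor_def or Let_def arc_im x y)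
    qed
  qed
  moreover have "dOb (pi0_mor L F M G \<phi>) (prOb ?p x) = prOb ?q (g x)" if "x \<notin> pre L F" for x
    using that presents_Ob_mem[OF P, of x] arc_im[OF that] by (simp add: pi0_mor_def Let_def)
  ultimately show ?thesis
    unfolding induces_def using eqv or by (simp add: pi0_mor_def Let_def)
qed

section \<open>The cyclic categories and the circle cut open\<close>

lemma seg_le_Ints: "x \<notin> \<int> \<Longrightarrow> seg_le \<int> x y \<longleftrightarrow> \<lfloor>x\<rfloor> \<le> \<lfloor>y\<rfloor>" for x y :: real
proof
  assume x: "x \<notin> \<int>" and le: "seg_le \<int> x y"
  show "\<lfloor>x\<rfloor> \<le> \<lfloor>y\<rfloor>"
  proof (rule ccontr)
    assume "\<not> \<lfloor>x\<rfloor> \<le> \<lfloor>y\<rfloor>"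
    then have "y < of_int \<lfloor>x\<rfloor>" by linarith
    moreover have "of_int \<lfloor>x\<rfloor> \<noteq> x" using x by (metis Ints_of_int)
    then have "of_int \<lfloor>x\<rfloor> < x" using of_int_floor_le[of x] by linarith
    ultimately have "of_int \<lfloor>x\<rfloor> \<in> {y<..<x} \<inter> \<int>" by simp
    then show False using le unfolding seg_le_def by blast
  qed
next
  assume "\<lfloor>x\<rfloor> \<le> \<lfloor>y\<rfloor>"
  have "\<not> (y < of_int n \<and> of_int n < x)" for n :: int
  proof
    assume n: "y < of_int n \<and> of_int n < x"
    then have "n \<le> \<lfloor>x\<rfloor>" by (simp add: le_floor_iff)
    then have "n \<le> \<lfloor>y\<rfloor>" using \<open>\<lfloor>x\<rfloor> \<le> \<lfloor>y\<rfloor>\<close> by simp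
    then show False using n by (simp add: le_floor_iff)
  qed
  then show "seg_le \<int> x y" by (auto simp: seg_le_def elim!: Ints_cases)
qed

lemma seg_eq_Ints: "x \<notin> \<int> \<Longrightarrow> y \<notin> \<int> \<Longrightarrow> seg_eq \<int> x y \<longleftrightarrow> \<lfloor>x\<rfloor> = \<lfloor>y\<rfloor>" for x y :: real
  using seg_le_Ints[of x y] seg_le_Ints[of y x] by (auto simp: seg_eq_def)

lemma half_notin_Ints: "of_int k + 1 / 2 \<notin> (\<int> :: real set)"
proof
  assume "of_int k + 1 / 2 \<in> (\<int> :: real set)"
  then obtain n :: int where "of_int k + 1 / 2 = (of_int n :: real)" by (auto elim: Ints_cases)
  then have "of_int (2 * k + 1) = (of_int (2 * n) :: real)" by simp
  then have "2 * k + 1 = 2 * n" by (simp only: of_int_eq_iff)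
  then show False by presburger
qed

lemma floor_half: "\<lfloor>of_int k + 1 / 2 :: real\<rfloor> = k"
  by linarith

text \<open>The number \<open>i\<close> corresponds to the open intervals $(i + k(N+1), i + 1 + k(N+1))$ of the line cut at the
integers. The number of passages through $a_n \to a_0$ is the difference of the blocks of length
\<open>N + 1\<close> that contain the two points.\<close>

definition ncycP :: "nat \<Rightarrow> zpres" where
  "ncycP N = \<lparr>prC = ncyc N, prS = \<int>, prT = real (N + 1),
     prOb = (\<lambda>x. Num (nat (\<lfloor>x\<rfloor> mod int (N + 1)))),
     prAr = (\<lambda>x y. (Num (nat (\<lfloor>x\<rfloor> mod int (N + 1))),
        Wind (nat (\<lfloor>y\<rfloor> div int (N + 1) - \<lfloor>x\<rfloor> div int (N + 1))),
        Num (nat (\<lfloor>y\<rfloor> mod int (N + 1)))))\<rparr>"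

lemma ncycP_simps [simp]:
  "prC (ncycP N) = ncyc N" "prS (ncycP N) = \<int>" "prT (ncycP N) = real (N + 1)"
  "prOb (ncycP N) x = Num (nat (\<lfloor>x\<rfloor> mod int (N + 1)))"
  "prAr (ncycP N) x y = (Num (nat (\<lfloor>x\<rfloor> mod int (N + 1))),
        Wind (nat (\<lfloor>y\<rfloor> div int (N + 1) - \<lfloor>x\<rfloor> div int (N + 1))),
        Num (nat (\<lfloor>y\<rfloor> mod int (N + 1))))"
  by (simp_all add: ncycP_def)

lemma mod_eq_shift: "(i::int) mod M = j mod M \<longleftrightarrow> (\<exists>k. i = j + k * M)"
proof
  assume "i mod M = j mod M"
  then have "i = j + (i div M - j div M) * M"
    using div_mult_mod_eq[of i M] div_mult_mod_eq[of j M] by (simp only: left_diff_distrib)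
  then show "\<exists>k. i = j + k * M" ..
qed auto

lemma floor_shift: "\<lfloor>y + of_int k * real M\<rfloor> = \<lfloor>y\<rfloor> + k * int M"
proof -
  have "y + of_int k * real M = y + of_int (k * int M)" by simp
  then show ?thesis by (simp only: floor_add_int)
qed

lemma ord_set_mem: "Num i \<in> ord_set N \<longleftrightarrow> i \<le> N"
  by (auto simp: ord_set_def)

lemma presents_ncycP: "presents (ncycP N)"
  unfolding presents_def
proof (intro conjI allI impI)
  let ?M = "int (N + 1)" and ?p = "ncycP N"
  have M: "?M > 0" by simp
  have per: "periodic \<int> (real (N + 1))"
  proof -
    have "x + real (N + 1) \<in> \<int> \<longleftrightarrow> x \<in> \<int>" for x :: real
      using Ints_add[of x "real (N + 1)"] Ints_diff[of "x + real (N + 1)" "real (N + 1)"] by auto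
    then show ?thesis by (auto simp: periodic_def intro: exI[of _ "0::real"])
  qed
  then show "periodic (prS ?p) (prT ?p)" by simp
  have half: "of_int i + 1 / 2 \<notin> (\<int>::real set)" "\<lfloor>of_int i + 1 / 2 :: real\<rfloor> = i" for i
    using half_notin_Ints floor_half by auto
  have shift: "y + of_int k * real (N + 1) \<notin> \<int>" if "y \<notin> \<int>" for y :: real and k
    using periodic_shift[OF per] that by blast
  have ok: "par_ok ?p x y \<longleftrightarrow> x \<notin> \<int> \<and> y \<notin> \<int> \<and> \<lfloor>x\<rfloor> \<le> \<lfloor>y\<rfloor>" for x y
    using seg_le_Ints by (auto simp: par_ok_def)
  have modN: "nat (i mod ?M) \<le> N" for i using pos_mod_bound[OF M, of i] by linarith
  show "zOb (prC ?p) = prOb ?p ` (- prS ?p)"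
  proof (intro Set.set_eqI iffI)
    fix a assume "a \<in> zOb (prC ?p)"
    then obtain i where i: "i \<le> N" "a = Num i" by (auto simp: ncyc_def cyc_def ord_set_def)
    then have "a = prOb ?p (of_int (int i) + 1 / 2)" unfolding ncycP_simps half by simp
    then show "a \<in> prOb ?p ` (- prS ?p)" by (rule image_eqI) (simp only: ncycP_simps Compl_iff half not_False_eq_True)
  next
    fix a assume "a \<in> prOb ?p ` (- prS ?p)"
    then show "a \<in> zOb (prC ?p)" using modN by (auto simp: ncyc_def cyc_def ord_set_mem)
  qed
  show "zAr (prC ?p) = {prAr ?p x y | x y. par_ok ?p x y}"
  proof (intro Set.set_eqI iffI)
    fix f assume "f \<in> zAr (prC ?p)"
    then obtain i j k where f: "i \<le> N" "j \<le> N" "f = (Num i, Wind k, Num j)" "i \<le> j \<or> 1 \<le> k"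
      by (auto simp: ncyc_def cyc_def ord_set_def ord_le_def)
    let ?x = "of_int (int i) + 1 / 2 :: real" and ?y = "of_int (int j + int k * ?M) + 1 / 2 :: real"
    have "int i \<le> int j + int k * ?M"
    proof (cases "i \<le> j")
      case False
      then have "1 * ?M \<le> int k * ?M" using f(4) by (intro mult_right_mono) auto
      moreover have "int i \<le> 1 * ?M" using f(1) by simp
      ultimately have "int i \<le> int k * ?M" by (rule order_trans[rotated])
      then show ?thesis by (rule add_increasing[rotated]) simp
    qed (rule add_increasing2, auto)
    then have "par_ok ?p ?x ?y" unfolding ok half by (simp add: half)
    moreover have "f = prAr ?p ?x ?y"
      unfolding ncycP_simps half using f(1,2) by (simp add: f(3))
    ultimately show "f \<in> {prAr ?p x y | x y. par_ok ?p x y}" by blast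
  next
    fix f assume "f \<in> {prAr ?p x y | x y. par_ok ?p x y}"
    then obtain x y where f: "f = prAr ?p x y" "\<lfloor>x\<rfloor> \<le> \<lfloor>y\<rfloor>" using ok by auto
    have "\<lfloor>x\<rfloor> mod ?M \<le> \<lfloor>y\<rfloor> mod ?M \<or> 1 \<le> \<lfloor>y\<rfloor> div ?M - \<lfloor>x\<rfloor> div ?M"
    proof (cases "\<lfloor>x\<rfloor> div ?M = \<lfloor>y\<rfloor> div ?M")
      case True
      then have "\<lfloor>x\<rfloor> mod ?M \<le> \<lfloor>y\<rfloor> mod ?M"
        using f(2) div_mult_mod_eq[of "\<lfloor>x\<rfloor>" ?M] div_mult_mod_eq[of "\<lfloor>y\<rfloor>" ?M] by (metis add_le_cancel_left)
      then show ?thesis by simp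
    next
      case False
      then show ?thesis using zdiv_mono1[OF f(2) M] by linarith
    qed
    then show "f \<in> zAr (prC ?p)"
      using f(1) modN by (auto simp: ncyc_def cyc_def ord_le_def ord_set_mem nat_le_eq_zle)
  qed
  show "prOb ?p x = prOb ?p y \<longleftrightarrow> (\<exists>k::int. seg_eq (prS ?p) x (y + of_int k * prT ?p))"
    if "x \<notin> prS ?p" "y \<notin> prS ?p" for x y
  proof -
    have "prOb ?p x = prOb ?p y \<longleftrightarrow> \<lfloor>x\<rfloor> mod ?M = \<lfloor>y\<rfloor> mod ?M"
      using pos_mod_sign[OF M] by (simp add: eq_nat_nat_iff)
    also have "\<dots> \<longleftrightarrow> (\<exists>k::int. seg_eq \<int> x (y + of_int k * real (N + 1)))"
      unfolding mod_eq_shift using seg_eq_Ints[of x] shift[of y] that by (simp add: floor_shift del: of_nat_Suc of_nat_add)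
    finally show ?thesis by simp
  qed
  show "prAr ?p x y = prAr ?p x' y' \<longleftrightarrow>
          (\<exists>k::int. seg_eq (prS ?p) x (x' + of_int k * prT ?p) \<and> seg_eq (prS ?p) y (y' + of_int k * prT ?p))"
    if xy: "par_ok ?p x y" "par_ok ?p x' y'" for x y x' y'
  proof -
    have n: "x \<notin> \<int>" "y \<notin> \<int>" "x' \<notin> \<int>" "y' \<notin> \<int>" "\<lfloor>x\<rfloor> \<le> \<lfloor>y\<rfloor>" "\<lfloor>x'\<rfloor> \<le> \<lfloor>y'\<rfloor>" using xy ok by auto
    have d: "\<lfloor>x\<rfloor> div ?M \<le> \<lfloor>y\<rfloor> div ?M" "\<lfloor>x'\<rfloor> div ?M \<le> \<lfloor>y'\<rfloor> div ?M" using n zdiv_mono1[OF _ M] by auto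
    have "prAr ?p x y = prAr ?p x' y' \<longleftrightarrow> \<lfloor>x\<rfloor> mod ?M = \<lfloor>x'\<rfloor> mod ?M \<and> \<lfloor>y\<rfloor> mod ?M = \<lfloor>y'\<rfloor> mod ?M \<and>
        \<lfloor>y\<rfloor> div ?M - \<lfloor>x\<rfloor> div ?M = \<lfloor>y'\<rfloor> div ?M - \<lfloor>x'\<rfloor> div ?M"
      using d pos_mod_sign[OF M] unfolding ncycP_simps prod.inject zob.inject zlabel.inject by (simp only: eq_nat_nat_iff diff_ge_0_iff_ge) auto
    also have "\<dots> \<longleftrightarrow> (\<exists>k. \<lfloor>x\<rfloor> = \<lfloor>x'\<rfloor> + k * ?M \<and> \<lfloor>y\<rfloor> = \<lfloor>y'\<rfloor> + k * ?M)" (is "?A \<longleftrightarrow> ?B")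
    proof
      assume A: ?A
      have "\<lfloor>x\<rfloor> = \<lfloor>x'\<rfloor> + (\<lfloor>x\<rfloor> div ?M - \<lfloor>x'\<rfloor> div ?M) * ?M"
        using A div_mult_mod_eq[of "\<lfloor>x\<rfloor>" ?M] div_mult_mod_eq[of "\<lfloor>x'\<rfloor>" ?M] by (simp only: left_diff_distrib)
      moreover have "\<lfloor>y\<rfloor> = \<lfloor>y'\<rfloor> + (\<lfloor>y\<rfloor> div ?M - \<lfloor>y'\<rfloor> div ?M) * ?M"
        using A div_mult_mod_eq[of "\<lfloor>y\<rfloor>" ?M] div_mult_mod_eq[of "\<lfloor>y'\<rfloor>" ?M] by (simp only: left_diff_distrib)
      moreover have "\<lfloor>y\<rfloor> div ?M - \<lfloor>y'\<rfloor> div ?M = \<lfloor>x\<rfloor> div ?M - \<lfloor>x'\<rfloor> div ?M" using A by linarith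
      ultimately show ?B by metis
    next
      assume ?B
      then obtain k where "\<lfloor>x\<rfloor> = \<lfloor>x'\<rfloor> + k * ?M" "\<lfloor>y\<rfloor> = \<lfloor>y'\<rfloor> + k * ?M" by blast
      then show ?A using M by (simp add: div_mult_self1)
    qed
    also have "\<dots> \<longleftrightarrow> (\<exists>k::int. seg_eq \<int> x (x' + of_int k * real (N + 1)) \<and> seg_eq \<int> y (y' + of_int k * real (N + 1)))"
      using seg_eq_Ints[of x] seg_eq_Ints[of y] shift[of x'] shift[of y'] n by (simp add: floor_shift del: of_nat_Suc of_nat_add)
    finally show ?thesis by simp
  qed
  show "zSrc (prC ?p) (prAr ?p x y) = prOb ?p x" "zTgt (prC ?p) (prAr ?p x y) = prOb ?p y" for x y
    by (simp_all add: ncyc_def cyc_def)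
  show "zId (prC ?p) (prOb ?p x) = prAr ?p x x" for x by (simp add: ncyc_def cyc_def)
  show "zEnd (prC ?p) (prOb ?p x) = prAr ?p x (x + prT ?p)" for x
    using floor_shift[of x 1 "N + 1"] by (simp add: ncyc_def cyc_def)
  show "zComp (prC ?p) (prAr ?p y z) (prAr ?p x y) = prAr ?p x z" if "par_ok ?p x y" "par_ok ?p y z" for x y z
  proof -
    have "\<lfloor>x\<rfloor> div ?M \<le> \<lfloor>y\<rfloor> div ?M" "\<lfloor>y\<rfloor> div ?M \<le> \<lfloor>z\<rfloor> div ?M" using that ok zdiv_mono1[OF _ M] by auto
    then show ?thesis by (simp add: ncyc_def cyc_def nat_add_distrib[symmetric])
  qed
qed

text \<open>A map of integers seen as a map of the intervals between them; midpoints serve as representatives.\<close>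

definition step_map :: "(int \<Rightarrow> int) \<Rightarrow> real \<Rightarrow> real" where
  "step_map t x = of_int (t \<lfloor>x\<rfloor>) + 1 / 2"

lemma step_map_simps [simp]: "step_map t x \<notin> \<int>" "\<lfloor>step_map t x\<rfloor> = t \<lfloor>x\<rfloor>"
  unfolding step_map_def using half_notin_Ints floor_half by auto

definition shift_mono :: "int \<Rightarrow> int \<Rightarrow> (int \<Rightarrow> int) \<Rightarrow> bool" where
  "shift_mono M M' t \<longleftrightarrow> mono t \<and> (\<forall>j. t (j + M) = t j + M')"

lemma shift_by:
  fixes t :: "int \<Rightarrow> 'a::comm_ring_1"
  assumes "\<And>j. t (j + M) = t j + M'"
  shows "t (j + k * M) = t j + of_int k * M'"
proof (induction k rule: int_induct[where k = 0])
  case (step1 i)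
  have "t (j + (i + 1) * M) = t ((j + i * M) + M)" by (simp add: algebra_simps)
  then show ?case using step1 assms[of "j + i * M"] by (simp add: distrib_right)
next
  case (step2 i)
  have "t (j + i * M) = t ((j + (i - 1) * M) + M)" by (simp add: algebra_simps)
  then have "t (j + (i - 1) * M) = t (j + i * M) - M'" using assms[of "j + (i - 1) * M"] by (simp only: add_diff_cancel_right')
  then show ?case using step2 by (simp add: left_diff_distrib)
qed simp

lemma equivariant_step_map:
  assumes t: "shift_mono (int (m + 1)) (int (n + 1)) t"
  shows "equivariant (ncycP m) (ncycP n) False (step_map t)"
  unfolding equivariant_def if_False ncycP_simps
proof (intro conjI allI impI)
  fix x y assume "par_ok (ncycP m) x y"
  then have "\<lfloor>x\<rfloor> \<le> \<lfloor>y\<rfloor>" using seg_le_Ints by (auto simp: par_ok_def)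
  then show "seg_le \<int> (step_map t x) (step_map t y)"
    using t seg_le_Ints[of "step_map t x"] by (simp add: shift_mono_def mono_def)
next
  fix x :: real
  have "step_map t x + of_int 1 * real (n + 1) \<notin> \<int>"
    using periodic_shift[OF presentsD(1)[OF presents_ncycP[of n]], of "step_map t x" 1] by simp
  moreover have "\<lfloor>step_map t (x + of_int 1 * real (m + 1))\<rfloor> = \<lfloor>step_map t x + of_int 1 * real (n + 1)\<rfloor>"
    unfolding floor_shift step_map_simps using t by (simp add: shift_mono_def)
  ultimately have "seg_eq \<int> (step_map t (x + of_int 1 * real (m + 1))) (step_map t x + of_int 1 * real (n + 1))"
    using seg_eq_Ints step_map_simps(1) by blast
  then show "seg_eq \<int> (step_map t (x + real (m + 1))) (step_map t x + real (n + 1))" by simp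
qed simp

text \<open>A map $[m] \to [n]$ becomes an equivariant map of $\mathbb{Z}$, translation by \<open>m + 1\<close> corresponding to
translation by \<open>n + 1\<close>.\<close>

definition int_ext :: "nat \<Rightarrow> nat \<Rightarrow> (nat \<Rightarrow> nat) \<Rightarrow> int \<Rightarrow> int" where
  "int_ext m n \<theta> j = (j div int (m + 1)) * int (n + 1) + int (\<theta> (nat (j mod int (m + 1))))"

lemma DeltaHom_le: "\<theta> \<in> DeltaHom m n \<Longrightarrow> i \<le> m \<Longrightarrow> \<theta> i \<le> n"
  by (auto simp: DeltaHom_def)

lemma DeltaHom_mono: "\<theta> \<in> DeltaHom m n \<Longrightarrow> i \<le> j \<Longrightarrow> j \<le> m \<Longrightarrow> \<theta> i \<le> \<theta> j"
  by (auto simp: DeltaHom_def mono_on_def)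

lemma nat_mod_le: "nat (j mod int (m + 1)) \<le> m"
  using pos_mod_bound[of "int (m + 1)" j] by linarith

lemma int_ext_div_mod:
  assumes "\<theta> \<in> DeltaHom m n"
  shows "int_ext m n \<theta> j div int (n + 1) = j div int (m + 1)"
    and "int_ext m n \<theta> j mod int (n + 1) = int (\<theta> (nat (j mod int (m + 1))))"
proof -
  have "\<theta> (nat (j mod int (m + 1))) \<le> n" by (rule DeltaHom_le[OF assms nat_mod_le])
  then have *: "0 \<le> int (\<theta> (nat (j mod int (m + 1))))" "int (\<theta> (nat (j mod int (m + 1)))) < int (n + 1)" by auto
  show "int_ext m n \<theta> j div int (n + 1) = j div int (m + 1)"
    unfolding int_ext_def using div_pos_pos_trivial[OF *] by (subst div_mult_self3) (auto simp del: of_nat_Suc of_nat_add)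
  show "int_ext m n \<theta> j mod int (n + 1) = int (\<theta> (nat (j mod int (m + 1))))"
    unfolding int_ext_def using mod_pos_pos_trivial[OF *] by (subst mod_mult_self3) simp
qed

lemma int_div_cases:
  fixes i j M :: int
  assumes "i \<le> j" "M > 0"
  obtains "i div M < j div M" | "i div M = j div M" "i mod M \<le> j mod M"
proof (cases "i div M = j div M")
  case True
  then have "i mod M \<le> j mod M"
    using assms div_mult_mod_eq[of i M] div_mult_mod_eq[of j M] by (metis add_le_cancel_left)
  then show ?thesis using True that by blast
next
  case False
  then show ?thesis using zdiv_mono1[OF assms] that by linarith
qed

lemma block_mono:
  fixes b b' q q' M :: int
  assumes "q < q'" "b < M" "0 \<le> b'" "M > 0"
  shows "q * M + b \<le> q' * M + b'"
proof -
  have "(q + 1) * M \<le> q' * M" using assms by (intro mult_right_mono) auto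
  then show ?thesis using assms by (simp add: distrib_right)
qed

lemma shift_mono_int_ext:
  assumes "\<theta> \<in> DeltaHom m n"
  shows "shift_mono (int (m + 1)) (int (n + 1)) (int_ext m n \<theta>)"
proof -
  have "int_ext m n \<theta> i \<le> int_ext m n \<theta> j" if ij: "i \<le> j" for i j
    using ij
  proof (rule int_div_cases[where M = "int (m + 1)"])
    assume "i div int (m + 1) < j div int (m + 1)"
    then show ?thesis unfolding int_ext_def
      using DeltaHom_le[OF assms nat_mod_le, of i] by (intro block_mono) auto
  next
    assume h: "i div int (m + 1) = j div int (m + 1)" "i mod int (m + 1) \<le> j mod int (m + 1)"
    then have "nat (i mod int (m + 1)) \<le> nat (j mod int (m + 1))" by (intro nat_mono)
    then show ?thesis unfolding int_ext_def h(1) using DeltaHom_mono[OF assms _ nat_mod_le] by simp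
  qed simp
  moreover have "int_ext m n \<theta> (j + int (m + 1)) = int_ext m n \<theta> j + int (n + 1)" for j
    unfolding int_ext_def by (simp del: of_nat_Suc of_nat_add add: distrib_right)
  ultimately show ?thesis by (simp add: shift_mono_def mono_def)
qed

abbreviation ncyc_mor :: "nat \<Rightarrow> nat \<Rightarrow> (nat \<Rightarrow> nat) \<Rightarrow> dmor" where
  "ncyc_mor m n \<theta> \<equiv> cyc_mor (ord_set m) ord_le (ord_set n) ord_le (\<lambda>a. Num (\<theta> (num_of a)))"

lemma induces_ncyc_mor:
  assumes "\<theta> \<in> DeltaHom m n"
  shows "induces (ncycP m) (ncycP n) False (step_map (int_ext m n \<theta>)) (ncyc_mor m n \<theta>)"
proof -
  have "dAr (ncyc_mor m n \<theta>) (prAr (ncycP m) x y) = prAr (ncycP n) (step_map (int_ext m n \<theta>) x) (step_map (int_ext m n \<theta>) y)"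
    if "par_ok (ncycP m) x y" for x y
  proof -
    have "prAr (ncycP m) x y \<in> zAr (ncyc m)"
      using zHom_zAr[OF presents_Ar_mem[OF presents_ncycP that]] by simp
    then show ?thesis unfolding ncycP_simps step_map_simps int_ext_div_mod[OF assms]
      by (simp add: cyc_mor_def ncyc_def[symmetric])
  qed
  moreover have "dOb (ncyc_mor m n \<theta>) (prOb (ncycP m) x) = prOb (ncycP n) (step_map (int_ext m n \<theta>) x)" for x
    unfolding ncycP_simps step_map_simps int_ext_div_mod[OF assms] using nat_mod_le[of "\<lfloor>x\<rfloor>" m]
    by (simp add: cyc_mor_def ord_set_mem)
  ultimately show ?thesis
    using equivariant_step_map[OF shift_mono_int_ext[OF assms]]
    by (simp add: induces_def del: ncycP_simps(4,5)) (auto simp: cyc_mor_def ncyc_def cyc_def)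
qed

lemma ncyc_mor_dHom: "\<theta> \<in> DeltaHom m n \<Longrightarrow> ncyc_mor m n \<theta> \<in> dHom (ncyc m) (ncyc n)"
  using induces_dHom[OF presents_ncycP presents_ncycP induces_ncyc_mor] by simp

lemma int_multiple_bounds:
  assumes "L > 0"
  shows "of_int k * real L < real L \<Longrightarrow> k \<le> 0" "- real L < of_int k * real L \<Longrightarrow> 0 \<le> k"
    "of_int k * real L \<le> real L \<Longrightarrow> k \<le> 1" "- real L \<le> of_int k * real L \<Longrightarrow> - 1 \<le> k"
proof -
  have L: "(0::real) < real L" using assms by simp
  show "of_int k * real L < real L \<Longrightarrow> k \<le> 0"
    using mult_less_cancel_right_pos[OF L, of "of_int k" 1, unfolded mult_1_left] by linarith
  show "- real L < of_int k * real L \<Longrightarrow> 0 \<le> k"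
    using mult_less_cancel_right_pos[OF L, of "- 1" "of_int k", unfolded mult_minus1] by linarith
  show "of_int k * real L \<le> real L \<Longrightarrow> k \<le> 1"
    using mult_le_cancel_right_pos[OF L, of "of_int k" 1, unfolded mult_1_left] by linarith
  show "- real L \<le> of_int k * real L \<Longrightarrow> - 1 \<le> k"
    using mult_le_cancel_right_pos[OF L, of "- 1" "of_int k", unfolded mult_minus1] by linarith
qed

text \<open>A finite set of cut points of $[0,L]$ that contains both ends; its components are then components of the
line, and the base point of the circle is one of the cuts.\<close>

locale cut =
  fixes L :: nat and F :: "real set"
  assumes L: "L > 0" and F: "finite F" "F \<subseteq> {0..real L}" "0 \<in> F" "real L \<in> F"
begin

abbreviation "FF \<equiv> circ_proj L ` F"
abbreviation "S \<equiv> pre L FF"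

lemma FF: "FF \<in> fin_subsets L"
  using F by (auto simp: fin_subsets_def topspace_circ)

lemma per: "periodic S (real L)"
  by (rule periodic_pre[OF L FF])

lemma mem_S: "0 \<le> x \<Longrightarrow> x \<le> real L \<Longrightarrow> x \<in> S \<longleftrightarrow> x \<in> F"
proof
  assume x: "0 \<le> x" "x \<le> real L" and "x \<in> S"
  then obtain y where y: "y \<in> F" "circ_proj L x = circ_proj L y" by (auto simp: pre_def)
  then obtain k :: int where k: "x = y + of_int k * real L" using circ_proj_eq_iff by blast
  have "0 \<le> y" "y \<le> real L" using y F by auto
  then have "- real L \<le> of_int k * real L" "of_int k * real L \<le> real L" using k x by auto
  then have "- 1 \<le> k" "k \<le> 1" using int_multiple_bounds[OF L, of k] by auto
  then consider "k = 0" | "k = 1" | "k = - 1" by linarith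
  then show "x \<in> F"
  proof cases
    case 1 then show ?thesis using k y by simp
  next
    case 2 then have "x = real L" using k x \<open>0 \<le> y\<close> by simp then show ?thesis using F by simp
  next
    case 3 then have "x = 0" using k x \<open>y \<le> real L\<close> by simp then show ?thesis using F by simp
  qed
qed (auto simp: pre_def)

lemma comp_at_sub:
  assumes "x \<in> {0..real L} - F"
  shows "comp_at S x \<subseteq> {0<..<real L} - F"
proof
  fix u assume u: "u \<in> comp_at S x"
  have 0: "0 \<in> S" "real L \<in> S" using mem_S F by auto
  have "x \<noteq> 0" "x \<noteq> real L" "0 \<le> x" "x \<le> real L" using assms F by auto
  then have x: "0 < x" "x < real L" by linarith+
  have e: "{x<..<u} \<inter> S = {}" "{u<..<x} \<inter> S = {}" "u \<notin> S" using u by (auto simp: comp_at_def seg_eq_def seg_le_def)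
  have "0 < u"
  proof (rule ccontr)
    assume "\<not> 0 < u"
    moreover have "u \<noteq> 0" using e(3) 0 by auto
    ultimately have "u < 0" by linarith
    then have "0 \<in> {u<..<x} \<inter> S" using x 0 by simp
    then show False using e(2) by blast
  qed
  moreover have "u < real L"
  proof (rule ccontr)
    assume "\<not> u < real L"
    moreover have "u \<noteq> real L" using e(3) 0 by auto
    ultimately have "real L < u" by linarith
    then have "real L \<in> {x<..<u} \<inter> S" using x 0 by simp
    then show False using e(1) by blast
  qed
  ultimately show "u \<in> {0<..<real L} - F" using e(3) mem_S by auto
qed

lemma notin_S: "x \<in> {0..real L} - F \<Longrightarrow> x \<notin> S"
  using mem_S by auto

lemma component_at:
  assumes x: "x \<in> {0..real L} - F"
  shows "connected_component_set ({0..real L} - F) x = comp_at S x"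
proof
  have "connected (comp_at S x)"
    unfolding is_interval_connected_1[symmetric] is_interval_1 using comp_at_convex[OF _ _ notin_S[OF x]] by blast
  then show "comp_at S x \<subseteq> connected_component_set ({0..real L} - F) x"
    using comp_at_sub[OF x] comp_at_self[OF notin_S[OF x]] by (intro connected_component_maximal) auto
  show "connected_component_set ({0..real L} - F) x \<subseteq> comp_at S x"
  proof
    fix u assume "u \<in> connected_component_set ({0..real L} - F) x"
    then obtain T where T: "connected T" "T \<subseteq> {0..real L} - F" "x \<in> T" "u \<in> T"
      by (auto simp: connected_component_def)
    then have "t \<in> T" if "x \<le> t \<and> t \<le> u \<or> u \<le> t \<and> t \<le> x" for t
      using T(1) that unfolding is_interval_connected_1[symmetric] is_interval_1 by blast
    then have "t \<notin> S" if "x \<le> t \<and> t \<le> u \<or> u \<le> t \<and> t \<le> x" for t using that T(2) notin_S by blast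
    then have "t \<notin> S" if "x < t \<and> t < u \<or> u < t \<and> t < x \<or> t = u" for t
      using that linear[of x u] by auto
    then show "u \<in> comp_at S x" by (auto simp: comp_at_def seg_eq_def seg_le_def)
  qed
qed

lemma components_eq: "components ({0..real L} - F) = comp_at S ` ({0..real L} - F)"
  unfolding components_def using component_at by auto

lemma unroll_arc_at:
  assumes x: "x \<in> {0..real L} - F"
  shows "unroll L F (arc_at L FF x) = comp_at S x"
proof -
  have "u \<in> comp_at S x" if u: "u \<in> {0..real L}" "circ_proj L u \<in> arc_at L FF x" for u
  proof -
    obtain k :: int where k: "u + of_int k * real L \<in> comp_at S x"
      using u(2) arc_at_mem_iff[OF L FF notin_S[OF x]] by blast
    then have "0 < u + of_int k * real L" "u + of_int k * real L < real L" using comp_at_sub[OF x] by auto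
    moreover have "0 \<le> u" "u \<le> real L" using u(1) by auto
    ultimately have "- real L < of_int k * real L" "of_int k * real L < real L" by linarith+
    then have "k = 0" using int_multiple_bounds[OF L, of k] by simp
    then show ?thesis using k by simp
  qed
  then have eq: "{u \<in> {0..real L}. circ_proj L u \<in> arc_at L FF x} = comp_at S x"
    using comp_at_sub[OF x] by (auto simp: arc_at_def)
  show ?thesis
    unfolding unroll_def eq components_eq
  proof (rule the_equality)
    fix e assume e: "e \<in> comp_at S ` ({0..real L} - F) \<and> comp_at S x \<subseteq> e"
    then obtain y where y: "y \<in> {0..real L} - F" "e = comp_at S y" "x \<in> comp_at S y"
      using comp_at_self[OF notin_S[OF x]] by blast
    then show "e = comp_at S x"
      using comp_at_cong[of S y x] notin_S[OF y(1)] notin_S[OF x] by (simp add: comp_at_def)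
  qed (use x in auto)
qed

text \<open>The composite of the identification of $\pi_0(\mathbb{R}/L\mathbb{Z} \setminus \overline F)$ with
$\pi_0([0,L] \setminus F)_{\mathrm{cyc}}$ and of the functor given by the labels.\<close>

definition label_mor :: "nat \<Rightarrow> (real set \<Rightarrow> nat) \<Rightarrow> dmor" where
  "label_mor N f = dComp (cyc_mor (ipi0 L F) ipi0_le (ord_set N) ord_le (\<lambda>e. Num (f (intv_of e)))) (cut_mor L F)"

lemma exists_shift:
  assumes "x \<notin> S"
  shows "x - of_int \<lfloor>x / real L\<rfloor> * real L \<in> {0..real L} - F"
proof -
  have "of_int \<lfloor>x / real L\<rfloor> * real L \<le> x" "x \<le> (of_int \<lfloor>x / real L\<rfloor> + 1) * real L"
    using floor_divide_lower[of "real L" x] floor_divide_upper[of "real L" x] L by auto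
  moreover have "x + of_int (- \<lfloor>x / real L\<rfloor>) * real L \<notin> S" using periodic_shift[OF per] assms by blast
  ultimately show ?thesis using mem_S by (auto simp: algebra_simps)
qed

text \<open>The label of an arrow of the cut circle counts the crossings of the base point. For a pair $(x, y)$ with
$x \in [0,L]$ it is the index of the interval $[kL, (k+1)L]$ that contains \<open>y\<close>, which is also the number of
full periods by which the periodic extension of the labels increases.\<close>

lemma induces_label_mor:
  assumes g: "equivariant (pi0P L FF) (ncycP N) False g"
    and f: "\<And>x. x \<in> {0..real L} - F \<Longrightarrow> 0 \<le> \<lfloor>g x\<rfloor> \<and> \<lfloor>g x\<rfloor> \<le> int N \<and> f (comp_at S x) = nat \<lfloor>g x\<rfloor>"
  shows "induces (pi0P L FF) (ncycP N) False g (label_mor N f)"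
proof -
  let ?p = "pi0P L FF" and ?q = "ncycP N" and ?M = "int (N + 1)"
  note P = presents_pi0P[OF L FF] and Q = presents_ncycP[of N]
  have gn: "g x \<notin> \<int>" if "x \<notin> S" for x using equivariant_notin[OF g] that by simp
  have gfl: "\<lfloor>g (x + of_int k * real L)\<rfloor> = \<lfloor>g x\<rfloor> + k * ?M" if x: "x \<notin> S" for x and k :: int
  proof -
    have x': "x + of_int k * real L \<notin> S" using periodic_shift[OF per] x by blast
    have e: "seg_eq \<int> (g (x + of_int k * real L)) (g x + of_int k * real (N + 1))"
      using equivariant_shift[OF P Q g, of x k] x by simp
    have "g x + of_int k * real (N + 1) \<notin> \<int>" using periodic_shift[OF presentsD(1)[OF Q], of "g x" k] gn[OF x] by simp
    then show ?thesis using e seg_eq_Ints[OF gn[OF x']] floor_shift[of "g x" k "N + 1"] by metis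
  qed
  have ob: "dOb (label_mor N f) (prOb ?p x) = prOb ?q (g x)" if x: "x \<notin> S" for x
  proof -
    let ?k = "\<lfloor>x / real L\<rfloor>" and ?y = "x - of_int \<lfloor>x / real L\<rfloor> * real L"
    have y: "?y \<in> {0..real L} - F" by (rule exists_shift[OF x])
    have x': "x = ?y + of_int ?k * real L" by simp
    have a: "arc_at L FF x = arc_at L FF ?y"
      using arc_at_eq_iff[OF L FF x notin_S[OF y]] seg_eq_refl[of S x] x' by metis
    have mem: "Intv (comp_at S ?y) \<in> ipi0 L F" unfolding ipi0_def components_eq using y by blast
    have "Arc (arc_at L FF x) \<in> zOb (pi0 L FF)" using presents_Ob_mem[OF P, of x] x by simp
    then have "dOb (label_mor N f) (prOb ?p x) = Num (f (comp_at S ?y))"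
      using mem by (simp add: label_mor_def dComp_def cut_mor_def compose_eq cyc_mor_def a unroll_arc_at[OF y])
    moreover have "\<lfloor>g x\<rfloor> = \<lfloor>g ?y\<rfloor> + ?k * ?M" using gfl[OF notin_S[OF y], of ?k] x' by simp
    then have "\<lfloor>g x\<rfloor> mod ?M = \<lfloor>g ?y\<rfloor>" using f[OF y] by (simp add: mod_pos_pos_trivial)
    ultimately show ?thesis using f[OF y] by simp
  qed
  have ar0: "dAr (label_mor N f) (prAr ?p x y) = prAr ?q (g x) (g y)"
    if ok: "par_ok ?p x y" and x: "x \<in> {0..real L} - F" for x y
  proof -
    have y: "y \<notin> S" and le: "seg_le S x y" using ok by (auto simp: par_ok_def)
    let ?k = "\<lfloor>y / real L\<rfloor>" and ?z = "y - of_int \<lfloor>y / real L\<rfloor> * real L"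
    have z: "?z \<in> {0..real L} - F" by (rule exists_shift[OF y])
    have y': "y = ?z + of_int ?k * real L" by simp
    have a: "arc_at L FF y = arc_at L FF ?z"
      using arc_at_eq_iff[OF L FF y notin_S[OF z]] seg_eq_refl[of S y] y' by metis
    have "0 \<le> y"
    proof (rule ccontr)
      assume "\<not> 0 \<le> y"
      moreover have "x \<noteq> 0" "0 \<le> x" using x F by auto
      then have "0 < x" by linarith
      ultimately have "0 \<in> {y<..<x} \<inter> S" using mem_S[of 0] F by auto
      then show False using le unfolding seg_le_def by blast
    qed
    then have k0: "0 \<le> ?k" using L by simp
    let ?bx = "base_pt L FF x" and ?by = "base_pt L FF y"
    note bx = base_pt(1)[OF L FF notin_S[OF x]]
    have byz: "?by = base_pt L FF ?z + of_int ?k * real L"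
      by (rule base_pt_cong[OF L FF y notin_S[OF z]]) simp
    have bz: "?by - of_int ?k * real L \<in> comp_at S ?z" using base_pt(1)[OF L FF notin_S[OF z]] byz by simp
    have the: "(THE k. \<exists>p\<in>lift_class L ?bx ?by. \<exists>g. lifts_to L p g \<and> g 0 \<in> comp_at S x \<and> g 1 - real k * real L \<in> comp_at S ?z) = nat ?k"
    proof (rule the_equality)
      obtain p where "p \<in> lift_class L ?bx ?by" using lift_class_nonempty[OF base_pt_le[OF L FF ok]] by blast
      moreover then obtain h where "lifts_to L p h" "h 0 = ?bx" "h 1 = ?by" by (auto simp: lift_class_def)
      ultimately show "\<exists>p\<in>lift_class L ?bx ?by. \<exists>g. lifts_to L p g \<and> g 0 \<in> comp_at S x \<and> g 1 - real (nat ?k) * real L \<in> comp_at S ?z"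
        using bx bz k0 by (intro bexI[of _ p] exI[of _ h]) auto
    next
      fix k assume "\<exists>p\<in>lift_class L ?bx ?by. \<exists>g. lifts_to L p g \<and> g 0 \<in> comp_at S x \<and> g 1 - real k * real L \<in> comp_at S ?z"
      then obtain p h where p: "p \<in> lift_class L ?bx ?by" and h: "lifts_to L p h" "h 0 \<in> comp_at S x" "h 1 - real k * real L \<in> comp_at S ?z" by blast
      obtain j :: int where j: "?bx = h 0 + of_int j * real L" "?by = h 1 + of_int j * real L"
        by (rule lift_class_lift[OF L p h(1)])
      have "seg_eq S (h 0) (h 0 + of_int j * real L)"
        using bx h(2) notin_S[OF x] unfolding j(1) comp_at_def using seg_eq_trans seg_eq_sym by blast
      then have "j = 0" using seg_eq_no_wrap[OF per] h(2) by (auto simp: comp_at_def)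
      then have "?by - real k * real L \<in> comp_at S ?z" using h(3) j by simp
      then have "0 < ?by - real k * real L" "?by - real k * real L < real L"
        "0 < ?by - of_int ?k * real L" "?by - of_int ?k * real L < real L"
        using bz comp_at_sub[OF z] by (auto simp del: divide_const_simps)
      then have "(of_int ?k - real k) * real L < 1 * real L" "(real k - of_int ?k) * real L < 1 * real L"
        by (simp_all only: left_diff_distrib)
      then have "of_int ?k - real k < 1" "real k - of_int ?k < 1" unfolding mult_less_cancel_right using L by auto
      then have "?k = int k" by linarith
      then show "k = nat ?k" by simp
    qed
    have mem: "Intv (comp_at S x) \<in> ipi0 L F" "Intv (comp_at S ?z) \<in> ipi0 L F"
      unfolding ipi0_def components_eq using x z by auto
    have "ipi0_le (Intv (comp_at S x)) (Intv (comp_at S ?z)) \<or> 1 \<le> nat ?k"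
    proof (cases "?k = 0")
      case True
      have xx: "x \<in> comp_at S x" "y \<in> comp_at S y" using comp_at_self notin_S[OF x] y by auto
      show ?thesis
      proof (cases "x \<le> y")
        case True then show ?thesis using \<open>?k = 0\<close> xx by (auto simp: ipi0_le_def)
      next
        case False
        then have "seg_eq S x y" using le seg_le_of_le[of y x S] by (simp add: seg_eq_def)
        then have "y \<in> comp_at S x" using y by (simp add: comp_at_def)
        then show ?thesis using \<open>?k = 0\<close> xx(2) by (auto simp: ipi0_le_def)
      qed
    next
      case False
      then have "1 \<le> ?k" using k0 by linarith
      then have "1 \<le> nat ?k" by linarith
      then show ?thesis ..
    qed
    then have mid: "(Intv (comp_at S x), Wind (nat ?k), Intv (comp_at S ?z)) \<in> zAr (cyc (ipi0 L F) ipi0_le)"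
      using mem by (auto simp: cyc_def)
    have fm: "prAr ?p x y \<in> zAr (pi0 L FF)" using zHom_zAr[OF presents_Ar_mem[OF P ok]] by simp
    have cut: "dAr (cut_mor L F) (prAr ?p x y) = (Intv (comp_at S x), Wind (nat ?k), Intv (comp_at S ?z))"
      using fm by (simp add: cut_mor_def Let_def a unroll_arc_at[OF z] unroll_arc_at[OF x] the[unfolded a])
    have "zAr (dSrc (cut_mor L F)) = zAr (pi0 L FF)" by (simp add: cut_mor_def)
    then have "dAr (label_mor N f) (prAr ?p x y) =
        dAr (cyc_mor (ipi0 L F) ipi0_le (ord_set N) ord_le (\<lambda>e. Num (f (intv_of e)))) (dAr (cut_mor L F) (prAr ?p x y))"
      unfolding label_mor_def dComp_def using fm by (simp only: dmor.simps compose_eq)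
    then have "dAr (label_mor N f) (prAr ?p x y) = (Num (f (comp_at S x)), Wind (nat ?k), Num (f (comp_at S ?z)))"
      unfolding cut using mid by (simp add: cyc_mor_def)
    moreover have gy: "\<lfloor>g y\<rfloor> = \<lfloor>g ?z\<rfloor> + ?k * ?M" using gfl[OF notin_S[OF z], of ?k] y' by simp
    moreover have "\<lfloor>g x\<rfloor> mod ?M = \<lfloor>g x\<rfloor>" "\<lfloor>g x\<rfloor> div ?M = 0" using f[OF x] by (auto simp: mod_pos_pos_trivial div_pos_pos_trivial)
    moreover have "\<lfloor>g ?z\<rfloor> mod ?M = \<lfloor>g ?z\<rfloor>" "\<lfloor>g ?z\<rfloor> div ?M = 0" using f[OF z] by (auto simp: mod_pos_pos_trivial div_pos_pos_trivial)
    moreover have "(\<lfloor>g ?z\<rfloor> + ?k * ?M) mod ?M = \<lfloor>g ?z\<rfloor> mod ?M" "(\<lfloor>g ?z\<rfloor> + ?k * ?M) div ?M = ?k + \<lfloor>g ?z\<rfloor> div ?M"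
      by (rule mod_mult_self1, rule div_mult_self1) simp
    ultimately show ?thesis using f[OF x] f[OF z] unfolding ncycP_simps by simp
  qed
  have ar: "dAr (label_mor N f) (prAr ?p x y) = prAr ?q (g x) (g y)" if ok: "par_ok ?p x y" for x y
  proof -
    have x: "x \<notin> S" and y: "y \<notin> S" using ok by (auto simp: par_ok_def)
    let ?k = "\<lfloor>x / real L\<rfloor>"
    let ?x = "x + of_int (- ?k) * real L" and ?y = "y + of_int (- ?k) * real L"
    have x': "?x \<in> {0..real L} - F" using exists_shift[OF x] by simp
    have ok': "par_ok ?p ?x ?y" using par_ok_shift[OF P, of x "- ?k" y] ok by simp
    have "prAr ?p ?x ?y = prAr ?p x y" using presents_Ar_shift[OF P ok, of "- ?k"] by simp
    moreover have "\<lfloor>g ?x\<rfloor> = \<lfloor>g x\<rfloor> + (- ?k) * ?M" "\<lfloor>g ?y\<rfloor> = \<lfloor>g y\<rfloor> + (- ?k) * ?M" using gfl[OF x] gfl[OF y] by blast+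
    then have "prAr ?q (g ?x) (g ?y) = prAr ?q (g x) (g y)"
      unfolding ncycP_simps by (simp only: mod_mult_self1 div_mult_self1[of ?M] ) simp
    ultimately show ?thesis using ar0[OF ok' x'] by metis
  qed
  show ?thesis
    unfolding induces_def using g ob ar
    by (simp del: ncycP_simps(4,5) pi0P_simps(4,5))
      (auto simp: label_mor_def dComp_def cut_mor_def cyc_mor_def ncyc_def)
qed

end

section \<open>Periodic subdivisions of the line\<close>

text \<open>A locally finite periodic subdivision of the line, repetitions of nodes allowed, with \<open>N + 1\<close> nodes per
period. Degenerate points of a simplex give repeated nodes.\<close>

definition subdiv :: "nat \<Rightarrow> nat \<Rightarrow> (int \<Rightarrow> real) \<Rightarrow> bool" where
  "subdiv L N W \<longleftrightarrow> L > 0 \<and> mono W \<and> (\<forall>j. W (j + int (N + 1)) = W j + real L)"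

lemma subdiv_L: "subdiv L N W \<Longrightarrow> L > 0"
  by (simp add: subdiv_def)

lemma subdiv_mono: "subdiv L N W \<Longrightarrow> i \<le> j \<Longrightarrow> W i \<le> W j"
  by (simp add: subdiv_def mono_def)

lemma subdiv_shift: "subdiv L N W \<Longrightarrow> W (j + k * int (N + 1)) = W j + of_int k * real L"
  using shift_by[of W "int (N + 1)" "real L" j k] by (simp add: subdiv_def)

definition nodes :: "nat \<Rightarrow> (int \<Rightarrow> real) \<Rightarrow> real set set" where
  "nodes L W = circ_proj L ` range W"

lemma pre_nodes:
  assumes "subdiv L N W"
  shows "pre L (nodes L W) = range W"
proof (intro Set.set_eqI iffI)
  fix x assume "x \<in> pre L (nodes L W)"
  then obtain j where "circ_proj L x = circ_proj L (W j)" by (auto simp: pre_def nodes_def)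
  then obtain k :: int where "x = W j + of_int k * real L" unfolding circ_proj_eq_iff ..
  then have "x = W (j + k * int (N + 1))" using subdiv_shift[OF assms] by simp
  then show "x \<in> range W" by blast
qed (auto simp: pre_def nodes_def)

lemma nodes_eq:
  assumes "subdiv L N W"
  shows "nodes L W = (\<lambda>j. circ_proj L (W j)) ` {0..int N}"
proof
  show "nodes L W \<subseteq> (\<lambda>j. circ_proj L (W j)) ` {0..int N}"
  proof
    fix c assume "c \<in> nodes L W"
    then obtain j where j: "c = circ_proj L (W j)" by (auto simp: nodes_def)
    let ?M = "int (N + 1)"
    have "W j = W (j mod ?M) + of_int (j div ?M) * real L"
      using subdiv_shift[OF assms, of "j mod ?M" "j div ?M"] mod_div_mult_eq[of j ?M] by simp
    then have "c = circ_proj L (W (j mod ?M))" using j by simp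
    moreover have "0 \<le> j mod ?M" "j mod ?M < ?M" by (rule pos_mod_sign, simp, rule pos_mod_bound, simp)
    then have "j mod ?M \<in> {0..int N}" unfolding atLeastAtMost_iff by linarith
    ultimately show "c \<in> (\<lambda>j. circ_proj L (W j)) ` {0..int N}" by blast
  qed
qed (auto simp: nodes_def)

lemma nodes_fin_subsets: "subdiv L N W \<Longrightarrow> nodes L W \<in> fin_subsets L"
  by (auto simp: fin_subsets_def nodes_eq)

lemma subdiv_between:
  assumes W: "subdiv L N W" and x: "x \<notin> range W"
  shows "\<exists>!j. W j < x \<and> x < W (j + 1)"
proof -
  let ?M = "int (N + 1)"
  have L: "real L > 0" using subdiv_L[OF W] by simp
  obtain a :: int where a: "W 0 + of_int a * real L < x"
  proof -
    have "of_int (\<lceil>(x - W 0) / real L\<rceil> - 1) * real L < x - W 0"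
      unfolding pos_less_divide_eq[OF L, symmetric] by linarith
    then show ?thesis using that[of "\<lceil>(x - W 0) / real L\<rceil> - 1"] by linarith
  qed
  obtain b :: int where b: "x < W 0 + of_int b * real L"
  proof -
    have "x - W 0 < of_int (\<lfloor>(x - W 0) / real L\<rfloor> + 1) * real L"
      unfolding pos_divide_less_eq[OF L, symmetric] by linarith
    then show ?thesis using that[of "\<lfloor>(x - W 0) / real L\<rfloor> + 1"] by linarith
  qed
  have ab: "W (a * ?M) < x" "x < W (b * ?M)" using a b subdiv_shift[OF W, of 0] by auto
  let ?J = "{j \<in> {a * ?M .. b * ?M}. W j < x}"
  have lt: "a * ?M < b * ?M" using ab subdiv_mono[OF W, of "b * ?M" "a * ?M"] by linarith
  have "finite ?J" by (rule finite_subset[of _ "{a * ?M .. b * ?M}"]) auto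
  moreover have "a * ?M \<in> ?J" unfolding mem_Collect_eq atLeastAtMost_iff using ab lt by linarith
  ultimately have fin: "finite ?J" "?J \<noteq> {}" by blast+
  let ?j = "Max ?J"
  have j: "?j \<in> ?J" by (rule Max_in[OF fin])
  have "?j \<noteq> b * ?M" using j ab(2) by force
  then have "\<not> W (?j + 1) < x" using Max_ge[OF fin(1), of "?j + 1"] j by force
  moreover have "W (?j + 1) \<in> range W" by (rule rangeI)
  then have "W (?j + 1) \<noteq> x" using x by metis
  ultimately have "W ?j < x \<and> x < W (?j + 1)" using j by force
  moreover have "i = j" if "W i < x \<and> x < W (i + 1)" "W j < x \<and> x < W (j + 1)" for i j
  proof (rule ccontr)
    assume "i \<noteq> j"
    then consider "i + 1 \<le> j" | "j + 1 \<le> i" by linarith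
    then show False using that subdiv_mono[OF W, of "i + 1" j] subdiv_mono[OF W, of "j + 1" i] by cases auto
  qed
  ultimately show ?thesis by blast
qed

definition slot :: "(int \<Rightarrow> real) \<Rightarrow> real \<Rightarrow> int" where
  "slot W x = (THE j. W j < x \<and> x < W (j + 1))"

lemma slot:
  assumes "subdiv L N W" "x \<notin> range W"
  shows "W (slot W x) < x" "x < W (slot W x + 1)"
  using theI'[OF subdiv_between[OF assms]] unfolding slot_def by auto

lemma slot_unique:
  assumes "subdiv L N W" "W j < x" "x < W (j + 1)"
  shows "x \<notin> range W" "slot W x = j"
proof -
  show n: "x \<notin> range W"
  proof
    assume "x \<in> range W"
    then obtain i where "x = W i" by blast
    then show False using assms subdiv_mono[OF assms(1), of "j + 1" i] subdiv_mono[OF assms(1), of i j]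
      by (cases "i \<le> j") auto
  qed
  show "slot W x = j" using slot[OF assms(1) n] subdiv_between[OF assms(1) n] assms by blast
qed

lemma slot_le:
  assumes W: "subdiv L N W" and x: "x \<notin> range W" and y: "y \<notin> range W" and le: "seg_le (range W) x y"
  shows "slot W x \<le> slot W y"
proof (rule ccontr)
  assume "\<not> slot W x \<le> slot W y"
  then have "W (slot W y + 1) \<le> W (slot W x)" by (intro subdiv_mono[OF W]) simp
  then have "W (slot W x) \<in> {y<..<x} \<inter> range W" using slot[OF W x] slot[OF W y] by auto
  then show False using le unfolding seg_le_def by blast
qed

lemma slot_eq_seg_eq:
  assumes W: "subdiv L N W" and x: "x \<notin> range W" and y: "y \<notin> range W" and e: "slot W x = slot W y"
  shows "seg_eq (range W) x y"
proof -
  have "t \<notin> range W" if "x < t \<and> t < y \<or> y < t \<and> t < x" for t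
    using slot_unique(1)[OF W, of "slot W x" t] slot[OF W x] slot[OF W y] that e by auto
  then show ?thesis unfolding seg_eq_def seg_le_def disjoint_iff greaterThanLessThan_iff by blast
qed

lemma slot_shift:
  assumes W: "subdiv L N W" and x: "x \<notin> range W"
  shows "slot W (x + of_int k * real L) = slot W x + k * int (N + 1)"
proof (rule slot_unique(2)[OF W])
  have "W (slot W x + k * int (N + 1) + 1) = W (slot W x + 1) + of_int k * real L"
    using subdiv_shift[OF W, of "slot W x + 1" k] by (simp add: algebra_simps)
  then show "x + of_int k * real L < W (slot W x + k * int (N + 1) + 1)" using slot[OF W x] by simp
  show "W (slot W x + k * int (N + 1)) < x + of_int k * real L"
    unfolding subdiv_shift[OF W] using slot[OF W x] by simp
qed

text \<open>Adding \<open>1 / 2\<close> moves the index of a gap into the interval between integers that has the same label in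
\<open>ncycP\<close>.\<close>

definition lam :: "(int \<Rightarrow> real) \<Rightarrow> real \<Rightarrow> real" where
  "lam W x = of_int (slot W x) + 1 / 2"

lemma lam_simps [simp]: "lam W x \<notin> \<int>" "\<lfloor>lam W x\<rfloor> = slot W x"
  unfolding lam_def using half_notin_Ints floor_half by auto

lemma equivariant_lam:
  assumes W: "subdiv L N W" and G: "nodes L W \<subseteq> G"
  shows "equivariant (pi0P L G) (ncycP N) False (lam W)"
  unfolding equivariant_def if_False ncycP_simps pi0P_simps
proof (intro conjI allI impI)
  have sub: "range W \<subseteq> pre L G" using pre_nodes[OF W] G by (auto simp: pre_def)
  fix x y assume "par_ok (pi0P L G) x y"
  then have "x \<notin> range W" "y \<notin> range W" "seg_le (range W) x y" using sub by (auto simp: par_ok_def seg_le_def)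
  then show "seg_le \<int> (lam W x) (lam W y)" using slot_le[OF W] seg_le_Ints by simp
next
  have sub: "range W \<subseteq> pre L G" using pre_nodes[OF W] G by (auto simp: pre_def)
  fix x assume "x \<notin> pre L G"
  then have x: "x \<notin> range W" using sub by blast
  have "lam W (x + of_int 1 * real L) = lam W x + of_int 1 * real (N + 1)"
    using slot_shift[OF W x, of 1] by (simp add: lam_def)
  then show "seg_eq \<int> (lam W (x + real L)) (lam W x + real (N + 1))" by simp
qed simp

text \<open>Inverse to the labelling, up to components, if no gap is empty.\<close>

definition midpt :: "(int \<Rightarrow> real) \<Rightarrow> real \<Rightarrow> real" where
  "midpt W y = (W \<lfloor>y\<rfloor> + W (\<lfloor>y\<rfloor> + 1)) / 2"

lemma midpt:
  assumes W: "subdiv L N W" and s: "strict_mono W"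
  shows "midpt W y \<notin> range W" "slot W (midpt W y) = \<lfloor>y\<rfloor>"
proof -
  have "W \<lfloor>y\<rfloor> < W (\<lfloor>y\<rfloor> + 1)" using s by (simp add: strict_mono_def)
  then have "W \<lfloor>y\<rfloor> < midpt W y" "midpt W y < W (\<lfloor>y\<rfloor> + 1)" by (auto simp: midpt_def)
  from slot_unique[OF W this] show "midpt W y \<notin> range W" "slot W (midpt W y) = \<lfloor>y\<rfloor>" by auto
qed

lemma equivariant_midpt:
  assumes W: "subdiv L N W" and s: "strict_mono W"
  shows "equivariant (ncycP N) (pi0P L (nodes L W)) False (midpt W)"
  unfolding equivariant_def if_False ncycP_simps pi0P_simps pre_nodes[OF W]
proof (intro conjI allI impI)
  fix x y assume "par_ok (ncycP N) x y"
  then have "\<lfloor>x\<rfloor> \<le> \<lfloor>y\<rfloor>" using seg_le_Ints by (auto simp: par_ok_def)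
  then have "midpt W x \<le> midpt W y" unfolding midpt_def
    using subdiv_mono[OF W, of "\<lfloor>x\<rfloor>" "\<lfloor>y\<rfloor>"] subdiv_mono[OF W, of "\<lfloor>x\<rfloor> + 1" "\<lfloor>y\<rfloor> + 1"] by auto
  then show "seg_le (range W) (midpt W x) (midpt W y)" by (rule seg_le_of_le)
next
  fix x :: real
  have e1: "W (\<lfloor>x\<rfloor> + 1 * int (N + 1)) = W \<lfloor>x\<rfloor> + of_int 1 * real L" by (rule subdiv_shift[OF W])
  have "\<lfloor>x\<rfloor> + 1 * int (N + 1) + 1 = (\<lfloor>x\<rfloor> + 1) + 1 * int (N + 1)" by simp
  then have e2: "W (\<lfloor>x\<rfloor> + 1 * int (N + 1) + 1) = W (\<lfloor>x\<rfloor> + 1) + of_int 1 * real L" using subdiv_shift[OF W] by metis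
  have "midpt W (x + of_int 1 * real (N + 1)) = midpt W x + real L"
    unfolding midpt_def floor_shift e1 e2 by (simp add: field_simps)
  then show "seg_eq (range W) (midpt W (x + real (N + 1))) (midpt W x + real L)" by simp
qed (use midpt(1)[OF W s] in auto)

lemma lam_midpt:
  assumes W: "subdiv L N W" and s: "strict_mono W"
  shows "y \<notin> \<int> \<Longrightarrow> seg_eq \<int> (lam W (midpt W y)) y"
    and "x \<notin> range W \<Longrightarrow> seg_eq (range W) (midpt W (lam W x)) x"
proof -
  show "y \<notin> \<int> \<Longrightarrow> seg_eq \<int> (lam W (midpt W y)) y"
    using seg_eq_Ints[of "lam W (midpt W y)" y] midpt(2)[OF W s] by simp
  show "x \<notin> range W \<Longrightarrow> seg_eq (range W) (midpt W (lam W x)) x"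
    using slot_eq_seg_eq[OF W midpt(1)[OF W s]] midpt(2)[OF W s] by simp
qed

definition periodic_ext :: "nat \<Rightarrow> nat \<Rightarrow> (nat \<Rightarrow> real) \<Rightarrow> int \<Rightarrow> real" where
  "periodic_ext L N y j = y (nat (j mod int (N + 1))) + of_int (j div int (N + 1)) * real L"

lemma periodic_ext_strict:
  assumes L: "L > 0" and y: "\<And>i j. i < j \<Longrightarrow> j \<le> N \<Longrightarrow> y i < y j" and b: "y N < y 0 + real L"
  shows "subdiv L N (periodic_ext L N y)" "strict_mono (periodic_ext L N y)"
proof -
  let ?M = "int (N + 1)" and ?W = "periodic_ext L N y"
  have yle: "y i \<le> y j" if "i \<le> j" "j \<le> N" for i j using y[of i j] that by (cases "i = j") auto
  have "?W i < ?W j" if ij: "i < j" for i j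
  proof -
    have m: "nat (i mod ?M) \<le> N" "nat (j mod ?M) \<le> N" by (rule nat_mod_le)+
    show ?thesis
    proof (cases "i div ?M = j div ?M")
      case True
      then have "i mod ?M < j mod ?M"
        using ij div_mult_mod_eq[of i ?M] div_mult_mod_eq[of j ?M] by (metis add_less_cancel_left)
      then have "y (nat (i mod ?M)) < y (nat (j mod ?M))" using m nat_less_eq_zless[of "i mod ?M" "j mod ?M"] by (intro y) simp_all
      then show ?thesis unfolding periodic_ext_def True by (rule add_strict_right_mono)
    next
      case False
      then have "i div ?M + 1 \<le> j div ?M" using zdiv_mono1[of i j ?M] ij by linarith
      then have "of_int (i div ?M + 1) * real L \<le> of_int (j div ?M) * real L" using L by (intro mult_right_mono) linarith+
      moreover have "y (nat (i mod ?M)) < y (nat (j mod ?M)) + real L"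
        using yle[of "nat (i mod ?M)" N] yle[of 0 "nat (j mod ?M)"] m b by linarith
      ultimately show ?thesis by (simp add: periodic_ext_def distrib_right del: of_nat_Suc of_nat_add)
    qed
  qed
  then show s: "strict_mono ?W" by (rule strict_monoI)
  have "?W (j + ?M) = ?W j + real L" for j
    unfolding periodic_ext_def by (simp add: distrib_right del: of_nat_Suc of_nat_add)
  then show "subdiv L N ?W" using L strict_mono_mono[OF s] by (simp add: subdiv_def)
qed

text \<open>List the representatives in $[0,L)$ in increasing order and extend periodically.\<close>

lemma fin_subset_subdiv:
  assumes L: "L > 0" and F: "F \<in> fin_subsets L"
  obtains N W where "subdiv L N W" "strict_mono W" "nodes L W = F"
proof -
  define R where "R = {x \<in> {0..<real L}. circ_proj L x \<in> F}"
  have inj: "inj_on (circ_proj L) R"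
  proof (rule inj_onI)
    fix x y assume xy: "x \<in> R" "y \<in> R" "circ_proj L x = circ_proj L y"
    then obtain k :: int where k: "x = y + of_int k * real L" unfolding circ_proj_eq_iff by blast
    have "0 \<le> x" "x < real L" "0 \<le> y" "y < real L" using xy by (auto simp: R_def)
    then have "- real L < of_int k * real L" "of_int k * real L < real L" using k by linarith+
    then have "k = 0" using int_multiple_bounds(1,2)[OF L, of k] by linarith
    then show "x = y" using k by simp
  qed
  have img: "circ_proj L ` R = F"
  proof
    show "F \<subseteq> circ_proj L ` R"
    proof
      fix c assume c: "c \<in> F"
      then obtain x where x: "c = circ_proj L x" using F by (auto simp: fin_subsets_def topspace_circ)
      let ?y = "x + of_int (- \<lfloor>x / real L\<rfloor>) * real L"
      have "0 \<le> ?y" "?y < real L"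
        using floor_divide_lower[of "real L" x] floor_divide_upper[of "real L" x] L by (auto simp: algebra_simps)
      moreover have "c = circ_proj L ?y" using x by (simp only: circ_proj_shift)
      ultimately show "c \<in> circ_proj L ` R" using c unfolding R_def by (intro image_eqI[of _ _ ?y]) auto
    qed
  qed (auto simp: R_def)
  have "finite F" "F \<noteq> {}" using F by (auto simp: fin_subsets_def)
  then have fin: "finite R" "R \<noteq> {}" using finite_imageD[OF _ inj] img by auto
  define xs where "xs = sorted_list_of_set R"
  define N where "N = length xs - 1"
  have len: "length xs = N + 1" using fin by (simp add: N_def xs_def card_gt_0_iff)
  have set: "set xs = R" using fin by (simp add: xs_def)
  have st: "xs ! i < xs ! j" if "i < j" "j \<le> N" for i j
    using that len strict_sorted_list_of_set[of R] by (auto simp: xs_def[symmetric] sorted_wrt_iff_nth_less)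
  have mem: "xs ! i \<in> R" if "i \<le> N" for i using that len nth_mem[of i xs] set by auto
  have "xs ! N < xs ! 0 + real L" using mem[of N] mem[of 0] by (auto simp: R_def)
  note W = periodic_ext_strict[OF L, of N "\<lambda>i. xs ! i", OF st this]
  let ?W = "periodic_ext L N (\<lambda>i. xs ! i)"
  have "nodes L ?W = F"
  proof -
    have "circ_proj L (?W j) = circ_proj L (xs ! nat j)" if "j \<in> {0..int N}" for j
      using that by (simp add: periodic_ext_def mod_pos_pos_trivial div_pos_pos_trivial)
    then have "nodes L ?W = (\<lambda>j. circ_proj L (xs ! nat j)) ` {0..int N}" using nodes_eq[OF W(1)] by (metis (no_types, lifting) image_cong)
    also have "\<dots> = circ_proj L ` (!) xs ` {..N}"
    proof -
      have "{0..int N} = int ` {..N}" using image_int_atLeastAtMost[of 0 N] by (simp add: atLeast0AtMost)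
      then show ?thesis by (simp add: image_image)
    qed
    also have "(!) xs ` {..N} = R" using set len by (auto simp: set_conv_nth less_Suc_eq_le)
    finally show ?thesis using img by simp
  qed
  then show ?thesis using that W by blast
qed

text \<open>The labelling of the gaps of a strictly increasing subdivision is an isomorphism onto the model of
$[N]_{\mathrm{cyc}}$.\<close>

lemma pi0_DeltaBigD:
  assumes L: "L > 0" and F: "F \<in> fin_subsets L"
  shows "pi0 L F \<in> DeltaBigD"
proof -
  obtain N W where W: "subdiv L N W" and s: "strict_mono W" and n: "nodes L W = F"
    using fin_subset_subdiv[OF L F] by metis
  have P: "presents (pi0P L (nodes L W))" using presents_pi0P[OF L F] n by simp
  have "prC (pi0P L (nodes L W)) \<in> DeltaBigD"
    by (rule presents_DeltaBigD[OF P presents_ncycP _ induces_ind[OF P presents_ncycP equivariant_lam[OF W order_refl]]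
          induces_ind[OF presents_ncycP P equivariant_midpt[OF W s]]])
      (use lam_midpt[OF W s] pre_nodes[OF W] in auto)
  then show ?thesis using n by simp
qed

section \<open>The colimits and the maps between them\<close>

text \<open>Realizations and colimits are both quotients by generated equivalence relations; this lemma yields the
maps out of either.\<close>

lemma class_map_equivclp:
  assumes "\<And>p q. r p q \<Longrightarrow> h p = h q"
  shows "class_map h {q. equivclp r x q} = h x"
proof -
  have "h q = h x" if "equivclp r x q" for q
    using that
  proof (induction rule: equivclp_induct)
    case (step y z)
    from step.hyps(2) have "h z = h y"
    proof
      assume "r y z" from assms[OF this] show ?thesis by (rule sym)
    next
      assume "r z y" from assms[OF this] show ?thesis .
    qed
    from trans[OF this step.IH] show ?case .
  qed (rule refl)
  then have "h ` {q. equivclp r x q} \<subseteq> {h x}" by blast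
  moreover have "x \<in> {q. equivclp r x q}" by simp
  ultimately have "h ` {q. equivclp r x q} = {h x}" by blast
  then show ?thesis by (simp add: class_map_def)
qed

lemma equivclp_class_eq_iff: "{q. equivclp r x q} = {q. equivclp r y q} \<longleftrightarrow> equivclp r x y"
proof
  assume e: "{q. equivclp r x q} = {q. equivclp r y q}"
  have "y \<in> {q. equivclp r y q}" by simp
  then show "equivclp r x y" unfolding e[symmetric] by simp
next
  assume xy: "equivclp r x y"
  show "{q. equivclp r x q} = {q. equivclp r y q}"
    by (intro Collect_cong iffI) (blast intro: equivclp_trans[OF equivclp_sym[OF xy]], blast intro: equivclp_trans[OF xy])
qed

text \<open>The inverse \<open>h\<close> of the lift is part of the data because it induces the inverse functors.\<close>

definition circ_homeo :: "nat \<Rightarrow> nat \<Rightarrow> (real set \<Rightarrow> real set) \<Rightarrow> bool \<Rightarrow> (real \<Rightarrow> real) \<Rightarrow> (real \<Rightarrow> real) \<Rightarrow> bool" where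
  "circ_homeo L M \<phi> c g h \<longleftrightarrow> L > 0 \<and> M > 0 \<and> circ_lift L M \<phi> c g \<and> continuous_on UNIV h \<and>
     (\<forall>x. h (g x) = x) \<and> (\<forall>y. g (h y) = y)"

lemma circ_homeoD:
  assumes "circ_homeo L M \<phi> c g h"
  shows "L > 0" "M > 0" "circ_lift L M \<phi> c g" "continuous_on UNIV h" "\<And>x. h (g x) = x" "\<And>y. g (h y) = y"
    "\<And>x. \<phi> (circ_proj L x) = circ_proj M (g x)"
  using assms by (auto simp: circ_homeo_def circ_lift_def)

lemma circ_lift_shift:
  assumes g: "circ_lift L M \<phi> c g"
  shows "g (x + of_int k * real L) = g x + of_int (if c then - k else k) * real M"
proof (induction k rule: int_induct[where k = 0])
  case (step1 i)
  have "g (x + of_int (i + 1) * real L) = g ((x + of_int i * real L) + real L)" by (simp add: algebra_simps)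
  then show ?case using step1 circ_liftD(3)[OF g, of "x + of_int i * real L"] by (simp add: algebra_simps split: if_splits)
next
  case (step2 i)
  have "g (x + of_int i * real L) = g ((x + of_int (i - 1) * real L) + real L)" by (simp add: algebra_simps)
  then show ?case using step2 circ_liftD(3)[OF g, of "x + of_int (i - 1) * real L"] by (simp add: algebra_simps split: if_splits)
qed simp

lemma circ_homeo_inverse_shift:
  assumes H: "circ_homeo L M \<phi> c g h"
  shows "h (y + of_int k * real M) = h y + of_int (if c then - k else k) * real L"
proof -
  note D = circ_homeoD[OF H]
  have "g (h y + of_int (if c then - k else k) * real L) = y + of_int k * real M"
    unfolding circ_lift_shift[OF D(3)] using D(6) by simp
  then show ?thesis using D(5) by metis
qed

lemma circ_homeo_inverse:
  assumes H: "circ_homeo L M \<phi> c g h"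
  obtains \<psi> where "circ_homeo M L \<psi> c h g"
proof -
  note D = circ_homeoD[OF H]
  define \<psi> where "\<psi> C = circ_proj L (h (SOME y. y \<in> C))" for C
  have psi: "\<psi> (circ_proj M y) = circ_proj L (h y)" for y
  proof -
    have "(SOME z. z \<in> circ_proj M y) \<in> circ_proj M y" by (rule someI, rule self_in_circ_proj)
    then obtain k :: int where "(SOME z. z \<in> circ_proj M y) = y + of_int k * real M" unfolding mem_circ_proj ..
    then show ?thesis by (simp add: \<psi>_def circ_homeo_inverse_shift[OF H] del: of_int_minus)
  qed
  have "if c then antimono h else mono h"
  proof (cases c)
    case True
    have "h y \<le> h x" if "x \<le> y" for x y
    proof (rule ccontr)
      assume "\<not> h y \<le> h x"
      then have "g (h y) \<le> g (h x)" using circ_liftD(4)[OF D(3), of "h x" "h y"] True by simp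
      then show False using that \<open>\<not> h y \<le> h x\<close> by (simp add: D(6))
    qed
    then show ?thesis using True by (simp add: antimono_def)
  next
    case False
    have "h x \<le> h y" if "x \<le> y" for x y
    proof (rule ccontr)
      assume "\<not> h x \<le> h y"
      then have "g (h y) \<le> g (h x)" using circ_liftD(4)[OF D(3), of "h y" "h x"] False by simp
      then show False using that \<open>\<not> h x \<le> h y\<close> by (simp add: D(6))
    qed
    then show ?thesis using False by (simp add: mono_def)
  qed
  moreover have "h (y + real M) = (if c then h y - real L else h y + real L)" for y
    using circ_homeo_inverse_shift[OF H, of y 1] by auto
  ultimately have "circ_lift M L \<psi> c h" using D(4) psi by (simp add: circ_lift_def)
  then have "circ_homeo M L \<psi> c h g" using D circ_liftD(1)[OF D(3)] by (simp add: circ_homeo_def)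
  then show ?thesis by (rule that)
qed

lemma circ_homeo_comp:
  assumes H: "circ_homeo L M \<phi> c g h" and K: "circ_homeo M N \<psi> d g' h'"
    and e: "\<And>x. \<omega> (circ_proj L x) = \<psi> (\<phi> (circ_proj L x))"
  shows "circ_homeo L N \<omega> (c \<noteq> d) (\<lambda>x. g' (g x)) (\<lambda>y. h (h' y))"
proof -
  note A = circ_homeoD[OF H] and B = circ_homeoD[OF K]
  have "continuous_on UNIV (\<lambda>x. g' (g x))" "continuous_on UNIV (\<lambda>y. h (h' y))"
    using continuous_on_compose2[OF circ_liftD(1)[OF B(3)] circ_liftD(1)[OF A(3)]]
      continuous_on_compose2[OF A(4) B(4)] by auto
  moreover have "if c \<noteq> d then antimono (\<lambda>x. g' (g x)) else mono (\<lambda>x. g' (g x))"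
    using circ_liftD(4)[OF A(3)] circ_liftD(4)[OF B(3)] by (auto simp: mono_def antimono_def)
  moreover have "g' (g (x + real L)) = (if c \<noteq> d then g' (g x) - real N else g' (g x) + real N)" for x
    using circ_liftD(3)[OF A(3), of x] circ_lift_shift[OF B(3), of "g x" 1] circ_lift_shift[OF B(3), of "g x" "- 1"]
    by (cases c; cases d) auto
  ultimately show ?thesis using A B e by (simp add: circ_homeo_def circ_lift_def)
qed

lemma circ_homeo_id: "L > 0 \<Longrightarrow> (\<And>x. \<phi> (circ_proj L x) = circ_proj L x) \<Longrightarrow> circ_homeo L L \<phi> False (\<lambda>x. x) (\<lambda>x. x)"
  by (simp add: circ_homeo_def circ_lift_def mono_def)

lemma circ_homeo_pre:
  assumes H: "circ_homeo L M \<phi> c g h" and F: "F \<in> fin_subsets L"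
  shows "g x \<in> pre M (\<phi> ` F) \<longleftrightarrow> x \<in> pre L F"
proof
  note D = circ_homeoD[OF H]
  assume "g x \<in> pre M (\<phi> ` F)"
  then obtain C where C: "C \<in> F" "circ_proj M (g x) = \<phi> C" by (auto simp: pre_def)
  then obtain z where z: "C = circ_proj L z" using F by (auto simp: fin_subsets_def topspace_circ)
  then obtain k :: int where "g x = g z + of_int k * real M" using C D(7) circ_proj_eq_iff by metis
  then have "x = h (g z + of_int k * real M)" using D(5) by metis
  then have "circ_proj L x = circ_proj L z" by (simp add: circ_homeo_inverse_shift[OF H] D(5) del: of_int_minus)
  then show "x \<in> pre L F" using C z by (simp add: pre_def)
next
  assume "x \<in> pre L F"
  then show "g x \<in> pre M (\<phi> ` F)" using circ_homeoD(7)[OF H, of x] by (auto simp: pre_def intro: rev_image_eqI)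
qed

lemma circ_homeo_image:
  assumes H: "circ_homeo L M \<phi> c g h" and F: "F \<in> fin_subsets L"
  shows "\<phi> ` F \<in> fin_subsets M"
  using F circ_homeoD(7)[OF H] by (auto simp: fin_subsets_def topspace_circ subset_iff image_iff) (metis rangeE)

text \<open>By definition the inverse morphism is only characterised as an inverse. The functor induced by \<open>h\<close> is one,
and inverses are unique.\<close>

lemma induces_dInv_pi0_mor:
  assumes H: "circ_homeo L M \<phi> c g h" and F: "F \<in> fin_subsets L"
  shows "induces (pi0P M (\<phi> ` F)) (pi0P L F) c h (dInv (pi0_mor L F M (\<phi> ` F) \<phi>))"
proof -
  note D = circ_homeoD[OF H] and G = circ_homeo_image[OF H F]
  obtain \<psi> where K: "circ_homeo M L \<psi> c h g" using circ_homeo_inverse[OF H] .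
  note P = presents_pi0P[OF D(1) F] and Q = presents_pi0P[OF D(2) G]
  have 1: "induces (pi0P L F) (pi0P M (\<phi> ` F)) c g (pi0_mor L F M (\<phi> ` F) \<phi>)"
    by (rule induces_pi0_mor[OF D(1,2) F G D(3)]) (simp add: circ_homeo_pre[OF H F])
  have "h y \<notin> pre L F" if "y \<notin> pre M (\<phi> ` F)" for y
    using that circ_homeo_pre[OF H F, of "h y"] D(6) by simp
  then have 2: "induces (pi0P M (\<phi> ` F)) (pi0P L F) c h (pi0_mor M (\<phi> ` F) L F \<psi>)"
    by (rule induces_pi0_mor[OF D(2,1) G F circ_homeoD(3)[OF K]])
  have "dInv (pi0_mor L F M (\<phi> ` F) \<phi>) = pi0_mor M (\<phi> ` F) L F \<psi>"
    by (rule induces_dInv(3)[OF P Q 1 2]) (simp_all add: D)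
  then show ?thesis using 2 by simp
qed

lemma induces_inclusion:
  assumes L: "L > 0" and F: "F \<in> fin_subsets L" and G: "G \<in> fin_subsets L" and FG: "F \<subseteq> G"
  shows "induces (pi0P L G) (pi0P L F) False (\<lambda>x. x) (pi0_mor L G L F (\<lambda>x. x))"
  by (rule induces_pi0_mor[OF L L G F circ_homeoD(3)[OF circ_homeo_id[OF L]]]) (use FG in \<open>auto simp: pre_def\<close>)

lemma fin_subsets_Un: "F \<in> fin_subsets L \<Longrightarrow> G \<in> fin_subsets L \<Longrightarrow> F \<union> G \<in> fin_subsets L"
  by (auto simp: fin_subsets_def)

text \<open>The cell \<open>\<xi>\<close> seen in the term of \<open>F\<close> through the functor to $[N]_{\mathrm{cyc}}$ that \<open>g\<close> induces. In this form
transitions and rescalings act on the function \<open>g\<close> alone.\<close>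

definition pull :: "'a presheaf \<Rightarrow> nat \<Rightarrow> real set set \<Rightarrow> nat \<Rightarrow> (real \<Rightarrow> real) \<Rightarrow> 'a \<Rightarrow> 'a" where
  "pull P L F N g \<xi> = pmap P (ind (pi0P L F) (ncycP N) False g) \<xi>"

locale big_presheaf =
  fixes P :: "'a presheaf"
  assumes P: "presheaf_on DeltaBigD P"
begin

lemma pmap_mem: "\<lbrakk>C \<in> DeltaBigD; D \<in> DeltaBigD; f \<in> dHom C D; x \<in> pset P D\<rbrakk> \<Longrightarrow> pmap P f x \<in> pset P C"
  using P unfolding presheaf_on_def by blast

lemma pmap_id: "\<lbrakk>C \<in> DeltaBigD; x \<in> pset P C\<rbrakk> \<Longrightarrow> pmap P (dId C) x = x"
  using P unfolding presheaf_on_def by blast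

lemma pmap_comp: "\<lbrakk>B \<in> DeltaBigD; C \<in> DeltaBigD; D \<in> DeltaBigD; f \<in> dHom B C; g \<in> dHom C D; x \<in> pset P D\<rbrakk>
    \<Longrightarrow> pmap P f (pmap P g x) = pmap P (dComp g f) x"
  using P unfolding presheaf_on_def by simp

text \<open>The rule that turns identities between functions on the line into identities between elements.\<close>

lemma pmap_induced_comp:
  assumes p: "presents p" "prC p \<in> DeltaBigD" and q: "presents q" "prC q \<in> DeltaBigD" and r: "presents r" "prC r \<in> DeltaBigD"
    and f: "induces p q c g f" and k: "induces q r d h k" and m: "induces p r (c \<noteq> d) u m"
    and e: "\<And>x. x \<notin> prS p \<Longrightarrow> seg_eq (prS r) (h (g x)) (u x)" and x: "x \<in> pset P (prC r)"
  shows "pmap P f (pmap P k x) = pmap P m x"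
proof -
  have "dComp k f = m"
    by (rule induces_unique[where k = 0, OF p(1) r(1) induces_comp[OF p(1) q(1) r(1) f k] m]) (simp add: e)
  then show ?thesis
    using pmap_comp[OF p(2) q(2) r(2) induces_dHom[OF p(1) q(1) f] induces_dHom[OF q(1) r(1) k] x] by simp
qed

lemma pmap_induced_id:
  assumes p: "presents p" "prC p \<in> DeltaBigD" and f: "induces p p False g f"
    and e: "\<And>x. x \<notin> prS p \<Longrightarrow> seg_eq (prS p) (g x) x" and x: "x \<in> pset P (prC p)"
  shows "pmap P f x = x"
proof -
  have "f = dId (prC p)" by (rule induces_unique[where k = 0, OF p(1) p(1) f induces_id[OF p(1)]]) (simp add: e)
  then show ?thesis using pmap_id[OF p(2) x] by simp
qed

lemma pmap_induced_mem:
  assumes "presents p" "prC p \<in> DeltaBigD" "presents q" "prC q \<in> DeltaBigD" "induces p q c g f" "x \<in> pset P (prC q)"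
  shows "pmap P f x \<in> pset P (prC p)"
  using pmap_mem assms induces_dHom by blast

lemma ncycP_Big: "prC (ncycP N) \<in> DeltaBigD"
  using ncyc_in_DeltaBigD by simp

lemma pi0P_Big: "L > 0 \<Longrightarrow> F \<in> fin_subsets L \<Longrightarrow> prC (pi0P L F) \<in> DeltaBigD"
  using pi0_DeltaBigD by simp

context
  fixes L :: nat
  assumes L: "L > 0"
begin

lemma transition_mem:
  assumes "F \<in> fin_subsets L" "G \<in> fin_subsets L" "F \<subseteq> G" "x \<in> pset P (pi0 L F)"
  shows "transition P L F G x \<in> pset P (pi0 L G)"
  using pmap_induced_mem[OF presents_pi0P[OF L assms(2)] pi0P_Big[OF L assms(2)] presents_pi0P[OF L assms(1)]
      pi0P_Big[OF L assms(1)] induces_inclusion[OF L assms(1-3)]] assms(4) by (simp add: transition_def)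

lemma transition_refl:
  assumes "F \<in> fin_subsets L" "x \<in> pset P (pi0 L F)"
  shows "transition P L F F x = x"
  using pmap_induced_id[OF presents_pi0P[OF L assms(1)] pi0P_Big[OF L assms(1)]
      induces_inclusion[OF L assms(1) assms(1) order_refl]] assms(2) by (simp add: transition_def)

lemma transition_trans:
  assumes F: "F \<in> fin_subsets L" and G: "G \<in> fin_subsets L" and H: "H \<in> fin_subsets L" and FG: "F \<subseteq> G" and GH: "G \<subseteq> H"
    and x: "x \<in> pset P (pi0 L F)"
  shows "transition P L G H (transition P L F G x) = transition P L F H x"
  unfolding transition_def
  by (rule pmap_induced_comp[OF presents_pi0P[OF L H] pi0P_Big[OF L H] presents_pi0P[OF L G] pi0P_Big[OF L G]
        presents_pi0P[OF L F] pi0P_Big[OF L F] induces_inclusion[OF L G H GH] induces_inclusion[OF L F G FG]])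
    (use induces_inclusion[OF L F H] FG GH x in auto)

lemma filtered_diagram: "filtered_diagram P L"
  unfolding filtered_diagram_def
proof (intro conjI ballI impI)
  have "{circ_proj L 0} \<in> fin_subsets L" by (simp add: fin_subsets_def)
  then show "fin_subsets L \<noteq> {}" by blast
  fix F G assume F: "F \<in> fin_subsets L" and G: "G \<in> fin_subsets L"
  show "\<exists>H\<in>fin_subsets L. F \<subseteq> H \<and> G \<subseteq> H" using fin_subsets_Un[OF F G] by blast
  assume FG: "F \<subseteq> G"
  show "pi0_mor L G L F (\<lambda>x. x) \<in> dHom (pi0 L G) (pi0 L F)"
    using induces_dHom[OF presents_pi0P[OF L G] presents_pi0P[OF L F] induces_inclusion[OF L F G FG]] by simp
  show "transition P L F G \<in> pset P (pi0 L F) \<rightarrow> pset P (pi0 L G)"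
    using transition_mem[OF F G FG] by blast
qed (use pi0_DeltaBigD[OF L] transition_refl transition_trans in auto)

lemma cin_transition:
  assumes "F \<in> fin_subsets L" "G \<in> fin_subsets L" "F \<subseteq> G" "x \<in> pset P (pi0 L F)"
  shows "cin P L G (transition P L F G x) = cin P L F x"
proof -
  have "colim_step P L (F, x) (G, transition P L F G x)" unfolding colim_step_def using assms by blast
  then show ?thesis unfolding cin_def equivclp_class_eq_iff by (blast intro: r_into_equivclp equivclp_sym)
qed

text \<open>In a filtered colimit two elements agree only if they already agree at some later stage. The stages of a
zigzag are joined one at a time by unions of finite sets.\<close>

lemma cin_eqD:
  assumes F: "F \<in> fin_subsets L" and x: "x \<in> pset P (pi0 L F)"
    and e: "cin P L F x = cin P L G y"
  shows "\<exists>H\<in>fin_subsets L. F \<subseteq> H \<and> G \<subseteq> H \<and> transition P L F H x = transition P L G H y"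
proof -
  have "\<exists>G y. q = (G, y) \<and> G \<in> fin_subsets L \<and> y \<in> pset P (pi0 L G) \<and>
      (\<exists>H\<in>fin_subsets L. F \<subseteq> H \<and> G \<subseteq> H \<and> transition P L F H x = transition P L G H y)"
    if "equivclp (colim_step P L) (F, x) q" for q
    using that
  proof (induction rule: equivclp_induct)
    case base
    then show ?case using F x by blast
  next
    case (step q q')
    then obtain G y H where q: "q = (G, y)" "G \<in> fin_subsets L" "y \<in> pset P (pi0 L G)"
      and H: "H \<in> fin_subsets L" "F \<subseteq> H" "G \<subseteq> H" "transition P L F H x = transition P L G H y" by blast
    from step.hyps(2) show ?case
    proof
      assume "colim_step P L q q'"
      then obtain G' where G': "G' \<in> fin_subsets L" "G \<subseteq> G'" "q' = (G', transition P L G G' y)"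
        using q by (auto simp: colim_step_def)
      \<comment> \<open>The next stage must dominate both the old stage and the new index.\<close>
      let ?H = "H \<union> G'"
      have H': "?H \<in> fin_subsets L" by (rule fin_subsets_Un[OF H(1) G'(1)])
      have "transition P L F ?H x = transition P L H ?H (transition P L F H x)"
        using transition_trans[OF F H(1) H' H(2) _ x] by simp
      also have "\<dots> = transition P L G ?H y"
        using transition_trans[OF q(2) H(1) H' H(3) _ q(3)] H(4) by simp
      also have "\<dots> = transition P L G' ?H (transition P L G G' y)"
        using transition_trans[OF q(2) G'(1) H' G'(2) _ q(3)] by simp
      finally show ?case using G' H H' transition_mem[OF q(2) G'(1,2) q(3)] by (intro exI conjI bexI[OF _ H']) auto
    next
      assume "colim_step P L q' q"
      then obtain G' y' where G': "G' \<in> fin_subsets L" "G' \<subseteq> G" "q' = (G', y')" "y' \<in> pset P (pi0 L G')" "y = transition P L G' G y'"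
        using q by (auto simp: colim_step_def)
      have "transition P L F H x = transition P L G' H y'"
        using transition_trans[OF G'(1) q(2) H(1) G'(2) H(3) G'(4)] H(4) G'(5) by simp
      then show ?case using G' H by (intro exI conjI bexI[OF _ H(1)]) auto
    qed
  qed
  moreover have "equivclp (colim_step P L) (F, x) (G, y)" using e unfolding cin_def equivclp_class_eq_iff .
  ultimately show ?thesis by blast
qed

lemma pull_mem:
  assumes "F \<in> fin_subsets L" "equivariant (pi0P L F) (ncycP N) False g" "\<xi> \<in> pset P (ncyc N)"
  shows "pull P L F N g \<xi> \<in> pset P (pi0 L F)"
  using pmap_induced_mem[OF presents_pi0P[OF L assms(1)] pi0P_Big[OF L assms(1)] presents_ncycP ncycP_Big
      induces_ind[OF presents_pi0P[OF L assms(1)] presents_ncycP assms(2)]] assms(3) by (simp add: pull_def)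

lemma pull_eqI:
  assumes F: "F \<in> fin_subsets L" and g: "equivariant (pi0P L F) (ncycP N) False g"
    and f: "induces (pi0P L F) (ncycP N) False g' f" and e: "\<And>x. x \<notin> pre L F \<Longrightarrow> seg_eq \<int> (g x) (g' x)"
  shows "pull P L F N g \<xi> = pmap P f \<xi>"
proof -
  have "ind (pi0P L F) (ncycP N) False g = f"
    by (rule induces_unique[where k = 0, OF presents_pi0P[OF L F] presents_ncycP induces_ind[OF presents_pi0P[OF L F] presents_ncycP g] f])
      (simp add: e)
  then show ?thesis by (simp add: pull_def)
qed

lemma pmap_pull:
  assumes F: "F \<in> fin_subsets L" and K: "K > 0" and H: "H \<in> fin_subsets K"
    and f: "induces (pi0P K H) (pi0P L F) False h f"
    and g: "equivariant (pi0P L F) (ncycP N) False g" and g': "equivariant (pi0P K H) (ncycP N) False g'"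
    and e: "\<And>x. x \<notin> pre K H \<Longrightarrow> seg_eq \<int> (g (h x)) (g' x)"
    and x: "\<xi> \<in> pset P (ncyc N)"
  shows "pmap P f (pull P L F N g \<xi>) = pull P K H N g' \<xi>"
  unfolding pull_def
  by (rule pmap_induced_comp[OF presents_pi0P[OF K H] pi0P_Big[OF K H] presents_pi0P[OF L F] pi0P_Big[OF L F]
        presents_ncycP ncycP_Big f induces_ind[OF presents_pi0P[OF L F] presents_ncycP g]])
    (use induces_ind[OF presents_pi0P[OF K H] presents_ncycP g'] e x in auto)

lemma pull_ncyc_mor:
  assumes F: "F \<in> fin_subsets L" and \<theta>: "\<theta> \<in> DeltaHom m n"
    and g: "equivariant (pi0P L F) (ncycP m) False g" and g': "equivariant (pi0P L F) (ncycP n) False g'"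
    and e: "\<And>x. x \<notin> pre L F \<Longrightarrow> int_ext m n \<theta> \<lfloor>g x\<rfloor> = \<lfloor>g' x\<rfloor>"
    and x: "\<xi> \<in> pset P (ncyc n)"
  shows "pull P L F m g (pmap P (ncyc_mor m n \<theta>) \<xi>) = pull P L F n g' \<xi>"
  unfolding pull_def
proof (rule pmap_induced_comp[OF presents_pi0P[OF L F] pi0P_Big[OF L F] presents_ncycP ncycP_Big presents_ncycP ncycP_Big
        induces_ind[OF presents_pi0P[OF L F] presents_ncycP g] induces_ncyc_mor[OF \<theta>]])
  fix x assume x: "x \<notin> prS (pi0P L F)"
  show "seg_eq (prS (ncycP n)) (step_map (int_ext m n \<theta>) (g x)) (g' x)"
    using seg_eq_Ints[of "step_map (int_ext m n \<theta>) (g x)" "g' x"] equivariant_notin[OF g' x] e x by simp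
qed (use induces_ind[OF presents_pi0P[OF L F] presents_ncycP g'] x in auto)

end

text \<open>Well-definedness: enlarging \<open>F\<close> before or after applying \<open>\<phi>\<close> gives functors induced by the same \<open>h\<close>.\<close>

lemma colim_map_cin:
  assumes H: "circ_homeo L M \<phi> c g h"
  shows "colim_map P L M \<phi> (cin P L F x) = colim_rep P L M \<phi> F x"
proof -
  note D = circ_homeoD[OF H]
  have "colim_rep P L M \<phi> F x = colim_rep P L M \<phi> G (transition P L F G x)"
    if F: "F \<in> fin_subsets L" and G: "G \<in> fin_subsets L" and FG: "F \<subseteq> G" and x: "x \<in> pset P (pi0 L F)" for F G x
  proof -
    let ?a = "dInv (pi0_mor L F M (\<phi> ` F) \<phi>)" and ?b = "dInv (pi0_mor L G M (\<phi> ` G) \<phi>)"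
    note F' = circ_homeo_image[OF H F] and G' = circ_homeo_image[OF H G]
    note a = induces_dInv_pi0_mor[OF H F] and b = induces_dInv_pi0_mor[OF H G]
    note i = induces_inclusion[OF D(1) F G FG] and j = induces_inclusion[OF D(2) F' G' image_mono[OF FG]]
    note PF = presents_pi0P[OF D(1) F] pi0P_Big[OF D(1) F] and PG = presents_pi0P[OF D(1) G] pi0P_Big[OF D(1) G]
      and PF' = presents_pi0P[OF D(2) F'] pi0P_Big[OF D(2) F'] and PG' = presents_pi0P[OF D(2) G'] pi0P_Big[OF D(2) G']
    have x': "x \<in> pset P (prC (pi0P L F))" using x by simp
    have m: "induces (pi0P M (\<phi> ` G)) (pi0P L F) c h (dComp (pi0_mor L G L F (\<lambda>x. x)) ?b)"
      using induces_comp[OF PG'(1) PG(1) PF(1) b i] by simp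
    have "pmap P ?b (transition P L F G x) = pmap P (dComp (pi0_mor L G L F (\<lambda>x. x)) ?b) x"
      unfolding transition_def by (rule pmap_induced_comp[OF PG' PG PF b i]) (use m x' in auto)
    also have "\<dots> = transition P M (\<phi> ` F) (\<phi> ` G) (pmap P ?a x)"
      unfolding transition_def by (rule pmap_induced_comp[OF PG' PF' PF j a, symmetric]) (use m x' in auto)
    finally have "pmap P ?b (transition P L F G x) = transition P M (\<phi> ` F) (\<phi> ` G) (pmap P ?a x)" .
    moreover have "pmap P ?a x \<in> pset P (pi0 M (\<phi> ` F))" using pmap_induced_mem[OF PF' PF a x'] by simp
    ultimately show ?thesis
      unfolding colim_rep_def using cin_transition[OF D(2) F' G' image_mono[OF FG]] by simp
  qed
  then have "(case p of (F, x) \<Rightarrow> colim_rep P L M \<phi> F x) = (case q of (F, x) \<Rightarrow> colim_rep P L M \<phi> F x)"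
    if "colim_step P L p q" for p q
    using that by (auto simp: colim_step_def)
  then show ?thesis unfolding colim_map_def cin_def by (subst class_map_equivclp) auto
qed

lemma colim_map_well_defined: "circ_homeo L M \<phi> c g h \<Longrightarrow> colim_map_well_defined P L M \<phi>"
  unfolding colim_map_well_defined_def using colim_map_cin by blast

lemma colim_map_induced:
  assumes H: "circ_homeo L M \<phi> c g h" and F: "F \<in> fin_subsets L"
    and f: "induces (pi0P M (\<phi> ` F)) (pi0P L F) c h f"
  shows "colim_map P L M \<phi> (cin P L F x) = cin P M (\<phi> ` F) (pmap P f x)"
proof -
  note D = circ_homeoD[OF H]
  have "dInv (pi0_mor L F M (\<phi> ` F) \<phi>) = f"
    by (rule induces_unique[where k = 0, OF presents_pi0P[OF D(2) circ_homeo_image[OF H F]] presents_pi0P[OF D(1) F] induces_dInv_pi0_mor[OF H F] f]) simp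
  then show ?thesis unfolding colim_map_cin[OF H] colim_rep_def by simp
qed

lemma colim_map_mem:
  assumes H: "circ_homeo L M \<phi> c g h" and z: "z \<in> colim P L"
  shows "colim_map P L M \<phi> z \<in> colim P M"
proof -
  note D = circ_homeoD[OF H]
  obtain F x where F: "F \<in> fin_subsets L" and x: "x \<in> pset P (pi0 L F)" and z: "z = cin P L F x"
    using z by (auto simp: colim_def)
  note F' = circ_homeo_image[OF H F]
  have "pmap P (dInv (pi0_mor L F M (\<phi> ` F) \<phi>)) x \<in> pset P (pi0 M (\<phi> ` F))"
    using pmap_induced_mem[OF presents_pi0P[OF D(2) F'] pi0P_Big[OF D(2) F'] presents_pi0P[OF D(1) F] pi0P_Big[OF D(1) F]
        induces_dInv_pi0_mor[OF H F]] x by simp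
  then show ?thesis using F' unfolding z colim_map_cin[OF H] colim_rep_def colim_def by blast
qed

text \<open>Functoriality of the maps of colimits. It yields the group actions, the bijectivity of each map
(\<open>colim_map_bij\<close>) and the equivariance of the rescaling.\<close>

lemma colim_map_comp:
  assumes H: "circ_homeo L M \<phi> c g h" and K: "circ_homeo M N \<psi> d g' h'"
    and e: "\<And>x. \<omega> (circ_proj L x) = \<psi> (\<phi> (circ_proj L x))" and z: "z \<in> colim P L"
  shows "colim_map P M N \<psi> (colim_map P L M \<phi> z) = colim_map P L N \<omega> z"
proof -
  note A = circ_homeoD[OF H] and B = circ_homeoD[OF K] and C = circ_homeo_comp[OF H K e]
  obtain F x where F: "F \<in> fin_subsets L" and x: "x \<in> pset P (pi0 L F)" and z: "z = cin P L F x"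
    using z by (auto simp: colim_def)
  note F1 = circ_homeo_image[OF H F]
  note F2 = circ_homeo_image[OF K F1]
  have im: "\<omega> ` F = \<psi> ` \<phi> ` F"
    unfolding image_image using F e by (intro image_cong) (auto simp: fin_subsets_def topspace_circ)
  note a = induces_dInv_pi0_mor[OF H F] and b = induces_dInv_pi0_mor[OF K F1] and m = induces_dInv_pi0_mor[OF C F]
  let ?a = "dInv (pi0_mor L F M (\<phi> ` F) \<phi>)" and ?b = "dInv (pi0_mor M (\<phi> ` F) N (\<psi> ` \<phi> ` F) \<psi>)"
  have "colim_map P M N \<psi> (colim_map P L M \<phi> z) = cin P N (\<psi> ` \<phi> ` F) (pmap P ?b (pmap P ?a x))"
    unfolding z colim_map_cin[OF H] colim_rep_def colim_map_cin[OF K] ..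
  also have "pmap P ?b (pmap P ?a x) = pmap P (dInv (pi0_mor L F N (\<omega> ` F) \<omega>)) x"
    by (rule pmap_induced_comp[OF presents_pi0P[OF B(2) F2] pi0P_Big[OF B(2) F2] presents_pi0P[OF A(2) F1] pi0P_Big[OF A(2) F1]
          presents_pi0P[OF A(1) F] pi0P_Big[OF A(1) F] b a])
      (use m x in \<open>auto simp: im eq_commute[of c d]\<close>)
  finally show ?thesis unfolding z colim_map_cin[OF C] colim_rep_def im .
qed

lemma colim_map_id:
  assumes L: "L > 0" and e: "\<And>x. \<phi> (circ_proj L x) = circ_proj L x" and z: "z \<in> colim P L"
  shows "colim_map P L L \<phi> z = z"
proof -
  note H = circ_homeo_id[where \<phi> = \<phi>, OF L e]
  obtain F x where F: "F \<in> fin_subsets L" and x: "x \<in> pset P (pi0 L F)" and z: "z = cin P L F x"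
    using z by (auto simp: colim_def)
  have im: "\<phi> ` F = F" using F e by (force simp: fin_subsets_def topspace_circ)
  note P = presents_pi0P[OF L F]
  have "induces (pi0P L F) (pi0P L F) False (\<lambda>x. x) (dId (prC (pi0P L F)))" by (rule induces_id[OF P])
  from colim_map_induced[OF H F, unfolded im, OF this] show ?thesis
    using pmap_id[OF pi0P_Big[OF L F]] x unfolding z by simp
qed

lemma colim_map_bij:
  assumes H: "circ_homeo L M \<phi> c g h"
  shows "bij_betw (colim_map P L M \<phi>) (colim P L) (colim P M)"
proof -
  note D = circ_homeoD[OF H]
  obtain \<psi> where K: "circ_homeo M L \<psi> c h g" using circ_homeo_inverse[OF H] .
  note E = circ_homeoD[OF K]
  have "colim_map P M L \<psi> (colim_map P L M \<phi> z) = z" if "z \<in> colim P L" for z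
    using colim_map_comp[OF H K _ that, of "\<lambda>x. \<psi> (\<phi> x)"] colim_map_id[OF D(1) _ that, of "\<lambda>x. \<psi> (\<phi> x)"] D(5,7) E(7) by simp
  moreover have "colim_map P L M \<phi> (colim_map P M L \<psi> z) = z" if "z \<in> colim P M" for z
    using colim_map_comp[OF K H _ that, of "\<lambda>x. \<phi> (\<psi> x)"] colim_map_id[OF D(2) _ that, of "\<lambda>x. \<phi> (\<psi> x)"] D(6,7) E(7) by simp
  ultimately show ?thesis
    by (intro bij_betwI[of _ _ _ "colim_map P M L \<psi>"]) (auto intro: colim_map_mem[OF H] colim_map_mem[OF K])
qed

end

section \<open>Edgewise subdivision along a word of directions\<close>

lemma xcoord_0 [simp]: "xcoord z 0 = 0"
  by (simp add: xcoord_def)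

lemma xcoord_Suc: "xcoord z (Suc i) = xcoord z i + z i"
  by (simp add: xcoord_def)

lemma simplex_nonneg: "z \<in> standard_simplex n \<Longrightarrow> 0 \<le> z i"
  by (simp add: standard_simplex_def)

lemma simplex_zero: "z \<in> standard_simplex n \<Longrightarrow> i > n \<Longrightarrow> z i = 0"
  by (simp add: standard_simplex_def)

lemma xcoord_mono: "z \<in> standard_simplex n \<Longrightarrow> i \<le> j \<Longrightarrow> xcoord z i \<le> xcoord z j"
  unfolding xcoord_def by (rule sum_mono2) (auto intro: simplex_nonneg)

lemma xcoord_last: "z \<in> standard_simplex n \<Longrightarrow> xcoord z (Suc n) = 1"
  by (simp add: standard_simplex_def xcoord_def lessThan_Suc_atMost)

lemma xcoord_01: "z \<in> standard_simplex n \<Longrightarrow> i \<le> Suc n \<Longrightarrow> 0 \<le> xcoord z i \<and> xcoord z i \<le> 1"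
  using xcoord_mono[of z n 0 i] xcoord_mono[of z n i "Suc n"] xcoord_last[of z n] by auto

lemma simplexI:
  assumes "\<And>i. i \<le> n \<Longrightarrow> 0 \<le> z i" "\<And>i. i > n \<Longrightarrow> z i = 0" "xcoord z (Suc n) = 1"
  shows "z \<in> standard_simplex n"
proof -
  have s: "(\<Sum>i\<le>n. z i) = 1" using assms(3) by (simp add: xcoord_def lessThan_Suc_atMost)
  have "z i \<le> 1" if "i \<le> n" for i
    using member_le_sum[of i "{..n}" z] that assms(1) s by auto
  then show ?thesis using assms s unfolding standard_simplex_def by (auto simp: not_le) (metis le_cases not_le order_refl zero_le_one)+
qed

lemma xcoord_push:
  assumes "\<theta> \<in> DeltaHom m n"
  shows "xcoord (simplex_push m \<theta> z) c = (\<Sum>i | i \<le> m \<and> \<theta> i < c. z i)"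
proof -
  have "xcoord (simplex_push m \<theta> z) c = (\<Sum>j<c. \<Sum>i | i \<in> {i. i \<le> m \<and> \<theta> i < c} \<and> \<theta> i = j. z i)"
    unfolding xcoord_def simplex_push_def by (intro sum.cong) auto
  also have "\<dots> = (\<Sum>i | i \<le> m \<and> \<theta> i < c. z i)"
    by (rule sum.group) auto
  finally show ?thesis .
qed

lemma push_simplex:
  assumes \<theta>: "\<theta> \<in> DeltaHom m n" and z: "z \<in> standard_simplex m"
  shows "simplex_push m \<theta> z \<in> standard_simplex n"
proof (rule simplexI)
  show "0 \<le> simplex_push m \<theta> z i" for i
    unfolding simplex_push_def by (rule sum_nonneg) (use simplex_nonneg[OF z] in auto)
  show "simplex_push m \<theta> z i = 0" if "i > n" for i
  proof -
    have "{i'. i' \<le> m \<and> \<theta> i' = i} = {}" using DeltaHom_le[OF \<theta>] that by force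
    then show ?thesis unfolding simplex_push_def by (metis (no_types) sum.empty)
  qed
  have "{i. i \<le> m \<and> \<theta> i < Suc n} = {..m}" using DeltaHom_le[OF \<theta>] by (auto simp: less_Suc_eq_le)
  then show "xcoord (simplex_push m \<theta> z) (Suc n) = 1"
    unfolding xcoord_push[OF \<theta>] using z by (simp add: standard_simplex_def)
qed

lemma xcoord_push_bounds:
  assumes \<theta>: "\<theta> \<in> DeltaHom m n" and z: "z \<in> standard_simplex m" and i: "i \<le> m"
  shows "xcoord (simplex_push m \<theta> z) (\<theta> i) \<le> xcoord z i"
    and "xcoord z (Suc i) \<le> xcoord (simplex_push m \<theta> z) (Suc (\<theta> i))"
proof -
  have nn: "\<And>b. 0 \<le> z b" by (rule simplex_nonneg[OF z])
  have "{i'. i' \<le> m \<and> \<theta> i' < \<theta> i} \<subseteq> {..<i}"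
    using DeltaHom_mono[OF \<theta>, of i] by (auto simp: not_le[symmetric])
  then show "xcoord (simplex_push m \<theta> z) (\<theta> i) \<le> xcoord z i"
    unfolding xcoord_push[OF \<theta>] unfolding xcoord_def by (intro sum_mono2 nn) auto
  have "{..<Suc i} \<subseteq> {i'. i' \<le> m \<and> \<theta> i' < Suc (\<theta> i)}"
    using DeltaHom_mono[OF \<theta> _ i] i by (auto simp: less_Suc_eq_le)
  then show "xcoord z (Suc i) \<le> xcoord (simplex_push m \<theta> z) (Suc (\<theta> i))"
    unfolding xcoord_push[OF \<theta>] unfolding xcoord_def by (intro sum_mono2 nn) auto
qed

text \<open>The indices \<open>i\<close> with \<open>\<theta> i < c\<close> form an initial segment because \<open>\<theta>\<close> is monotone, so partial sums of
$\theta_* z$ are partial sums of \<open>z\<close>.\<close>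

lemma xcoord_push_image:
  assumes \<theta>: "\<theta> \<in> DeltaHom m n"
  shows "xcoord (simplex_push m \<theta> z) c \<in> xcoord z ` {..Suc m}"
proof -
  let ?A = "{i. i \<le> m \<and> \<theta> i < c}"
  have "?A = {..<card ?A}"
  proof -
    have fin: "finite ?A" by simp
    have down: "i \<in> ?A" if "j \<in> ?A" "i \<le> j" for i j
      using that DeltaHom_mono[OF \<theta>, of i j] by auto
    have "\<exists>k. ?A = {..<k}"
    proof (cases "?A = {}")
      case True then show ?thesis by (intro exI[of _ 0]) auto
    next
      case False
      have "?A = {..<Suc (Max ?A)}"
      proof
        show "?A \<subseteq> {..<Suc (Max ?A)}" using Max_ge[OF fin] by (auto simp: less_Suc_eq_le)
        show "{..<Suc (Max ?A)} \<subseteq> ?A" using down[OF Max_in[OF fin False]] by (meson lessThan_iff less_Suc_eq_le subsetI)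
      qed
      then show ?thesis by blast
    qed
    then show ?thesis by (metis card_lessThan)
  qed
  moreover have "card ?A \<le> Suc m" using card_mono[of "{..m}" ?A] by auto
  ultimately have "xcoord (simplex_push m \<theta> z) c = xcoord z (card ?A)" "card ?A \<in> {..Suc m}"
    unfolding xcoord_push[OF \<theta>] by (simp_all only: xcoord_def atMost_iff)
  then show ?thesis by (rule image_eqI)
qed

text \<open>If the break points of \<open>u\<close> contain those of \<open>z\<close>, collapse each gap of \<open>u\<close> into the gap of \<open>z\<close> that contains
it. Taking the largest admissible index selects one gap where \<open>z\<close> has repeated break points.\<close>

lemma push_exists:
  assumes z: "z \<in> standard_simplex n" and u: "u \<in> standard_simplex m"
    and sub: "xcoord z ` {..Suc n} \<subseteq> xcoord u ` {..Suc m}"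
  shows "\<exists>\<theta>\<in>DeltaHom m n. simplex_push m \<theta> u = z"
proof -
  define \<theta> where "\<theta> = (\<lambda>i\<in>{..m}. Max {j. j \<le> n \<and> xcoord z j \<le> xcoord u i})"
  let ?J = "\<lambda>i. {j. j \<le> n \<and> xcoord z j \<le> xcoord u i}"
  have fin: "finite (?J i)" for i by simp
  have ne: "?J i \<noteq> {}" if "i \<le> m" for i using xcoord_01[OF u, of i] that by (auto intro!: exI[of _ 0])
  have ge: "c \<le> \<theta> i \<longleftrightarrow> xcoord z c \<le> xcoord u i" if "i \<le> m" "c \<le> n" for i c
  proof
    assume "c \<le> \<theta> i"
    then have "xcoord z c \<le> xcoord z (\<theta> i)" by (rule xcoord_mono[OF z])
    moreover have "\<theta> i \<in> ?J i" using Max_in[OF fin ne[OF that(1)]] that(1) by (simp add: \<theta>_def)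
    ultimately show "xcoord z c \<le> xcoord u i" by auto
  next
    assume "xcoord z c \<le> xcoord u i"
    then show "c \<le> \<theta> i" using Max_ge[OF fin, of c i] that by (simp add: \<theta>_def)
  qed
  have le: "\<theta> i \<le> n" if "i \<le> m" for i using Max_in[OF fin ne[OF that]] that by (simp add: \<theta>_def)
  have "\<theta> i \<le> \<theta> j" if "i \<le> j" "j \<le> m" for i j
  proof -
    have i: "i \<le> m" using that by simp
    have "xcoord z (\<theta> i) \<le> xcoord u i" using ge[OF i le[OF i]] by simp
    then have "xcoord z (\<theta> i) \<le> xcoord u j" using xcoord_mono[OF u that(1)] by linarith
    then show ?thesis using ge[OF that(2) le[OF i]] by simp
  qed
  note mono = this
  have "\<theta> \<in> extensional {..m}" by (simp add: \<theta>_def)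
  then have \<theta>: "\<theta> \<in> DeltaHom m n" using le mono by (simp add: DeltaHom_def mono_on_def PiE_def)
  have xc: "xcoord (simplex_push m \<theta> u) c = xcoord z c" if c: "c \<le> Suc n" for c
  proof (cases "c = Suc n")
    case True
    then show ?thesis using xcoord_last[OF push_simplex[OF \<theta> u]] xcoord_last[OF z] by simp
  next
    case False
    then have c': "c \<le> n" using c by simp
    have eq: "{i. i \<le> m \<and> \<theta> i < c} = {i. i \<le> m \<and> xcoord u i < xcoord z c}"
      using ge[OF _ c'] by (auto simp: not_le[symmetric])
    obtain t where t: "t \<le> Suc m" "xcoord z c = xcoord u t" using sub c by (auto simp: image_subset_iff image_iff)
    have "(\<Sum>i | i \<le> m \<and> xcoord u i < xcoord u t. u i) = (\<Sum>i<t. u i)"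
    proof (rule sum.mono_neutral_left)
      show "{i. i \<le> m \<and> xcoord u i < xcoord u t} \<subseteq> {..<t}" using xcoord_mono[OF u] by (auto simp: not_le[symmetric])
      show "\<forall>i\<in>{..<t} - {i. i \<le> m \<and> xcoord u i < xcoord u t}. u i = 0"
      proof
        fix i assume i: "i \<in> {..<t} - {i. i \<le> m \<and> xcoord u i < xcoord u t}"
        then have "xcoord u t \<le> xcoord u i" "i < t" using t by auto
        then have "xcoord u (Suc i) \<le> xcoord u i" using xcoord_mono[OF u, of "Suc i" t] by simp
        then show "u i = 0" using simplex_nonneg[OF u, of i] by (simp add: xcoord_Suc)
      qed
    qed simp
    then show ?thesis unfolding xcoord_push[OF \<theta>] eq t(2) by (simp add: xcoord_def)
  qed
  have "simplex_push m \<theta> u i = z i" for i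
  proof (cases "i \<le> n")
    case True
    then show ?thesis using xc[of i] xc[of "Suc i"] by (simp add: xcoord_Suc)
  next
    case False
    then show ?thesis using simplex_zero[OF z] simplex_zero[OF push_simplex[OF \<theta> u]] by simp
  qed
  then show ?thesis using \<theta> by blast
qed

text \<open>Every node set in the unit interval is cut out by an interior point of a simplex; this is what makes the map
from the realization to the colimit surjective.\<close>

lemma gaps_exist:
  assumes Y: "finite Y" "Y \<subseteq> {0..1}" "0 \<in> Y" "1 \<in> Y"
  shows "\<exists>m u. u \<in> standard_simplex m \<and> (\<forall>i\<le>m. 0 < u i) \<and> xcoord u ` {..Suc m} = Y \<and> m + 2 = card Y"
proof -
  define ys where "ys = sorted_list_of_set Y"
  have "card {0, 1::real} \<le> card Y" by (rule card_mono) (use Y in auto)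
  then obtain m where m: "card Y = m + 2" by (metis add.commute card_2_iff le_Suc_ex zero_neq_one)
  have len: "length ys = m + 2" and set: "set ys = Y" using Y m by (simp_all add: ys_def)
  have st: "ys ! i < ys ! j" if "i < j" "j < m + 2" for i j
    using that len strict_sorted_list_of_set[of Y] by (auto simp: ys_def[symmetric] sorted_wrt_iff_nth_less)
  have mono: "ys ! i \<le> ys ! j" if "i \<le> j" "j < m + 2" for i j using st[of i j] that by (cases "i = j") auto
  have mem: "ys ! i \<in> Y" if "i < m + 2" for i using nth_mem[of i ys] that len set by simp
  obtain i0 where i0: "i0 < m + 2" "ys ! i0 = 0" using Y(3) set len by (metis in_set_conv_nth)
  obtain i1 where i1: "i1 < m + 2" "ys ! i1 = 1" using Y(4) set len by (metis in_set_conv_nth)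
  have y0: "ys ! 0 = 0" using mono[of 0 i0] i0 mem[of 0] Y(2) by auto
  have y1: "ys ! Suc m = 1" using mono[of i1 "Suc m"] i1 mem[of "Suc m"] Y(2) by auto
  define u where "u i = (if i \<le> m then ys ! Suc i - ys ! i else 0)" for i
  have xc: "i \<le> Suc m \<Longrightarrow> xcoord u i = ys ! i" for i
    by (induction i) (auto simp: y0 xcoord_Suc u_def)
  have "u \<in> standard_simplex m"
    by (rule simplexI) (use mono xc[of "Suc m"] y1 in \<open>auto simp: u_def\<close>)
  moreover have "\<forall>i\<le>m. 0 < u i" using st by (auto simp: u_def)
  moreover have "xcoord u ` {..Suc m} = Y"
  proof -
    have "xcoord u ` {..Suc m} = (!) ys ` {..Suc m}" using xc by (intro image_cong) auto
    also have "\<dots> = set ys" using len by (auto simp: set_conv_nth less_Suc_eq_le)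
    finally show ?thesis using set by simp
  qed
  ultimately show ?thesis using m by auto
qed

lemma mono_intI:
  fixes W :: "int \<Rightarrow> real"
  assumes "\<And>j. W j \<le> W (j + 1)"
  shows "mono W"
proof (rule monoI)
  fix i j :: int assume "i \<le> j"
  then show "W i \<le> W j"
    by (induction j rule: int_ge_induct) (auto intro: order_trans[OF _ assms])
qed

lemma strict_mono_intI:
  fixes W :: "int \<Rightarrow> real"
  assumes "\<And>j. W j < W (j + 1)"
  shows "strict_mono W"
proof (rule strict_monoI)
  fix i j :: int assume "i < j"
  then have "i + 1 \<le> j" by simp
  then show "W i < W j"
    by (induction j rule: int_ge_induct) (auto intro: assms order.strict_trans[OF _ assms])
qed

text \<open>The nodes on the line of a point \<open>z\<close> of the simplex: each unit interval $[q, q+1]$ is divided in the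
proportions of \<open>z\<close>, read backwards if \<open>\<epsilon> q\<close>.\<close>

definition sd_seq :: "(int \<Rightarrow> bool) \<Rightarrow> nat \<Rightarrow> (nat \<Rightarrow> real) \<Rightarrow> int \<Rightarrow> real" where
  "sd_seq \<epsilon> n z j = (let q = j div int (n + 1); b = nat (j mod int (n + 1)) in
     of_int q + (if \<epsilon> q then 1 - xcoord z (n + 1 - b) else xcoord z b))"

text \<open>The subdivision of \<open>\<theta>\<close> on the indices of the gaps. For the word that is constantly false it is the
periodic extension of $\mathrm{sd}_r[\theta]$, for \<open>odd\<close> that of $\mathrm{sd}_r[\theta^{\mathrm e}]$.\<close>

definition sd_hom :: "(int \<Rightarrow> bool) \<Rightarrow> nat \<Rightarrow> nat \<Rightarrow> (nat \<Rightarrow> nat) \<Rightarrow> int \<Rightarrow> int" where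
  "sd_hom \<epsilon> m n \<theta> j = (let q = j div int (m + 1); b = nat (j mod int (m + 1)) in
     q * int (n + 1) + int (if \<epsilon> q then n - \<theta> (m - b) else \<theta> b))"

lemma int_block:
  obtains q :: int and b :: nat where "j = q * int (n + 1) + int b" "b \<le> n"
proof -
  have "int (nat (j mod int (n + 1))) = j mod int (n + 1)" by simp
  then have "j = (j div int (n + 1)) * int (n + 1) + int (nat (j mod int (n + 1)))" by (simp only: div_mult_mod_eq)
  then show ?thesis using that nat_mod_le[of j n] by blast
qed

lemma block_div_mod:
  assumes "b \<le> n"
  shows "(q * int (n + 1) + int b) div int (n + 1) = q" "(q * int (n + 1) + int b) mod int (n + 1) = int b"
proof -
  have *: "0 \<le> int b" "int b < int (n + 1)" using assms by auto
  show "(q * int (n + 1) + int b) div int (n + 1) = q"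
    using div_pos_pos_trivial[OF *] by (subst div_mult_self3) (auto simp del: of_nat_Suc of_nat_add)
  show "(q * int (n + 1) + int b) mod int (n + 1) = int b"
    using mod_pos_pos_trivial[OF *] by (subst mod_mult_self3) simp
qed

lemma sd_seq_block:
  assumes z: "z \<in> standard_simplex n" and b: "b \<le> Suc n"
  shows "sd_seq \<epsilon> n z (q * int (n + 1) + int b) = of_int q + (if \<epsilon> q then 1 - xcoord z (Suc n - b) else xcoord z b)"
proof (cases "b \<le> n")
  case True
  then show ?thesis unfolding sd_seq_def Let_def block_div_mod[OF True] by simp
next
  case False
  then have b: "b = Suc n" using b by simp
  then have e: "q * int (n + 1) + int b = (q + 1) * int (n + 1) + int 0" by (simp add: algebra_simps)
  show ?thesis unfolding e unfolding sd_seq_def Let_def block_div_mod[OF le0] using b xcoord_last[OF z] by simp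
qed

lemma sd_seq_step:
  assumes z: "z \<in> standard_simplex n" and b: "b \<le> n"
  shows "sd_seq \<epsilon> n z (q * int (n + 1) + int b + 1) = sd_seq \<epsilon> n z (q * int (n + 1) + int b) + z (if \<epsilon> q then n - b else b)"
proof -
  have e: "q * int (n + 1) + int b + 1 = q * int (n + 1) + int (Suc b)" by simp
  have "Suc n - b = Suc (n - b)" using b by simp
  then show ?thesis
    unfolding e sd_seq_block[OF z, of "Suc b", OF Suc_le_mono[THEN iffD2, OF b]] sd_seq_block[OF z, of b, OF le_SucI[OF b]]
    by (simp add: xcoord_Suc)
qed

lemma sd_seq_0: "z \<in> standard_simplex n \<Longrightarrow> sd_seq \<epsilon> n z 0 = 0"
  using sd_seq_block[of z n 0 \<epsilon> 0] xcoord_last[of z n] by (simp split: if_splits)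

lemma sd_hom_block:
  "b \<le> m \<Longrightarrow> sd_hom \<epsilon> m n \<theta> (q * int (m + 1) + int b) = q * int (n + 1) + int (if \<epsilon> q then n - \<theta> (m - b) else \<theta> b)"
  unfolding sd_hom_def Let_def by (simp only: block_div_mod nat_int)

text \<open>The gap number \<open>j\<close> of \<open>z\<close> lies inside the gap number \<open>sd_hom \<epsilon> m n \<theta> j\<close> of $\theta_* z$. This is the
geometric content of the compatibility of subdivision with the relations of the realization.\<close>

lemma sd_hom_sd_seq:
  assumes \<theta>: "\<theta> \<in> DeltaHom m n" and z: "z \<in> standard_simplex m"
  shows "sd_seq \<epsilon> n (simplex_push m \<theta> z) (sd_hom \<epsilon> m n \<theta> j) \<le> sd_seq \<epsilon> m z j"
    and "sd_seq \<epsilon> m z (j + 1) \<le> sd_seq \<epsilon> n (simplex_push m \<theta> z) (sd_hom \<epsilon> m n \<theta> j + 1)"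
proof -
  obtain q b where j: "j = q * int (m + 1) + int b" and b: "b \<le> m" by (rule int_block)
  let ?z = "simplex_push m \<theta> z"
  note z' = push_simplex[OF \<theta> z]
  let ?c = "if \<epsilon> q then n - \<theta> (m - b) else \<theta> b"
  have c: "?c \<le> n" using DeltaHom_le[OF \<theta> b] by simp
  have t: "\<theta> (m - b) \<le> n" by (rule DeltaHom_le[OF \<theta>]) simp
  have j1: "j + 1 = q * int (m + 1) + int (Suc b)" and c1: "q * int (n + 1) + int ?c + 1 = q * int (n + 1) + int (Suc ?c)" using j by simp_all
  have eqs: "sd_seq \<epsilon> n ?z (sd_hom \<epsilon> m n \<theta> j) = of_int q + (if \<epsilon> q then 1 - xcoord ?z (Suc n - ?c) else xcoord ?z ?c)"
    "sd_seq \<epsilon> n ?z (sd_hom \<epsilon> m n \<theta> j + 1) = of_int q + (if \<epsilon> q then 1 - xcoord ?z (Suc n - Suc ?c) else xcoord ?z (Suc ?c))"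
    "sd_seq \<epsilon> m z j = of_int q + (if \<epsilon> q then 1 - xcoord z (Suc m - b) else xcoord z b)"
    "sd_seq \<epsilon> m z (j + 1) = of_int q + (if \<epsilon> q then 1 - xcoord z (Suc m - Suc b) else xcoord z (Suc b))"
    unfolding j1 unfolding j sd_hom_block[OF b] c1
    using sd_seq_block[OF z', of ?c] sd_seq_block[OF z', of "Suc ?c"] sd_seq_block[OF z, of b] sd_seq_block[OF z, of "Suc b"] b c by auto
  have sm: "Suc m - b = Suc (m - b)" using b by simp
  have sn: "Suc n - (n - \<theta> (m - b)) = Suc (\<theta> (m - b))" "Suc n - Suc (n - \<theta> (m - b)) = \<theta> (m - b)" using t by auto
  note bd = xcoord_push_bounds[OF \<theta> z b] xcoord_push_bounds[OF \<theta> z, of "m - b"]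
  show "sd_seq \<epsilon> n ?z (sd_hom \<epsilon> m n \<theta> j) \<le> sd_seq \<epsilon> m z j" unfolding eqs using bd sm sn by (cases "\<epsilon> q") simp_all
  show "sd_seq \<epsilon> m z (j + 1) \<le> sd_seq \<epsilon> n ?z (sd_hom \<epsilon> m n \<theta> j + 1)" unfolding eqs using bd sm sn by (cases "\<epsilon> q") simp_all
qed

lemma range_sd_seq:
  assumes z: "z \<in> standard_simplex n"
  shows "range (sd_seq \<epsilon> n z) = {of_int q + (if \<epsilon> q then 1 - x else x) | q x. x \<in> xcoord z ` {..Suc n}}"
proof (intro Set.set_eqI iffI)
  fix y assume "y \<in> range (sd_seq \<epsilon> n z)"
  then obtain j where j: "y = sd_seq \<epsilon> n z j" by blast
  obtain q b where jb: "j = q * int (n + 1) + int b" and b: "b \<le> n" by (rule int_block)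
  have "y = of_int q + (if \<epsilon> q then 1 - xcoord z (Suc n - b) else xcoord z b)"
    unfolding j jb by (rule sd_seq_block[OF z]) (use b in simp)
  then show "y \<in> {of_int q + (if \<epsilon> q then 1 - x else x) | q x. x \<in> xcoord z ` {..Suc n}}"
    using b by (intro CollectI exI[of _ q] exI[of _ "if \<epsilon> q then xcoord z (Suc n - b) else xcoord z b"]) auto
next
  fix y assume "y \<in> {of_int q + (if \<epsilon> q then 1 - x else x) | q x. x \<in> xcoord z ` {..Suc n}}"
  then obtain q c where y: "y = of_int q + (if \<epsilon> q then 1 - xcoord z c else xcoord z c)" and c: "c \<le> Suc n" by auto
  let ?b = "if \<epsilon> q then Suc n - c else c"
  have "y = sd_seq \<epsilon> n z (q * int (n + 1) + int ?b)"
    unfolding y using c sd_seq_block[OF z, of ?b \<epsilon> q] by (simp split: if_splits)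
  then show "y \<in> range (sd_seq \<epsilon> n z)" by blast
qed

text \<open>The word must be periodic for the nodes to descend to the circle of length \<open>L\<close>.\<close>

locale sd_word =
  fixes \<epsilon> :: "int \<Rightarrow> bool" and L :: nat
  assumes L: "L > 0" and eps: "\<epsilon> (q + int L) = \<epsilon> q"
begin

abbreviation "top_deg n \<equiv> L * (n + 1) - 1"

lemma top_deg: "top_deg n + 1 = L * (n + 1)" "int (top_deg n + 1) = int L * int (n + 1)"
proof -
  have "1 \<le> L * (n + 1)" using L by simp
  then show "top_deg n + 1 = L * (n + 1)" by simp
  then show "int (top_deg n + 1) = int L * int (n + 1)" by (metis of_nat_mult)
qed

lemma subdiv_sd_seq:
  assumes z: "z \<in> standard_simplex n"
  shows "subdiv L (top_deg n) (sd_seq \<epsilon> n z)"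
proof -
  have "sd_seq \<epsilon> n z j \<le> sd_seq \<epsilon> n z (j + 1)" for j
  proof -
    obtain q b where j: "j = q * int (n + 1) + int b" and b: "b \<le> n" by (rule int_block)
    show ?thesis unfolding j sd_seq_step[OF z b] using simplex_nonneg[OF z] by simp
  qed
  then have "mono (sd_seq \<epsilon> n z)" by (rule mono_intI)
  moreover have "sd_seq \<epsilon> n z (j + int (top_deg n + 1)) = sd_seq \<epsilon> n z j + real L" for j
  proof -
    obtain q b where j: "j = q * int (n + 1) + int b" and b: "b \<le> n" by (rule int_block)
    have e: "j + int (top_deg n + 1) = (q + int L) * int (n + 1) + int b" unfolding top_deg j by (simp add: algebra_simps)
    have b': "b \<le> Suc n" using b by simp
    show ?thesis unfolding e unfolding j sd_seq_block[OF z b'] eps by simp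
  qed
  ultimately show ?thesis using L by (simp add: subdiv_def)
qed

lemma strict_sd_seq:
  assumes z: "z \<in> standard_simplex n" and pos: "\<And>i. i \<le> n \<Longrightarrow> 0 < z i"
  shows "strict_mono (sd_seq \<epsilon> n z)"
proof (rule strict_mono_intI)
  fix j
  obtain q b where j: "j = q * int (n + 1) + int b" and b: "b \<le> n" by (rule int_block)
  show "sd_seq \<epsilon> n z j < sd_seq \<epsilon> n z (j + 1)" unfolding j sd_seq_step[OF z b] using pos b by simp
qed

lemma sd_hom_shift_mono:
  assumes \<theta>: "\<theta> \<in> DeltaHom m n"
  shows "mono (sd_hom \<epsilon> m n \<theta>)"
    and "sd_hom \<epsilon> m n \<theta> (j + k * int (top_deg m + 1)) = sd_hom \<epsilon> m n \<theta> j + k * int (top_deg n + 1)"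
proof -
  have val: "int (if \<epsilon> q then n - \<theta> (m - b) else \<theta> b) \<le> int n" if "b \<le> m" for q b
    using DeltaHom_le[OF \<theta> that] by simp
  show "mono (sd_hom \<epsilon> m n \<theta>)"
  proof (rule monoI)
    fix i j :: int assume ij: "i \<le> j"
    obtain q b where i: "i = q * int (m + 1) + int b" and b: "b \<le> m" by (rule int_block)
    obtain q' b' where j: "j = q' * int (m + 1) + int b'" and b': "b' \<le> m" by (rule int_block)
    have "0 < int (m + 1)" by simp
    from ij this show "sd_hom \<epsilon> m n \<theta> i \<le> sd_hom \<epsilon> m n \<theta> j"
    proof (rule int_div_cases)
      assume "i div int (m + 1) < j div int (m + 1)"
      then have "q < q'" unfolding i j block_div_mod[OF b] block_div_mod[OF b'] .
      then show ?thesis unfolding i j sd_hom_block[OF b] sd_hom_block[OF b'] using val[OF b, of q] by (intro block_mono) auto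
    next
      assume "i div int (m + 1) = j div int (m + 1)" "i mod int (m + 1) \<le> j mod int (m + 1)"
      then have "q = q'" "b \<le> b'" unfolding i j block_div_mod[OF b] block_div_mod[OF b'] by auto
      then show ?thesis unfolding i j sd_hom_block[OF b] sd_hom_block[OF b']
        using DeltaHom_mono[OF \<theta> _ b'] DeltaHom_mono[OF \<theta>, of "m - b'" "m - b"]
        by (auto intro!: diff_le_mono2)
    qed
  qed
  obtain q b where j: "j = q * int (m + 1) + int b" and b: "b \<le> m" by (rule int_block)
  have e: "j + k * int (top_deg m + 1) = (q + k * int L) * int (m + 1) + int b" unfolding top_deg j by (simp add: algebra_simps)
  have "\<epsilon> (q + k * int L) = \<epsilon> q"
  proof (induction k rule: int_induct[where k = 0])
    case (step1 i)
    have "q + (i + 1) * int L = (q + i * int L) + int L" by (simp add: algebra_simps)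
    then show ?case using step1 eps by metis
  next
    case (step2 i)
    have "q + i * int L = (q + (i - 1) * int L) + int L" by (simp add: algebra_simps)
    then show ?case using step2 eps by metis
  qed simp
  then show "sd_hom \<epsilon> m n \<theta> (j + k * int (top_deg m + 1)) = sd_hom \<epsilon> m n \<theta> j + k * int (top_deg n + 1)"
    unfolding e unfolding j sd_hom_block[OF b] unfolding top_deg by (simp add: algebra_simps)
qed

lemma sd_hom_range:
  assumes \<theta>: "\<theta> \<in> DeltaHom m n" and j: "0 \<le> j" "j \<le> int (top_deg m)"
  shows "0 \<le> sd_hom \<epsilon> m n \<theta> j" "sd_hom \<epsilon> m n \<theta> j \<le> int (top_deg n)"
proof -
  have 0: "0 \<le> sd_hom \<epsilon> m n \<theta> 0" using sd_hom_block[of 0 m \<epsilon> n \<theta> 0] by simp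
  have mono: "sd_hom \<epsilon> m n \<theta> i \<le> sd_hom \<epsilon> m n \<theta> i'" if "i \<le> i'" for i i' using sd_hom_shift_mono(1)[OF \<theta>] that by (simp add: mono_def)
  show "0 \<le> sd_hom \<epsilon> m n \<theta> j" using 0 mono[OF j(1)] by simp
  obtain q b where jb: "j = q * int (m + 1) + int b" and b: "b \<le> m" by (rule int_block)
  have "q < int L"
  proof (rule ccontr)
    assume "\<not> q < int L"
    then have "int L * int (m + 1) \<le> q * int (m + 1)" by (intro mult_right_mono) auto
    then have "int (top_deg m + 1) \<le> j" unfolding top_deg(2) jb by (rule order_trans) (simp only: le_add_same_cancel1 of_nat_0_le_iff)
    then show False using j(2) by simp
  qed
  then have "(q + 1) * int (n + 1) \<le> int L * int (n + 1)" by (intro mult_right_mono) auto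
  moreover have "int (if \<epsilon> q then n - \<theta> (m - b) else \<theta> b) \<le> int n" using DeltaHom_le[OF \<theta> b] by simp
  moreover have "(q + 1) * int (n + 1) = q * int (n + 1) + int n + 1" by (simp add: algebra_simps)
  ultimately have "sd_hom \<epsilon> m n \<theta> j + 1 \<le> int (top_deg n + 1)"
    unfolding top_deg(2) jb sd_hom_block[OF b] by linarith
  then show "sd_hom \<epsilon> m n \<theta> j \<le> int (top_deg n)" by simp
qed

lemma sd_hom_DeltaHom:
  assumes \<theta>: "\<theta> \<in> DeltaHom m n" and ext: "\<sigma> \<in> extensional {..top_deg m}"
    and s: "\<And>j. j \<le> top_deg m \<Longrightarrow> int (\<sigma> j) = sd_hom \<epsilon> m n \<theta> (int j)"
  shows "\<sigma> \<in> DeltaHom (top_deg m) (top_deg n)" "int_ext (top_deg m) (top_deg n) \<sigma> j = sd_hom \<epsilon> m n \<theta> j"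
proof -
  have "\<sigma> i \<le> top_deg n" if "i \<le> top_deg m" for i
    using s[OF that] sd_hom_range(2)[OF \<theta>, of "int i"] that by linarith
  moreover have "\<sigma> i \<le> \<sigma> j" if "i \<le> j" "j \<le> top_deg m" for i j
    using s[of i] s[of j] monoD[OF sd_hom_shift_mono(1)[OF \<theta>], of "int i" "int j"] that by linarith
  ultimately show "\<sigma> \<in> DeltaHom (top_deg m) (top_deg n)"
    using ext by (auto simp: DeltaHom_def mono_on_def PiE_def)
  let ?M = "int (top_deg m + 1)"
  have "nat (j mod ?M) \<le> top_deg m" by (rule nat_mod_le)
  then have "int (\<sigma> (nat (j mod ?M))) = sd_hom \<epsilon> m n \<theta> (j mod ?M)" using s[of "nat (j mod ?M)"] by (simp del: of_nat_add of_nat_Suc)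
  then show "int_ext (top_deg m) (top_deg n) \<sigma> j = sd_hom \<epsilon> m n \<theta> j"
    unfolding int_ext_def using sd_hom_shift_mono(2)[OF \<theta>, of "j mod ?M" "j div ?M"] mod_div_mult_eq[of j ?M] by simp
qed

lemma nodes_push:
  assumes \<theta>: "\<theta> \<in> DeltaHom m n" and z: "z \<in> standard_simplex m"
  shows "nodes L (sd_seq \<epsilon> n (simplex_push m \<theta> z)) \<subseteq> nodes L (sd_seq \<epsilon> m z)"
  unfolding nodes_def range_sd_seq[OF z] range_sd_seq[OF push_simplex[OF \<theta> z]]
  using xcoord_push_image[OF \<theta>, of z] by blast

lemma slot_push:
  assumes \<theta>: "\<theta> \<in> DeltaHom m n" and z: "z \<in> standard_simplex m" and x: "x \<notin> range (sd_seq \<epsilon> m z)"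
  shows "slot (sd_seq \<epsilon> n (simplex_push m \<theta> z)) x = sd_hom \<epsilon> m n \<theta> (slot (sd_seq \<epsilon> m z) x)"
  using slot[OF subdiv_sd_seq[OF z] x] sd_hom_sd_seq[OF \<theta> z]
  by (intro slot_unique(2)[OF subdiv_sd_seq[OF push_simplex[OF \<theta> z]]]) (meson le_less_trans less_le_trans)+

text \<open>Folding the circle onto $[0,1]$. Both \<open>x\<close> and \<open>1 - x\<close> are included, so that laying out the set in either
direction on every unit interval recovers the points that were folded.\<close>

definition fold_set :: "real set set \<Rightarrow> real set" where
  "fold_set G = (\<lambda>c. frac (SOME x. x \<in> c)) ` G \<union> (\<lambda>c. 1 - frac (SOME x. x \<in> c)) ` G \<union> {0, 1}"

lemma fold_set: "finite G \<Longrightarrow> finite (fold_set G)" "fold_set G \<subseteq> {0..1}" "0 \<in> fold_set G" "1 \<in> fold_set G"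
proof -
  have "0 \<le> frac x \<and> frac x \<le> 1" for x :: real using frac_lt_1[of x] by (simp add: less_imp_le)
  then show "fold_set G \<subseteq> {0..1}" by (auto simp: fold_set_def)
qed (auto simp: fold_set_def)

lemma card_fold_set: "finite G \<Longrightarrow> card (fold_set G) \<le> 2 * card G + 2"
proof -
  assume G: "finite G"
  have "card (fold_set G) \<le> card ((\<lambda>c. frac (SOME x. x \<in> c)) ` G) + card ((\<lambda>c. 1 - frac (SOME x. x \<in> c)) ` G) + card {0, 1::real}"
    unfolding fold_set_def by (intro order_trans[OF card_Un_le] add_mono) auto
  also have "\<dots> \<le> card G + card G + 2" using card_image_le[OF G] by (intro add_mono) auto
  finally show ?thesis by simp
qed

lemma fold_set_nodes:
  assumes G: "G \<in> fin_subsets L" and u: "u \<in> standard_simplex m" and sub: "fold_set G \<subseteq> xcoord u ` {..Suc m}"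
  shows "G \<subseteq> nodes L (sd_seq \<epsilon> m u)"
proof
  fix c assume c: "c \<in> G"
  then obtain x0 where "c = circ_proj L x0" using G by (auto simp: fin_subsets_def topspace_circ)
  then have "x0 \<in> c" using self_in_circ_proj by simp
  define x where "x = (SOME x. x \<in> c)"
  have "x \<in> c" unfolding x_def by (rule someI[of _ x0]) fact
  then have cx: "c = circ_proj L x" using \<open>c = circ_proj L x0\<close> circ_proj_mem_eq by metis
  have fx: "frac x \<in> xcoord u ` {..Suc m}" "1 - frac x \<in> xcoord u ` {..Suc m}"
    using sub c unfolding fold_set_def x_def by auto
  have "x = of_int \<lfloor>x\<rfloor> + (if \<epsilon> \<lfloor>x\<rfloor> then 1 - (1 - frac x) else frac x)" by (simp add: frac_def)
  then have "x \<in> range (sd_seq \<epsilon> m u)" unfolding range_sd_seq[OF u] using fx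
    by (intro CollectI exI[of _ "\<lfloor>x\<rfloor>"] exI[of _ "if \<epsilon> \<lfloor>x\<rfloor> then 1 - frac x else frac x"]) (auto simp: frac_def)
  then show "c \<in> nodes L (sd_seq \<epsilon> m u)" unfolding nodes_def cx by blast
qed

end

section \<open>The canonical bijections\<close>

lemma topspace_realization:
  "topspace (realization Y) = {realize_class Y (n, \<xi>, z) | n \<xi> z. \<xi> \<in> cells Y n \<and> z \<in> standard_simplex n}"
  unfolding realization_def topspace_quotient_top
  by (auto simp: topspace_sum_topology topspace_standard_simplex image_iff) blast+

lemma realize_class_mem: "\<xi> \<in> cells Y n \<Longrightarrow> z \<in> standard_simplex n \<Longrightarrow> realize_class Y (n, \<xi>, z) \<in> topspace (realization Y)"
  unfolding topspace_realization by blast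

lemma realize_class_step:
  assumes "\<theta> \<in> DeltaHom m n" "y \<in> cells Y n" "z \<in> standard_simplex m"
  shows "realize_class Y (n, y, simplex_push m \<theta> z) = realize_class Y (m, smap Y m n \<theta> y, z)"
  unfolding realize_class_def equivclp_class_eq_iff
  by (rule r_into_equivclp) (use assms in \<open>auto simp: realize_step_def\<close>)

text \<open>A simplicial set that is the subdivision along \<open>\<epsilon>\<close> of the simplicial set underlying \<open>P\<close>, with the map from
representatives to the colimit. The index map \<open>\<sigma>\<close> is required only to have the values of \<open>sd_hom\<close>, so that
the several concrete formulas for subdivisions fit.\<close>

locale realized = big_presheaf P + sd_word \<epsilon> L
  for P :: "'a presheaf" and \<epsilon> :: "int \<Rightarrow> bool" and L :: nat +
  fixes Y :: "'a sset" and rep :: "nat \<times> 'a \<times> (nat \<Rightarrow> real) \<Rightarrow> (real set set \<times> 'a) set"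
  assumes cells: "cells Y n = pset P (ncyc (top_deg n))"
    and smap: "\<And>m n \<theta> y. \<lbrakk>\<theta> \<in> DeltaHom m n; y \<in> cells Y n\<rbrakk> \<Longrightarrow> \<exists>\<sigma>\<in>extensional {..top_deg m}.
        (\<forall>j\<le>top_deg m. int (\<sigma> j) = sd_hom \<epsilon> m n \<theta> (int j)) \<and>
        smap Y m n \<theta> y = pmap P (ncyc_mor (top_deg m) (top_deg n) \<sigma>) y"
    and rep: "\<And>n \<xi> z. z \<in> standard_simplex n \<Longrightarrow> \<xi> \<in> cells Y n \<Longrightarrow> rep (n, \<xi>, z) =
        cin P L (nodes L (sd_seq \<epsilon> n z)) (pull P L (nodes L (sd_seq \<epsilon> n z)) (top_deg n) (lam (sd_seq \<epsilon> n z)) \<xi>)"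
begin

abbreviation "W \<equiv> sd_seq \<epsilon>"
abbreviation "nds n z \<equiv> nodes L (sd_seq \<epsilon> n z)"
abbreviation "el G n z \<equiv> pull P L G (top_deg n) (lam (sd_seq \<epsilon> n z))"

lemma nds: "z \<in> standard_simplex n \<Longrightarrow> nds n z \<in> fin_subsets L"
  using nodes_fin_subsets subdiv_sd_seq by blast

lemma equivariant_el: "z \<in> standard_simplex n \<Longrightarrow> nds n z \<subseteq> G \<Longrightarrow> equivariant (pi0P L G) (ncycP (top_deg n)) False (lam (W n z))"
  using equivariant_lam subdiv_sd_seq by blast

lemma el_mem: "\<lbrakk>z \<in> standard_simplex n; G \<in> fin_subsets L; nds n z \<subseteq> G; \<xi> \<in> cells Y n\<rbrakk> \<Longrightarrow> el G n z \<xi> \<in> pset P (pi0 L G)"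
  using pull_mem[OF L _ equivariant_el] cells by simp

lemma transition_el:
  assumes z: "z \<in> standard_simplex n" and F: "F \<in> fin_subsets L" "nds n z \<subseteq> F" and G: "G \<in> fin_subsets L" "F \<subseteq> G"
    and x: "\<xi> \<in> cells Y n"
  shows "transition P L F G (el F n z \<xi>) = el G n z \<xi>"
  unfolding transition_def
  by (rule pmap_pull[OF L F(1) L G(1) induces_inclusion[OF L F(1) G] equivariant_el[OF z F(2)] equivariant_el[OF z order_trans[OF F(2) G(2)]]])
    (use x cells in auto)

lemma smap_mem:
  assumes \<theta>: "\<theta> \<in> DeltaHom m n" and y: "y \<in> cells Y n"
  shows "smap Y m n \<theta> y \<in> cells Y m"
proof -
  obtain \<sigma> where s: "\<sigma> \<in> extensional {..top_deg m}" "\<And>j. j \<le> top_deg m \<Longrightarrow> int (\<sigma> j) = sd_hom \<epsilon> m n \<theta> (int j)"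
    "smap Y m n \<theta> y = pmap P (ncyc_mor (top_deg m) (top_deg n) \<sigma>) y" using smap[OF \<theta> y] by blast
  show ?thesis unfolding s(3) cells
    by (rule pmap_mem[OF ncyc_in_DeltaBigD ncyc_in_DeltaBigD ncyc_mor_dHom[OF sd_hom_DeltaHom(1)[OF \<theta> s(1,2)]]])
      (use y cells in auto)
qed

text \<open>The labelling by the gaps of $\theta_* z$ is the labelling by the gaps of \<open>z\<close> followed by the subdivision
of \<open>\<theta>\<close>.\<close>

lemma el_smap:
  assumes \<theta>: "\<theta> \<in> DeltaHom m n" and y: "y \<in> cells Y n" and z: "z \<in> standard_simplex m"
    and G: "G \<in> fin_subsets L" "nds m z \<subseteq> G"
  shows "el G m z (smap Y m n \<theta> y) = el G n (simplex_push m \<theta> z) y"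
proof -
  obtain \<sigma> where s: "\<sigma> \<in> extensional {..top_deg m}" "\<And>j. j \<le> top_deg m \<Longrightarrow> int (\<sigma> j) = sd_hom \<epsilon> m n \<theta> (int j)"
    "smap Y m n \<theta> y = pmap P (ncyc_mor (top_deg m) (top_deg n) \<sigma>) y" using smap[OF \<theta> y] by blast
  have sub: "nds n (simplex_push m \<theta> z) \<subseteq> G" using nodes_push[OF \<theta> z] G(2) by blast
  show ?thesis unfolding s(3)
  proof (rule pull_ncyc_mor[OF L G(1) sd_hom_DeltaHom(1)[OF \<theta> s(1,2)] equivariant_el[OF z G(2)] equivariant_el[OF push_simplex[OF \<theta> z] sub]])
    fix x assume "x \<notin> pre L G"
    then have "x \<notin> range (W m z)" using pre_nodes[OF subdiv_sd_seq[OF z]] G(2) by (auto simp: pre_def)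
    then show "int_ext (top_deg m) (top_deg n) \<sigma> \<lfloor>lam (W m z) x\<rfloor> = \<lfloor>lam (W n (simplex_push m \<theta> z)) x\<rfloor>"
      unfolding lam_simps using slot_push[OF \<theta> z] sd_hom_DeltaHom(2)[OF \<theta> s(1,2), of "slot (W m z) x"] by simp
  qed (use y cells in auto)
qed

lemma rep_refine:
  assumes z: "z \<in> standard_simplex n" and G: "G \<in> fin_subsets L" "nds n z \<subseteq> G" and x: "\<xi> \<in> cells Y n"
  shows "rep (n, \<xi>, z) = cin P L G (el G n z \<xi>)"
  using rep[OF z x] cin_transition[OF L nds[OF z] G el_mem[OF z nds[OF z] order_refl x]]
    transition_el[OF z nds[OF z] order_refl G x] by simp

lemma rep_step:
  assumes \<theta>: "\<theta> \<in> DeltaHom m n" and y: "y \<in> cells Y n" and z: "z \<in> standard_simplex m"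
  shows "rep (n, y, simplex_push m \<theta> z) = rep (m, smap Y m n \<theta> y, z)"
  using rep_refine[OF push_simplex[OF \<theta> z] nds[OF z] nodes_push[OF \<theta> z] y]
    rep_refine[OF z nds[OF z] order_refl smap_mem[OF \<theta> y]] el_smap[OF \<theta> y z nds[OF z] order_refl] by simp

lemma class_map_rep: "class_map rep (realize_class Y p) = rep p"
  unfolding realize_class_def
  by (rule class_map_equivclp) (auto simp: realize_step_def rep_step)

text \<open>For an interior point no gap is empty, so the labelling functor is an isomorphism.\<close>

lemma el_bij:
  assumes u: "u \<in> standard_simplex m" and pos: "\<And>i. i \<le> m \<Longrightarrow> 0 < u i"
  shows "bij_betw (el (nds m u) m u) (cells Y m) (pset P (pi0 L (nds m u)))"
proof -
  let ?G = "nds m u"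
  note G = nds[OF u] and Wd = subdiv_sd_seq[OF u] and s = strict_sd_seq[OF u pos]
  let ?p = "pi0P L ?G" and ?q = "ncycP (top_deg m)"
  note p = presents_pi0P[OF L G] pi0P_Big[OF L G] and q = presents_ncycP[of "top_deg m"] ncycP_Big[of "top_deg m"]
  have f: "induces ?p ?q False (lam (W m u)) (ind ?p ?q False (lam (W m u)))"
    by (rule induces_ind[OF p(1) q(1) equivariant_el[OF u order_refl]])
  have k: "induces ?q ?p False (midpt (W m u)) (ind ?q ?p False (midpt (W m u)))"
    by (rule induces_ind[OF q(1) p(1) equivariant_midpt[OF Wd s]])
  let ?k = "ind ?q ?p False (midpt (W m u))"
  show ?thesis
  proof (rule bij_betwI)
    show "el ?G m u \<in> cells Y m \<rightarrow> pset P (pi0 L ?G)" using el_mem[OF u G order_refl] by blast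
    show "pmap P ?k \<in> pset P (pi0 L ?G) \<rightarrow> cells Y m" using pmap_induced_mem[OF q p k] cells by auto
    fix \<xi> assume x: "\<xi> \<in> cells Y m"
    have "pmap P ?k (el ?G m u \<xi>) = pmap P (dId (ncyc (top_deg m))) \<xi>"
      unfolding pull_def
      by (rule pmap_induced_comp[OF q p q k f, where u = "\<lambda>x. x"])
        (use induces_id[OF q(1)] lam_midpt(1)[OF Wd s] x cells in auto)
    then show "pmap P ?k (el ?G m u \<xi>) = \<xi>" using pmap_id[OF ncyc_in_DeltaBigD] x cells by simp
  next
    fix y assume y: "y \<in> pset P (pi0 L ?G)"
    have "el ?G m u (pmap P ?k y) = pmap P (dId (pi0 L ?G)) y"
      unfolding pull_def
      by (rule pmap_induced_comp[OF p q p f k, where u = "\<lambda>x. x"])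
        (use induces_id[OF p(1)] lam_midpt(2)[OF Wd s] pre_nodes[OF Wd] y in auto)
    then show "el ?G m u (pmap P ?k y) = y" using pmap_id p(2) y by simp
  qed
qed

text \<open>An interior point whose nodes contain a given finite subset of the circle and whose break points contain
a given finite subset of $[0,1]$. The last clause bounds its dimension.\<close>

lemma refinement:
  assumes H: "H \<in> fin_subsets L" and A: "finite A" "A \<subseteq> {0..1}"
  obtains m u where "u \<in> standard_simplex m" "\<And>i. i \<le> m \<Longrightarrow> 0 < u i" "H \<subseteq> nds m u" "A \<subseteq> xcoord u ` {..Suc m}"
    "m + 2 = card (A \<union> fold_set H)"
proof -
  have fH: "finite H" using H by (simp add: fin_subsets_def)
  have "finite (A \<union> fold_set H)" "A \<union> fold_set H \<subseteq> {0..1}" "0 \<in> A \<union> fold_set H" "1 \<in> A \<union> fold_set H"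
    using fold_set(1)[OF fH] fold_set(2)[of H] fold_set(3,4) A by auto
  from gaps_exist[OF this] obtain m u where mu: "u \<in> standard_simplex m" "\<forall>i\<le>m. 0 < u i" "xcoord u ` {..Suc m} = A \<union> fold_set H"
    "m + 2 = card (A \<union> fold_set H)" by blast
  show ?thesis
    by (rule that[OF mu(1)]) (use mu fold_set_nodes[OF H mu(1)] in auto)
qed

text \<open>Equality in the colimit holds at some finite set \<open>H\<close>. Refine \<open>H\<close> to the nodes of an interior point \<open>u\<close> that
also refines \<open>z\<close> and \<open>z'\<close>; both points are then represented over \<open>u\<close>, and their cells have the same image
under the bijection \<open>el_bij\<close>.\<close>

lemma rep_inj:
  assumes x: "\<xi> \<in> cells Y n" and z: "z \<in> standard_simplex n" and x': "\<xi>' \<in> cells Y n'" and z': "z' \<in> standard_simplex n'"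
    and e: "rep (n, \<xi>, z) = rep (n', \<xi>', z')"
  shows "realize_class Y (n, \<xi>, z) = realize_class Y (n', \<xi>', z')"
proof -
  let ?F = "nds n z" and ?F' = "nds n' z'"
  note F = nds[OF z] and F' = nds[OF z']
  have mem: "el ?F n z \<xi> \<in> pset P (pi0 L ?F)" "el ?F' n' z' \<xi>' \<in> pset P (pi0 L ?F')"
    using el_mem[OF z F order_refl x] el_mem[OF z' F' order_refl x'] by auto
  obtain H where H: "H \<in> fin_subsets L" "?F \<subseteq> H" "?F' \<subseteq> H"
    "transition P L ?F H (el ?F n z \<xi>) = transition P L ?F' H (el ?F' n' z' \<xi>')"
    using cin_eqD[OF L F mem(1)] e unfolding rep[OF z x] rep[OF z' x'] by blast
  have HH: "el H n z \<xi> = el H n' z' \<xi>'"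
    using H(4) unfolding transition_el[OF z F order_refl H(1,2) x] transition_el[OF z' F' order_refl H(1,3) x'] .
  \<comment> \<open>Break points that a common refinement of \<open>z\<close> and \<open>z'\<close> must have.\<close>
  let ?A = "xcoord z ` {..Suc n} \<union> xcoord z' ` {..Suc n'}"
  have A: "finite ?A" "?A \<subseteq> {0..1}" using xcoord_01[OF z] xcoord_01[OF z'] by auto
  obtain m u where u: "u \<in> standard_simplex m" and pos: "\<And>i. i \<le> m \<Longrightarrow> 0 < u i" and HU: "H \<subseteq> nds m u" and AU: "?A \<subseteq> xcoord u ` {..Suc m}"
    using refinement[OF H(1) A] by metis
  note U = nds[OF u]
  obtain \<theta> where t: "\<theta> \<in> DeltaHom m n" "simplex_push m \<theta> u = z" using push_exists[OF z u] AU by auto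
  obtain \<theta>' where t': "\<theta>' \<in> DeltaHom m n'" "simplex_push m \<theta>' u = z'" using push_exists[OF z' u] AU by auto
  have 1: "el (nds m u) m u (smap Y m n \<theta> \<xi>) = transition P L H (nds m u) (el H n z \<xi>)"
    using el_smap[OF t(1) x u U order_refl] transition_el[OF z H(1,2) U HU x] t(2) by simp
  have 2: "el (nds m u) m u (smap Y m n' \<theta>' \<xi>') = transition P L H (nds m u) (el H n' z' \<xi>')"
    using el_smap[OF t'(1) x' u U order_refl] transition_el[OF z' H(1,3) U HU x'] t'(2) by simp
  have "smap Y m n \<theta> \<xi> = smap Y m n' \<theta>' \<xi>'"
    using bij_betw_imp_inj_on[OF el_bij[OF u pos]] 1 2 HH smap_mem[OF t(1) x] smap_mem[OF t'(1) x']
    by (metis (no_types, lifting) inj_onD)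
  then show ?thesis
    using realize_class_step[OF t(1) x u] realize_class_step[OF t'(1) x' u] t(2) t'(2) by simp
qed

lemma rep_surj:
  assumes "w \<in> colim P L"
  obtains m \<xi> u where "\<xi> \<in> cells Y m" "u \<in> standard_simplex m" "w = rep (m, \<xi>, u)"
proof -
  obtain F y where F: "F \<in> fin_subsets L" and y: "y \<in> pset P (pi0 L F)" and w: "w = cin P L F y"
    using assms by (auto simp: colim_def)
  obtain m u where u: "u \<in> standard_simplex m" and pos: "\<And>i. i \<le> m \<Longrightarrow> 0 < u i" and FU: "F \<subseteq> nds m u"
    using refinement[OF F, of "{}"] by (metis finite.emptyI empty_subsetI)
  note U = nds[OF u]
  have "transition P L F (nds m u) y \<in> pset P (pi0 L (nds m u))" by (rule transition_mem[OF L F U FU y])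
  then obtain \<xi> where x: "\<xi> \<in> cells Y m" "el (nds m u) m u \<xi> = transition P L F (nds m u) y"
    using bij_betw_imp_surj_on[OF el_bij[OF u pos]] by (metis (no_types, lifting) imageE)
  then have "w = rep (m, \<xi>, u)" unfolding rep[OF u x(1)] w x(2) by (rule_tac cin_transition[OF L F U FU y, symmetric])
  then show ?thesis using that x(1) u by blast
qed

lemma rep_colim: "\<xi> \<in> cells Y n \<Longrightarrow> z \<in> standard_simplex n \<Longrightarrow> rep (n, \<xi>, z) \<in> colim P L"
  unfolding colim_def using rep nds el_mem by blast

lemma canonical_bijection: "canonical_bijection P L Y rep"
  unfolding canonical_bijection_def
proof (intro conjI allI ballI)
  show "bij_betw (class_map rep) (topspace (realization Y)) (colim P L)"
    unfolding bij_betw_def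
  proof
    show "inj_on (class_map rep) (topspace (realization Y))"
    proof (rule inj_onI)
      fix a b assume a: "a \<in> topspace (realization Y)" and b: "b \<in> topspace (realization Y)" and e: "class_map rep a = class_map rep b"
      obtain n \<xi> z where 1: "a = realize_class Y (n, \<xi>, z)" "\<xi> \<in> cells Y n" "z \<in> standard_simplex n" using a unfolding topspace_realization by blast
      obtain n' \<xi>' z' where 2: "b = realize_class Y (n', \<xi>', z')" "\<xi>' \<in> cells Y n'" "z' \<in> standard_simplex n'" using b unfolding topspace_realization by blast
      show "a = b" using rep_inj[OF 1(2,3) 2(2,3)] e unfolding 1(1) 2(1) class_map_rep by blast
    qed
    show "class_map rep ` topspace (realization Y) = colim P L"
    proof
      show "class_map rep ` topspace (realization Y) \<subseteq> colim P L"
        unfolding topspace_realization using rep_colim by (auto simp: class_map_rep)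
      show "colim P L \<subseteq> class_map rep ` topspace (realization Y)"
      proof
        fix w assume "w \<in> colim P L"
        then obtain m \<xi> u where "\<xi> \<in> cells Y m" "u \<in> standard_simplex m" "w = rep (m, \<xi>, u)" by (rule rep_surj)
        then show "w \<in> class_map rep ` topspace (realization Y)"
          using class_map_rep[of "(m, \<xi>, u)"] realize_class_mem by (metis image_eqI)
      qed
    qed
  qed
qed (rule class_map_rep)

end

lemma rescale_circ_proj: "L > 0 \<Longrightarrow> rescale L (circ_proj L x) = circ_proj 1 (x / real L)"
proof (intro Set.set_eqI iffI)
  assume L: "L > 0"
  fix y
  { assume "y \<in> rescale L (circ_proj L x)"
    then obtain t where t: "t \<in> circ_proj L x" "y = t / real L" unfolding rescale_def by blast
    then obtain k :: int where "t = x + of_int k * real L" unfolding mem_circ_proj by blast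
    then have "y = (x + of_int k * real L) / real L" using t by simp
    then have "y = x / real L + of_int k * real 1" using L by (simp add: field_simps)
    then show "y \<in> circ_proj 1 (x / real L)" unfolding mem_circ_proj by blast
  next
    assume "y \<in> circ_proj 1 (x / real L)"
    then obtain k :: int where "y = x / real L + of_int k * real 1" unfolding mem_circ_proj by blast
    then have "y = (x + of_int k * real L) / real L" using L by (simp add: field_simps)
    then show "y \<in> rescale L (circ_proj L x)" unfolding rescale_def mem_circ_proj image_iff by (auto simp: mem_circ_proj) }
qed

lemma circ_homeo_rescale: "L > 0 \<Longrightarrow> circ_homeo L 1 (rescale L) False (\<lambda>x. x / real L) (\<lambda>y. y * real L)"
  by (auto simp: circ_homeo_def circ_lift_def rescale_circ_proj mono_def divide_right_mono add_divide_distrib intro!: continuous_intros)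

context sd_word
begin

text \<open>The gaps of \<open>z\<close> in one period, rescaled to total length \<open>1\<close>: for $\mathrm{sd}_r$ the point
$(z, \dots, z)/r$, for $\mathrm{sd}^{\mathrm e}_r$ the point $(z, \bar z, \dots, z, \bar z)/2r$ with
$\bar z$ the reversal of \<open>z\<close>.\<close>

definition spread :: "nat \<Rightarrow> (nat \<Rightarrow> real) \<Rightarrow> nat \<Rightarrow> real" where
  "spread n z j = (if j \<le> top_deg n then z (if \<epsilon> (int (j div (n + 1))) then n - j mod (n + 1) else j mod (n + 1)) / real L else 0)"

lemma spread_step:
  assumes z: "z \<in> standard_simplex n" and j: "j \<le> top_deg n"
  shows "spread n z j = (sd_seq \<epsilon> n z (int j + 1) - sd_seq \<epsilon> n z (int j)) / real L"
proof -
  have e: "int j = int (j div (n + 1)) * int (n + 1) + int (j mod (n + 1))" by (metis div_mult_mod_eq of_nat_add of_nat_mult)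
  have b: "j mod (n + 1) \<le> n" by (metis Suc_eq_plus1 less_Suc_eq_le mod_less_divisor zero_less_Suc)
  show ?thesis using j sd_seq_step[OF z b, of \<epsilon> "int (j div (n + 1))", folded e] by (simp add: spread_def)
qed

lemma xcoord_spread:
  assumes z: "z \<in> standard_simplex n"
  shows "j \<le> Suc (top_deg n) \<Longrightarrow> xcoord (spread n z) j = sd_seq \<epsilon> n z (int j) / real L"
proof (induction j)
  case 0 then show ?case using sd_seq_0[OF z] by simp
next
  case (Suc j)
  then show ?case using spread_step[OF z, of j] by (simp add: xcoord_Suc diff_divide_distrib add.commute)
qed

lemma spread_simplex:
  assumes z: "z \<in> standard_simplex n"
  shows "spread n z \<in> standard_simplex (top_deg n)"
proof (rule simplexI)
  show "0 \<le> spread n z i" for i using simplex_nonneg[OF z] by (simp add: spread_def)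
  show "spread n z i = 0" if "i > top_deg n" for i using that by (simp add: spread_def)
  have "sd_seq \<epsilon> n z (0 + 1 * int (top_deg n + 1)) = sd_seq \<epsilon> n z 0 + of_int 1 * real L" by (rule subdiv_shift[OF subdiv_sd_seq[OF z]])
  then have "sd_seq \<epsilon> n z (int (Suc (top_deg n))) = real L" using sd_seq_0[OF z] by simp
  then show "xcoord (spread n z) (Suc (top_deg n)) = 1" using xcoord_spread[OF z, of "Suc (top_deg n)"] L by simp
qed

lemma sd_seq_spread:
  assumes z: "z \<in> standard_simplex n"
  shows "sd_seq (\<lambda>_. False) (top_deg n) (spread n z) j = sd_seq \<epsilon> n z j / real L"
proof -
  obtain q b where j: "j = q * int (top_deg n + 1) + int b" and b: "b \<le> top_deg n" by (rule int_block)
  have e: "int b + q * int (top_deg n + 1) = j" using j by simp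
  have "sd_seq \<epsilon> n z j = sd_seq \<epsilon> n z (int b) + of_int q * real L" using subdiv_shift[OF subdiv_sd_seq[OF z], of "int b" q] unfolding e .
  then have "sd_seq \<epsilon> n z j / real L = of_int q + sd_seq \<epsilon> n z (int b) / real L" using L by (simp add: field_simps)
  moreover have "sd_seq (\<lambda>_. False) (top_deg n) (spread n z) j = of_int q + xcoord (spread n z) b"
    unfolding j using sd_seq_block[OF spread_simplex[OF z], of b "\<lambda>_. False" q] b by simp
  ultimately show ?thesis using xcoord_spread[OF z, of b] b by simp
qed

end

lemma slot_scale:
  assumes "subdiv L N W" "subdiv M N V" "\<And>j. V j = W j / c" "c > 0" "y \<notin> range V"
  shows "slot W (y * c) = slot V y"
  by (rule slot_unique(2)[OF assms(1)]) (use slot[OF assms(2,5)] assms(3,4) in \<open>auto simp: field_simps\<close>)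

text \<open>Rescaling a subdivision of $[0,L]$ to $[0,1]$ keeps the labels of the gaps, hence the cell.\<close>

lemma colim_map_rescale_rep:
  assumes A: "realized P \<epsilon> L Y rep" and B: "realized P (\<lambda>_. False) 1 Y1 rep1"
    and x: "\<xi> \<in> cells Y n" and z: "z \<in> standard_simplex n"
  shows "colim_map P L 1 (rescale L) (rep (n, \<xi>, z)) = rep1 (L * (n + 1) - 1, \<xi>, sd_word.spread \<epsilon> L n z)"
    and "\<xi> \<in> cells Y1 (L * (n + 1) - 1)" "sd_word.spread \<epsilon> L n z \<in> standard_simplex (L * (n + 1) - 1)"
proof -
  interpret A: realized P \<epsilon> L Y rep by (rule A)
  interpret B: realized P "\<lambda>_. False" 1 Y1 rep1 by (rule B)
  let ?N = "A.top_deg n" and ?v = "A.spread n z"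
  have L: "L > 0" by (rule A.L)
  have N: "B.top_deg ?N = ?N" by simp
  show v: "?v \<in> standard_simplex ?N" by (rule A.spread_simplex[OF z])
  show x1: "\<xi> \<in> cells Y1 ?N" using x unfolding A.cells B.cells N .
  let ?W = "sd_seq \<epsilon> n z" and ?V = "sd_seq (\<lambda>_. False) ?N ?v"
  have VW: "?V j = ?W j / real L" for j by (rule A.sd_seq_spread[OF z])
  note SW = A.subdiv_sd_seq[OF z] and SV = B.subdiv_sd_seq[OF v, unfolded N]
  note H = circ_homeo_rescale[OF L] and F = A.nds[OF z]
  have im: "rescale L ` A.nds n z = B.nds ?N ?v"
    unfolding nodes_def image_image rescale_circ_proj[OF L] VW ..
  note G = B.nds[OF v]
  note ind = induces_dInv_pi0_mor[OF H F, unfolded im]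
  have "pmap P (dInv (pi0_mor L (A.nds n z) 1 (B.nds ?N ?v) (rescale L))) (A.el (A.nds n z) n z \<xi>) = B.el (B.nds ?N ?v) ?N ?v \<xi>"
    unfolding N
  proof (rule A.pmap_pull[OF L F B.L G ind A.equivariant_el[OF z order_refl] B.equivariant_el[OF v order_refl, unfolded N]])
    fix y assume "y \<notin> pre 1 (B.nds ?N ?v)"
    then have "y \<notin> range ?V" using pre_nodes[OF SV] by simp
    then have "slot ?W (y * real L) = slot ?V y" using slot_scale[OF SW SV VW] L by simp
    then show "seg_eq \<int> (lam ?W (y * real L)) (lam ?V y)" by (simp add: lam_def)
  qed (use x A.cells in auto)
  then show "colim_map P L 1 (rescale L) (rep (n, \<xi>, z)) = rep1 (?N, \<xi>, ?v)"
    unfolding A.rep[OF z x] B.rep[OF v x1] A.colim_map_cin[OF H] colim_rep_def im by simp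
qed

text \<open>A numbering of the components of $[0,L] \setminus F$, which are the nonempty gaps of \<open>W\<close> in $[0,L]$, extends
periodically to the labelling of all gaps of the line.\<close>

lemma (in big_presheaf) interval_point_eq:
  assumes W: "subdiv L N W" and W0: "W 0 = 0" and F: "F = W ` {0..int N + 1}"
    and f: "\<And>j. \<lbrakk>0 \<le> j; j \<le> int N; W j < W (j + 1)\<rbrakk> \<Longrightarrow> f {W j<..<W (j + 1)} = nat j"
    and x: "\<xi> \<in> pset P (ncyc N)"
  shows "interval_point P L F N f \<xi> = cin P L (nodes L W) (pull P L (nodes L W) N (lam W) \<xi>)"
proof -
  have L: "L > 0" by (rule subdiv_L[OF W])
  have WN: "W (int N + 1) = real L" using subdiv_shift[OF W, of 0 1] W0 by (simp add: add.commute)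
  have rng: "0 \<le> W j \<and> W j \<le> real L" if "j \<in> {0..int N + 1}" for j
    using subdiv_mono[OF W, of 0 j] subdiv_mono[OF W, of j "int N + 1"] W0 WN that by auto
  interpret C: cut L F
  proof
    show "0 \<in> F" "real L \<in> F" unfolding F using W0 WN by (auto intro: image_eqI[of _ W 0] image_eqI[of _ W "int N + 1"])
    show "finite F" "F \<subseteq> {0..real L}" unfolding F using rng by auto
  qed (rule L)
  have nd: "circ_proj L ` F = nodes L W"
  proof
    show "circ_proj L ` F \<subseteq> nodes L W" unfolding F nodes_def by blast
    show "nodes L W \<subseteq> circ_proj L ` F" unfolding nodes_eq[OF W] F image_image by (rule image_mono) auto
  qed
  have g: "equivariant (pi0P L (nodes L W)) (ncycP N) False (lam W)" by (rule equivariant_lam[OF W order_refl])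
  have "induces (pi0P L (nodes L W)) (ncycP N) False (lam W) (C.label_mor N f)"
  proof (rule C.induces_label_mor[unfolded nd, OF g])
    fix y assume y: "y \<in> {0..real L} - F"
    have yn: "y \<notin> range W" using C.notin_S[OF y] unfolding nd pre_nodes[OF W] .
    let ?j = "slot W y"
    note s = slot[OF W yn]
    have j: "0 \<le> ?j" "?j \<le> int N"
    proof -
      show "0 \<le> ?j"
      proof (rule ccontr)
        assume "\<not> 0 \<le> ?j"
        then have "W (?j + 1) \<le> W 0" by (intro subdiv_mono[OF W]) simp
        then show False using s y W0 by auto
      qed
      show "?j \<le> int N"
      proof (rule ccontr)
        assume "\<not> ?j \<le> int N"
        then have "W (int N + 1) \<le> W ?j" by (intro subdiv_mono[OF W]) simp
        then show False using s y WN by auto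
      qed
    qed
    have "comp_at (range W) y = {W ?j<..<W (?j + 1)}"
    proof (intro Set.set_eqI iffI)
      fix t assume "t \<in> comp_at (range W) y"
      then have t: "t \<notin> range W" "seg_eq (range W) y t" by (auto simp: comp_at_def)
      then have "slot W t = ?j" using slot_le[OF W yn t(1)] slot_le[OF W t(1) yn] by (auto simp: seg_eq_def)
      then show "t \<in> {W ?j<..<W (?j + 1)}" using slot[OF W t(1)] by simp
    next
      fix t assume "t \<in> {W ?j<..<W (?j + 1)}"
      then have t: "t \<notin> range W" "slot W t = ?j" using slot_unique[OF W, of ?j t] by auto
      then show "t \<in> comp_at (range W) y" using slot_eq_seg_eq[OF W yn t(1)] by (simp add: comp_at_def)
    qed
    then have "f (comp_at (range W) y) = nat ?j" using f[OF j] s by simp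
    then show "0 \<le> \<lfloor>lam W y\<rfloor> \<and> \<lfloor>lam W y\<rfloor> \<le> int N \<and> f (comp_at (pre L (nodes L W)) y) = nat \<lfloor>lam W y\<rfloor>"
      unfolding pre_nodes[OF W] lam_simps using j by simp
  qed
  from pull_eqI[OF L nodes_fin_subsets[OF W] g this] show ?thesis
    unfolding interval_point_def nd C.label_mor_def by simp
qed

text \<open>A nonempty gap determines its index, so any description of the labels by the intervals is unambiguous.\<close>

lemma the_label:
  assumes W: "subdiv L N W" and lt: "W j < W (j + 1)" and j: "0 \<le> j" and Q: "Q (nat j)"
    and u: "\<And>i. Q i \<Longrightarrow> {W (int i)<..<W (int i + 1)} = {W j<..<W (j + 1)}"
  shows "(THE i. Q i) = nat j"
proof (rule the_equality)
  show "Q (nat j)" by (rule Q)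
next
  fix i assume "Q i"
  obtain t where t: "W j < t" "t < W (j + 1)" using dense[OF lt] by blast
  then have "t \<in> {W (int i)<..<W (int i + 1)}" unfolding u[OF \<open>Q i\<close>] by simp
  then have "slot W t = int i" using slot_unique(2)[OF W, of "int i" t] by simp
  moreover have "slot W t = j" using slot_unique(2)[OF W t] .
  ultimately show "i = nat j" by simp
qed

lemma (in sd_word) block_bounds:
  assumes j: "0 \<le> j" "j < int L * int (n + 1)" and jb: "j = q * int (n + 1) + int b" and b: "b \<le> n"
  shows "0 \<le> q" "q < int L"
proof -
  show "0 \<le> q" using zdiv_mono1[OF j(1), of "int (n + 1)"] unfolding jb block_div_mod[OF b] by simp
  show "q < int L"
  proof (rule ccontr)
    assume "\<not> q < int L"
    then have "int L * int (n + 1) \<le> q * int (n + 1)" by (intro mult_right_mono) auto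
    then show False using j(2) unfolding jb by linarith
  qed
qed

text \<open>The last node $L$ is not the start of a block of the period; it occurs on the right as the end of the
last unit interval.\<close>

lemma (in sd_word) sd_seq_image:
  assumes z: "z \<in> standard_simplex n"
  shows "sd_seq \<epsilon> n z ` {0..int (top_deg n) + 1} =
    {real k + (if \<epsilon> (int k) then 1 - xcoord z i else xcoord z i) | k i. k < L \<and> i \<le> n + 1}" (is "_ = ?B")
proof (intro Set.set_eqI iffI)
  let ?W = "sd_seq \<epsilon> n z"
  have td: "int (top_deg n) + 1 = int L * int (n + 1)" using top_deg(2)[of n] by simp
  fix t
  {
    assume "t \<in> ?W ` {0..int (top_deg n) + 1}"
    then obtain j where j: "0 \<le> j" "j \<le> int L * int (n + 1)" "t = ?W j" unfolding td by auto
    show "t \<in> ?B"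
    proof (cases "j = int L * int (n + 1)")
      case True
      \<comment> \<open>The end point \<open>L\<close> belongs to the last unit interval, which ends with break point \<open>n + 1\<close> or, reversed, \<open>0\<close>.\<close>
      have "?W (int (L - 1) * int (n + 1) + int (n + 1)) = t"
        unfolding j(3) True using L by (simp add: of_nat_diff algebra_simps)
      then have "t = real (L - 1) + (if \<epsilon> (int (L - 1)) then 1 - xcoord z 0 else xcoord z (n + 1))"
        using sd_seq_block[OF z, of "n + 1" \<epsilon> "int (L - 1)"] by simp
      then show ?thesis using L
        by (intro CollectI exI[of _ "L - 1"] exI[of _ "if \<epsilon> (int (L - 1)) then 0 else n + 1"]) auto
    next
      case False
      obtain q b where jb: "j = q * int (n + 1) + int b" and b: "b \<le> n" by (rule int_block)
      have "j < int L * int (n + 1)" using j(2) False by simp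
      from block_bounds[OF j(1) this jb b] have q: "0 \<le> q" "q < int L" .
      have "t = real (nat q) + (if \<epsilon> (int (nat q)) then 1 - xcoord z (Suc n - b) else xcoord z b)"
        unfolding j(3) jb using sd_seq_block[OF z, of b \<epsilon> q] b q by simp
      then show ?thesis using q b
        by (intro CollectI exI[of _ "nat q"] exI[of _ "if \<epsilon> (int (nat q)) then Suc n - b else b"]) auto
    qed
  next
    assume "t \<in> ?B"
    then obtain k i where k: "k < L" "i \<le> n + 1" "t = real k + (if \<epsilon> (int k) then 1 - xcoord z i else xcoord z i)" by blast
    let ?b = "if \<epsilon> (int k) then Suc n - i else i"
    have "int k * int (n + 1) + int ?b \<le> (int k + 1) * int (n + 1)" using k(2) by (simp add: distrib_right)
    also have "\<dots> \<le> int L * int (n + 1)" using k(1) by (intro mult_right_mono) auto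
    finally have "int k * int (n + 1) + int ?b \<in> {0..int (top_deg n) + 1}" unfolding td by simp
    moreover have "t = ?W (int k * int (n + 1) + int ?b)"
      using sd_seq_block[OF z, of ?b \<epsilon> "int k"] k(2,3) by (simp split: if_splits)
    ultimately show "t \<in> ?W ` {0..int (top_deg n) + 1}" by (rule rev_image_eqI)
  }
qed

text \<open>The three explicit descriptions of the canonical bijections differ only in how the blocks are indexed.
The predicate \<open>Q\<close> stands for any description equivalent to the one by unit intervals.\<close>

lemma interval_point_word:
  assumes P: "big_presheaf P" and word: "sd_word \<epsilon> L" and z: "z \<in> standard_simplex n" and x: "\<xi> \<in> pset P (ncyc (L * (n + 1) - 1))"
    and F: "F = {real k + (if \<epsilon> (int k) then 1 - xcoord z i else xcoord z i) | k i. k < L \<and> i \<le> n + 1}"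
    and Q: "\<And>e i. Q e i \<longleftrightarrow> (\<exists>k<L. \<exists>b\<le>n. i = k * (n + 1) + (if \<epsilon> (int k) then n - b else b) \<and>
        e = (if \<epsilon> (int k) then {real k + 1 - xcoord z (b + 1)<..<real k + 1 - xcoord z b}
             else {real k + xcoord z b<..<real k + xcoord z (b + 1)}))"
  shows "interval_point P L F (L * (n + 1) - 1) (\<lambda>e. THE i. Q e i) \<xi> =
    cin P L (nodes L (sd_seq \<epsilon> n z)) (pull P L (nodes L (sd_seq \<epsilon> n z)) (L * (n + 1) - 1) (lam (sd_seq \<epsilon> n z)) \<xi>)"
proof -
  interpret big_presheaf P by (rule P)
  interpret sd_word \<epsilon> L by (rule word)
  let ?W = "sd_seq \<epsilon> n z"
  note W = subdiv_sd_seq[OF z]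
  define I where "I k b = (if \<epsilon> (int k) then {real k + 1 - xcoord z (b + 1)<..<real k + 1 - xcoord z b}
      else {real k + xcoord z b<..<real k + xcoord z (b + 1)})" for k b
  have I: "{?W (int i)<..<?W (int i + 1)} = I k b" if i: "i = k * (n + 1) + (if \<epsilon> (int k) then n - b else b)" and b: "b \<le> n" for i k b
  proof -
    let ?b = "if \<epsilon> (int k) then n - b else b"
    have e: "int i = int k * int (n + 1) + int ?b" "int i + 1 = int k * int (n + 1) + int (Suc ?b)"
      unfolding i by (simp_all only: of_nat_add of_nat_mult of_nat_Suc add.assoc)
    have c: "?b \<le> Suc n" "Suc ?b \<le> Suc n" using b by auto
    have "Suc n - (n - b) = b + 1" "Suc n - Suc (n - b) = b" using b by auto
    then show ?thesis
      unfolding e(2) unfolding e(1) sd_seq_block[OF z c(1)] sd_seq_block[OF z c(2)] I_def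
      by (cases "\<epsilon> (int k)") (simp_all add: add_diff_eq)
  qed
  have f: "(THE i. Q {?W j<..<?W (j + 1)} i) = nat j" if j: "0 \<le> j" "j \<le> int (top_deg n)" "?W j < ?W (j + 1)" for j
  proof (rule the_label[OF W j(3,1)])
    obtain q b where jb: "j = q * int (n + 1) + int b" and b: "b \<le> n" by (rule int_block)
    have "j < int L * int (n + 1)" using j(2) top_deg(2)[of n] by simp
    from block_bounds[OF j(1) this jb b] have q: "0 \<le> q" "q < int L" .
    let ?k = "nat q" and ?b = "if \<epsilon> q then n - b else b"
    have "int (nat j) = int (?k * (n + 1) + b)" using j(1) q unfolding jb by (simp add: algebra_simps)
    then have nj: "nat j = ?k * (n + 1) + (if \<epsilon> (int ?k) then n - ?b else ?b)" unfolding of_nat_eq_iff using q b by simp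
    have "{?W j<..<?W (j + 1)} = I ?k ?b" using I[OF nj] b j(1) by simp
    then show "Q {?W j<..<?W (j + 1)} (nat j)"
      unfolding Q I_def[symmetric] using q b by (intro exI[of _ ?k] conjI exI[of _ ?b] nj) auto
  next
    fix i assume "Q {?W j<..<?W (j + 1)} i"
    then obtain k b where "b \<le> n" "i = k * (n + 1) + (if \<epsilon> (int k) then n - b else b)" "{?W j<..<?W (j + 1)} = I k b"
      unfolding Q I_def[symmetric] by blast
    then show "{?W (int i)<..<?W (int i + 1)} = {?W j<..<?W (j + 1)}" using I by simp
  qed
  show ?thesis
    by (rule interval_point_eq[OF W sd_seq_0[OF z] _ f x]) (simp_all only: F sd_seq_image[OF z])
qed

lemma dihedral_extensionD:
  assumes "dihedral_extension X P"
  shows "presheaf_on DeltaBigD P" "pset P (ncyc n) = pset X (ncyc n)"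
    "\<And>f x. f \<in> dHom (ncyc m) (ncyc n) \<Longrightarrow> x \<in> pset P (ncyc n) \<Longrightarrow> pmap X f x = pmap P f x"
  using assms unfolding dihedral_extension_def DeltaD_def by auto

lemma realized_sd:
  assumes r: "r > 0" and X: "dihedral_extension X P"
  shows "realized P (\<lambda>_. False) r (sd r (underlying_sset X)) (rep_sd P r)"
proof -
  interpret big_presheaf P by unfold_locales (rule dihedral_extensionD(1)[OF X])
  interpret sd_word "\<lambda>_. False" r by unfold_locales (use r in auto)
  show ?thesis
  proof unfold_locales
    fix n show c: "cells (sd r (underlying_sset X)) n = pset P (ncyc (top_deg n))"
      by (simp add: sd_def underlying_sset_def dihedral_extensionD(2)[OF X])
  next
    fix m n \<theta> y assume t: "\<theta> \<in> DeltaHom m n" and y: "y \<in> cells (sd r (underlying_sset X)) n"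
    let ?s = "sd_map r m n \<theta>"
    have ext: "?s \<in> extensional {..top_deg m}" by (simp add: sd_map_def)
    have s: "int (?s j) = sd_hom (\<lambda>_. False) m n \<theta> (int j)" if "j \<le> top_deg m" for j
    proof -
      have "int j div int (m + 1) = int (j div (m + 1))" "nat (int j mod int (m + 1)) = j mod (m + 1)"
        by (simp_all only: zdiv_int[symmetric] zmod_int[symmetric] nat_int)
      then show ?thesis using that by (simp add: sd_map_def sd_hom_def Let_def del: of_nat_Suc of_nat_add) (simp add: algebra_simps)
    qed
    have y': "y \<in> pset P (ncyc (top_deg n))" using y by (simp add: sd_def underlying_sset_def dihedral_extensionD(2)[OF X])
    have "smap (sd r (underlying_sset X)) m n \<theta> y = pmap X (ncyc_mor (top_deg m) (top_deg n) ?s) y"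
      by (simp add: sd_def underlying_sset_def)
    also have "\<dots> = pmap P (ncyc_mor (top_deg m) (top_deg n) ?s) y"
      by (rule dihedral_extensionD(3)[OF X ncyc_mor_dHom[OF sd_hom_DeltaHom(1)[OF t ext s]] y'])
    finally show "\<exists>\<sigma>\<in>extensional {..top_deg m}. (\<forall>j\<le>top_deg m. int (\<sigma> j) = sd_hom (\<lambda>_. False) m n \<theta> (int j)) \<and>
        smap (sd r (underlying_sset X)) m n \<theta> y = pmap P (ncyc_mor (top_deg m) (top_deg n) \<sigma>) y"
      using ext s by blast
  next
    fix n \<xi> z assume z: "z \<in> standard_simplex n" and x: "\<xi> \<in> cells (sd r (underlying_sset X)) n"
    have x': "\<xi> \<in> pset P (ncyc (top_deg n))" using x by (simp add: sd_def underlying_sset_def dihedral_extensionD(2)[OF X])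
    show "rep_sd P r (n, \<xi>, z) = cin P r (nodes r (sd_seq (\<lambda>_. False) n z))
        (pull P r (nodes r (sd_seq (\<lambda>_. False) n z)) (top_deg n) (lam (sd_seq (\<lambda>_. False) n z)) \<xi>)"
      unfolding rep_sd_def case_prod_conv Let_def
      by (rule interval_point_word[OF big_presheaf_axioms sd_word_axioms z x']) auto
  qed
qed

lemma realized_identity:
  assumes X: "dihedral_extension X P"
  shows "realized P (\<lambda>_. False) 1 (underlying_sset X) (rep_sd P 1)"
proof -
  interpret A: realized P "\<lambda>_. False" 1 "sd 1 (underlying_sset X)" "rep_sd P 1"
    by (rule realized_sd[OF _ X]) simp
  have c: "cells (underlying_sset X) n = cells (sd 1 (underlying_sset X)) n" for n
    by (simp add: sd_def)
  show ?thesis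
  proof unfold_locales
    show "cells (underlying_sset X) n = pset P (ncyc (A.top_deg n))" for n unfolding c by (rule A.cells)
    show "rep_sd P 1 (n, \<xi>, z) = cin P 1 (A.nds n z) (A.el (A.nds n z) n z \<xi>)" if "z \<in> standard_simplex n" "\<xi> \<in> cells (underlying_sset X) n" for n \<xi> z
      by (rule A.rep) (use that c in auto)
    fix m n \<theta> y assume t: "\<theta> \<in> DeltaHom m n" and y: "y \<in> cells (underlying_sset X) n"
    have ext: "\<theta> \<in> extensional {..A.top_deg m}" using t by (simp add: DeltaHom_def PiE_def)
    have s: "int (\<theta> j) = sd_hom (\<lambda>_. False) m n \<theta> (int j)" if "j \<le> A.top_deg m" for j
      using sd_hom_block[of j m "\<lambda>_. False" n \<theta> 0] that by simp
    have y': "y \<in> pset P (ncyc n)" using y by (simp add: underlying_sset_def dihedral_extensionD(2)[OF X])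
    have "smap (underlying_sset X) m n \<theta> y = pmap P (ncyc_mor m n \<theta>) y"
      using dihedral_extensionD(3)[OF X ncyc_mor_dHom[OF t] y'] by (simp add: underlying_sset_def)
    then show "\<exists>\<sigma>\<in>extensional {..A.top_deg m}. (\<forall>j\<le>A.top_deg m. int (\<sigma> j) = sd_hom (\<lambda>_. False) m n \<theta> (int j)) \<and>
        smap (underlying_sset X) m n \<theta> y = pmap P (ncyc_mor (A.top_deg m) (A.top_deg n) \<sigma>) y"
      using ext s by (intro bexI[of _ \<theta>]) auto
  qed
qed

text \<open>The unit intervals $[2k, 2k+1]$ and $[2k+1, 2k+2]$ carry the simplex forwards and backwards, which is the
alternating word. Most of the proof translates the indexing by pairs of intervals into the indexing by
single ones.\<close>

lemma realized_sde:
  assumes r: "r > 0" and X: "dihedral_extension X P"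
  shows "realized P odd (2 * r) (sde (sd r (underlying_sset X))) (rep_sde P r)"
proof -
  interpret big_presheaf P by unfold_locales (rule dihedral_extensionD(1)[OF X])
  interpret sd_word odd "2 * r" by unfold_locales (use r in auto)
  have td: "r * (2 * n + 1 + 1) - 1 = top_deg n" for n by (simp add: algebra_simps)
  show ?thesis
  proof unfold_locales
    fix n show c: "cells (sde (sd r (underlying_sset X))) n = pset P (ncyc (top_deg n))"
      using td[of n] by (simp add: sde_def sd_def underlying_sset_def dihedral_extensionD(2)[OF X])
  next
    fix m n \<theta> y assume t: "\<theta> \<in> DeltaHom m n" and y: "y \<in> cells (sde (sd r (underlying_sset X))) n"
    let ?s = "sd_map r (2 * m + 1) (2 * n + 1) (sde_map m n \<theta>)"
    have ext: "?s \<in> extensional {..top_deg m}" unfolding sd_map_def td by simp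
    have s: "int (?s j) = sd_hom odd m n \<theta> (int j)" if j: "j \<le> top_deg m" for j
    proof -
      define a where "a = j div (2 * m + 1 + 1)"
      define c where "c = j mod (2 * m + 1 + 1)"
      have c: "c \<le> 2 * m + 1" using mod_less_divisor[of "2 * m + 1 + 1" j] by (simp add: c_def)
      have jac: "j = a * (2 * m + 1 + 1) + c" by (simp only: a_def c_def div_mult_mod_eq)
      have sj: "?s j = a * (2 * n + 1 + 1) + (if c \<le> m then \<theta> c else 2 * n + 1 - \<theta> (2 * m + 1 - c))"
        using j c unfolding sd_map_def td a_def[symmetric] c_def[symmetric] by (simp add: sde_map_def a_def c_def)
      show ?thesis
      proof (cases "c \<le> m")
        case True
        have "int j = int (2 * a) * int (m + 1) + int c" unfolding jac by (simp add: algebra_simps)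
        then show ?thesis using True sd_hom_block[OF True, of odd n \<theta> "int (2 * a)"] sj by (simp add: algebra_simps)
      next
        case False
        let ?b = "c - (m + 1)"
        have b: "?b \<le> m" "c = m + 1 + ?b" using c False by auto
        have "int j = int (2 * a + 1) * int (m + 1) + int ?b" unfolding jac using b(2) by (simp add: algebra_simps of_nat_diff)
        then have "sd_hom odd m n \<theta> (int j) = int (2 * a + 1) * int (n + 1) + int (n - \<theta> (m - ?b))"
          using sd_hom_block[OF b(1), of odd n \<theta> "int (2 * a + 1)"] by simp
        moreover have "2 * m + 1 - c = m - ?b" using b by simp
        moreover have "\<theta> (m - ?b) \<le> n" by (rule DeltaHom_le[OF t]) simp
        ultimately show ?thesis using False sj by (simp add: algebra_simps of_nat_diff)
      qed
    qed
    have y': "y \<in> pset P (ncyc (top_deg n))" using y td[of n] by (simp add: sde_def sd_def underlying_sset_def dihedral_extensionD(2)[OF X])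
    have "smap (sde (sd r (underlying_sset X))) m n \<theta> y = pmap X (ncyc_mor (top_deg m) (top_deg n) ?s) y"
      unfolding td[symmetric] by (simp add: sde_def sd_def underlying_sset_def)
    also have "\<dots> = pmap P (ncyc_mor (top_deg m) (top_deg n) ?s) y"
      by (rule dihedral_extensionD(3)[OF X ncyc_mor_dHom[OF sd_hom_DeltaHom(1)[OF t ext s]] y'])
    finally show "\<exists>\<sigma>\<in>extensional {..top_deg m}. (\<forall>j\<le>top_deg m. int (\<sigma> j) = sd_hom odd m n \<theta> (int j)) \<and>
        smap (sde (sd r (underlying_sset X))) m n \<theta> y = pmap P (ncyc_mor (top_deg m) (top_deg n) \<sigma>) y"
      using ext s by blast
  next
    fix n \<xi> z assume z: "z \<in> standard_simplex n" and x: "\<xi> \<in> cells (sde (sd r (underlying_sset X))) n"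
    let ?x = "xcoord z"
    have x': "\<xi> \<in> pset P (ncyc (top_deg n))" using x td[of n] by (simp add: sde_def sd_def underlying_sset_def dihedral_extensionD(2)[OF X])
    have F: "{2 * real k + ?x i | k i. k < r \<and> i \<le> n + 1} \<union> {2 * real k + 2 - ?x i | k i. k < r \<and> i \<le> n + 1} =
        {real k + (if odd (int k) then 1 - ?x i else ?x i) | k i. k < 2 * r \<and> i \<le> n + 1}" (is "?A = ?B")
    proof
      show "?A \<subseteq> ?B"
      proof
        fix t assume "t \<in> ?A"
        then obtain k i where k: "k < r" "i \<le> n + 1" "t = 2 * real k + ?x i \<or> t = 2 * real k + 2 - ?x i" by blast
        from k(3) show "t \<in> ?B"
        proof
          assume "t = 2 * real k + ?x i"
          then show ?thesis using k(1,2) by (intro CollectI exI[of _ "2 * k"] exI[of _ i]) auto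
        next
          assume "t = 2 * real k + 2 - ?x i"
          then show ?thesis using k(1,2) by (intro CollectI exI[of _ "2 * k + 1"] exI[of _ i]) auto
        qed
      qed
      show "?B \<subseteq> ?A"
      proof
        fix t assume "t \<in> ?B"
        then obtain k i where k: "k < 2 * r" "i \<le> n + 1" "t = real k + (if odd (int k) then 1 - ?x i else ?x i)" by blast
        show "t \<in> ?A"
        proof (cases "even k")
          case True
          then obtain l where "k = 2 * l" by (rule evenE)
          then show ?thesis using k by (intro UnI1 CollectI exI[of _ l] exI[of _ i]) auto
        next
          case False
          then obtain l where "k = 2 * l + 1" by (rule oddE)
          then show ?thesis using k by (intro UnI2 CollectI exI[of _ l] exI[of _ i]) auto
        qed
      qed
    qed
    have Q: "(\<exists>k<r. \<exists>i\<le>n. e = {2 * real k + ?x i<..<2 * real k + ?x (i + 1)} \<and> j = 2 * k * (n + 1) + i \<or>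
          e = {2 * real k + 2 - ?x (i + 1)<..<2 * real k + 2 - ?x i} \<and> j = 2 * k * (n + 1) + 2 * n + 1 - i) \<longleftrightarrow>
        (\<exists>k<2 * r. \<exists>b\<le>n. j = k * (n + 1) + (if odd (int k) then n - b else b) \<and>
          e = (if odd (int k) then {real k + 1 - ?x (b + 1)<..<real k + 1 - ?x b} else {real k + ?x b<..<real k + ?x (b + 1)}))"
      (is "?A = ?B") for e j
    proof
      assume ?A
      then obtain k i where k: "k < r" "i \<le> n" "e = {2 * real k + ?x i<..<2 * real k + ?x (i + 1)} \<and> j = 2 * k * (n + 1) + i \<or>
          e = {2 * real k + 2 - ?x (i + 1)<..<2 * real k + 2 - ?x i} \<and> j = 2 * k * (n + 1) + 2 * n + 1 - i" by blast
      from k(3) show ?B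
      proof
        assume "e = {2 * real k + ?x i<..<2 * real k + ?x (i + 1)} \<and> j = 2 * k * (n + 1) + i"
        then show ?B using k(1,2) by (intro exI[of _ "2 * k"] conjI exI[of _ i]) auto
      next
        assume "e = {2 * real k + 2 - ?x (i + 1)<..<2 * real k + 2 - ?x i} \<and> j = 2 * k * (n + 1) + 2 * n + 1 - i"
        then show ?B using k(1,2) by (intro exI[of _ "2 * k + 1"] conjI exI[of _ i]) auto
      qed
    next
      assume ?B
      then obtain k b where k: "k < 2 * r" "b \<le> n" "j = k * (n + 1) + (if odd (int k) then n - b else b)"
        "e = (if odd (int k) then {real k + 1 - ?x (b + 1)<..<real k + 1 - ?x b} else {real k + ?x b<..<real k + ?x (b + 1)})" by blast
      show ?A
      proof (cases "even k")
        case True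
        then obtain l where "k = 2 * l" by (rule evenE)
        then show ?thesis using k by (intro exI[of _ l] conjI exI[of _ b] disjI1) auto
      next
        case False
        then obtain l where "k = 2 * l + 1" by (rule oddE)
        then show ?thesis using k by (intro exI[of _ l] conjI exI[of _ b] disjI2) auto
      qed
    qed
    show "rep_sde P r (n, \<xi>, z) = cin P (2 * r) (nodes (2 * r) (sd_seq odd n z))
        (pull P (2 * r) (nodes (2 * r) (sd_seq odd n z)) (top_deg n) (lam (sd_seq odd n z)) \<xi>)"
      unfolding rep_sde_def case_prod_conv Let_def
      by (rule interval_point_word[OF big_presheaf_axioms sd_word_axioms z x' F Q])
  qed
qed

section \<open>The topology of the realization\<close>

abbreviation simplex_top :: "nat \<Rightarrow> (nat \<Rightarrow> real) topology" where
  "simplex_top n \<equiv> subtopology (powertop_real UNIV) (standard_simplex n)"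

text \<open>An open set is the union of its slices, and each slice is the preimage under the continuous inclusion
$z \mapsto (a, z)$.\<close>

lemma openin_prod_discrete:
  "openin (prod_topology (discrete_topology A) T) V \<longleftrightarrow>
    V \<subseteq> A \<times> topspace T \<and> (\<forall>a\<in>A. openin T {z. (a, z) \<in> V})"
proof
  assume V: "openin (prod_topology (discrete_topology A) T) V"
  then have sub: "V \<subseteq> A \<times> topspace T" using openin_subset by fastforce
  have "openin T {z. (a, z) \<in> V}" if a: "a \<in> A" for a
  proof -
    have "continuous_map T (prod_topology (discrete_topology A) T) (\<lambda>z. (a, z))"
      using a by (intro continuous_map_pairedI) auto
    from openin_continuous_map_preimage[OF this V] have "openin T {z \<in> topspace T. (a, z) \<in> V}" .
    moreover have "{z \<in> topspace T. (a, z) \<in> V} = {z. (a, z) \<in> V}" using sub by auto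
    ultimately show ?thesis by simp
  qed
  then show "V \<subseteq> A \<times> topspace T \<and> (\<forall>a\<in>A. openin T {z. (a, z) \<in> V})" using sub by blast
next
  assume V: "V \<subseteq> A \<times> topspace T \<and> (\<forall>a\<in>A. openin T {z. (a, z) \<in> V})"
  then have "V = (\<Union>a\<in>A. {a} \<times> {z. (a, z) \<in> V})" by auto
  moreover have "openin (prod_topology (discrete_topology A) T) ({a} \<times> {z. (a, z) \<in> V})" if "a \<in> A" for a
    using V that by (simp add: openin_prod_Times_iff)
  ultimately show "openin (prod_topology (discrete_topology A) T) V" by (metis (no_types, lifting) openin_Union imageE)
qed

lemma openin_realization:
  "openin (realization Y) U \<longleftrightarrow> U \<subseteq> topspace (realization Y) \<and>
    (\<forall>n. \<forall>\<xi>\<in>cells Y n. openin (simplex_top n) {z \<in> standard_simplex n. realize_class Y (n, \<xi>, z) \<in> U})"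
proof -
  let ?T = "\<lambda>n. prod_topology (discrete_topology (cells Y n)) (simplex_top n)"
  let ?V = "{x \<in> topspace (sum_topology ?T UNIV). realize_class Y x \<in> U}"
  have top: "topspace (realization Y) = realize_class Y ` topspace (sum_topology ?T UNIV)"
    unfolding realization_def topspace_quotient_top ..
  have "openin (sum_topology ?T UNIV) ?V \<longleftrightarrow> (\<forall>n. openin (?T n) {x. (n, x) \<in> ?V})"
    unfolding openin_sum_topology by (auto simp: topspace_sum_topology)
  also have "\<dots> \<longleftrightarrow> (\<forall>n. \<forall>\<xi>\<in>cells Y n. openin (simplex_top n) {z \<in> standard_simplex n. realize_class Y (n, \<xi>, z) \<in> U})"
  proof -
    have "{z. (\<xi>, z) \<in> {x. (n, x) \<in> ?V}} = {z \<in> standard_simplex n. realize_class Y (n, \<xi>, z) \<in> U}" if "\<xi> \<in> cells Y n" for n \<xi>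
      using that by (auto simp: topspace_standard_simplex)
    moreover have "{x. (n, x) \<in> ?V} \<subseteq> cells Y n \<times> topspace (simplex_top n)" for n by auto
    ultimately show ?thesis unfolding openin_prod_discrete by (simp cong: ball_cong)
  qed
  finally show ?thesis unfolding top unfolding realization_def openin_quotient_top by simp
qed

lemma closedin_realization:
  "closedin (realization Y) C \<longleftrightarrow> C \<subseteq> topspace (realization Y) \<and>
    (\<forall>n. \<forall>\<xi>\<in>cells Y n. closedin (simplex_top n) {z \<in> standard_simplex n. realize_class Y (n, \<xi>, z) \<in> C})"
proof -
  have "standard_simplex n - {z \<in> standard_simplex n. realize_class Y (n, \<xi>, z) \<in> C} =
      {z \<in> standard_simplex n. realize_class Y (n, \<xi>, z) \<in> topspace (realization Y) - C}" if "\<xi> \<in> cells Y n" for n \<xi>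
    using that realize_class_mem by auto
  then show ?thesis
    unfolding closedin_def openin_realization topspace_standard_simplex by (auto cong: ball_cong)
qed

lemma continuous_simplex_coordinate: "continuous_map (simplex_top n) euclideanreal (\<lambda>z. z i)"
  by (intro continuous_map_from_subtopology continuous_map_product_projection) simp

lemma continuous_simplex_push:
  assumes "\<theta> \<in> DeltaHom m n"
  shows "continuous_map (simplex_top m) (simplex_top n) (simplex_push m \<theta>)"
  unfolding continuous_map_in_subtopology continuous_map_componentwise_UNIV
proof (intro conjI allI)
  show "continuous_map (simplex_top m) euclideanreal (\<lambda>z. simplex_push m \<theta> z k)" for k
    unfolding simplex_push_def by (intro continuous_map_sum continuous_simplex_coordinate) simp
  show "simplex_push m \<theta> \<in> topspace (simplex_top m) \<rightarrow> standard_simplex n"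
    using push_simplex[OF assms] by (auto simp: topspace_standard_simplex)
qed

lemma (in sd_word) continuous_spread: "continuous_map (simplex_top n) (simplex_top (top_deg n)) (spread n)"
  unfolding continuous_map_in_subtopology continuous_map_componentwise_UNIV
proof (intro conjI allI)
  show "continuous_map (simplex_top n) euclideanreal (\<lambda>z. spread n z k)" for k
  proof (cases "k \<le> top_deg n")
    case True
    then show ?thesis unfolding spread_def using L
      by (simp only: if_True) (intro continuous_map_real_divide continuous_simplex_coordinate continuous_map_const[THEN iffD2]; simp)
  next
    case False
    then show ?thesis by (simp add: spread_def)
  qed
  show "spread n \<in> topspace (simplex_top n) \<rightarrow> standard_simplex (top_deg n)"
    using spread_simplex by (auto simp: topspace_standard_simplex)
qed

text \<open>A map from a compact space to a Hausdorff space.\<close>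

lemma closed_map_simplex:
  assumes "continuous_map (simplex_top m) (simplex_top n) f"
  shows "closed_map (simplex_top m) (simplex_top n) f"
proof (rule continuous_imp_closed_map_gen[OF _ _ assms])
  show "compact_space (simplex_top m)" by (rule compact_space_subtopology[OF compactin_standard_simplex])
  have "Hausdorff_space (simplex_top n)"
    by (intro Hausdorff_space_subtopology) (simp add: Hausdorff_space_product_topology)
  then show "kc_space (simplex_top n)" by (rule Hausdorff_imp_kc_space)
qed

lemma finite_DeltaHom: "finite (DeltaHom m n)"
  by (rule finite_subset[of _ "{..m} \<rightarrow>\<^sub>E {..n}"]) (auto simp: DeltaHom_def intro: finite_PiE)

text \<open>Choose \<open>u\<close> so that the nodes of \<open>u\<close> on $[0,L]$ contain \<open>L\<close> times the break points of \<open>z\<close>; then \<open>\<theta>\<close> exists by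
\<open>push_exists\<close>. The bound on \<open>m\<close> comes from counting the folded points, two for each of the at most
\<open>n0 + 2\<close> break points and two ends.\<close>

lemma (in sd_word) spread_cover:
  assumes z: "z \<in> standard_simplex n0"
  obtains m u \<theta> where "m \<le> 2 * n0 + 4" "u \<in> standard_simplex m" "\<theta> \<in> DeltaHom (top_deg m) n0" "simplex_push (top_deg m) \<theta> (spread m u) = z"
proof -
  define H where "H = (\<lambda>i. circ_proj L (real L * xcoord z i)) ` {..Suc n0}"
  have H: "H \<in> fin_subsets L" by (auto simp: H_def fin_subsets_def)
  have fH: "finite H" by (simp add: H_def)
  from gaps_exist[OF fold_set(1)[OF fH] fold_set(2,3,4)] obtain m u where
    u: "u \<in> standard_simplex m" and pos: "\<And>i. i \<le> m \<Longrightarrow> 0 < u i" and xc: "xcoord u ` {..Suc m} = fold_set H" and m: "m + 2 = card (fold_set H)" by auto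
  have "card H \<le> n0 + 2" using card_image_le[of "{..Suc n0}" "\<lambda>i. circ_proj L (real L * xcoord z i)"] by (simp add: H_def)
  then have mb: "m \<le> 2 * n0 + 4" using m card_fold_set[OF fH] by simp
  note W = subdiv_sd_seq[OF u] and s = strict_sd_seq[OF u pos]
  let ?W = "sd_seq \<epsilon> m u"
  have W1: "?W (int (top_deg m) + 1) = real L" using subdiv_shift[OF W, of 0 1] sd_seq_0[OF u] by (simp add: add.commute)
  have "xcoord z ` {..Suc n0} \<subseteq> xcoord (spread m u) ` {..Suc (top_deg m)}"
  proof
    fix t assume "t \<in> xcoord z ` {..Suc n0}"
    then obtain i where i: "i \<le> Suc n0" "t = xcoord z i" by auto
    have "circ_proj L (real L * t) \<in> nodes L ?W" using fold_set_nodes[OF H u] xc i by (auto simp: H_def)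
    then have "real L * t \<in> range ?W" using pre_nodes[OF W] by (auto simp: pre_def)
    then obtain j where j: "real L * t = ?W j" by blast
    have "0 \<le> real L * t" "real L * t \<le> real L" using xcoord_01[OF z i(1)] i(2) L by (auto simp: mult_le_cancel_left1)
    then have "?W 0 \<le> ?W j" "?W j \<le> ?W (int (top_deg m) + 1)" using j W1 sd_seq_0[OF u] by auto
    then have "0 \<le> j" "j \<le> int (top_deg m) + 1" using s by (auto simp: strict_mono_less_eq)
    then have nj: "nat j \<le> Suc (top_deg m)" "int (nat j) = j" by linarith+
    have "t = real L * t / real L" using L by simp
    then have "t = xcoord (spread m u) (nat j)" unfolding xcoord_spread[OF u nj(1)] nj(2) j .
    with nj(1) show "t \<in> xcoord (spread m u) ` {..Suc (top_deg m)}" by blast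
  qed
  from push_exists[OF z spread_simplex[OF u] this] show ?thesis using that mb u by blast
qed

text \<open>For a closed set \<open>C\<close> the points \<open>z\<close> of a simplex whose class lies in the image of \<open>C\<close> form the union, over the
finitely many pairs of \<open>spread_cover\<close>, of the images of the closed sets of those \<open>w\<close> for which the cell
pulled back along \<open>\<theta>\<close> gives a point of \<open>C\<close>. Injectivity of \<open>D\<close> is used for this description.\<close>

lemma homeomorphic_realization_rescale:
  assumes A: "realized P \<epsilon> L Y rep" and B: "realized P (\<lambda>_. False) 1 Y1 rep1"
    and D: "\<And>p. D p = inv_into (topspace (realization Y1)) (class_map rep1) (colim_map P L 1 (rescale L) (class_map rep p))"
  shows "homeomorphic_map (realization Y) (realization Y1) D"
    and "\<And>p. p \<in> topspace (realization Y) \<Longrightarrow> class_map rep1 (D p) = colim_map P L 1 (rescale L) (class_map rep p)"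
proof -
  interpret A: realized P \<epsilon> L Y rep by (rule A)
  interpret B: realized P "\<lambda>_. False" 1 Y1 rep1 by (rule B)
  have bA: "bij_betw (class_map rep) (topspace (realization Y)) (colim P L)"
    and bB: "bij_betw (class_map rep1) (topspace (realization Y1)) (colim P 1)"
    using A.canonical_bijection B.canonical_bijection by (auto simp: canonical_bijection_def)
  have bM: "bij_betw (colim_map P L 1 (rescale L)) (colim P L) (colim P 1)"
    by (rule A.colim_map_bij[OF circ_homeo_rescale[OF A.L]])
  have bI: "bij_betw (inv_into (topspace (realization Y1)) (class_map rep1)) (colim P 1) (topspace (realization Y1))"
    by (rule bij_betw_inv_into[OF bB])
  have "bij_betw (inv_into (topspace (realization Y1)) (class_map rep1) \<circ> (colim_map P L 1 (rescale L) \<circ> class_map rep)) (topspace (realization Y)) (topspace (realization Y1))"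
    by (rule bij_betw_trans[OF bij_betw_trans[OF bA bM] bI])
  then have bD: "bij_betw D (topspace (realization Y)) (topspace (realization Y1))"
    by (rule bij_betw_cong[THEN iffD1, rotated]) (simp add: D)
  show eqD: "class_map rep1 (D p) = colim_map P L 1 (rescale L) (class_map rep p)" if "p \<in> topspace (realization Y)" for p
  proof -
    have "colim_map P L 1 (rescale L) (class_map rep p) \<in> class_map rep1 ` topspace (realization Y1)"
      using that bij_betw_apply[OF bM bij_betw_apply[OF bA that]] bij_betw_imp_surj_on[OF bB] by simp
    then show ?thesis unfolding D by (rule f_inv_into_f)
  qed
  have Dcl: "D (realize_class Y (n, \<xi>, z)) = realize_class Y1 (A.top_deg n, \<xi>, A.spread n z)"
    if x: "\<xi> \<in> cells Y n" and z: "z \<in> standard_simplex n" for n \<xi> z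
  proof -
    note cm = colim_map_rescale_rep[OF A B x z]
    have "class_map rep1 (D (realize_class Y (n, \<xi>, z))) = class_map rep1 (realize_class Y1 (A.top_deg n, \<xi>, A.spread n z))"
      unfolding eqD[OF realize_class_mem[OF x z]] A.class_map_rep B.class_map_rep by (rule cm(1))
    then show ?thesis
      using bij_betw_imp_inj_on[OF bB] bij_betw_apply[OF bD realize_class_mem[OF x z]] realize_class_mem[OF cm(2,3)] by (simp add: inj_on_eq_iff)
  qed
  have "continuous_map (realization Y) (realization Y1) D"
    unfolding continuous_map_def
  proof (intro conjI allI impI)
    show "D \<in> topspace (realization Y) \<rightarrow> topspace (realization Y1)" using bij_betw_apply[OF bD] by blast
    fix U assume U: "openin (realization Y1) U"
    show "openin (realization Y) {x \<in> topspace (realization Y). D x \<in> U}"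
      unfolding openin_realization[of Y]
    proof (intro conjI allI ballI)
      fix n \<xi> assume x: "\<xi> \<in> cells Y n"
      have x1: "\<xi> \<in> cells Y1 (A.top_deg n)" using x unfolding A.cells B.cells by simp
      have "{z \<in> standard_simplex n. realize_class Y (n, \<xi>, z) \<in> {p \<in> topspace (realization Y). D p \<in> U}} =
          {z \<in> topspace (simplex_top n). A.spread n z \<in> {v \<in> standard_simplex (A.top_deg n). realize_class Y1 (A.top_deg n, \<xi>, v) \<in> U}}"
        using Dcl[OF x] realize_class_mem[OF x] A.spread_simplex by (auto simp: topspace_standard_simplex)
      moreover have "openin (simplex_top (A.top_deg n)) {v \<in> standard_simplex (A.top_deg n). realize_class Y1 (A.top_deg n, \<xi>, v) \<in> U}"
        using U x1 unfolding openin_realization by blast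
      ultimately show "openin (simplex_top n) {z \<in> standard_simplex n. realize_class Y (n, \<xi>, z) \<in> {p \<in> topspace (realization Y). D p \<in> U}}"
        by (simp only: openin_continuous_map_preimage[OF A.continuous_spread])
    qed auto
  qed
  moreover have "closed_map (realization Y) (realization Y1) D"
    unfolding closed_map_def
  proof (intro allI impI)
    fix C assume C: "closedin (realization Y) C"
    have CT: "C \<subseteq> topspace (realization Y)" by (rule closedin_subset[OF C])
    show "closedin (realization Y1) (D ` C)"
      unfolding closedin_realization[of Y1]
    proof (intro conjI allI ballI)
      show "D ` C \<subseteq> topspace (realization Y1)" using CT bij_betw_apply[OF bD] by blast
      fix n \<xi> assume x: "\<xi> \<in> cells Y1 n"
      define I where "I = (SIGMA m : {..2 * n + 4}. DeltaHom (A.top_deg m) n)"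
      define K where "K = (\<lambda>(m, \<theta>). (\<lambda>w. simplex_push (A.top_deg m) \<theta> (A.spread m w)) `
        {w \<in> standard_simplex m. realize_class Y (m, smap Y1 (A.top_deg m) n \<theta> \<xi>, w) \<in> C})"
      have step: "realize_class Y1 (n, \<xi>, simplex_push (A.top_deg m) \<theta> (A.spread m w)) = D (realize_class Y (m, smap Y1 (A.top_deg m) n \<theta> \<xi>, w))"
        and mem: "smap Y1 (A.top_deg m) n \<theta> \<xi> \<in> cells Y m"
        if t: "\<theta> \<in> DeltaHom (A.top_deg m) n" and w: "w \<in> standard_simplex m" for m \<theta> w
      proof -
        have "smap Y1 (A.top_deg m) n \<theta> \<xi> \<in> cells Y1 (A.top_deg m)" by (rule B.smap_mem[OF t x])
        then show m: "smap Y1 (A.top_deg m) n \<theta> \<xi> \<in> cells Y m" unfolding A.cells B.cells by simp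
        show "realize_class Y1 (n, \<xi>, simplex_push (A.top_deg m) \<theta> (A.spread m w)) = D (realize_class Y (m, smap Y1 (A.top_deg m) n \<theta> \<xi>, w))"
          unfolding Dcl[OF m w] by (rule realize_class_step[OF t x A.spread_simplex[OF w]])
      qed
      have eq: "{z \<in> standard_simplex n. realize_class Y1 (n, \<xi>, z) \<in> D ` C} = \<Union>(K ` I)"
      proof (intro Set.set_eqI iffI)
        fix z assume "z \<in> {z \<in> standard_simplex n. realize_class Y1 (n, \<xi>, z) \<in> D ` C}"
        then obtain c where z: "z \<in> standard_simplex n" and c: "c \<in> C" "realize_class Y1 (n, \<xi>, z) = D c" by blast
        obtain m u \<theta> where mu: "m \<le> 2 * n + 4" "u \<in> standard_simplex m" "\<theta> \<in> DeltaHom (A.top_deg m) n" "simplex_push (A.top_deg m) \<theta> (A.spread m u) = z"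
          by (rule A.spread_cover[OF z])
        have "D (realize_class Y (m, smap Y1 (A.top_deg m) n \<theta> \<xi>, u)) = D c" using step[OF mu(3,2)] mu(4) c(2) by simp
        then have "realize_class Y (m, smap Y1 (A.top_deg m) n \<theta> \<xi>, u) = c"
          using bij_betw_imp_inj_on[OF bD] realize_class_mem[OF mem[OF mu(3,2)] mu(2)] CT c(1) by (auto dest: inj_onD)
        then have "z \<in> K (m, \<theta>)" unfolding K_def using mu(2,4) c(1) by auto
        then show "z \<in> \<Union>(K ` I)" using mu(1,3) by (auto simp: I_def)
      next
        fix z assume "z \<in> \<Union>(K ` I)"
        then obtain m \<theta> w where mw: "\<theta> \<in> DeltaHom (A.top_deg m) n" "w \<in> standard_simplex m"
          "realize_class Y (m, smap Y1 (A.top_deg m) n \<theta> \<xi>, w) \<in> C" "z = simplex_push (A.top_deg m) \<theta> (A.spread m w)" by (auto simp: I_def K_def)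
        then show "z \<in> {z \<in> standard_simplex n. realize_class Y1 (n, \<xi>, z) \<in> D ` C}"
          using step[OF mw(1,2)] push_simplex[OF mw(1) A.spread_simplex[OF mw(2)]] by auto
      qed
      have "closedin (simplex_top n) (K i)" if i: "i \<in> I" for i
      proof -
        obtain m \<theta> where i: "i = (m, \<theta>)" and t: "\<theta> \<in> DeltaHom (A.top_deg m) n" using i by (auto simp: I_def)
        have "standard_simplex m \<noteq> {}" by (rule nonempty_standard_simplex)
        then have "smap Y1 (A.top_deg m) n \<theta> \<xi> \<in> cells Y m" using mem[OF t] by blast
        then have "closedin (simplex_top m) {w \<in> standard_simplex m. realize_class Y (m, smap Y1 (A.top_deg m) n \<theta> \<xi>, w) \<in> C}"
          using C unfolding closedin_realization by blast
        moreover have "closed_map (simplex_top m) (simplex_top n) (\<lambda>w. simplex_push (A.top_deg m) \<theta> (A.spread m w))"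
          using continuous_map_compose[OF A.continuous_spread continuous_simplex_push[OF t]]
          by (intro closed_map_simplex) (simp add: o_def)
        ultimately show ?thesis unfolding i K_def closed_map_def by simp
      qed
      moreover have "finite I" unfolding I_def by (intro finite_SigmaI finite_DeltaHom) simp
      ultimately show "closedin (simplex_top n) {z \<in> standard_simplex n. realize_class Y1 (n, \<xi>, z) \<in> D ` C}"
        unfolding eq by (intro closedin_Union) auto
    qed
  qed
  ultimately show "homeomorphic_map (realization Y) (realization Y1) D"
    using bD by (intro bijective_closed_imp_homeomorphic_map) (auto simp: bij_betw_def)
qed

section \<open>Homeomorphism groups and their actions\<close>

lemma HomeoD:
  assumes "\<alpha> \<in> carrier (Homeo L)"
  shows "\<alpha> \<in> extensional (topspace (circ L))" "homeomorphic_map (circ L) (circ L) \<alpha>"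
  using assms by (auto simp: Homeo_def)

lemma continuous_self_map_lift:
  assumes L: "L > 0" and f: "continuous_map (circ L) (circ L) f"
  obtains g where "continuous_on UNIV g" "\<And>x. f (circ_proj L x) = circ_proj L (g x)"
proof -
  have "continuous_map (top_of_set UNIV) (circ L) (\<lambda>x. f (circ_proj L x))"
    using continuous_map_compose[OF continuous_map_circ_proj[of UNIV "\<lambda>x. x" L] f] by (simp add: o_def)
  from circ_lift_exists[OF L _ this] show ?thesis
    using that convex_imp_contractible[OF convex_UNIV] by (metis UNIV_I)
qed

text \<open>Lift \<open>\<alpha>\<close> and its inverse. The composites of the lifts are translations, so the lift of \<open>\<alpha>\<close> is a continuous
bijection of the line, hence strictly monotone. The degrees of the two lifts have product \<open>1\<close>, so each is
\<open>1\<close> or \<open>-1\<close>.\<close>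

lemma homeo_circ_homeo:
  assumes L: "L > 0" and a: "homeomorphic_map (circ L) (circ L) \<alpha>"
  obtains c g h where "circ_homeo L L \<alpha> c g h"
proof -
  obtain \<beta> where hm: "homeomorphic_maps (circ L) (circ L) \<alpha> \<beta>" using a homeomorphic_map_maps by blast
  then have c: "continuous_map (circ L) (circ L) \<alpha>" "continuous_map (circ L) (circ L) \<beta>"
    and inv: "\<And>x. \<beta> (\<alpha> (circ_proj L x)) = circ_proj L x" "\<And>x. \<alpha> (\<beta> (circ_proj L x)) = circ_proj L x"
    by (auto simp: homeomorphic_maps_def)
  obtain g where g: "continuous_on UNIV g" "\<And>x. \<alpha> (circ_proj L x) = circ_proj L (g x)" using continuous_self_map_lift[OF L c(1)] by metis
  obtain h where h: "continuous_on UNIV h" "\<And>x. \<beta> (circ_proj L x) = circ_proj L (h x)" using continuous_self_map_lift[OF L c(2)] by metis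
  have deg: "\<exists>d::int. \<forall>x. k (x + real L) = k x + of_int d * real L"
    if k: "continuous_on UNIV k" "\<And>x. f (circ_proj L x) = circ_proj L (k x)" for k :: "real \<Rightarrow> real" and f
  proof -
    have "circ_proj L (x + real L) = circ_proj L x" for x using circ_proj_shift[of L x 1] by simp
    then have "circ_proj L (k (x + real L)) = circ_proj L (k x)" for x using k(2) by metis
    moreover have "continuous_on UNIV (\<lambda>x. k (x + real L))"
      by (rule continuous_on_compose2[OF k(1)]) (auto intro!: continuous_intros)
    ultimately obtain d :: int where "\<And>x. k (x + real L) = k x + of_int d * real L"
      using circ_lift_unique[OF L, of UNIV "\<lambda>x. k (x + real L)" k] k(1) by (metis UNIV_I connected_UNIV)
    then show ?thesis by blast
  qed
  obtain d :: int where d: "\<And>x. g (x + real L) = g x + of_int d * real L" using deg[OF g] by blast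
  obtain e :: int where e: "\<And>x. h (x + real L) = h x + of_int e * real L" using deg[OF h] by blast
  have comp: "\<exists>k::int. \<forall>x. u (v x) = x + of_int k * real L"
    if uv: "continuous_on UNIV u" "continuous_on UNIV v" "\<And>x. circ_proj L (u (v x)) = circ_proj L x" for u v :: "real \<Rightarrow> real"
  proof -
    have "continuous_on UNIV (\<lambda>x. u (v x))" using continuous_on_compose2[OF uv(1,2)] by simp
    then obtain k :: int where "\<And>x. u (v x) = x + of_int k * real L"
      using circ_lift_unique[OF L, of UNIV "\<lambda>x. u (v x)" "\<lambda>x. x"] uv(3) by (metis UNIV_I connected_UNIV continuous_on_id)
    then show ?thesis by blast
  qed
  have hg: "circ_proj L (h (g x)) = circ_proj L x" "circ_proj L (g (h x)) = circ_proj L x" for x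
    using g(2) h(2) inv by metis+
  obtain i :: int where i: "\<And>x. h (g x) = x + of_int i * real L" using comp[OF h(1) g(1) hg(1)] by blast
  obtain j :: int where j: "\<And>x. g (h x) = x + of_int j * real L" using comp[OF g(1) h(1) hg(2)] by blast
  \<comment> \<open>Correct the lift of the inverse by a translation to make it inverse to \<open>g\<close>.\<close>
  define h' where "h' y = h y - of_int i * real L" for y
  have h'g: "h' (g x) = x" for x by (simp add: h'_def i)
  have "surj g"
  proof
    show "UNIV \<subseteq> range g"
    proof
      fix y have "y = g (h (y - of_int j * real L))" using j[of "y - of_int j * real L"] by simp
      then show "y \<in> range g" by blast
    qed
  qed simp
  then have gh': "g (h' y) = y" for y using h'g by (metis surjD)
  have inj: "inj g" by (rule inj_on_inverseI[of _ h']) (simp add: h'g)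
  have hs: "h (y + of_int k * real L) = h y + of_int (k * e) * real L" for y and k :: int
  proof (induction k rule: int_induct[where k = 0])
    case (step1 k)
    have "h (y + of_int (k + 1) * real L) = h ((y + of_int k * real L) + real L)" by (simp add: algebra_simps)
    then show ?case using step1 e[of "y + of_int k * real L"] by (simp add: algebra_simps)
  next
    case (step2 k)
    have "h (y + of_int k * real L) = h ((y + of_int (k - 1) * real L) + real L)" by (simp add: algebra_simps)
    then show ?case using step2 e[of "y + of_int (k - 1) * real L"] by (simp add: algebra_simps)
  qed simp
  have "h (g (0 + real L)) = h (g 0) + of_int (d * e) * real L" unfolding d hs ..
  then have "of_int 1 * real L = of_int (d * e) * real L" unfolding i by simp
  then have "d * e = 1" using L by (metis mult_right_cancel of_int_eq_iff of_nat_0_less_iff less_irrefl)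
  then have d1: "d = 1 \<or> d = - 1" by (metis zmult_eq_1_iff)
  have "strict_mono_on UNIV g \<or> strict_antimono_on UNIV g"
    using injective_eq_monotone_map[OF is_interval_univ g(1)] inj by simp
  then have "\<exists>c. circ_lift L L \<alpha> c g"
  proof
    assume m: "strict_mono_on UNIV g"
    then have "g 0 < g (0 + real L)" using L by (auto simp: strict_mono_on_def)
    then have "d = 1" using d[of 0] d1 L by auto
    moreover have "mono g" using m by (simp add: strict_mono_mono)
    ultimately show ?thesis using g d by (intro exI[of _ False]) (simp add: circ_lift_def)
  next
    assume m: "strict_antimono_on UNIV g"
    then have lt: "x < y \<Longrightarrow> g y < g x" for x y by (auto simp: monotone_on_def)
    then have "g (0 + real L) < g 0" using L by simp
    then have "d = - 1" using d[of 0] d1 L by auto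
    moreover have "antimono g" using lt by (intro antimonoI) (metis le_less)
    ultimately show ?thesis using g d by (intro exI[of _ True]) (simp add: circ_lift_def)
  qed
  then obtain c where "circ_lift L L \<alpha> c g" ..
  moreover have "continuous_on UNIV h'" unfolding h'_def by (intro continuous_intros h)
  ultimately have "circ_homeo L L \<alpha> c g h'" using L h'g gh' by (simp add: circ_homeo_def)
  then show ?thesis by (rule that)
qed

lemma circ_homeo_homeomorphic:
  assumes H: "circ_homeo L M \<phi> c g h"
  shows "homeomorphic_map (circ L) (circ M) \<phi>"
proof -
  obtain \<psi> where K: "circ_homeo M L \<psi> c h g" using circ_homeo_inverse[OF H] .
  note A = circ_homeoD[OF H] and B = circ_homeoD[OF K]
  have cont: "continuous_map (circ L) (circ M) \<phi>" if H: "circ_homeo L M \<phi> c g h" for L M \<phi> g h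
  proof (rule continuous_compose_quotient_map[OF quotient_map_circ_proj])
    note A = circ_homeoD[OF H]
    have "\<phi> \<circ> circ_proj L = (\<lambda>x. circ_proj M (g x))" using A(7) by auto
    then show "continuous_map euclideanreal (circ M) (\<phi> \<circ> circ_proj L)"
      using continuous_map_circ_proj[OF circ_liftD(1)[OF A(3)], of M] by simp
  qed
  have "homeomorphic_maps (circ L) (circ M) \<phi> \<psi>"
    unfolding homeomorphic_maps_def using cont[OF H] cont[OF K] A B by (auto simp: topspace_circ)
  then show ?thesis using homeomorphic_map_maps by blast
qed

lemma group_Homeo: "group (Homeo L)"
proof (rule groupI)
  let ?T = "topspace (circ L)"
  show "x \<otimes>\<^bsub>Homeo L\<^esub> y \<in> carrier (Homeo L)" if "x \<in> carrier (Homeo L)" "y \<in> carrier (Homeo L)" for x y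
  proof -
    have "homeomorphic_map (circ L) (circ L) (x \<circ> y)" using HomeoD that homeomorphic_map_compose by blast
    then have "homeomorphic_map (circ L) (circ L) (compose ?T x y)"
      by (rule homeomorphic_map_eq) (simp add: compose_eq)
    then show ?thesis by (simp add: Homeo_def)
  qed
  show "\<one>\<^bsub>Homeo L\<^esub> \<in> carrier (Homeo L)"
    using homeomorphic_map_eq[OF homeomorphic_map_id[THEN iffD2, OF refl], of "circ L" "\<lambda>x\<in>?T. x"]
    by (simp add: Homeo_def)
  show "x \<otimes>\<^bsub>Homeo L\<^esub> y \<otimes>\<^bsub>Homeo L\<^esub> z = x \<otimes>\<^bsub>Homeo L\<^esub> (y \<otimes>\<^bsub>Homeo L\<^esub> z)"
    if "x \<in> carrier (Homeo L)" "y \<in> carrier (Homeo L)" "z \<in> carrier (Homeo L)" for x y z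
    using homeomorphic_imp_surjective_map[OF HomeoD(2)[OF that(3)]] by (auto simp: Homeo_def compose_def fun_eq_iff)
  show "\<one>\<^bsub>Homeo L\<^esub> \<otimes>\<^bsub>Homeo L\<^esub> x = x" if "x \<in> carrier (Homeo L)" for x
    using homeomorphic_imp_surjective_map[OF HomeoD(2)[OF that]] HomeoD(1)[OF that]
    by (auto simp: Homeo_def compose_def fun_eq_iff extensional_def)
  show "\<exists>y\<in>carrier (Homeo L). y \<otimes>\<^bsub>Homeo L\<^esub> x = \<one>\<^bsub>Homeo L\<^esub>" if x: "x \<in> carrier (Homeo L)" for x
  proof -
    obtain y where y: "homeomorphic_maps (circ L) (circ L) x y" using HomeoD(2)[OF x] homeomorphic_map_maps by blast
    then have "homeomorphic_map (circ L) (circ L) y" using homeomorphic_maps_map by blast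
    then have "homeomorphic_map (circ L) (circ L) (restrict y ?T)" by (rule homeomorphic_map_eq) simp
    then have "restrict y ?T \<in> carrier (Homeo L)" by (simp add: Homeo_def)
    moreover have "restrict y ?T \<otimes>\<^bsub>Homeo L\<^esub> x = \<one>\<^bsub>Homeo L\<^esub>"
      using y homeomorphic_imp_surjective_map[OF HomeoD(2)[OF x]] by (auto simp: Homeo_def compose_def fun_eq_iff homeomorphic_maps_def)
    ultimately show ?thesis by blast
  qed
qed

lemma rescale_inj: "L > 0 \<Longrightarrow> rescale L c = rescale L d \<Longrightarrow> c = d"
  unfolding rescale_def by (rule inj_image_eq_iff[THEN iffD1, rotated]) (auto intro!: injI)

lemma circ_1_point:
  assumes "L > 0" "c \<in> topspace (circ 1)"
  obtains x where "c = rescale L (circ_proj L x)"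
proof -
  obtain y where "c = circ_proj 1 y" using assms(2) unfolding topspace_circ by blast
  then have "c = rescale L (circ_proj L (y * real L))" using assms(1) by (simp add: rescale_circ_proj)
  then show ?thesis by (rule that)
qed

text \<open>Conjugation by the rescaling, evaluated at a point of the form \<open>rescale L c\<close>; every point of the unit circle
has this form (\<open>circ_1_point\<close>).\<close>

lemma Homeo_rescale_rescale:
  assumes L: "L > 0"
  shows "Homeo_rescale L \<alpha> (rescale L (circ_proj L x)) = rescale L (\<alpha> (circ_proj L x))"
proof -
  let ?c = "rescale L (circ_proj L x)"
  have c: "?c \<in> topspace (circ 1)" unfolding rescale_circ_proj[OF L] by simp
  have "?c \<in> rescale L ` topspace (circ L)" by simp
  then have "rescale L (inv_into (topspace (circ L)) (rescale L) ?c) = ?c" by (rule f_inv_into_f)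
  then have "inv_into (topspace (circ L)) (rescale L) ?c = circ_proj L x" by (rule rescale_inj[OF L])
  then show ?thesis using c by (simp add: Homeo_rescale_def)
qed

lemma Homeo_image:
  assumes "\<alpha> \<in> carrier (Homeo L)"
  obtains y where "\<alpha> (circ_proj L x) = circ_proj L y"
proof -
  have "\<alpha> (circ_proj L x) \<in> topspace (circ L)"
    using homeomorphic_imp_surjective_map[OF HomeoD(2)[OF assms]] circ_proj_in_topspace by blast
  then show ?thesis using that unfolding topspace_circ by blast
qed

lemma homeomorphic_rescale: "L > 0 \<Longrightarrow> homeomorphic_map (circ L) (circ 1) (rescale L)"
  using circ_homeo_homeomorphic circ_homeo_rescale by blast

lemma Homeo_rescale_iso:
  assumes L: "L > 0"
  shows "Homeo_rescale L \<in> iso (Homeo L) (Homeo 1)"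
proof -
  obtain \<psi> where s: "homeomorphic_maps (circ L) (circ 1) (rescale L) \<psi>"
    using homeomorphic_rescale[OF L] homeomorphic_map_maps by blast
  then have psi: "\<psi> (rescale L (circ_proj L x)) = circ_proj L x" and hp: "homeomorphic_map (circ 1) (circ L) \<psi>" for x
    using homeomorphic_maps_map by (auto simp: homeomorphic_maps_def)
  have psi1: "rescale L (\<psi> c) = c" if "c \<in> topspace (circ 1)" for c
    using s that by (auto simp: homeomorphic_maps_def)
  have ext: "Homeo_rescale L \<alpha> \<in> extensional (topspace (circ 1))" for \<alpha> by (simp add: Homeo_rescale_def)
  have mem: "Homeo_rescale L \<alpha> \<in> carrier (Homeo 1)" if a: "\<alpha> \<in> carrier (Homeo L)" for \<alpha>
  proof -
    have "homeomorphic_map (circ 1) (circ 1) (rescale L \<circ> (\<alpha> \<circ> \<psi>))"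
      using homeomorphic_map_compose[OF homeomorphic_map_compose[OF hp HomeoD(2)[OF a]] homeomorphic_rescale[OF L]] .
    then have "homeomorphic_map (circ 1) (circ 1) (Homeo_rescale L \<alpha>)"
    proof (rule homeomorphic_map_eq)
      fix c assume "c \<in> topspace (circ 1)"
      then obtain x where "c = rescale L (circ_proj L x)" by (rule circ_1_point[OF L])
      then show "(rescale L \<circ> (\<alpha> \<circ> \<psi>)) c = Homeo_rescale L \<alpha> c" by (simp add: psi Homeo_rescale_rescale[OF L])
    qed
    then show ?thesis using ext by (simp add: Homeo_def)
  qed
  have hom: "Homeo_rescale L (\<alpha> \<otimes>\<^bsub>Homeo L\<^esub> \<beta>) = Homeo_rescale L \<alpha> \<otimes>\<^bsub>Homeo 1\<^esub> Homeo_rescale L \<beta>"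
    if a: "\<alpha> \<in> carrier (Homeo L)" and b: "\<beta> \<in> carrier (Homeo L)" for \<alpha> \<beta>
  proof (rule extensionalityI[of _ "topspace (circ 1)"])
    show "Homeo_rescale L (\<alpha> \<otimes>\<^bsub>Homeo L\<^esub> \<beta>) \<in> extensional (topspace (circ 1))" by (rule ext)
    show "Homeo_rescale L \<alpha> \<otimes>\<^bsub>Homeo 1\<^esub> Homeo_rescale L \<beta> \<in> extensional (topspace (circ 1))" by (simp add: Homeo_def)
    fix c assume "c \<in> topspace (circ 1)"
    then obtain x where c: "c = rescale L (circ_proj L x)" by (rule circ_1_point[OF L])
    obtain y where y: "\<beta> (circ_proj L x) = circ_proj L y" by (rule Homeo_image[OF b])
    have "Homeo_rescale L (\<alpha> \<otimes>\<^bsub>Homeo L\<^esub> \<beta>) c = rescale L (\<alpha> (circ_proj L y))"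
      unfolding c Homeo_rescale_rescale[OF L] by (simp add: Homeo_def compose_eq y)
    moreover have "(Homeo_rescale L \<alpha> \<otimes>\<^bsub>Homeo 1\<^esub> Homeo_rescale L \<beta>) c = rescale L (\<alpha> (circ_proj L y))"
      using \<open>c \<in> topspace (circ 1)\<close> by (simp add: Homeo_def compose_eq c Homeo_rescale_rescale[OF L] y)
    ultimately show "Homeo_rescale L (\<alpha> \<otimes>\<^bsub>Homeo L\<^esub> \<beta>) c = (Homeo_rescale L \<alpha> \<otimes>\<^bsub>Homeo 1\<^esub> Homeo_rescale L \<beta>) c" by simp
  qed
  have inj: "inj_on (Homeo_rescale L) (carrier (Homeo L))"
  proof (rule inj_onI)
    fix \<alpha> \<beta> assume a: "\<alpha> \<in> carrier (Homeo L)" and b: "\<beta> \<in> carrier (Homeo L)" and e: "Homeo_rescale L \<alpha> = Homeo_rescale L \<beta>"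
    show "\<alpha> = \<beta>"
    proof (rule extensionalityI[OF HomeoD(1)[OF a] HomeoD(1)[OF b]])
      fix c assume "c \<in> topspace (circ L)"
      then obtain x where c: "c = circ_proj L x" unfolding topspace_circ by blast
      have "rescale L (\<alpha> c) = rescale L (\<beta> c)" unfolding c using Homeo_rescale_rescale[OF L] e by metis
      then show "\<alpha> c = \<beta> c" by (rule rescale_inj[OF L])
    qed
  qed
  have surj: "\<gamma> \<in> Homeo_rescale L ` carrier (Homeo L)" if g: "\<gamma> \<in> carrier (Homeo 1)" for \<gamma>
  proof -
    let ?a = "restrict (\<psi> \<circ> (\<gamma> \<circ> rescale L)) (topspace (circ L))"
    have "homeomorphic_map (circ L) (circ L) (\<psi> \<circ> (\<gamma> \<circ> rescale L))"
      using homeomorphic_map_compose[OF homeomorphic_map_compose[OF homeomorphic_rescale[OF L] HomeoD(2)[OF g]] hp] .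
    then have "homeomorphic_map (circ L) (circ L) ?a" by (rule homeomorphic_map_eq) simp
    then have a: "?a \<in> carrier (Homeo L)" by (simp add: Homeo_def)
    have "Homeo_rescale L ?a = \<gamma>"
    proof (rule extensionalityI[OF ext HomeoD(1)[OF g]])
      fix c assume c: "c \<in> topspace (circ 1)"
      then obtain x where x: "c = rescale L (circ_proj L x)" by (rule circ_1_point[OF L])
      have "\<gamma> c \<in> topspace (circ 1)" using homeomorphic_imp_surjective_map[OF HomeoD(2)[OF g]] c by blast
      then show "Homeo_rescale L ?a c = \<gamma> c" unfolding x Homeo_rescale_rescale[OF L] using psi1 by simp
    qed
    then show ?thesis using a by (intro image_eqI) auto
  qed
  show ?thesis
    unfolding iso_def hom_def bij_betw_def using mem hom inj surj by blast
qed

context realized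
begin

lemma bij_rep: "bij_betw (class_map rep) (topspace (realization Y)) (colim P L)"
  using canonical_bijection by (simp add: canonical_bijection_def)

lemma colim_map_well_defined_Homeo:
  assumes "\<alpha> \<in> carrier (Homeo L)"
  shows "colim_map_well_defined P L L \<alpha>"
  by (rule homeo_circ_homeo[OF L HomeoD(2)[OF assms]]) (rule colim_map_well_defined)

lemma colim_map_Homeo_bij:
  assumes "\<alpha> \<in> carrier (Homeo L)"
  shows "bij_betw (colim_map P L L \<alpha>) (colim P L) (colim P L)"
  by (rule homeo_circ_homeo[OF L HomeoD(2)[OF assms]]) (rule colim_map_bij)

lemma class_map_act:
  assumes "\<alpha> \<in> carrier (Homeo L)" "p \<in> topspace (realization Y)"
  shows "class_map rep (act P L Y rep \<alpha> p) = colim_map P L L \<alpha> (class_map rep p)"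
proof -
  have "colim_map P L L \<alpha> (class_map rep p) \<in> class_map rep ` topspace (realization Y)"
    using bij_betw_apply[OF colim_map_Homeo_bij[OF assms(1)] bij_betw_apply[OF bij_rep assms(2)]] bij_betw_imp_surj_on[OF bij_rep] by simp
  from f_inv_into_f[OF this] show ?thesis using assms(2) by (simp add: act_def)
qed

lemma act_Bij:
  assumes "\<alpha> \<in> carrier (Homeo L)"
  shows "act P L Y rep \<alpha> \<in> Bij (topspace (realization Y))"
proof -
  let ?T = "topspace (realization Y)"
  have "bij_betw (inv_into ?T (class_map rep) \<circ> (colim_map P L L \<alpha> \<circ> class_map rep)) ?T ?T"
    by (rule bij_betw_trans[OF bij_betw_trans[OF bij_rep colim_map_Homeo_bij[OF assms]] bij_betw_inv_into[OF bij_rep]])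
  then have "bij_betw (act P L Y rep \<alpha>) ?T ?T"
    by (rule bij_betw_cong[THEN iffD1, rotated]) (simp add: act_def)
  then show ?thesis by (simp add: Bij_def act_def)
qed

lemma act_mem:
  "\<alpha> \<in> carrier (Homeo L) \<Longrightarrow> p \<in> topspace (realization Y) \<Longrightarrow> act P L Y rep \<alpha> p \<in> topspace (realization Y)"
  using act_Bij[of \<alpha>] bij_betw_apply by (auto simp: Bij_def)

text \<open>The action is the action on the colimit transported along the canonical bijection, so multiplicativity is
\<open>colim_map_comp\<close>.\<close>

lemma group_action_act: "group_action (Homeo L) (topspace (realization Y)) (act P L Y rep)"
proof -
  let ?T = "topspace (realization Y)"
  have "act P L Y rep (\<alpha> \<otimes>\<^bsub>Homeo L\<^esub> \<beta>) = act P L Y rep \<alpha> \<otimes>\<^bsub>BijGroup ?T\<^esub> act P L Y rep \<beta>"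
    if a: "\<alpha> \<in> carrier (Homeo L)" and b: "\<beta> \<in> carrier (Homeo L)" for \<alpha> \<beta>
  proof -
    have ab: "\<alpha> \<otimes>\<^bsub>Homeo L\<^esub> \<beta> \<in> carrier (Homeo L)" by (rule monoid.m_closed[OF group.is_monoid[OF group_Homeo] a b])
    have "act P L Y rep (\<alpha> \<otimes>\<^bsub>Homeo L\<^esub> \<beta>) = compose ?T (act P L Y rep \<alpha>) (act P L Y rep \<beta>)"
    proof (rule extensionalityI[of _ ?T])
      fix p assume p: "p \<in> ?T"
      have bp: "act P L Y rep \<beta> p \<in> ?T" by (rule act_mem[OF b p])
      obtain c g h where C: "circ_homeo L L \<alpha> c g h" using homeo_circ_homeo[OF L HomeoD(2)[OF a]] .
      obtain d g' h' where D: "circ_homeo L L \<beta> d g' h'" using homeo_circ_homeo[OF L HomeoD(2)[OF b]] .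
      have "class_map rep (act P L Y rep (\<alpha> \<otimes>\<^bsub>Homeo L\<^esub> \<beta>) p) = colim_map P L L (\<alpha> \<otimes>\<^bsub>Homeo L\<^esub> \<beta>) (class_map rep p)"
        by (rule class_map_act[OF ab p])
      also have "\<dots> = colim_map P L L \<alpha> (colim_map P L L \<beta> (class_map rep p))"
        by (rule colim_map_comp[OF D C _ bij_betw_apply[OF bij_rep p], symmetric]) (simp add: Homeo_def compose_eq)
      also have "\<dots> = class_map rep (act P L Y rep \<alpha> (act P L Y rep \<beta> p))"
        unfolding class_map_act[OF a bp] class_map_act[OF b p] ..
      finally have "act P L Y rep (\<alpha> \<otimes>\<^bsub>Homeo L\<^esub> \<beta>) p = act P L Y rep \<alpha> (act P L Y rep \<beta> p)"
        using inj_onD[OF bij_betw_imp_inj_on[OF bij_rep]] act_mem[OF ab p] act_mem[OF a bp] by blast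
      then show "act P L Y rep (\<alpha> \<otimes>\<^bsub>Homeo L\<^esub> \<beta>) p = compose ?T (act P L Y rep \<alpha>) (act P L Y rep \<beta>) p"
        using p by (simp add: compose_eq)
    qed (simp_all add: act_def)
    then show ?thesis using act_Bij[OF a] act_Bij[OF b] by (simp add: BijGroup_def)
  qed
  then have "act P L Y rep \<in> hom (Homeo L) (BijGroup ?T)"
    using act_Bij by (auto simp: hom_def BijGroup_def)
  then show ?thesis
    by (intro group_action.intro group_hom.intro group_hom_axioms.intro group_Homeo group_BijGroup)
qed

end

text \<open>Both sides are compared in the colimit of the unit circle, where they are the maps induced by
\<open>rescale L\<close> after \<open>\<alpha>\<close> and by the conjugate of \<open>\<alpha>\<close> after \<open>rescale L\<close>.\<close>

lemma rescale_equivariant: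
  assumes A: "realized P \<epsilon> L Y rep" and B: "realized P (\<lambda>_. False) 1 Y1 rep1"
    and D: "\<And>p. D p = inv_into (topspace (realization Y1)) (class_map rep1) (colim_map P L 1 (rescale L) (class_map rep p))"
    and a: "\<alpha> \<in> carrier (Homeo L)" and p: "p \<in> topspace (realization Y)"
  shows "D (act P L Y rep \<alpha> p) = act P 1 Y1 rep1 (Homeo_rescale L \<alpha>) (D p)"
proof -
  interpret A: realized P \<epsilon> L Y rep by (rule A)
  interpret B: realized P "\<lambda>_. False" 1 Y1 rep1 by (rule B)
  note L = A.L
  note DD = homeomorphic_realization_rescale[OF A B D]
  have Dm: "D p \<in> topspace (realization Y1)" if "p \<in> topspace (realization Y)" for p
    using homeomorphic_imp_surjective_map[OF DD(1)] that by blast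
  have a1: "Homeo_rescale L \<alpha> \<in> carrier (Homeo 1)"
    using Homeo_rescale_iso[OF L] a by (auto simp: iso_def hom_def)
  obtain c g h where C: "circ_homeo L L \<alpha> c g h" using homeo_circ_homeo[OF L HomeoD(2)[OF a]] .
  obtain c' g' h' where C': "circ_homeo 1 1 (Homeo_rescale L \<alpha>) c' g' h'" using homeo_circ_homeo[OF _ HomeoD(2)[OF a1]] by auto
  note S = circ_homeo_rescale[OF L]
  have ap: "act P L Y rep \<alpha> p \<in> topspace (realization Y)" by (rule A.act_mem[OF a p])
  have q: "class_map rep p \<in> colim P L" by (rule bij_betw_apply[OF A.bij_rep p])
  have "class_map rep1 (D (act P L Y rep \<alpha> p)) = colim_map P L 1 (rescale L) (colim_map P L L \<alpha> (class_map rep p))"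
    unfolding DD(2)[OF ap] A.class_map_act[OF a p] ..
  also have "\<dots> = colim_map P L 1 (\<lambda>x. rescale L (\<alpha> x)) (class_map rep p)" by (rule A.colim_map_comp[OF C S _ q]) simp
  also have "\<dots> = colim_map P 1 1 (Homeo_rescale L \<alpha>) (colim_map P L 1 (rescale L) (class_map rep p))"
    by (rule A.colim_map_comp[OF S C' _ q, symmetric]) (simp add: Homeo_rescale_rescale[OF L])
  also have "\<dots> = class_map rep1 (act P 1 Y1 rep1 (Homeo_rescale L \<alpha>) (D p))"
    unfolding B.class_map_act[OF a1 Dm[OF p]] DD(2)[OF p] ..
  finally have "class_map rep1 (D (act P L Y rep \<alpha> p)) = class_map rep1 (act P 1 Y1 rep1 (Homeo_rescale L \<alpha>) (D p))" .
  moreover have "act P 1 Y1 rep1 (Homeo_rescale L \<alpha>) (D p) \<in> topspace (realization Y1)"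
    by (rule B.act_mem[OF a1 Dm[OF p]])
  ultimately show ?thesis using bij_betw_imp_inj_on[OF B.bij_rep] Dm[OF ap] by (simp add: inj_on_eq_iff)
qed

lemma realized_statement:
  assumes A: "realized P \<epsilon> L Y rep" and B: "realized P (\<lambda>_. False) 1 (underlying_sset X) (rep_sd P 1)"
  shows "filtered_diagram P L \<and>
        canonical_bijection P L Y rep \<and>
        (\<forall>\<alpha>\<in>carrier (Homeo L). colim_map_well_defined P L L \<alpha>) \<and>
        group_action (Homeo L) (topspace (realization Y)) (act P L Y rep) \<and>
        colim_map_well_defined P L 1 (rescale L) \<and>
        homeomorphic_map (realization Y) (realization (underlying_sset X)) (realization_rescale X P L rep) \<and>
        Homeo_rescale L \<in> iso (Homeo L) (Homeo 1) \<and>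
        (\<forall>\<alpha>\<in>carrier (Homeo L). \<forall>p\<in>topspace (realization Y).
           realization_rescale X P L rep (act P L Y rep \<alpha> p) =
           act P 1 (underlying_sset X) (rep_sd P 1) (Homeo_rescale L \<alpha>) (realization_rescale X P L rep p))"
proof -
  interpret A: realized P \<epsilon> L Y rep by (rule A)
  note L = A.L
  note D = realization_rescale_def[of X P L rep]
  show ?thesis
    by (intro conjI ballI A.filtered_diagram[OF L] A.canonical_bijection A.colim_map_well_defined_Homeo A.group_action_act
        A.colim_map_well_defined[OF circ_homeo_rescale[OF L]] homeomorphic_realization_rescale(1)[OF A B D]
        Homeo_rescale_iso[OF L] rescale_equivariant[OF A B D])
qed

theorem theorem1p6:
  fixes r :: nat and X P :: "'a presheaf"
  assumes "r > 0" and "dihedral_set X" and "dihedral_extension X P"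
  shows
    "let Y = underlying_sset X;
         rep\<^sub>1 = rep_sd P 1; act\<^sub>1 = act P 1 Y rep\<^sub>1;
         Y\<^sub>a = sd r Y; rep\<^sub>a = rep_sd P r; act\<^sub>a = act P r Y\<^sub>a rep\<^sub>a;
         D\<^sub>a = realization_rescale X P r rep\<^sub>a;
         Y\<^sub>b = sde (sd r Y); rep\<^sub>b = rep_sde P r; act\<^sub>b = act P (2 * r) Y\<^sub>b rep\<^sub>b;
         D\<^sub>b = realization_rescale X P (2 * r) rep\<^sub>b
     in
       (canonical_bijection P 1 Y rep\<^sub>1 \<and>
        group_action (Homeo 1) (topspace (realization Y)) act\<^sub>1)
     \<and>
       (filtered_diagram P r \<and>
        canonical_bijection P r Y\<^sub>a rep\<^sub>a \<and>
        (\<forall>\<alpha>\<in>carrier (Homeo r). colim_map_well_defined P r r \<alpha>) \<and>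
        group_action (Homeo r) (topspace (realization Y\<^sub>a)) act\<^sub>a \<and>
        colim_map_well_defined P r 1 (rescale r) \<and>
        homeomorphic_map (realization Y\<^sub>a) (realization Y) D\<^sub>a \<and>
        Homeo_rescale r \<in> iso (Homeo r) (Homeo 1) \<and>
        (\<forall>\<alpha>\<in>carrier (Homeo r). \<forall>p\<in>topspace (realization Y\<^sub>a).
           D\<^sub>a (act\<^sub>a \<alpha> p) = act\<^sub>1 (Homeo_rescale r \<alpha>) (D\<^sub>a p)))
     \<and>
       (filtered_diagram P (2 * r) \<and>
        canonical_bijection P (2 * r) Y\<^sub>b rep\<^sub>b \<and>
        (\<forall>\<alpha>\<in>carrier (Homeo (2 * r)). colim_map_well_defined P (2 * r) (2 * r) \<alpha>) \<and>
        group_action (Homeo (2 * r)) (topspace (realization Y\<^sub>b)) act\<^sub>b \<and>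
        colim_map_well_defined P (2 * r) 1 (rescale (2 * r)) \<and>
        homeomorphic_map (realization Y\<^sub>b) (realization Y) D\<^sub>b \<and>
        Homeo_rescale (2 * r) \<in> iso (Homeo (2 * r)) (Homeo 1) \<and>
        (\<forall>\<alpha>\<in>carrier (Homeo (2 * r)). \<forall>p\<in>topspace (realization Y\<^sub>b).
           D\<^sub>b (act\<^sub>b \<alpha> p) = act\<^sub>1 (Homeo_rescale (2 * r) \<alpha>) (D\<^sub>b p)))"
proof -
  have one: "realized P (\<lambda>_. False) 1 (underlying_sset X) (rep_sd P 1)"
    by (rule realized_identity[OF assms(3)])
  show ?thesis
    unfolding Let_def
    by (intro conjI[OF conjI[OF realized.canonical_bijection[OF one] realized.group_action_act[OF one]]]
        conjI[OF realized_statement[OF realized_sd[OF assms(1,3)] one] realized_statement[OF realized_sde[OF assms(1,3)] one]])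
qed

end
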